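(* The Robbin-Salamon index $\mu_{RS}$ for continuous paths of symplectic matrices is characterized by the following properties; that is, $\mu_{RS}$ has these properties, and any correspondence $\mu$ assigning, for every $n\ge1$, a half-integer $\mu(\psi)\in\frac12\mathbb{Z}$ to every continuous path $\psi:[a,b]\to\mathrm{Sp}(\mathbb{R}^{2n},\Omega_0)$ and having these properties is equal to $\mu_{RS}$: - (Homotopy) it is invariant under homotopies with fixed end points; - (Catenation) it is additive under catenation of paths; - (Zero) it vanishes on any path $\psi:[a,b]\to\mathrm{Sp}(\mathbb{R}^{2n},\Omega_0)$ of matrices such that $\dim\ker(\psi(t)-\mathrm{Id})=k$ is constant on $[a,b]$; - (Normalization) if $S=S^\tau\in\mathbb{R}^{2n\times2n}$ is a symmetric matrix with all eigenvalues of absolute value $<2\pi$ and if $\psi(t)=\exp(J_0St)$ for $t\in[0,1]$, then the index of $\psi$ is $\frac12\,\mathrm{Sign}\,S$, where $\mathrm{Sign}\,S$ is the signature of $S$.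
   Context: Notation. $\Omega_0=\begin{pmatrix}0&\mathrm{Id}_n\\-\mathrm{Id}_n&0\end{pmatrix}$, $\Omega_0(v,w)=v^\tau\Omega_0w$, on $\mathbb{R}^{2n}$; $\mathrm{Sp}(\mathbb{R}^{2n},\Omega_0)$ is the group of symplectic $2n\times2n$ matrices; $J_0=\begin{pmatrix}0&-\mathrm{Id}_n\\\mathrm{Id}_n&0\end{pmatrix}$; $\tau$ denotes transpose. The signature of a symmetric matrix or form (possibly degenerate) is the number of positive minus the number of negative eigenvalues. Additivity under catenation means $\mu(\psi)=\mu(\psi|_{[a,c]})+\mu(\psi|_{[c,b]})$ for $a<c<b$. Robbin-Salamon index of a path of Lagrangians. Let $(W,\Omega)$ be a finite-dimensional real symplectic vector space and $L\subset W$ a fixed Lagrangian subspace. For a smooth path $\Lambda:[a,b]\to\mathcal{L}_{(W,\Omega)}$ in the space of Lagrangian subspaces and $t_0\in[a,b]$, choose a Lagrangian $M$ with $\Lambda_{t_0}\oplus M=W$; for $t$ near $t_0$ write $\Lambda_t=\{v+\alpha_t(v)\mid v\in\Lambda_{t_0}\}$ with $\alpha_t:\Lambda_{t_0}\to M$ linear, and let $Q(\Lambda_{t_0},\dot\Lambda_{t_0})(v,v')=\frac{d}{dt}\Omega(v,\alpha_t(v'))|_{t=t_0}$, a symmetric bilinear form on $\Lambda_{t_0}$ independent of $M$. A crossing is a $t$ with $\Lambda_t\cap L\ne\{0\}$; its crossing form is $\Gamma(\Lambda,L,t)=Q(\Lambda_t,\dot\Lambda_t)|_{\Lambda_t\cap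 L}$; it is regular if this form is nondegenerate. For a path with only regular crossings, $$\mu_{RS}(\Lambda,L)=\tfrac12\mathrm{Sign}\,\Gamma(\Lambda,L,a)+\sum_{a<t<b,\ t\text{ crossing}}\mathrm{Sign}\,\Gamma(\Lambda,L,t)+\tfrac12\mathrm{Sign}\,\Gamma(\Lambda,L,b).$$ Every continuous path of Lagrangians is homotopic with fixed end points to one with only regular crossings, and two paths with only regular crossings homotopic with fixed end points have the same index; this defines $\mu_{RS}(\Lambda,L)$ for every continuous path. Robbin-Salamon index of a path of symplectic matrices. For a continuous $\psi:[a,b]\to\mathrm{Sp}(\mathbb{R}^{2n},\Omega_0)$, $\mu_{RS}(\psi):=\mu_{RS}(\mathrm{Gr}\,\psi,\Delta)$, where $\mathrm{Gr}\,\psi_t=\{(x,\psi_tx)\mid x\in\mathbb{R}^{2n}\}$ and $\Delta=\{(x,x)\mid x\in\mathbb{R}^{2n}\}$ are Lagrangians in $(\mathbb{R}^{2n}\times\mathbb{R}^{2n},\overline\Omega=-\Omega_0\times\Omega_0)$. *)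

theory Defs
  imports "HOL-Analysis.Analysis"
begin

section \<open>Signatures\<close>

text \<open>The eigenspaces of a symmetric bilinear form on a subspace of a Euclidean space are those of
  its Gram matrix in an orthonormal basis. By Sylvester's law the signature does not depend on the
  inner product. Only finitely many summands in the signatures below are nonzero, and for symmetric
  forms and matrices geometric and algebraic multiplicities agree.\<close>

definition form_eigenspace :: "'w::euclidean_space set \<Rightarrow> ('w \<Rightarrow> 'w \<Rightarrow> real) \<Rightarrow> real \<Rightarrow> 'w set" where
  "form_eigenspace V B c = {v \<in> V. \<forall>w\<in>V. B v w = c * (v \<bullet> w)}"

definition form_signature :: "'w::euclidean_space set \<Rightarrow> ('w \<Rightarrow> 'w \<Rightarrow> real) \<Rightarrow> int" where
  "form_signature V B =
     (\<Sum>c | c > 0 \<and> form_eigenspace V B c \<noteq> {0}. int (dim (form_eigenspace V B c))) -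
     (\<Sum>c | c < 0 \<and> form_eigenspace V B c \<noteq> {0}. int (dim (form_eigenspace V B c)))"

definition nondegenerate_on :: "'w::euclidean_space set \<Rightarrow> ('w \<Rightarrow> 'w \<Rightarrow> real) \<Rightarrow> bool" where
  "nondegenerate_on V B \<longleftrightarrow> (\<forall>v\<in>V. (\<forall>w\<in>V. B v w = 0) \<longrightarrow> v = 0)"

definition eigenspace :: "real^'m^'m \<Rightarrow> real \<Rightarrow> (real^'m) set" where
  "eigenspace S c = {v. S *v v = c *\<^sub>R v}"

definition is_eigenvalue :: "real^'m^'m \<Rightarrow> real \<Rightarrow> bool" where
  "is_eigenvalue S c \<longleftrightarrow> (\<exists>v. v \<noteq> 0 \<and> S *v v = c *\<^sub>R v)"

definition matrix_signature :: "real^'m^'m \<Rightarrow> int" where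
  "matrix_signature S =
     (\<Sum>c | c > 0 \<and> is_eigenvalue S c. int (dim (eigenspace S c))) -
     (\<Sum>c | c < 0 \<and> is_eigenvalue S c. int (dim (eigenspace S c)))"

lemma matrix_signature_eq_form_signature:
  assumes "transpose S = S"
  shows "matrix_signature S = form_signature UNIV (\<lambda>v w. v \<bullet> (S *v w))"
proof -
  have "form_eigenspace UNIV (\<lambda>v w. v \<bullet> (S *v w)) c = eigenspace S c" for c
  proof -
    have "(\<forall>w. v \<bullet> (S *v w) = c * (v \<bullet> w)) \<longleftrightarrow> S *v v = c *\<^sub>R v" for v
    proof -
      have "v \<bullet> (S *v w) = (S *v v) \<bullet> w" for w
        using dot_lmul_matrix[of v S w] transpose_matrix_vector[of S v] assms by simp
      then show ?thesis
        by (metis inner_scaleR_left vector_eq_rdot)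
    qed
    then show ?thesis
      by (simp add: form_eigenspace_def eigenspace_def)
  qed
  moreover have "is_eigenvalue S c \<longleftrightarrow> eigenspace S c \<noteq> {0}" for c
  proof -
    have "0 \<in> eigenspace S c"
      by (simp add: eigenspace_def)
    then show ?thesis
      by (auto simp: is_eigenvalue_def eigenspace_def)
  qed
  ultimately show ?thesis
    by (simp add: matrix_signature_def form_signature_def)
qed


section \<open>Lagrangian subspaces\<close>

definition symplectic_form :: "('w::euclidean_space \<Rightarrow> 'w \<Rightarrow> real) \<Rightarrow> bool" where
  "symplectic_form \<Omega> \<longleftrightarrow>
     bilinear \<Omega> \<and> (\<forall>v w. \<Omega> v w = - \<Omega> w v) \<and> nondegenerate_on UNIV \<Omega>"

definition lagrangian :: "('w::euclidean_space \<Rightarrow> 'w \<Rightarrow> real) \<Rightarrow> 'w set \<Rightarrow> bool" where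
  "lagrangian \<Omega> L \<longleftrightarrow> subspace L \<and> L = {w. \<forall>v\<in>L. \<Omega> v w = 0}"

text \<open>A subspace is identified with the orthogonal projection onto it. On functions, the type class
  topology is that of pointwise convergence, which on linear endomorphisms of a finite-dimensional
  space is the norm topology; so this is the usual topology of the Lagrangian Grassmannian, as a
  subspace of the Grassmannian.\<close>

definition lagrangian_grassmannian :: "('w::euclidean_space \<Rightarrow> 'w \<Rightarrow> real) \<Rightarrow> 'w set topology" where
  "lagrangian_grassmannian \<Omega> = pullback_topology {L. lagrangian \<Omega> L} closest_point euclidean"

definition smooth_on_Icc :: "real \<Rightarrow> real \<Rightarrow> (real \<Rightarrow> 'w::real_normed_vector) \<Rightarrow> bool" where
  "smooth_on_Icc a b f \<longleftrightarrow>
     (\<exists>D. D 0 = f \<and>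
        (\<forall>k. \<forall>t\<in>{a..b}. (D k has_vector_derivative D (Suc k) t) (at t within {a..b})))"

text \<open>Under the same identification the Grassmannian is an embedded submanifold of the space of
  linear endomorphisms, whence the smoothness condition.\<close>

definition smooth_lagrangian_path ::
    "('w::euclidean_space \<Rightarrow> 'w \<Rightarrow> real) \<Rightarrow> real \<Rightarrow> real \<Rightarrow> (real \<Rightarrow> 'w set) \<Rightarrow> bool" where
  "smooth_lagrangian_path \<Omega> a b \<Lambda> \<longleftrightarrow>
     (\<forall>t\<in>{a..b}. lagrangian \<Omega> (\<Lambda> t)) \<and>
     (\<forall>w. smooth_on_Icc a b (\<lambda>t. closest_point (\<Lambda> t) w))"


section \<open>The index of a path of Lagrangian subspaces\<close>

definition complementary :: "'w::euclidean_space set \<Rightarrow> 'w set \<Rightarrow> bool" where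
  "complementary V M \<longleftrightarrow> V \<inter> M = {0} \<and> {v + m | v m. v \<in> V \<and> m \<in> M} = UNIV"

text \<open>If \<open>V = {v + \<alpha> v | v. v \<in> V0}\<close> with \<open>\<alpha>\<close> mapping \<open>V0\<close> to a complement \<open>M\<close> of \<open>V0\<close>,
  then \<open>\<alpha> v = graph_map M V v\<close> for \<open>v \<in> V0\<close>.\<close>

definition graph_map :: "'w::euclidean_space set \<Rightarrow> 'w set \<Rightarrow> 'w \<Rightarrow> 'w" where
  "graph_map M V v = (THE m. m \<in> M \<and> v + m \<in> V)"

text \<open>The value of the form does not depend on the complement \<open>M\<close> chosen. The derivative is
  one-sided at the end points of \<open>{a..b}\<close>.\<close>

definition velocity_form ::
    "('w::euclidean_space \<Rightarrow> 'w \<Rightarrow> real) \<Rightarrow> real \<Rightarrow> real \<Rightarrow> (real \<Rightarrow> 'w set) \<Rightarrow> real \<Rightarrow> 'w \<Rightarrow> 'w \<Rightarrow> real"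
  where
  "velocity_form \<Omega> a b \<Lambda> t0 v v' =
     (let M = (SOME M. lagrangian \<Omega> M \<and> complementary (\<Lambda> t0) M)
      in vector_derivative (\<lambda>t. \<Omega> v (graph_map M (\<Lambda> t) v')) (at t0 within {a..b}))"

definition crossing :: "'w::euclidean_space set \<Rightarrow> (real \<Rightarrow> 'w set) \<Rightarrow> real \<Rightarrow> bool" where
  "crossing L \<Lambda> t \<longleftrightarrow> \<Lambda> t \<inter> L \<noteq> {0}"

definition regular_crossings ::
    "('w::euclidean_space \<Rightarrow> 'w \<Rightarrow> real) \<Rightarrow> 'w set \<Rightarrow> real \<Rightarrow> real \<Rightarrow> (real \<Rightarrow> 'w set) \<Rightarrow> bool" where
  "regular_crossings \<Omega> L a b \<Lambda> \<longleftrightarrow>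
     (\<forall>t\<in>{a..b}. crossing L \<Lambda> t \<longrightarrow> nondegenerate_on (\<Lambda> t \<inter> L) (velocity_form \<Omega> a b \<Lambda> t))"

definition crossing_signature ::
    "('w::euclidean_space \<Rightarrow> 'w \<Rightarrow> real) \<Rightarrow> 'w set \<Rightarrow> real \<Rightarrow> real \<Rightarrow> (real \<Rightarrow> 'w set) \<Rightarrow> real \<Rightarrow> int" where
  "crossing_signature \<Omega> L a b \<Lambda> t = form_signature (\<Lambda> t \<inter> L) (velocity_form \<Omega> a b \<Lambda> t)"

text \<open>Regular crossings are isolated, so for smooth paths with only regular crossings the sum is
  finite. If an end point is not a crossing, its contribution is the signature of a form on
  \<open>{0}\<close>, that is, zero.\<close>

definition regular_rs_index ::
    "('w::euclidean_space \<Rightarrow> 'w \<Rightarrow> real) \<Rightarrow> 'w set \<Rightarrow> real \<Rightarrow> real \<Rightarrow> (real \<Rightarrow> 'w set) \<Rightarrow> real" where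
  "regular_rs_index \<Omega> L a b \<Lambda> =
     1/2 * of_int (crossing_signature \<Omega> L a b \<Lambda> a) +
     (\<Sum>t | a < t \<and> t < b \<and> crossing L \<Lambda> t. of_int (crossing_signature \<Omega> L a b \<Lambda> t)) +
     1/2 * of_int (crossing_signature \<Omega> L a b \<Lambda> b)"

definition lagrangian_homotopic ::
    "('w::euclidean_space \<Rightarrow> 'w \<Rightarrow> real) \<Rightarrow> real \<Rightarrow> real \<Rightarrow> (real \<Rightarrow> 'w set) \<Rightarrow> (real \<Rightarrow> 'w set) \<Rightarrow> bool"
  where
  "lagrangian_homotopic \<Omega> a b \<Lambda> \<Lambda>' \<longleftrightarrow>
     homotopic_with (\<lambda>K. K a = \<Lambda> a \<and> K b = \<Lambda> b)
       (top_of_set {a..b}) (lagrangian_grassmannian \<Omega>) \<Lambda> \<Lambda>'"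

definition lagrangian_rs_index ::
    "('w::euclidean_space \<Rightarrow> 'w \<Rightarrow> real) \<Rightarrow> 'w set \<Rightarrow> real \<Rightarrow> real \<Rightarrow> (real \<Rightarrow> 'w set) \<Rightarrow> real" where
  "lagrangian_rs_index \<Omega> L a b \<Lambda> =
     (THE r. \<exists>\<Lambda>'. smooth_lagrangian_path \<Omega> a b \<Lambda>' \<and> regular_crossings \<Omega> L a b \<Lambda>' \<and>
        lagrangian_homotopic \<Omega> a b \<Lambda> \<Lambda>' \<and> r = regular_rs_index \<Omega> L a b \<Lambda>')"


section \<open>Symplectic matrices\<close>

text \<open>The index type \<^typ>\<open>'n + 'n\<close> has \<open>2 * CARD('n)\<close> elements; \<open>Inl\<close> is the first half of the
  coordinates and \<open>Inr\<close> the second.\<close>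

definition block_matrix ::
    "real^'n^'n \<Rightarrow> real^'n^'n \<Rightarrow> real^'n^'n \<Rightarrow> real^'n^'n \<Rightarrow> real^('n::finite + 'n)^('n + 'n)" where
  "block_matrix A B C D = (\<chi> i j.
     case i of
       Inl p \<Rightarrow> (case j of Inl q \<Rightarrow> A $ p $ q | Inr q \<Rightarrow> B $ p $ q)
     | Inr p \<Rightarrow> (case j of Inl q \<Rightarrow> C $ p $ q | Inr q \<Rightarrow> D $ p $ q))"

definition Omega0 :: "real^('n::finite + 'n)^('n + 'n)" where
  "Omega0 = block_matrix 0 (mat 1) (- mat 1) 0"

definition J0 :: "real^('n::finite + 'n)^('n + 'n)" where
  "J0 = block_matrix 0 (- mat 1) (mat 1) 0"

definition omega0 :: "real^('n::finite + 'n) \<Rightarrow> real^('n + 'n) \<Rightarrow> real" where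
  "omega0 v w = v \<bullet> (Omega0 *v w)"

definition Sp :: "(real^('n::finite + 'n)^('n + 'n)) set" where
  "Sp = {A. transpose A ** Omega0 ** A = Omega0}"

definition symplectic_path :: "real \<Rightarrow> real \<Rightarrow> (real \<Rightarrow> real^('n::finite + 'n)^('n + 'n)) \<Rightarrow> bool" where
  "symplectic_path a b \<psi> \<longleftrightarrow> continuous_on {a..b} \<psi> \<and> \<psi> ` {a..b} \<subseteq> Sp"

text \<open>Multiplication in the type class sense is componentwise on \<^typ>\<open>real^'m^'m\<close>, so the constant
  \<^const>\<open>exp\<close> is not the exponential of matrices.\<close>

definition matrix_exp :: "real^'m^'m \<Rightarrow> real^'m^'m" where
  "matrix_exp A = (\<Sum>k. (1 / fact k) *\<^sub>R (((**) A) ^^ k) (mat 1))"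

definition omega_bar ::
    "(real^('n::finite + 'n)) \<times> (real^('n + 'n)) \<Rightarrow> (real^('n + 'n)) \<times> (real^('n + 'n)) \<Rightarrow> real" where
  "omega_bar v w = - omega0 (fst v) (fst w) + omega0 (snd v) (snd w)"

definition graph :: "real^'m^'m \<Rightarrow> ((real^'m) \<times> (real^'m)) set" where
  "graph A = {(x, A *v x) | x. True}"

definition diagonal :: "((real^'m) \<times> (real^'m)) set" where
  "diagonal = {(x, x) | x. True}"

definition rs_index :: "real \<Rightarrow> real \<Rightarrow> (real \<Rightarrow> real^('n::finite + 'n)^('n + 'n)) \<Rightarrow> real" where
  "rs_index a b \<psi> = lagrangian_rs_index omega_bar diagonal a b (\<lambda>t. graph (\<psi> t))"

lemma transpose_Omega0: "transpose Omega0 = - Omega0"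
  by (auto simp: Omega0_def block_matrix_def vec_eq_iff transpose_def mat_def split: sum.splits)

lemma Omega0_squared: "Omega0 ** Omega0 = (- mat 1 :: real^('n::finite + 'n)^('n + 'n))"
proof -
  have sum_split: "(\<Sum>k\<in>UNIV. f k) = (\<Sum>p\<in>UNIV. f (Inl p)) + (\<Sum>p\<in>UNIV. f (Inr p))"
    for f :: "'n + 'n \<Rightarrow> real"
    by (subst UNIV_Plus_UNIV[symmetric], subst sum.Plus) auto
  have "(\<Sum>k\<in>UNIV. Omega0 $ i $ k * Omega0 $ k $ j) = (- mat 1 :: real^('n + 'n)^('n + 'n)) $ i $ j"
    for i j :: "'n + 'n"
    by (cases i; cases j)
       (simp_all add: sum_split Omega0_def block_matrix_def mat_def sum_negf mult_delta_left
          mult_delta_right)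
  then show ?thesis
    by (simp add: vec_eq_iff matrix_matrix_mult_def)
qed

lemma omega0_antisym: "omega0 v w = - omega0 w v"
proof -
  have "omega0 v w = (transpose Omega0 *v v) \<bullet> w"
    by (simp add: omega0_def dot_lmul_matrix)
  also have "\<dots> = - (Omega0 *v v) \<bullet> w"
    using matrix_vector_mult_diff_rdistrib[of 0 Omega0 v] by (simp add: transpose_Omega0)
  finally show ?thesis
    by (simp add: omega0_def inner_commute)
qed

lemma omega0_nondegenerate:
  assumes "\<And>u. omega0 u w = 0"
  shows "w = 0"
proof -
  have "Omega0 *v w = 0"
    using assms[of "Omega0 *v w"] by (simp add: omega0_def)
  then have "(Omega0 ** Omega0) *v w = 0"
    by (simp flip: matrix_vector_mul_assoc)
  then show ?thesis
    using matrix_vector_mult_diff_rdistrib[of 0 "mat 1" w] by (simp add: Omega0_squared)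
qed

lemma omega0_linear_right: "linear (omega0 v)"
  unfolding omega0_def
  by (rule linearI) (simp_all add: matrix_vector_right_distrib inner_add_right
      matrix_vector_mult_scaleR)

lemma symplectic_form_omega_bar:
  "symplectic_form (omega_bar :: (real^('n::finite + 'n)) \<times> (real^('n + 'n)) \<Rightarrow> _)"
proof -
  have antisym: "omega_bar v w = - omega_bar w v" for v w :: "(real^('n + 'n)) \<times> (real^('n + 'n))"
    unfolding omega_bar_def
    using omega0_antisym[of "fst v" "fst w"] omega0_antisym[of "snd v" "snd w"] by simp
  have linear_right: "linear (omega_bar v)" for v :: "(real^('n + 'n)) \<times> (real^('n + 'n))"
    unfolding omega_bar_def
    by (rule linearI) (simp_all add: linear_add[OF omega0_linear_right]
        linear_cmul[OF omega0_linear_right] algebra_simps)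
  have "linear (\<lambda>v. omega_bar v w)" for w :: "(real^('n + 'n)) \<times> (real^('n + 'n))"
    using linear_compose_neg[OF linear_right[of w]] by (simp flip: antisym)
  moreover have "v = 0" if "\<forall>w. omega_bar v w = 0" for v :: "(real^('n + 'n)) \<times> (real^('n + 'n))"
  proof -
    have "omega0 u (fst v) = 0" for u
      using that[rule_format, of "(u, 0)"] linear_0[OF omega0_linear_right, of "snd v"]
        omega0_antisym[of u "fst v"] by (simp add: omega_bar_def)
    moreover have "omega0 u (snd v) = 0" for u
      using that[rule_format, of "(0, u)"] linear_0[OF omega0_linear_right, of "fst v"]
        omega0_antisym[of u "snd v"] by (simp add: omega_bar_def)
    ultimately show ?thesis
      by (simp add: omega0_nondegenerate prod_eq_iff)
  qed
  ultimately show ?thesis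
    unfolding symplectic_form_def nondegenerate_on_def bilinear_def
    using antisym linear_right by blast
qed

lemma lagrangian_graph:
  fixes A :: "real^('n::finite + 'n)^('n + 'n)"
  assumes "A \<in> Sp"
  shows "lagrangian omega_bar (graph A)"
proof -
  have inv: "omega0 (A *v u) (A *v x) = omega0 u x" for u x
  proof -
    have "omega0 (A *v u) (A *v x) = u \<bullet> ((transpose A ** Omega0 ** A) *v x)"
      by (simp add: omega0_def inner_commute dot_lmul_matrix flip: matrix_vector_mul_assoc)
         (metis dot_lmul_matrix inner_commute transpose_matrix_vector transpose_transpose)
    then show ?thesis
      using assms by (simp add: Sp_def omega0_def)
  qed
  have "inj ((*v) A)"
  proof (rule injI)
    fix x y assume eq: "A *v x = A *v y"
    have "omega0 u (x - y) = 0" for u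
      using inv[of u x] inv[of u y] eq by (simp add: linear_diff[OF omega0_linear_right])
    then show "x = y"
      using omega0_nondegenerate by fastforce
  qed
  then have surj: "surj ((*v) A)"
    by (simp add: linear_injective_imp_surjective)
  have "(\<forall>u. - omega0 u x + omega0 (A *v u) y = 0) \<longleftrightarrow> y = A *v x" for x y
  proof
    assume *: "\<forall>u. - omega0 u x + omega0 (A *v u) y = 0"
    have "omega0 z (y - A *v x) = 0" for z
    proof -
      obtain u where "z = A *v u"
        using surj by (metis surjD)
      then show ?thesis
        using *[rule_format, of u] inv[of u x] by (simp add: linear_diff[OF omega0_linear_right])
    qed
    then show "y = A *v x"
      using omega0_nondegenerate by fastforce
  qed (simp add: inv)
  then have "{w. \<forall>v\<in>graph A. omega_bar v w = 0} = graph A"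
    by (auto simp: graph_def omega_bar_def)
  moreover have "subspace (graph A)"
    by (auto simp: subspace_def graph_def matrix_vector_right_distrib matrix_vector_mult_scaleR
        zero_prod_def)
  ultimately show ?thesis
    by (simp add: lagrangian_def)
qed

lemma lagrangian_diagonal: "lagrangian omega_bar (diagonal :: ((real^('n::finite + 'n)) \<times> _) set)"
proof -
  have "lagrangian omega_bar (graph (mat 1 :: real^('n + 'n)^('n + 'n)))"
    by (rule lagrangian_graph) (simp add: Sp_def)
  then show ?thesis
    by (simp add: diagonal_def graph_def)
qed


section \<open>Characterizing properties\<close>

text \<open>A correspondence \<open>\<mu>\<close> takes the end points \<open>a < b\<close> and a function of which only the restriction
  to \<open>{a..b}\<close> is relevant. That \<open>\<mu> a b \<psi>\<close> depends on this restriction only is a consequence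
  of the homotopy property: two functions agreeing on \<open>{a..b}\<close> are homotopic in the sense of
  \<^const>\<open>homotopic_with\<close>. No property relates different dimensions, so a correspondence for all
  \<open>n \<ge> 1\<close> is a family of independent such \<open>\<mu>\<close>, one for each \<open>n = CARD('n)\<close>.\<close>

definition half_integer_valued ::
    "(real \<Rightarrow> real \<Rightarrow> (real \<Rightarrow> real^('n::finite + 'n)^('n + 'n)) \<Rightarrow> real) \<Rightarrow> bool" where
  "half_integer_valued \<mu> \<longleftrightarrow>
     (\<forall>a b \<psi>. a < b \<and> symplectic_path a b \<psi> \<longrightarrow> (\<exists>k::int. \<mu> a b \<psi> = of_int k / 2))"

definition homotopy_property ::
    "(real \<Rightarrow> real \<Rightarrow> (real \<Rightarrow> real^('n::finite + 'n)^('n + 'n)) \<Rightarrow> real) \<Rightarrow> bool" where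
  "homotopy_property \<mu> \<longleftrightarrow>
     (\<forall>a b \<psi> \<phi>. a < b \<and> symplectic_path a b \<psi> \<and> symplectic_path a b \<phi> \<and>
        homotopic_with_canon (\<lambda>\<xi>. \<xi> a = \<psi> a \<and> \<xi> b = \<psi> b) {a..b} Sp \<psi> \<phi> \<longrightarrow>
        \<mu> a b \<psi> = \<mu> a b \<phi>)"

definition catenation_property ::
    "(real \<Rightarrow> real \<Rightarrow> (real \<Rightarrow> real^('n::finite + 'n)^('n + 'n)) \<Rightarrow> real) \<Rightarrow> bool" where
  "catenation_property \<mu> \<longleftrightarrow>
     (\<forall>a b c \<psi>. a < c \<and> c < b \<and> symplectic_path a b \<psi> \<longrightarrow>
        \<mu> a b \<psi> = \<mu> a c \<psi> + \<mu> c b \<psi>)"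

definition zero_property ::
    "(real \<Rightarrow> real \<Rightarrow> (real \<Rightarrow> real^('n::finite + 'n)^('n + 'n)) \<Rightarrow> real) \<Rightarrow> bool" where
  "zero_property \<mu> \<longleftrightarrow>
     (\<forall>a b \<psi> k. a < b \<and> symplectic_path a b \<psi> \<and>
        (\<forall>t\<in>{a..b}. dim {v. (\<psi> t - mat 1) *v v = 0} = k) \<longrightarrow>
        \<mu> a b \<psi> = 0)"

definition normalization_property ::
    "(real \<Rightarrow> real \<Rightarrow> (real \<Rightarrow> real^('n::finite + 'n)^('n + 'n)) \<Rightarrow> real) \<Rightarrow> bool" where
  "normalization_property \<mu> \<longleftrightarrow>
     (\<forall>S. transpose S = S \<and> (\<forall>c. is_eigenvalue S c \<longrightarrow> \<bar>c\<bar> < 2 * pi) \<longrightarrow>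
        \<mu> 0 1 (\<lambda>t. matrix_exp (t *\<^sub>R (J0 ** S))) = 1/2 * of_int (matrix_signature S))"

definition rs_properties ::
    "(real \<Rightarrow> real \<Rightarrow> (real \<Rightarrow> real^('n::finite + 'n)^('n + 'n)) \<Rightarrow> real) \<Rightarrow> bool" where
  "rs_properties \<mu> \<longleftrightarrow>
     half_integer_valued \<mu> \<and> homotopy_property \<mu> \<and> catenation_property \<mu> \<and>
     zero_property \<mu> \<and> normalization_property \<mu>"

end

theory Submission
  imports Defs
begin

text \<open>The index is computed through the Kashiwara form: for a Lagrangian \<open>M\<close> transversal to \<open>L\<close> let
  \<open>kap L M Y\<close> be the signature of the chart form of \<open>Y\<close> over \<open>L\<close> with respect to \<open>M\<close>. The cocycle
  identity shows that changing \<open>M\<close> changes \<open>kap L M\<close> by a locally constant function, so along any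
  continuous path these functions glue to a function whose increment is a Maslov index. It is
  homotopy invariant and additive by construction. At a regular crossing it jumps by the crossing
  signature on either side, so half of it is the Robbin-Salamon index.

  For uniqueness, the difference \<open>\<nu>\<close> of two correspondences vanishes on constant-stratum paths and
  on small exponentials, hence, comparing exponentials with Cayley transforms, on all paths near the
  identity. Any symplectic \<open>A\<close> is joined to a matrix near the identity by transvection paths that
  do not change its fixed space; multiplying such a path with a small rotation gives a rectangle of
  which all sides but one are known, so \<open>\<nu>\<close> vanishes on short paths \<open>A ** rotation \<theta>\<close>. Since a
  small rotation removes all fixed vectors from nearby matrices, \<open>\<nu>\<close> vanishes locally on every path.\<close>

section \<open>Symmetric bilinear forms\<close>

text \<open>\<open>rs_index\<close> is a \<open>THE\<close> over regular smooth representatives, so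
  two facts must be supplied: such a representative exists, and all of them give the same number.
  The second is the reason for the detour through an integer defined for every continuous path:
  crossings are awkward to follow in a homotopy, since a signature jumps where its form degenerates.
  The cocycle identity avoids this. Its correction term is a signature on \<open>M'\<close> with
  radical \<open>M \<inter> M'\<close>, which does not move with \<open>Y\<close>, so it is locally
  constant even where \<open>Y\<close> meets \<open>L\<close>. The factor one half arises because an
  interior crossing is passed from both sides and an end point from one. For uniqueness the obstacle
  is that the normalization speaks only about exponentials with bounded generators, while matrices
  far from the identity must be treated too. The zero property sees only the fixed space, and
  rank-one changes can move a matrix without altering it. Keeping the space itself fixed, not just
  its dimension, makes one small angle work for the whole motion; this is what closes the
  rectangles.\<close>

definition sym_form :: "'w::euclidean_space set \<Rightarrow> ('w \<Rightarrow> 'w \<Rightarrow> real) \<Rightarrow> bool" where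
  "sym_form V B \<longleftrightarrow> subspace V \<and> (\<forall>x\<in>V. \<forall>y\<in>V. B x y = B y x) \<and>
     (\<forall>x\<in>V. \<forall>y\<in>V. \<forall>z\<in>V. B (x + y) z = B x z + B y z) \<and>
     (\<forall>c. \<forall>x\<in>V. \<forall>y\<in>V. B (c *\<^sub>R x) y = c * B x y)"

definition pos_def_on :: "'w::euclidean_space set \<Rightarrow> ('w \<Rightarrow> 'w \<Rightarrow> real) \<Rightarrow> bool" where
  "pos_def_on U B \<longleftrightarrow> (\<forall>x\<in>U. x \<noteq> 0 \<longrightarrow> B x x > 0)"

text \<open>The maximal dimension of a positive definite subspace, as in Sylvester's law. No basis
  is chosen, congruence invariance is immediate, and a positive definite subspace that survives a
  perturbation bounds the index from below.\<close>

definition pos_index :: "'w::euclidean_space set \<Rightarrow> ('w \<Rightarrow> 'w \<Rightarrow> real) \<Rightarrow> nat" where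
  "pos_index V B = Max {dim U | U. subspace U \<and> U \<subseteq> V \<and> pos_def_on U B}"

definition form_rad :: "'w::euclidean_space set \<Rightarrow> ('w \<Rightarrow> 'w \<Rightarrow> real) \<Rightarrow> 'w set" where
  "form_rad V B = {v \<in> V. \<forall>w\<in>V. B v w = 0}"

definition sig :: "'w::euclidean_space set \<Rightarrow> ('w \<Rightarrow> 'w \<Rightarrow> real) \<Rightarrow> int" where
  "sig V B = int (pos_index V B) - int (pos_index V (\<lambda>x y. - B x y))"

lemma sym_formD:
  assumes "sym_form V B"
  shows "subspace V" "\<And>x y. x \<in> V \<Longrightarrow> y \<in> V \<Longrightarrow> B x y = B y x"
    "\<And>x y z. x \<in> V \<Longrightarrow> y \<in> V \<Longrightarrow> z \<in> V \<Longrightarrow> B (x + y) z = B x z + B y z"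
    "\<And>x y z. x \<in> V \<Longrightarrow> y \<in> V \<Longrightarrow> z \<in> V \<Longrightarrow> B z (x + y) = B z x + B z y"
    "\<And>c x y. x \<in> V \<Longrightarrow> y \<in> V \<Longrightarrow> B (c *\<^sub>R x) y = c * B x y"
    "\<And>c x y. x \<in> V \<Longrightarrow> y \<in> V \<Longrightarrow> B x (c *\<^sub>R y) = c * B x y"
    "\<And>y. y \<in> V \<Longrightarrow> B 0 y = 0" "\<And>y. y \<in> V \<Longrightarrow> B y 0 = 0"
proof -
  show 1: "subspace V" "\<And>x y. x \<in> V \<Longrightarrow> y \<in> V \<Longrightarrow> B x y = B y x"
    "\<And>x y z. x \<in> V \<Longrightarrow> y \<in> V \<Longrightarrow> z \<in> V \<Longrightarrow> B (x + y) z = B x z + B y z"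
    "\<And>c x y. x \<in> V \<Longrightarrow> y \<in> V \<Longrightarrow> B (c *\<^sub>R x) y = c * B x y"
    using assms unfolding sym_form_def by auto
  show "B z (x + y) = B z x + B z y" if "x \<in> V" "y \<in> V" "z \<in> V" for x y z
    using 1(2)[of z "x + y"] 1(2)[of z x] 1(2)[of z y] 1(3)[of x y z] that subspace_add[OF 1(1)] by simp
  show "B x (c *\<^sub>R y) = c * B x y" if "x \<in> V" "y \<in> V" for c x y
    using 1(2)[of x "c *\<^sub>R y"] 1(2)[of x y] 1(4)[of y x c] that subspace_scale[OF 1(1)] by simp
  show 0: "B 0 y = 0" if "y \<in> V" for y using 1(4)[OF that that, of 0] by simp
  show "B y 0 = 0" if "y \<in> V" for y
    using 0[OF that] 1(2)[OF that subspace_0[OF 1(1)]] by simp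
qed

lemma sym_form_uminus: "sym_form V B \<Longrightarrow> sym_form V (\<lambda>x y. - B x y)"
  unfolding sym_form_def by auto

lemma sym_form_subset: "sym_form V B \<Longrightarrow> subspace U \<Longrightarrow> U \<subseteq> V \<Longrightarrow> sym_form U B"
  unfolding sym_form_def by (meson subsetD)

lemma sig_uminus: "sig V (\<lambda>x y. - B x y) = - sig V B"
  by (simp add: sig_def)

lemma sym_form_sum_left:
  assumes "sym_form V B" "finite I" "\<And>i. i \<in> I \<Longrightarrow> f i \<in> V" "y \<in> V"
  shows "B (\<Sum>i\<in>I. f i) y = (\<Sum>i\<in>I. B (f i) y)"
  using assms(2,3)
proof (induction I rule: finite_induct)
  case empty then show ?case using sym_formD(7)[OF assms(1,4)] by simp
next
  case (insert i I)
  have "(\<Sum>i\<in>I. f i) \<in> V" using insert sym_formD(1)[OF assms(1)] by (intro subspace_sum) auto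
  then show ?case using insert sym_formD(3)[OF assms(1), of "f i" "\<Sum>i\<in>I. f i" y] assms(4) by simp
qed

text \<open>Continuity and perturbation of forms are reduced to the finitely many numbers
  \<open>B e f\<close>.\<close>

lemma sym_form_expand:
  assumes B: "sym_form V B" and E: "finite E" "pairwise orthogonal E" "\<And>e. e \<in> E \<Longrightarrow> norm e = 1"
    "E \<subseteq> V" and xy: "x \<in> span E" "y \<in> span E"
  shows "B x y = (\<Sum>e\<in>E. \<Sum>f\<in>E. (x \<bullet> e) * (y \<bullet> f) * B e f)"
proof -
  note D = sym_formD[OF B]
  have EV: "\<And>e. e \<in> E \<Longrightarrow> e \<in> V" using E by auto
  have sV: "span E \<subseteq> V" using E D(1) by (simp add: span_minimal)
  have x: "x = (\<Sum>e\<in>E. (x \<bullet> e) *\<^sub>R e)" and y: "y = (\<Sum>e\<in>E. (y \<bullet> e) *\<^sub>R e)"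
    using orthonormal_basis_expand[OF E(2,3)] E(1) xy by simp_all
  have "B x y = B (\<Sum>e\<in>E. (x \<bullet> e) *\<^sub>R e) y" using x by simp
  also have "\<dots> = (\<Sum>e\<in>E. B ((x \<bullet> e) *\<^sub>R e) y)"
    using xy sV EV subspace_scale[OF D(1)] by (intro sym_form_sum_left[OF B E(1)]) auto
  also have "\<dots> = (\<Sum>e\<in>E. (x \<bullet> e) * B y e)"
    using xy sV EV D(5) D(2) by (intro sum.cong) (auto simp: subset_iff)
  also have "\<dots> = (\<Sum>e\<in>E. \<Sum>f\<in>E. (x \<bullet> e) * (y \<bullet> f) * B e f)"
  proof (rule sum.cong[OF refl])
    fix e assume e: "e \<in> E"
    have "B y e = B (\<Sum>e\<in>E. (y \<bullet> e) *\<^sub>R e) e" using y by simp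
    also have "\<dots> = (\<Sum>f\<in>E. B ((y \<bullet> f) *\<^sub>R f) e)"
      using e EV subspace_scale[OF D(1)] by (intro sym_form_sum_left[OF B E(1)]) auto
    also have "\<dots> = (\<Sum>f\<in>E. (y \<bullet> f) * B e f)"
      using e EV D(5) D(2) by (intro sum.cong) (auto simp: subset_iff)
    finally show "(x \<bullet> e) * B y e = (\<Sum>f\<in>E. (x \<bullet> e) * (y \<bullet> f) * B e f)"
      by (simp add: sum_distrib_left mult.assoc)
  qed
  finally show ?thesis .
qed

lemma orthonormal_basis_finite:
  assumes "subspace (V :: 'w::euclidean_space set)"
  obtains E where "finite E" "E \<subseteq> V" "pairwise orthogonal E" "\<And>e. e \<in> E \<Longrightarrow> norm e = 1" "span E = V" "card E = dim V"
  using orthonormal_basis_subspace[OF assms] by (metis independent_imp_finite)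

lemma continuous_on_sym_form:
  assumes "sym_form V B"
  shows "continuous_on V (\<lambda>x. B x x)"
proof -
  obtain E where E: "finite E" "E \<subseteq> V" "pairwise orthogonal E" "\<And>e. e \<in> E \<Longrightarrow> norm e = 1" "span E = V"
    using orthonormal_basis_finite[OF sym_formD(1)[OF assms]] by metis
  have "continuous_on V (\<lambda>x. \<Sum>e\<in>E. \<Sum>f\<in>E. (x \<bullet> e) * (x \<bullet> f) * B e f)"
    by (intro continuous_intros)
  then show ?thesis
    by (subst continuous_on_cong[OF refl sym_form_expand[OF assms E(1,3,4,2)]]) (auto simp: E)
qed

lemma compact_sphere_Int_subspace:
  "subspace (V :: 'w::euclidean_space set) \<Longrightarrow> compact (sphere 0 1 \<inter> V)"
  by (simp add: compact_Int_closed closed_subspace)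

text \<open>Spectral theorem for forms on a subspace: a unit vector \<open>e\<close> maximizing
  \<open>B x x\<close> is \<open>B\<close>-orthogonal to its orthogonal complement in
  \<open>V\<close>, and induction on the dimension diagonalizes the form there.\<close>

lemma sym_form_eigenbasis:
  assumes "sym_form V B"
  shows "\<exists>E. finite E \<and> pairwise orthogonal E \<and> (\<forall>e\<in>E. norm e = 1) \<and> span E = V \<and>
     (\<forall>e\<in>E. \<forall>f\<in>E. e \<noteq> f \<longrightarrow> B e f = 0)"
  using assms
proof (induction "dim V" arbitrary: V rule: less_induct)
  case less
  note D = sym_formD[OF less.prems]
  show ?case
  proof (cases "V = {0}")
    case True
    then show ?thesis by (intro exI[of _ "{}"]) auto
  next
    case False
    then obtain v where "v \<in> V" "v \<noteq> 0" using subspace_0[OF D(1)] by auto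
    then have "v /\<^sub>R norm v \<in> sphere 0 1 \<inter> V" by (simp add: subspace_scale[OF D(1)])
    then obtain e where e: "e \<in> sphere 0 1 \<inter> V" and emax: "\<And>x. x \<in> sphere 0 1 \<inter> V \<Longrightarrow> B x x \<le> B e e"
      using continuous_attains_sup[OF compact_sphere_Int_subspace[OF D(1)] _
          continuous_on_subset[OF continuous_on_sym_form[OF less.prems] Int_lower2]] by blast
    then have eV: "e \<in> V" and en: "norm e = 1" by auto
    have max: "B x x \<le> B e e * (norm x)\<^sup>2" if "x \<in> V" for x
    proof (cases "x = 0")
      case True then show ?thesis using D(7) subspace_0[OF D(1)] by simp
    next
      case False
      have "x /\<^sub>R norm x \<in> sphere 0 1 \<inter> V" using that False by (simp add: subspace_scale[OF D(1)])
      from emax[OF this] have "B (x /\<^sub>R norm x) (x /\<^sub>R norm x) \<le> B e e" .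
      moreover have "B (x /\<^sub>R norm x) (x /\<^sub>R norm x) = B x x / (norm x)\<^sup>2"
        using that subspace_scale[OF D(1)] by (simp add: D(5,6) power2_eq_square field_simps)
      ultimately have "B x x / (norm x)\<^sup>2 \<le> B e e" by simp
      then show ?thesis using False by (simp add: divide_le_eq)
    qed
    \<comment> \<open>First-order condition at the maximum: comparing \<open>e\<close> with
      \<open>e + t *\<^sub>R y\<close> gives a quadratic inequality in \<open>t\<close> without
      constant term. With \<open>d = 1 + \<bar>c\<bar>\<close> it fails at \<open>t = b / d\<close>
      unless the linear coefficient \<open>b\<close> is zero.\<close>
    have orth: "B e y = 0" if y: "y \<in> V" "y \<bullet> e = 0" for y
    proof -
      have "2 * t * B e y + t\<^sup>2 * (B y y - B e e * (norm y)\<^sup>2) \<le> 0" for t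
      proof -
        have "B (e + t *\<^sub>R y) (e + t *\<^sub>R y) = B e e + 2 * t * B e y + t\<^sup>2 * B y y"
          using eV y subspace_scale[OF D(1)] subspace_add[OF D(1)]
          by (simp add: D(3-6) D(2)[of y e] power2_eq_square algebra_simps)
        moreover have "(norm (e + t *\<^sub>R y))\<^sup>2 = 1 + t\<^sup>2 * (norm y)\<^sup>2"
          using en y(2) by (simp add: power2_norm_eq_inner inner_add_left inner_add_right inner_commute[of e y])
            (simp add: power2_eq_square dot_square_norm)
        moreover have "e + t *\<^sub>R y \<in> V" using eV y subspace_scale[OF D(1)] subspace_add[OF D(1)] by simp
        ultimately show ?thesis using max[of "e + t *\<^sub>R y"] by (simp add: algebra_simps)
      qed
      note t = this
      define b c where "b = B e y" and "c = B y y - B e e * (norm y)\<^sup>2"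
      have bc: "2 * t * b + t\<^sup>2 * c \<le> 0" for t using t unfolding b_def c_def .
      show ?thesis
      proof (rule ccontr)
        assume "B e y \<noteq> 0"
        then have b0: "b \<noteq> 0" by (simp add: b_def)
        define d where "d = 1 + \<bar>c\<bar>"
        have d: "d > 0" "2 * d + c > 0" by (auto simp: d_def)
        have "2 * (b / d) * b + (b / d)\<^sup>2 * c = b\<^sup>2 * (2 * d + c) / d\<^sup>2"
          using d(1) by (simp add: power2_eq_square field_simps)
        moreover have "b\<^sup>2 * (2 * d + c) / d\<^sup>2 > 0" using b0 d by simp
        ultimately show False using bc[of "b / d"] by simp
      qed
    qed
    define V' where "V' = {y \<in> V. orthogonal e y}"
    have "V' = V \<inter> {y. orthogonal e y}" by (auto simp: V'_def)
    then have sV': "subspace V'"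
      using D(1) subspace_orthogonal_to_vector[of e] subspace_inter by auto
    have V'V: "V' \<subseteq> V" by (auto simp: V'_def)
    have "e \<notin> V'" using en by (auto simp: V'_def orthogonal_def)
    then have "V' \<subset> V" using eV V'V by auto
    then have "dim V' < dim V" using sV' D(1) by (metis dim_psubset span_eq_iff)
    from less.hyps[OF this sym_form_subset[OF less.prems sV' V'V]]
    obtain E where E: "finite E" "pairwise orthogonal E" "\<forall>e\<in>E. norm e = 1" "span E = V'"
      "\<forall>e\<in>E. \<forall>f\<in>E. e \<noteq> f \<longrightarrow> B e f = 0" by auto
    have EV': "f \<in> V'" if "f \<in> E" for f using that E(4) span_base by auto
    have "span (insert e E) = V"
    proof
      show "span (insert e E) \<subseteq> V"
        using eV V'V EV' D(1) by (intro span_minimal) auto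
      show "V \<subseteq> span (insert e E)"
      proof
        fix y assume y: "y \<in> V"
        have "y - (y \<bullet> e) *\<^sub>R e \<in> V'"
          using y eV D(1) en by (simp add: V'_def subspace_diff subspace_scale orthogonal_def inner_diff_right dot_square_norm inner_commute)
        then have "y - (y \<bullet> e) *\<^sub>R e \<in> span E" using E(4) by simp
        then show "y \<in> span (insert e E)" by (auto simp: span_insert)
      qed
    qed
    moreover have "pairwise orthogonal (insert e E)"
      using E(2) EV' by (auto simp: pairwise_insert V'_def orthogonal_commute)
    moreover have "\<forall>e'\<in>insert e E. \<forall>f\<in>insert e E. e' \<noteq> f \<longrightarrow> B e' f = 0"
    proof -
      have "B e f = 0" "B f e = 0" if "f \<in> E" for f
        using orth[of f] EV'[OF that] D(2)[OF eV, of f] by (auto simp: V'_def orthogonal_def inner_commute)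
      then show ?thesis using E(5) by auto
    qed
    ultimately show ?thesis using E(1,3) en
      by (intro exI[of _ "insert e E"]) simp
  qed
qed

lemma span_orthogonal_disjoint:
  assumes "finite E" "pairwise orthogonal E" "\<And>e. e \<in> E \<Longrightarrow> norm e = 1" "F \<subseteq> E" "x \<in> span F" "e \<in> E - F"
  shows "x \<bullet> e = 0"
proof -
  have "orthogonal e f" if "f \<in> F" for f
    using assms that unfolding pairwise_def by (metis DiffE subsetD)
  then have "orthogonal e x" using assms(5) by (meson orthogonal_to_span)
  then show ?thesis by (simp add: orthogonal_def inner_commute)
qed

lemma eigenbasis_form:
  assumes B: "sym_form V B" and E: "finite E" "pairwise orthogonal E" "\<forall>e\<in>E. norm e = 1" "span E = V"
    "\<forall>e\<in>E. \<forall>f\<in>E. e \<noteq> f \<longrightarrow> B e f = 0" and xy: "x \<in> V" "y \<in> V"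
  shows "B x y = (\<Sum>e\<in>E. (x \<bullet> e) * (y \<bullet> e) * B e e)"
proof -
  have "E \<subseteq> V" using E(4) span_superset by auto
  then have "B x y = (\<Sum>e\<in>E. \<Sum>f\<in>E. (x \<bullet> e) * (y \<bullet> f) * B e f)"
    using sym_form_expand[OF B E(1,2)] E xy by auto
  also have "\<dots> = (\<Sum>e\<in>E. \<Sum>f\<in>E. if f = e then (x \<bullet> e) * (y \<bullet> e) * B e e else 0)"
    using E(5) by (intro sum.cong) auto
  also have "\<dots> = (\<Sum>e\<in>E. (x \<bullet> e) * (y \<bullet> e) * B e e)" using E(1) by simp
  finally show ?thesis .
qed

lemma eigenbasis_independent:
  assumes "pairwise orthogonal E" "\<forall>e\<in>E. norm e = 1"
  shows "independent E"
  using assms by (intro pairwise_orthogonal_independent) auto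

lemma dim_eigenbasis_part:
  assumes "pairwise orthogonal E" "\<forall>e\<in>E. norm e = 1" "F \<subseteq> E"
  shows "dim (span F) = card F"
  using independent_mono[OF eigenbasis_independent[OF assms(1,2)] assms(3)]
  by (simp add: dim_eq_card_independent)

lemma dim_image_inj:
  fixes T :: "'v::euclidean_space \<Rightarrow> 'w::euclidean_space"
  assumes "linear T" "subspace U" "inj_on T U"
  shows "dim (T ` U) = dim U"
  using assms by (intro dim_image_eq) (auto simp: span_eq_iff[THEN iffD2])

lemma pos_def_dim_le:
  assumes "subspace (V :: 'w::euclidean_space set)" "subspace U" "U \<subseteq> V" "subspace W" "W \<subseteq> V" "U \<inter> W = {0}"
  shows "dim U + dim W \<le> dim V"
proof -
  have "dim {x + y |x y. x \<in> U \<and> y \<in> W} + dim (U \<inter> W) = dim U + dim W"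
    by (rule dim_sums_Int[OF assms(2,4)])
  moreover have "dim {x + y |x y. x \<in> U \<and> y \<in> W} \<le> dim V"
    using assms by (intro dim_subset) (auto intro: subspace_add)
  ultimately show ?thesis using assms(6) by simp
qed

lemma finite_pos_dims:
  fixes V :: "'w::euclidean_space set"
  shows "finite {dim U | U. subspace U \<and> U \<subseteq> V \<and> pos_def_on U B}"
  by (rule finite_subset[of _ "{..dim V}"]) (auto intro: dim_subset)

lemma pos_index_ge:
  "subspace U \<Longrightarrow> U \<subseteq> V \<Longrightarrow> pos_def_on U B \<Longrightarrow> dim U \<le> pos_index V B"
  unfolding pos_index_def by (intro Max_ge finite_pos_dims) auto

lemma pos_index_attained:
  assumes "sym_form V B"
  obtains U where "subspace U" "U \<subseteq> V" "pos_def_on U B" "dim U = pos_index V B"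
proof -
  have "dim {0::'a} \<in> {dim U | U. subspace U \<and> U \<subseteq> V \<and> pos_def_on U B}"
    using subspace_0[OF sym_formD(1)[OF assms]]
    by (intro CollectI exI[of _ "{0}"]) (auto simp: pos_def_on_def)
  then have "pos_index V B \<in> {dim U | U. subspace U \<and> U \<subseteq> V \<and> pos_def_on U B}"
    unfolding pos_index_def using finite_pos_dims by (intro Max_in) auto
  then show ?thesis using that by auto
qed

text \<open>The span of the positive basis vectors is positive definite, which gives one inequality.
  A positive definite subspace meets the span of the nonpositive ones only in 0, and counting
  dimensions gives the other.\<close>

lemma pos_index_eigenbasis:
  assumes B: "sym_form V B" and E: "finite E" "pairwise orthogonal E" "\<forall>e\<in>E. norm e = 1" "span E = V"
    "\<forall>e\<in>E. \<forall>f\<in>E. e \<noteq> f \<longrightarrow> B e f = 0"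
  shows "pos_index V B = card {e\<in>E. B e e > 0}"
proof (rule antisym)
  note EF = eigenbasis_form[OF B E]
  define P N where "P = {e\<in>E. B e e > 0}" and "N = {e\<in>E. B e e \<le> 0}"
  have PE: "P \<subseteq> E" "N \<subseteq> E" and sP: "span P \<subseteq> V" "span N \<subseteq> V"
    using E(4) by (auto simp: P_def N_def intro!: span_mono)
  have zero: "x = 0" if "x \<in> V" "\<forall>e\<in>E. x \<bullet> e = 0" for x
    using orthonormal_basis_expand[OF E(2), of x] E that by auto
  have "pos_def_on (span P) B"
    unfolding pos_def_on_def
  proof (intro ballI impI)
    fix x assume x: "x \<in> span P" "x \<noteq> 0"
    have xV: "x \<in> V" using x sP by auto
    have "x \<bullet> e = 0" if "e \<in> E - P" for e
      using span_orthogonal_disjoint[OF E(1,2) _ PE(1) x(1) that] E(3) by auto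
    then have nn: "(x \<bullet> e) * (x \<bullet> e) * B e e \<ge> 0" if "e \<in> E" for e
      using that by (cases "e \<in> P") (auto simp: P_def)
    obtain e where e: "e \<in> E" "x \<bullet> e \<noteq> 0" using zero[OF xV] x(2) by blast
    then have "e \<in> P" using \<open>\<And>e. e \<in> E - P \<Longrightarrow> x \<bullet> e = 0\<close> by blast
    then have "(x \<bullet> e) * (x \<bullet> e) * B e e > 0" using e
      by (metis (mono_tags, lifting) P_def mem_Collect_eq mult_pos_pos not_real_square_gt_zero)
    then have "0 < (\<Sum>e\<in>E. (x \<bullet> e) * (x \<bullet> e) * B e e)" using E(1) e(1) nn by (intro sum_pos2) auto
    then show "B x x > 0" using EF[OF xV xV] by simp
  qed
  from pos_index_ge[OF subspace_span sP(1) this] show "card {e\<in>E. B e e > 0} \<le> pos_index V B"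
    using dim_eigenbasis_part[OF E(2,3) PE(1)] by (simp add: P_def)
  obtain U where U: "subspace U" "U \<subseteq> V" "pos_def_on U B" "dim U = pos_index V B"
    using pos_index_attained[OF B] by blast
  have "x = 0" if "x \<in> U" "x \<in> span N" for x
  proof (rule ccontr)
    assume "x \<noteq> 0"
    then have "B x x > 0" using that U(3) by (simp add: pos_def_on_def)
    moreover have xV: "x \<in> V" using that sP by auto
    have "x \<bullet> e = 0" if "e \<in> E - N" for e
      using span_orthogonal_disjoint[OF E(1,2) _ PE(2) \<open>x \<in> span N\<close> that] E(3) by auto
    then have "(x \<bullet> e) * (x \<bullet> e) * B e e \<le> 0" if "e \<in> E" for e
      using that by (cases "e \<in> N") (auto simp: N_def mult_nonneg_nonpos)
    then have "B x x \<le> 0" using EF[OF xV xV] by (simp add: sum_nonpos)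
    ultimately show False by simp
  qed
  then have "U \<inter> span N = {0}" using subspace_0[OF U(1)] span_0 by auto
  from pos_def_dim_le[OF sym_formD(1)[OF B] U(1,2) subspace_span sP(2) this]
  have "dim U + card N \<le> dim V" using dim_eigenbasis_part[OF E(2,3) PE(2)] by simp
  moreover have "dim V = card E" using dim_eigenbasis_part[OF E(2,3), of E] E(4) by simp
  moreover have "card E = card P + card N"
    using E(1) by (subst card_Un_disjoint[symmetric]) (auto simp: P_def N_def intro!: arg_cong[where f=card])
  ultimately show "pos_index V B \<le> card {e\<in>E. B e e > 0}" using U(4) by (simp add: P_def)
qed

text \<open>Stated for every \<open>c\<close>: the value 0 yields the radical, the other values
  yield the eigenspaces counted by \<open>form_signature\<close>.\<close>

lemma form_rad_eigenbasis:
  assumes B: "sym_form V B" and E: "finite E" "pairwise orthogonal E" "\<forall>e\<in>E. norm e = 1" "span E = V"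
    "\<forall>e\<in>E. \<forall>f\<in>E. e \<noteq> f \<longrightarrow> B e f = 0"
  shows "{v\<in>V. \<forall>w\<in>V. B v w = c * (v \<bullet> w)} = span {e\<in>E. B e e = c}"
proof -
  note EF = eigenbasis_form[OF B E]
  have EV: "e \<in> V" if "e \<in> E" for e using that E(4) span_base by auto
  have ee: "e \<bullet> f = (if e = f then 1 else 0)" if "e \<in> E" "f \<in> E" for e f
    using that E(2,3) by (auto simp: pairwise_def orthogonal_def dot_square_norm)
  have Be: "B v e = (v \<bullet> e) * B e e" if "v \<in> V" "e \<in> E" for v e
  proof -
    have "B v e = (\<Sum>f\<in>E. if f = e then (v \<bullet> e) * B e e else 0)"
      unfolding EF[OF that(1) EV[OF that(2)]] using that by (intro sum.cong) (auto simp: ee)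
    then show ?thesis using E(1) that by simp
  qed
  show ?thesis
  proof
    show "{v\<in>V. \<forall>w\<in>V. B v w = c * (v \<bullet> w)} \<subseteq> span {e\<in>E. B e e = c}"
    proof clarify
      fix v assume v: "v \<in> V" "\<forall>w\<in>V. B v w = c * (v \<bullet> w)"
      have "(v \<bullet> e) *\<^sub>R e \<in> span {e\<in>E. B e e = c}" if "e \<in> E" for e
      proof (cases "B e e = c")
        case True then show ?thesis using that by (intro span_scale span_base) auto
      next
        case False
        have "(v \<bullet> e) * B e e = c * (v \<bullet> e)" using v(2) Be[OF v(1) that] EV[OF that] by metis
        then have "v \<bullet> e = 0" using False by (metis mult.commute mult_cancel_left)
        then show ?thesis by (simp add: span_0)
      qed
      then have "(\<Sum>e\<in>E. (v \<bullet> e) *\<^sub>R e) \<in> span {e\<in>E. B e e = c}" by (rule span_sum)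
      then show "v \<in> span {e\<in>E. B e e = c}"
        using orthonormal_basis_expand[OF E(2), of v] E v by auto
    qed
    show "span {e\<in>E. B e e = c} \<subseteq> {v\<in>V. \<forall>w\<in>V. B v w = c * (v \<bullet> w)}"
    proof
      fix v assume v: "v \<in> span {e\<in>E. B e e = c}"
      have sV: "span {e\<in>E. B e e = c} \<subseteq> V" using E(4) span_mono[of "{e\<in>E. B e e = c}" E] by auto
      then have vV: "v \<in> V" using v by auto
      have 0: "v \<bullet> e = 0" if "e \<in> E" "B e e \<noteq> c" for e
        using span_orthogonal_disjoint[OF E(1,2) _ _ v, of e] E(3) that by auto
      have "B v w = c * (v \<bullet> w)" if "w \<in> V" for w
      proof -
        have "B v w = (\<Sum>e\<in>E. c * ((v \<bullet> e) * (w \<bullet> e)))"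
          unfolding EF[OF vV that] using 0 by (intro sum.cong) auto
        also have "\<dots> = c * (v \<bullet> (\<Sum>e\<in>E. (w \<bullet> e) *\<^sub>R e))"
          by (simp add: inner_sum_right sum_distrib_left mult.commute mult.left_commute)
        also have "(\<Sum>e\<in>E. (w \<bullet> e) *\<^sub>R e) = w"
          using orthonormal_basis_expand[OF E(2), of w] E that by auto
        finally show ?thesis .
      qed
      then show "v \<in> {v\<in>V. \<forall>w\<in>V. B v w = c * (v \<bullet> w)}" using vV by simp
    qed
  qed
qed

lemma subspace_form_rad: "sym_form V B \<Longrightarrow> subspace (form_rad V B)"
  using sym_formD[of V B] unfolding form_rad_def
  by (auto simp: subspace_def)

text \<open>The conservation law behind all stability results: lower bounds for the three summands
  that already add up to \<open>dim V\<close> must be equalities.\<close>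

lemma index_sum:
  assumes B: "sym_form V B"
  shows "pos_index V B + pos_index V (\<lambda>x y. - B x y) + dim (form_rad V B) = dim V"
proof -
  obtain E where E: "finite E" "pairwise orthogonal E" "\<forall>e\<in>E. norm e = 1" "span E = V"
    "\<forall>e\<in>E. \<forall>f\<in>E. e \<noteq> f \<longrightarrow> B e f = 0" using sym_form_eigenbasis[OF B] by auto
  have "pos_index V (\<lambda>x y. - B x y) = card {e\<in>E. B e e < 0}"
    using pos_index_eigenbasis[OF sym_form_uminus[OF B] E(1-4)] E(5) by auto
  moreover have "pos_index V B = card {e\<in>E. B e e > 0}" by (rule pos_index_eigenbasis[OF B E])
  moreover have "dim (form_rad V B) = card {e\<in>E. B e e = 0}"
    using form_rad_eigenbasis[OF B E, of 0] dim_eigenbasis_part[OF E(2,3), of "{e\<in>E. B e e = 0}"]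
    by (simp add: form_rad_def)
  moreover have "dim V = card E" using dim_eigenbasis_part[OF E(2,3), of E] E(4) by simp
  moreover have "card E = card {e\<in>E. B e e > 0} + card {e\<in>E. B e e < 0} + card {e\<in>E. B e e = 0}"
  proof -
    have "card (({e\<in>E. B e e > 0} \<union> {e\<in>E. B e e < 0}) \<union> {e\<in>E. B e e = 0})
        = card ({e\<in>E. B e e > 0} \<union> {e\<in>E. B e e < 0}) + card {e\<in>E. B e e = 0}"
      using E(1) by (intro card_Un_disjoint) auto
    moreover have "card ({e\<in>E. B e e > 0} \<union> {e\<in>E. B e e < 0}) = card {e\<in>E. B e e > 0} + card {e\<in>E. B e e < 0}"
      using E(1) by (intro card_Un_disjoint) auto
    moreover have "({e\<in>E. B e e > 0} \<union> {e\<in>E. B e e < 0}) \<union> {e\<in>E. B e e = 0} = E" by auto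
    ultimately show ?thesis by simp
  qed
  ultimately show ?thesis by simp
qed

text \<open>Connects the signature by eigenvalues with the basis-free one. Grouping an eigenbasis by
  the values \<open>B e e\<close> counts each eigenspace with its dimension.\<close>

lemma sig_eq_form_signature:
  assumes B: "sym_form V B"
  shows "form_signature V B = sig V B"
proof -
  obtain E where E: "finite E" "pairwise orthogonal E" "\<forall>e\<in>E. norm e = 1" "span E = V"
    "\<forall>e\<in>E. \<forall>f\<in>E. e \<noteq> f \<longrightarrow> B e f = 0" using sym_form_eigenbasis[OF B] by auto
  have eig: "form_eigenspace V B c = span {e\<in>E. B e e = c}" for c
    using form_rad_eigenbasis[OF B E] by (simp add: form_eigenspace_def)
  have dim: "dim (form_eigenspace V B c) = card {e\<in>E. B e e = c}" for c
    using dim_eigenbasis_part[OF E(2,3), of "{e\<in>E. B e e = c}"] by (simp add: eig)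
  have ne: "form_eigenspace V B c \<noteq> {0} \<longleftrightarrow> c \<in> (\<lambda>e. B e e) ` E" for c
  proof -
    have "form_eigenspace V B c \<noteq> {0} \<longleftrightarrow> dim (form_eigenspace V B c) \<noteq> 0"
      using dim_eq_0[of "form_eigenspace V B c"] span_0[of "{e\<in>E. B e e = c}"] unfolding eig by auto
    then show ?thesis unfolding dim using E(1) by auto
  qed
  have cnt: "(\<Sum>c | P c \<and> form_eigenspace V B c \<noteq> {0}. int (dim (form_eigenspace V B c)))
      = int (card {e\<in>E. P (B e e)})" for P
  proof -
    have fin: "finite {c. P c \<and> c \<in> (\<lambda>e. B e e) ` E}" using E(1) by simp
    have "(\<Sum>c\<in>{c. P c \<and> c \<in> (\<lambda>e. B e e) ` E}. card {e\<in>{e\<in>E. P (B e e)}. B e e = c}) = card {e\<in>E. P (B e e)}"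
      using sum.group[of "{e\<in>E. P (B e e)}" "{c. P c \<and> c \<in> (\<lambda>e. B e e) ` E}" "\<lambda>e. B e e" "\<lambda>_. 1::nat"] E(1) fin
      by auto
    moreover have "card {e\<in>{e\<in>E. P (B e e)}. B e e = c} = dim (form_eigenspace V B c)" if "P c" for c
      unfolding dim using that by (intro arg_cong[where f=card]) auto
    ultimately have "(\<Sum>c | P c \<and> form_eigenspace V B c \<noteq> {0}. dim (form_eigenspace V B c)) = card {e\<in>E. P (B e e)}"
      unfolding ne by simp
    then show ?thesis by (simp flip: of_nat_sum)
  qed
  have "pos_index V (\<lambda>x y. - B x y) = card {e\<in>E. B e e < 0}"
    using pos_index_eigenbasis[OF sym_form_uminus[OF B] E(1-4)] E(5) by auto
  then show ?thesis
    using pos_index_eigenbasis[OF B E] cnt[of "\<lambda>c. c > 0"] cnt[of "\<lambda>c. c < 0"]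
    by (simp add: form_signature_def sig_def)
qed

text \<open>\<open>T\<close> need be injective only on \<open>V\<close>, and source and target may
  be different spaces; \<open>kap_cocycle\<close> uses this for maps into a product.\<close>

lemma pos_index_congruent:
  fixes T :: "'v::euclidean_space \<Rightarrow> 'w::euclidean_space"
  assumes T: "linear T" "inj_on T V" "T ` V = V'" and V: "subspace V"
    and B: "\<And>x y. x \<in> V \<Longrightarrow> y \<in> V \<Longrightarrow> B' (T x) (T y) = B x y"
  shows "pos_index V' B' = pos_index V B"
proof -
  have "{dim U | U. subspace U \<and> U \<subseteq> V' \<and> pos_def_on U B'} = {dim U | U. subspace U \<and> U \<subseteq> V \<and> pos_def_on U B}"
  proof (intro set_eqI iffI)
    fix d assume "d \<in> {dim U | U. subspace U \<and> U \<subseteq> V' \<and> pos_def_on U B'}"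
    then obtain U where U: "subspace U" "U \<subseteq> V'" "pos_def_on U B'" "d = dim U" by auto
    define W where "W = V \<inter> T -` U"
    have W: "subspace W" unfolding W_def using V U(1) T(1)
      by (intro subspace_inter linear_subspace_vimage)
    have TW: "T ` W = U" using U(2) T(3) by (auto simp: W_def)
    have "dim W = d" using dim_image_inj[OF T(1) W] T(2) TW U(4)
      by (metis W_def inf_le1 inj_on_subset)
    moreover have "pos_def_on W B"
      unfolding pos_def_on_def
    proof (intro ballI impI)
      fix x assume "x \<in> W" "x \<noteq> 0"
      then have "T x \<noteq> 0" using T(1,2) V subspace_0[OF V] unfolding W_def
        by (metis IntD1 inj_onD linear_0)
      then show "B x x > 0" using B[of x x] \<open>x \<in> W\<close> U(3) by (auto simp: W_def pos_def_on_def)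
    qed
    ultimately show "d \<in> {dim U | U. subspace U \<and> U \<subseteq> V \<and> pos_def_on U B}"
      using W by (auto simp: W_def)
  next
    fix d assume "d \<in> {dim U | U. subspace U \<and> U \<subseteq> V \<and> pos_def_on U B}"
    then obtain U where U: "subspace U" "U \<subseteq> V" "pos_def_on U B" "d = dim U" by auto
    have "dim (T ` U) = d" using dim_image_inj[OF T(1) U(1)] T(2) U by (metis inj_on_subset)
    moreover have "pos_def_on (T ` U) B'"
      using U(2,3) B linear_0[OF T(1)] by (auto simp: pos_def_on_def subset_iff)
    moreover have "T ` U \<subseteq> V'" using U(2) T(3) by auto
    ultimately show "d \<in> {dim U | U. subspace U \<and> U \<subseteq> V' \<and> pos_def_on U B'}"
      using linear_subspace_image[OF T(1) U(1)] by blast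
  qed
  then show ?thesis by (simp add: pos_index_def)
qed

lemma sig_congruent:
  fixes T :: "'v::euclidean_space \<Rightarrow> 'w::euclidean_space"
  assumes "linear T" "inj_on T V" "T ` V = V'" "subspace V"
    "\<And>x y. x \<in> V \<Longrightarrow> y \<in> V \<Longrightarrow> B' (T x) (T y) = B x y"
  shows "sig V' B' = sig V B"
  unfolding sig_def using pos_index_congruent[OF assms(1-4)] assms(5) by simp

lemma sig_cong:
  assumes "subspace V" "\<And>x y. x \<in> V \<Longrightarrow> y \<in> V \<Longrightarrow> B' x y = B x y"
  shows "sig V B' = sig V B"
  using sig_congruent[of id V V B' B] assms by (simp add: linear_id)

lemma sig_scale:
  assumes "c > 0"
  shows "sig V (\<lambda>x y. c * B x y) = sig V B"
proof -
  have "pos_index V (\<lambda>x y. c * B x y) = pos_index V B" for B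
    using assms by (simp add: pos_index_def pos_def_on_def zero_less_mult_iff)
  from this[of B] this[of "\<lambda>x y. - B x y"] show ?thesis by (simp add: sig_def)
qed

lemma sig_zero:
  assumes "subspace V" "\<And>x y. x \<in> V \<Longrightarrow> y \<in> V \<Longrightarrow> B x y = 0"
  shows "sig V B = 0"
proof -
  have "sig V B = sig V (\<lambda>x y. 0)" using assms by (intro sig_cong) auto
  also have "\<dots> = 0" by (simp add: sig_def)
  finally show ?thesis .
qed

text \<open>On the compact unit sphere of \<open>U\<close> the limit form has a positive minimum.
  Coordinates of unit vectors are at most 1 in absolute value, so the values there move by at most
  the sum of the changes of the matrix entries, which is eventually smaller than that
  minimum.\<close>

lemma pos_def_on_eventually:
  assumes C: "sym_form V C" and B: "\<forall>\<^sub>F i in F. sym_form V (B i)"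
    and lim: "\<And>x y. x \<in> V \<Longrightarrow> y \<in> V \<Longrightarrow> ((\<lambda>i. B i x y) \<longlongrightarrow> C x y) F"
    and U: "subspace U" "U \<subseteq> V" "pos_def_on U C"
  shows "\<forall>\<^sub>F i in F. pos_def_on U (B i)"
proof (cases "U = {0}")
  case True then show ?thesis by (simp add: pos_def_on_def)
next
  case False
  obtain E where E: "finite E" "E \<subseteq> U" "pairwise orthogonal E" "\<And>e. e \<in> E \<Longrightarrow> norm e = 1" "span E = U"
    using orthonormal_basis_finite[OF U(1)] by metis
  have CU: "sym_form U C" using sym_form_subset[OF C U(1,2)] .
  obtain v where "v \<in> U" "v \<noteq> 0" using False subspace_0[OF U(1)] by auto
  then have "v /\<^sub>R norm v \<in> sphere 0 1 \<inter> U" by (simp add: subspace_scale[OF U(1)])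
  then obtain e where e: "e \<in> sphere 0 1 \<inter> U" and emin: "\<And>x. x \<in> sphere 0 1 \<inter> U \<Longrightarrow> C e e \<le> C x x"
    using continuous_attains_inf[OF compact_sphere_Int_subspace[OF U(1)] _
        continuous_on_subset[OF continuous_on_sym_form[OF CU] Int_lower2]] by blast
  then have c: "C e e > 0" using U(3) by (auto simp: pos_def_on_def)
  have "((\<lambda>i. \<Sum>e\<in>E. \<Sum>f\<in>E. \<bar>B i e f - C e f\<bar>) \<longlongrightarrow> (\<Sum>e\<in>E. \<Sum>f\<in>E. \<bar>C e f - C e f\<bar>)) F"
    using E(2) U(2) by (intro tendsto_intros lim) auto
  then have "((\<lambda>i. \<Sum>e\<in>E. \<Sum>f\<in>E. \<bar>B i e f - C e f\<bar>) \<longlongrightarrow> 0) F" by simp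
  then have "\<forall>\<^sub>F i in F. (\<Sum>e\<in>E. \<Sum>f\<in>E. \<bar>B i e f - C e f\<bar>) < C e e"
    using c by (auto dest: order_tendstoD(2))
  then show ?thesis using B
  proof eventually_elim
    case (elim i)
    have BU: "sym_form U (B i)" using sym_form_subset[OF elim(2) U(1,2)] .
    have pos: "B i x x > 0" if x: "x \<in> sphere 0 1 \<inter> U" for x
    proof -
      have x1: "\<bar>x \<bullet> f\<bar> \<le> 1" if "f \<in> E" for f
        using Cauchy_Schwarz_ineq2[of x f] E(4)[OF that] x by simp
      have xs: "x \<in> span E" using x E(5) by auto
      have "\<bar>B i x x - C x x\<bar> = \<bar>\<Sum>e\<in>E. \<Sum>f\<in>E. (x \<bullet> e) * (x \<bullet> f) * (B i e f - C e f)\<bar>"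
        using sym_form_expand[OF BU E(1,3,4,2) xs xs] sym_form_expand[OF CU E(1,3,4,2) xs xs]
        by (simp add: sum_subtractf right_diff_distrib)
      also have "\<dots> \<le> (\<Sum>e\<in>E. \<Sum>f\<in>E. \<bar>(x \<bullet> e) * (x \<bullet> f) * (B i e f - C e f)\<bar>)"
        by (intro order_trans[OF sum_abs] sum_mono) auto
      also have "\<dots> \<le> (\<Sum>e\<in>E. \<Sum>f\<in>E. \<bar>B i e f - C e f\<bar>)"
      proof (intro sum_mono)
        fix e f assume "e \<in> E" "f \<in> E"
        then have "\<bar>x \<bullet> e\<bar> * \<bar>x \<bullet> f\<bar> \<le> 1 * 1" by (intro mult_mono x1) auto
        then show "\<bar>(x \<bullet> e) * (x \<bullet> f) * (B i e f - C e f)\<bar> \<le> \<bar>B i e f - C e f\<bar>"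
          by (simp add: abs_mult mult_left_le_one_le)
      qed
      finally show ?thesis using elim(1) emin[OF x] by linarith
    qed
    show ?case
      unfolding pos_def_on_def
    proof (intro ballI impI)
      fix x assume x: "x \<in> U" "x \<noteq> 0"
      then have "x /\<^sub>R norm x \<in> sphere 0 1 \<inter> U" by (simp add: subspace_scale[OF U(1)])
      from pos[OF this] have "B i (x /\<^sub>R norm x) (x /\<^sub>R norm x) > 0" .
      moreover have "B i (x /\<^sub>R norm x) (x /\<^sub>R norm x) = B i x x / (norm x)\<^sup>2"
        using x subspace_scale[OF U(1)] by (simp add: sym_formD(5,6)[OF BU] power2_eq_square field_simps)
      ultimately show "B i x x > 0" using x by (simp add: zero_less_divide_iff)
    qed
  qed
qed

text \<open>Under convergence the positive and the negative index can only grow. If the radical does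
  not shrink, \<open>index_sum\<close> leaves no room for growth and both stay constant.\<close>

lemma sig_eventually_const:
  assumes C: "sym_form V C" and B: "\<forall>\<^sub>F i in F. sym_form V (B i)"
    and lim: "\<And>x y. x \<in> V \<Longrightarrow> y \<in> V \<Longrightarrow> ((\<lambda>i. B i x y) \<longlongrightarrow> C x y) F"
    and rad: "\<forall>\<^sub>F i in F. dim (form_rad V C) \<le> dim (form_rad V (B i))"
  shows "\<forall>\<^sub>F i in F. sig V (B i) = sig V C"
proof -
  obtain P where P: "subspace P" "P \<subseteq> V" "pos_def_on P C" "dim P = pos_index V C"
    using pos_index_attained[OF C] by blast
  obtain N where N: "subspace N" "N \<subseteq> V" "pos_def_on N (\<lambda>x y. - C x y)" "dim N = pos_index V (\<lambda>x y. - C x y)"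
    using pos_index_attained[OF sym_form_uminus[OF C]] by blast
  have "\<forall>\<^sub>F i in F. pos_def_on P (B i)" by (rule pos_def_on_eventually[OF C B lim P(1-3)])
  moreover have "\<forall>\<^sub>F i in F. pos_def_on N (\<lambda>x y. - B i x y)"
    using B lim
    by (intro pos_def_on_eventually[OF sym_form_uminus[OF C] _ _ N(1-3)] tendsto_minus)
      (auto elim!: eventually_mono intro: sym_form_uminus)
  ultimately show ?thesis using rad B
  proof eventually_elim
    case (elim i)
    have "pos_index V C \<le> pos_index V (B i)" using pos_index_ge[OF P(1,2) elim(1)] P(4) by simp
    moreover have "pos_index V (\<lambda>x y. - C x y) \<le> pos_index V (\<lambda>x y. - B i x y)"
      using pos_index_ge[OF N(1,2) elim(2)] N(4) by simp
    ultimately show ?case using index_sum[OF C] index_sum[OF elim(4)] elim(3) unfolding sig_def by linarith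
  qed
qed

lemma dim_direct_sum:
  fixes U W :: "'w::euclidean_space set"
  assumes "subspace U" "subspace W" "U \<inter> W = {0}"
  shows "dim {x + y |x y. x \<in> U \<and> y \<in> W} = dim U + dim W"
  using dim_sums_Int[OF assms(1,2)] assms(3) by simp

lemma pos_index_sum_ge:
  assumes B: "sym_form V B" and V: "subspace V1" "subspace V2" "V1 \<subseteq> V" "V2 \<subseteq> V" "V1 \<inter> V2 = {0}"
    and orth: "\<And>x y. x \<in> V1 \<Longrightarrow> y \<in> V2 \<Longrightarrow> B x y = 0"
  shows "pos_index V1 B + pos_index V2 B \<le> pos_index V B"
proof -
  obtain P where P: "subspace P" "P \<subseteq> V1" "pos_def_on P B" "dim P = pos_index V1 B"
    using pos_index_attained[OF sym_form_subset[OF B V(1,3)]] by blast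
  obtain N where N: "subspace N" "N \<subseteq> V2" "pos_def_on N B" "dim N = pos_index V2 B"
    using pos_index_attained[OF sym_form_subset[OF B V(2,4)]] by blast
  let ?S = "{x + y |x y. x \<in> P \<and> y \<in> N}"
  have PN: "P \<inter> N = {0}" using P N V(5) subspace_0 by blast
  have "pos_def_on ?S B"
    unfolding pos_def_on_def
  proof (intro ballI impI)
    fix z assume "z \<in> ?S" "z \<noteq> 0"
    then obtain x y where xy: "x \<in> P" "y \<in> N" "z = x + y" by blast
    then have xy0: "x \<noteq> 0 \<or> y \<noteq> 0" using \<open>z \<noteq> 0\<close> by auto
    have xV: "x \<in> V" "y \<in> V" using xy P N V by auto
    have "B x y = 0" using orth xy P N by auto
    then have "B z z = B x x + B y y"
      using xV sym_formD(2)[OF B xV] subspace_add[OF sym_formD(1)[OF B]] by (simp add: xy(3) sym_formD(3,4)[OF B])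
    moreover have "x \<noteq> 0 \<Longrightarrow> B x x > 0" "y \<noteq> 0 \<Longrightarrow> B y y > 0" using P N xy by (auto simp: pos_def_on_def)
    moreover have "x = 0 \<Longrightarrow> B x x = 0" "y = 0 \<Longrightarrow> B y y = 0" using sym_formD(7)[OF B] xV by auto
    ultimately show "B z z > 0" using xy0 by (smt (verit))
  qed
  moreover have "?S \<subseteq> V" using P N V subspace_add[OF sym_formD(1)[OF B]] by blast
  ultimately have "dim ?S \<le> pos_index V B"
    using subspace_sums[OF P(1) N(1)] by (intro pos_index_ge)
  then show ?thesis using dim_direct_sum[OF P(1) N(1) PN] P(4) N(4) by simp
qed

text \<open>Both indices and the dimension of the radical are superadditive for orthogonal summands.
  By \<open>index_sum\<close> their totals agree, so every inequality is an equality.\<close>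

lemma sig_sum:
  assumes B: "sym_form V B" and V: "subspace V1" "subspace V2" "V1 \<inter> V2 = {0}" "V = {x + y |x y. x \<in> V1 \<and> y \<in> V2}"
    and orth: "\<And>x y. x \<in> V1 \<Longrightarrow> y \<in> V2 \<Longrightarrow> B x y = 0"
  shows "sig V B = sig V1 B + sig V2 B"
proof -
  note D = sym_formD[OF B]
  have sub: "V1 \<subseteq> V" "V2 \<subseteq> V"
    unfolding V(4) using subspace_0[OF V(1)] subspace_0[OF V(2)] by force+
  have B1: "sym_form V1 B" and B2: "sym_form V2 B"
    using sym_form_subset[OF B] V(1,2) sub by auto
  have p: "pos_index V1 B + pos_index V2 B \<le> pos_index V B"
    using pos_index_sum_ge[OF B V(1,2) sub V(3) orth] .
  have n: "pos_index V1 (\<lambda>x y. - B x y) + pos_index V2 (\<lambda>x y. - B x y) \<le> pos_index V (\<lambda>x y. - B x y)"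
    using pos_index_sum_ge[OF sym_form_uminus[OF B] V(1,2) sub V(3)] orth by simp
  have sr: "{x + y |x y. x \<in> form_rad V1 B \<and> y \<in> form_rad V2 B} \<subseteq> form_rad V B"
  proof clarify
    fix x y assume xy: "x \<in> form_rad V1 B" "y \<in> form_rad V2 B"
    then have xV: "x \<in> V1" "y \<in> V2" "x \<in> V" "y \<in> V" using sub by (auto simp: form_rad_def)
    have "B (x + y) w = 0" if wV': "w \<in> V" for w
    proof -
      obtain w1 w2 where w: "w1 \<in> V1" "w2 \<in> V2" "w = w1 + w2" using wV' V(4) by blast
      have wV: "w1 \<in> V" "w2 \<in> V" using w sub by auto
      have "B y w1 = 0" using orth[OF w(1) xV(2)] D(2)[OF wV(1) xV(4)] by simp
      then show ?thesis
        using xy w xV wV orth subspace_add[OF D(1)] by (simp add: D(3,4) form_rad_def)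
    qed
    then show "x + y \<in> form_rad V B" using xV subspace_add[OF D(1)] by (simp add: form_rad_def)
  qed
  have dr: "dim {x + y |x y. x \<in> form_rad V1 B \<and> y \<in> form_rad V2 B} = dim (form_rad V1 B) + dim (form_rad V2 B)"
    using V(3) subspace_0[OF subspace_form_rad[OF B1]] subspace_0[OF subspace_form_rad[OF B2]]
    by (intro dim_direct_sum subspace_form_rad B1 B2) (auto simp: form_rad_def)
  have r: "dim (form_rad V1 B) + dim (form_rad V2 B) \<le> dim (form_rad V B)"
    using dim_subset[OF sr] unfolding dr .
  have "dim V = dim V1 + dim V2" using dim_direct_sum[OF V(1-3)] unfolding V(4)[symmetric] .
  then show ?thesis
    using p n r index_sum[OF B] index_sum[OF B1] index_sum[OF B2] unfolding sig_def by linarith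
qed

section \<open>Orthogonal projections and convergent families of linear maps\<close>

lemma subspace_closest_point:
  fixes X :: "'w::euclidean_space set"
  assumes "subspace X"
  shows "closest_point X w \<in> X" "x \<in> X \<Longrightarrow> (w - closest_point X w) \<bullet> x = 0"
    "p \<in> X \<Longrightarrow> (\<And>x. x \<in> X \<Longrightarrow> (w - p) \<bullet> x = 0) \<Longrightarrow> closest_point X w = p"
proof -
  have ne: "X \<noteq> {}" using subspace_0[OF assms] by auto
  obtain y z where yz: "y \<in> span X" "\<And>x. x \<in> span X \<Longrightarrow> orthogonal z x" "w = y + z"
    using orthogonal_subspace_decomp_exists[of X w] by blast
  have yX: "y \<in> X" using yz(1) assms by (simp add: span_eq_iff[THEN iffD2])
  have key: "closest_point X w = p" if p: "p \<in> X" "\<And>x. x \<in> X \<Longrightarrow> (w - p) \<bullet> x = 0" for p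
  proof -
    have "dist w p \<le> dist w x" if "x \<in> X" for x
    proof -
      have "orthogonal (w - p) (p - x)" using p(2)[OF subspace_diff[OF assms p(1) that]] by (simp add: orthogonal_def)
      then have "(norm (w - x))\<^sup>2 = (norm (w - p))\<^sup>2 + (norm (p - x))\<^sup>2"
        using norm_add_Pythagorean[of "w - p" "p - x"] by simp
      then have "(norm (w - p))\<^sup>2 \<le> (norm (w - x))\<^sup>2" by simp
      then show ?thesis by (simp add: dist_norm power_mono_iff)
    qed
    then show ?thesis
      using closest_point_unique[OF subspace_imp_convex[OF assms] closed_subspace[OF assms] p(1)] by auto
  qed
  have "(w - y) \<bullet> x = 0" if "x \<in> X" for x
    using yz(2)[OF span_base[OF that]] yz(3) by (simp add: orthogonal_def)
  then have y: "closest_point X w = y" "x \<in> X \<Longrightarrow> (w - y) \<bullet> x = 0" for x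
    using key[OF yX] by auto
  show "closest_point X w \<in> X" using y yX by simp
  show "x \<in> X \<Longrightarrow> (w - closest_point X w) \<bullet> x = 0" using y by simp
  show "p \<in> X \<Longrightarrow> (\<And>x. x \<in> X \<Longrightarrow> (w - p) \<bullet> x = 0) \<Longrightarrow> closest_point X w = p" by (rule key)
qed

lemma linear_closest_point:
  fixes X :: "'w::euclidean_space set"
  assumes "subspace X"
  shows "linear (closest_point X)"
proof (rule linearI)
  note c = subspace_closest_point[OF assms]
  show "closest_point X (a + b) = closest_point X a + closest_point X b" for a b
    using c(1)[of a] c(1)[of b] c(2)[of _ a] c(2)[of _ b] subspace_add[OF assms]
    by (intro c(3)) (auto simp: inner_diff_left inner_add_left)
  show "closest_point X (r *\<^sub>R b) = r *\<^sub>R closest_point X b" for r b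
    using c(1)[of b] c(2)[of _ b] subspace_scale[OF assms]
    by (intro c(3)) (auto simp: inner_diff_left)
qed

lemma closest_point_in_subspace:
  "subspace (X :: 'w::euclidean_space set) \<Longrightarrow> x \<in> X \<Longrightarrow> closest_point X x = x"
  by (simp add: closest_point_self)

text \<open>Pointwise convergence on the finite basis is uniform on the unit ball, so half of the
  lower bound for \<open>D0\<close> survives nearby.\<close>

lemma linear_family_inj_bound:
  fixes D :: "'p \<Rightarrow> 'w::euclidean_space \<Rightarrow> 'v::euclidean_space"
  assumes lin: "\<forall>\<^sub>F p in F. linear (D p)" and D0: "linear D0" and inj: "\<And>x. D0 x = 0 \<Longrightarrow> x = 0"
    and lim: "\<And>x. ((\<lambda>p. D p x) \<longlongrightarrow> D0 x) F"
  obtains c where "c > 0" "\<forall>\<^sub>F p in F. \<forall>x. c * norm x \<le> norm (D p x)"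
proof -
  obtain c where c: "c > 0" "\<And>x. c * norm x \<le> norm (D0 x)"
    using linear_inj_bounded_below_pos[OF D0] inj linear_injective_0[OF D0] by (metis mult.commute)
  have "((\<lambda>p. \<Sum>b\<in>Basis. norm (D p b - D0 b)) \<longlongrightarrow> (\<Sum>b\<in>Basis. norm (D0 b - D0 b))) F"
    by (intro tendsto_intros lim)
  then have "((\<lambda>p. \<Sum>b\<in>Basis. norm (D p b - D0 b)) \<longlongrightarrow> 0) F" by simp
  then have "\<forall>\<^sub>F p in F. (\<Sum>b\<in>Basis. norm (D p b - D0 b)) < c / 2"
    using c(1) by (intro order_tendstoD(2)) auto
  then have "\<forall>\<^sub>F p in F. \<forall>x. c / 2 * norm x \<le> norm (D p x)"
    using lin
  proof eventually_elim
    case (elim p)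
    show ?case
    proof
      fix x
      have "D p x - D0 x = (\<Sum>b\<in>Basis. (x \<bullet> b) *\<^sub>R (D p b - D0 b))"
        using linear_sum[OF elim(2), of "\<lambda>b. (x \<bullet> b) *\<^sub>R b" Basis] linear_sum[OF D0, of "\<lambda>b. (x \<bullet> b) *\<^sub>R b" Basis]
        by (simp add: linear_cmul[OF elim(2)] linear_cmul[OF D0] euclidean_representation sum_subtractf scaleR_diff_right)
      also have "norm \<dots> \<le> (\<Sum>b\<in>Basis. norm x * norm (D p b - D0 b))"
        by (intro sum_norm_le) (simp add: mult_right_mono Basis_le_norm)
      also have "\<dots> \<le> norm x * (c / 2)"
        unfolding sum_distrib_left[symmetric] using elim(1) by (intro mult_left_mono) auto
      finally show "c / 2 * norm x \<le> norm (D p x)"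
        using c(2)[of x] norm_triangle_ineq2[of "D0 x" "D0 x - D p x"] by (simp add: norm_minus_commute algebra_simps)
    qed
  qed
  then show ?thesis using that[of "c / 2"] c(1) by simp
qed

text \<open>The common source of continuity and differentiability for objects defined by linear
  equations: projections along a complement and inverse matrices.\<close>

lemma linear_family_solution_tendsto:
  fixes D :: "'p \<Rightarrow> 'w::euclidean_space \<Rightarrow> 'v::euclidean_space"
  assumes lin: "\<forall>\<^sub>F p in F. linear (D p)" and D0: "linear D0" and inj: "\<And>x. D0 x = 0 \<Longrightarrow> x = 0"
    and lim: "\<And>x. ((\<lambda>p. D p x) \<longlongrightarrow> D0 x) F"
    and y: "((\<lambda>p. D p (x p)) \<longlongrightarrow> D0 x0) F"
  shows "(x \<longlongrightarrow> x0) F"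
proof -
  obtain c where c: "c > 0" "\<forall>\<^sub>F p in F. \<forall>x. c * norm x \<le> norm (D p x)"
    using linear_family_inj_bound[OF lin D0 inj lim] by blast
  have "((\<lambda>p. norm (D p (x p) - D p x0) / c) \<longlongrightarrow> norm (D0 x0 - D0 x0) / c) F"
    using c(1) by (intro tendsto_intros y lim) auto
  then have "((\<lambda>p. norm (D p (x p) - D p x0) / c) \<longlongrightarrow> 0) F" by simp
  moreover have "\<forall>\<^sub>F p in F. norm (x p - x0) \<le> norm (D p (x p) - D p x0) / c"
    using c(2) lin
  proof eventually_elim
    case (elim p)
    have "c * norm (x p - x0) \<le> norm (D p (x p) - D p x0)" using elim by (metis linear_diff)
    then show ?case using c(1) by (simp add: field_simps)
  qed
  ultimately have "((\<lambda>p. x p - x0) \<longlongrightarrow> 0) F" by (rule Lim_null_comparison[rotated])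
  then show ?thesis by (simp add: LIM_zero_iff)
qed

definition proj_along :: "'w::euclidean_space set \<Rightarrow> 'w set \<Rightarrow> 'w \<Rightarrow> 'w" where
  "proj_along X M w = (THE x. x \<in> X \<and> w - x \<in> M)"

text \<open>The part orthogonal to \<open>M\<close> of the \<open>X\<close>-component of
  \<open>x\<close>, plus the \<open>M\<close>-part of its component orthogonal to \<open>X\<close>.
  It depends on \<open>X\<close> only through \<open>closest_point X\<close>, is invertible exactly
  in the transversal case, and turns \<open>proj_along X M u\<close> into the solution of a linear
  equation with right-hand side \<open>u - closest_point M u\<close>.\<close>

definition comp_op :: "'w::euclidean_space set \<Rightarrow> 'w set \<Rightarrow> 'w \<Rightarrow> 'w" where
  "comp_op X M x = (closest_point X x - closest_point M (closest_point X x)) + closest_point M (x - closest_point X x)"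

section \<open>Lagrangian subspaces of a compatible symplectic structure\<close>

text \<open>\<open>J\<close> is an orthogonal complex structure representing \<open>Om\<close> in
  the inner product. The two instances are \<open>Omega0\<close> on the coordinate space and
  \<open>Omega_bar\<close> on the product that contains the graphs.\<close>

locale compatible_symplectic =
  fixes J :: "'w::euclidean_space \<Rightarrow> 'w" and Om :: "'w \<Rightarrow> 'w \<Rightarrow> real"
  assumes linJ: "linear J" and JJ: "J (J x) = - x" and skew: "J x \<bullet> y = - (x \<bullet> J y)"
    and Om: "Om v w = v \<bullet> J w"
begin

lemma Om_simps [simp]:
  "Om (x + y) z = Om x z + Om y z" "Om z (x + y) = Om z x + Om z y"
  "Om (x - y) z = Om x z - Om y z" "Om z (x - y) = Om z x - Om z y"
  "Om (c *\<^sub>R x) z = c * Om x z" "Om z (c *\<^sub>R x) = c * Om z x"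
  "Om (- x) z = - Om x z" "Om z (- x) = - Om z x" "Om 0 z = 0" "Om z 0 = 0"
  by (simp_all add: Om linear_add[OF linJ] linear_diff[OF linJ] linear_cmul[OF linJ] linear_neg[OF linJ]
      linear_0[OF linJ] inner_add_left inner_add_right inner_diff_left inner_diff_right)

lemma Om_skew: "Om x y = - Om y x"
  using skew[of x y] by (simp add: Om inner_commute)

lemma Om_J: "Om x (J y) = - (x \<bullet> y)" "Om (J x) (J y) = Om x y" "Om (J x) y = x \<bullet> y"
  using skew[of x "J y"] skew[of x y] by (simp_all add: Om JJ skew)

lemma Om_tendsto:
  assumes "(f \<longlongrightarrow> x) F" "(g \<longlongrightarrow> y) F"
  shows "((\<lambda>p. Om (f p) (g p)) \<longlongrightarrow> Om x y) F"
  unfolding Om using bounded_linear.tendsto[OF linear_conv_bounded_linear[THEN iffD1, OF linJ] assms(2)] assms(1)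
  by (intro tendsto_inner)

abbreviation lag :: "'w set \<Rightarrow> bool" where "lag X \<equiv> lagrangian Om X"

lemma lagD:
  assumes "lag X"
  shows "subspace X" "x \<in> X \<Longrightarrow> y \<in> X \<Longrightarrow> Om x y = 0" "(\<And>v. v \<in> X \<Longrightarrow> Om v w = 0) \<Longrightarrow> w \<in> X"
  using assms unfolding lagrangian_def by auto

lemma lagI:
  assumes "subspace X" "\<And>x y. x \<in> X \<Longrightarrow> y \<in> X \<Longrightarrow> Om x y = 0" "\<And>w. (\<And>v. v \<in> X \<Longrightarrow> Om v w = 0) \<Longrightarrow> w \<in> X"
  shows "lag X"
  using assms unfolding lagrangian_def by blast

text \<open>\<open>J\<close> maps a Lagrangian onto its orthogonal complement.\<close>

lemma lag_dim:
  assumes "lag X"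
  shows "dim X + dim X = DIM('w)"
proof -
  have "{y. \<forall>x\<in>X. orthogonal x y} = J ` X"
  proof
    show "{y. \<forall>x\<in>X. orthogonal x y} \<subseteq> J ` X"
    proof clarify
      fix y assume "\<forall>x\<in>X. orthogonal x y"
      then have "- J y \<in> X" by (intro lagD(3)[OF assms]) (simp add: Om_J orthogonal_def)
      moreover have "J (- J y) = y" by (simp add: linear_neg[OF linJ] JJ)
      ultimately show "y \<in> J ` X" by (metis imageI)
    qed
    show "J ` X \<subseteq> {y. \<forall>x\<in>X. orthogonal x y}"
      using lagD(2)[OF assms] by (auto simp: orthogonal_def Om)
  qed
  moreover have "dim (J ` X) = dim X"
    using lagD(1)[OF assms] linJ JJ by (intro dim_image_inj) (auto intro!: inj_onI, metis neg_equal_iff_equal)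
  ultimately show ?thesis
    using dim_subspace_orthogonal_to_vectors[OF lagD(1)[OF assms] subspace_UNIV subset_UNIV] by simp
qed

lemma lag_decomp:
  assumes "lag X" "lag M" "X \<inter> M = {0}"
  obtains x where "x \<in> X" "w - x \<in> M"
proof -
  let ?S = "{x + y |x y. x \<in> X \<and> y \<in> M}"
  have "dim ?S = DIM('w)"
    using dim_direct_sum[OF lagD(1)[OF assms(1)] lagD(1)[OF assms(2)] assms(3)] lag_dim[OF assms(1)] lag_dim[OF assms(2)]
    by simp
  moreover have "subspace ?S" using assms by (intro subspace_sums lagD(1))
  ultimately have "?S = UNIV" using dim_eq_full[of ?S] by (simp add: span_eq_iff[THEN iffD2])
  then have "w \<in> ?S" by auto
  then obtain x y where "x \<in> X" "y \<in> M" "w = x + y" by blast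
  then show ?thesis using that[of x] by simp
qed

lemma proj_along:
  assumes "lag X" "lag M" "X \<inter> M = {0}"
  shows "proj_along X M w \<in> X" "w - proj_along X M w \<in> M"
    "x \<in> X \<Longrightarrow> w - x \<in> M \<Longrightarrow> proj_along X M w = x"
proof -
  have uniq: "x = y" if "x \<in> X" "w - x \<in> M" "y \<in> X" "w - y \<in> M" for x y
  proof -
    have "x - y \<in> X" using that lagD(1)[OF assms(1)] by (simp add: subspace_diff)
    moreover have "(w - y) - (w - x) \<in> M" using that lagD(1)[OF assms(2)] subspace_diff by blast
    ultimately have "x - y \<in> X \<inter> M" by simp
    then show ?thesis using assms(3) by simp
  qed
  obtain x0 where x0: "x0 \<in> X" "w - x0 \<in> M" using lag_decomp[OF assms] by blast
  have "proj_along X M w = x0" unfolding proj_along_def using x0 uniq by blast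
  then show "proj_along X M w \<in> X" "w - proj_along X M w \<in> M"
    "x \<in> X \<Longrightarrow> w - x \<in> M \<Longrightarrow> proj_along X M w = x"
    using x0 uniq by auto
qed

lemma proj_along_linear:
  assumes "lag X" "lag M" "X \<inter> M = {0}"
  shows "linear (proj_along X M)"
proof (rule linearI)
  note p = proj_along[OF assms]
  have s: "subspace X" "subspace M" using assms lagD(1) by auto
  show "proj_along X M (a + b) = proj_along X M a + proj_along X M b" for a b
    using p(1,2)[of a] p(1,2)[of b] subspace_add[OF s(1)] subspace_add[OF s(2), of "a - proj_along X M a" "b - proj_along X M b"]
    by (intro p(3)) (simp_all add: algebra_simps)
  show "proj_along X M (r *\<^sub>R b) = r *\<^sub>R proj_along X M b" for r b
    using p(1,2)[of b] subspace_scale[OF s(1)] subspace_scale[OF s(2), of "b - proj_along X M b" r]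
    by (intro p(3)) (simp_all add: algebra_simps)
qed

lemma comp_op_linear:
  assumes "lag X" "lag M"
  shows "linear (comp_op X M)"
proof -
  have "linear (closest_point X)" "linear (closest_point M)"
    using assms lagD(1) linear_closest_point by auto
  then show ?thesis
    by (intro linearI) (simp_all add: comp_op_def linear_add linear_diff linear_cmul algebra_simps)
qed

lemma comp_op_proj:
  assumes "lag X" "lag M" "X \<inter> M = {0}"
  shows "comp_op X M (proj_along X M u) = u - closest_point M u"
proof -
  note p = proj_along[OF assms]
  have s: "subspace X" "subspace M" using assms lagD(1) by auto
  let ?x = "proj_along X M u"
  have "closest_point M (u - ?x) = u - ?x" using p(2)[of u] s by (intro closest_point_in_subspace) auto
  moreover have "closest_point X ?x = ?x" using p(1)[of u] s by (intro closest_point_in_subspace) auto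
  ultimately show ?thesis
    using linear_diff[OF linear_closest_point[OF s(2)], of u ?x]
    by (simp add: comp_op_def linear_0[OF linear_closest_point[OF s(2)]] algebra_simps)
qed

lemma comp_op_inj_iff:
  assumes "lag X" "lag M"
  shows "(\<forall>x. comp_op X M x = 0 \<longrightarrow> x = 0) \<longleftrightarrow> X \<inter> M = {0}"
proof
  have s: "subspace X" "subspace M" using assms lagD(1) by auto
  note cX = subspace_closest_point[OF s(1)] and cM = subspace_closest_point[OF s(2)]
  {
    assume inj: "\<forall>x. comp_op X M x = 0 \<longrightarrow> x = 0"
    have "comp_op X M x = 0" if "x \<in> X" "x \<in> M" for x
      using that s by (simp add: comp_op_def closest_point_in_subspace linear_0[OF linear_closest_point])
    then show "X \<inter> M = {0}" using inj subspace_0[OF s(1)] subspace_0[OF s(2)] by auto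
  next
    assume tr: "X \<inter> M = {0}"
    show "\<forall>x. comp_op X M x = 0 \<longrightarrow> x = 0"
    proof (intro allI impI)
      fix x assume 0: "comp_op X M x = 0"
      let ?a = "closest_point X x - closest_point M (closest_point X x)"
      let ?b = "closest_point M (x - closest_point X x)"
      \<comment> \<open>The two summands of \<open>comp_op\<close> lie in the orthogonal complement
        of \<open>M\<close> and in \<open>M\<close>, so both vanish. The first places the
        \<open>X\<close>-component of \<open>x\<close> in \<open>X \<inter> M\<close>, hence it is
        0; then \<open>x\<close> is orthogonal to \<open>X\<close> and to \<open>M\<close>, which
        together span the space.\<close>
      have "?a \<bullet> ?b = 0" using cM(1,2) by blast
      moreover have "?a = - ?b" using 0 by (simp add: comp_op_def eq_neg_iff_add_eq_0)
      ultimately have b0: "?b = 0" and a0: "?a = 0" by auto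
      have "closest_point X x \<in> M" using a0 cM(1)[of "closest_point X x"] by simp
      then have x0: "closest_point X x = 0" using cX(1)[of x] tr by auto
      then have m0: "closest_point M x = 0" using b0 by simp
      obtain y where y: "y \<in> X" "x - y \<in> M" using lag_decomp[OF assms tr] by blast
      have "x \<bullet> y = 0" using cX(2)[OF y(1), of x] x0 by simp
      moreover have "x \<bullet> (x - y) = 0" using cM(2)[OF y(2), of x] m0 by simp
      ultimately show "x = 0" by (simp add: inner_diff_right)
    qed
  }
qed

text \<open>Formulated for filters, so that the same lemmas serve paths, rectangles and one-sided
  limits.\<close>

definition lag_tendsto :: "('p \<Rightarrow> 'w set) \<Rightarrow> 'w set \<Rightarrow> 'p filter \<Rightarrow> bool" where
  "lag_tendsto Y Y0 F \<longleftrightarrow> lag Y0 \<and> (\<forall>\<^sub>F p in F. lag (Y p)) \<and>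
     (\<forall>w. ((\<lambda>p. closest_point (Y p) w) \<longlongrightarrow> closest_point Y0 w) F)"

lemma lag_tendsto_comp_op:
  assumes "lag_tendsto Y Y0 F" "lag M"
  shows "((\<lambda>p. comp_op (Y p) M x) \<longlongrightarrow> comp_op Y0 M x) F"
proof -
  have "bounded_linear (closest_point M)"
    using linear_closest_point[OF lagD(1)[OF assms(2)]] by (simp add: linear_conv_bounded_linear)
  then show ?thesis using assms(1) unfolding comp_op_def lag_tendsto_def
    by (intro tendsto_intros bounded_linear.tendsto[of "closest_point M"]) auto
qed

lemma lag_tendsto_transversal:
  assumes "lag_tendsto Y Y0 F" "lag M" "Y0 \<inter> M = {0}"
  shows "\<forall>\<^sub>F p in F. Y p \<inter> M = {0}"
proof -
  have lag: "lag Y0" "\<forall>\<^sub>F p in F. lag (Y p)" using assms(1) by (auto simp: lag_tendsto_def)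
  have lin: "\<forall>\<^sub>F p in F. linear (comp_op (Y p) M)"
    using lag(2) by eventually_elim (rule comp_op_linear[OF _ assms(2)])
  obtain c where c0: "c > 0" and c: "\<forall>\<^sub>F p in F. \<forall>x. c * norm x \<le> norm (comp_op (Y p) M x)"
    using linear_family_inj_bound[OF lin comp_op_linear[OF lag(1) assms(2)] _ lag_tendsto_comp_op[OF assms(1,2)]]
      comp_op_inj_iff[OF lag(1) assms(2)] assms(3) by blast
  show ?thesis using c lag(2)
  proof eventually_elim
    case (elim p)
    have "x = 0" if "comp_op (Y p) M x = 0" for x
      using elim(1)[rule_format, of x] that c0 by (simp add: mult_le_0_iff)
    then show ?case using comp_op_inj_iff[OF elim(2) assms(2)] by blast
  qed
qed

lemma lag_tendsto_proj:
  assumes "lag_tendsto Y Y0 F" "lag M" "Y0 \<inter> M = {0}"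
  shows "((\<lambda>p. proj_along (Y p) M u) \<longlongrightarrow> proj_along Y0 M u) F"
proof -
  have lag: "lag Y0" "\<forall>\<^sub>F p in F. lag (Y p)" using assms(1) by (auto simp: lag_tendsto_def)
  have lin: "\<forall>\<^sub>F p in F. linear (comp_op (Y p) M)"
    using lag(2) by eventually_elim (rule comp_op_linear[OF _ assms(2)])
  have "\<forall>\<^sub>F p in F. u - closest_point M u = comp_op (Y p) M (proj_along (Y p) M u)"
    using lag(2) lag_tendsto_transversal[OF assms] by eventually_elim (simp add: comp_op_proj assms)
  then have lim: "((\<lambda>p. comp_op (Y p) M (proj_along (Y p) M u)) \<longlongrightarrow> comp_op Y0 M (proj_along Y0 M u)) F"
    unfolding comp_op_proj[OF lag(1) assms(2,3)] by (rule Lim_transform_eventually[OF tendsto_const])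
  have inj: "\<And>x. comp_op Y0 M x = 0 \<Longrightarrow> x = 0"
    using comp_op_inj_iff[OF lag(1) assms(2)] assms(3) by simp
  show ?thesis
    by (rule linear_family_solution_tendsto[OF lin comp_op_linear[OF lag(1) assms(2)] inj lag_tendsto_comp_op[OF assms(1,2)] lim])
qed


section \<open>The unitary flow exp (s J) and common Lagrangian complements\<close>

definition rot :: "real \<Rightarrow> 'w \<Rightarrow> 'w" where "rot s x = cos s *\<^sub>R x + sin s *\<^sub>R J x"

lemma rot_linear: "linear (rot s)"
  unfolding rot_def by (intro linearI) (simp_all add: linear_add[OF linJ] linear_cmul[OF linJ] algebra_simps)

lemma rot_inverse: "rot s (rot (- s) x) = x" "rot (- s) (rot s x) = x"
proof -
  have "cos s * cos s + sin s * sin s = 1" using sin_cos_squared_add3[of s] .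
  then have *: "(cos s * cos s) *\<^sub>R x + (sin s * sin s) *\<^sub>R x = x" by (metis scaleR_left_distrib scaleR_one)
  show "rot s (rot (- s) x) = x" "rot (- s) (rot s x) = x"
    using * by (simp_all add: rot_def linear_add[OF linJ] linear_cmul[OF linJ] linear_neg[OF linJ] linear_diff[OF linJ] JJ algebra_simps)
qed

lemma Om_rot: "Om (rot s x) (rot s y) = Om x y"
proof -
  have "cos s * cos s + sin s * sin s = 1" using sin_cos_squared_add3[of s] .
  then have *: "(cos s * cos s) * Om x y + (sin s * sin s) * Om x y = Om x y" by (metis distrib_right mult_1)
  moreover have "J x \<bullet> y = - Om x y" by (simp add: skew Om)
  ultimately show ?thesis by (simp add: rot_def Om_J algebra_simps)
qed

lemma lag_rot:
  assumes "lag X"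
  shows "lag (rot s ` X)"
proof (rule lagI)
  show "subspace (rot s ` X)" using rot_linear lagD(1)[OF assms] by (intro linear_subspace_image)
  show "Om x y = 0" if "x \<in> rot s ` X" "y \<in> rot s ` X" for x y
    using that lagD(2)[OF assms] by (auto simp: Om_rot)
  show "w \<in> rot s ` X" if "\<And>v. v \<in> rot s ` X \<Longrightarrow> Om v w = 0" for w
  proof -
    have "Om v (rot (- s) w) = 0" if "v \<in> X" for v
      using \<open>\<And>v. v \<in> rot s ` X \<Longrightarrow> Om v w = 0\<close>[of "rot s v"] that Om_rot[of s v "rot (- s) w"] by (simp add: rot_inverse)
    then have "rot (- s) w \<in> X" by (intro lagD(3)[OF assms])
    then show ?thesis by (metis imageI rot_inverse(1))
  qed
qed

text \<open>Let \<open>x\<close> in \<open>X\<close> be rotated into \<open>Y\<close>. Pairing with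
  \<open>X \<inter> Y\<close> shows that \<open>x\<close> is orthogonal to this intersection, since
  \<open>sin s\<close> is nonzero. On that part \<open>Z\<close> of \<open>X\<close> the distance to
  \<open>Y\<close> is at least \<open>c * norm x\<close>, whereas a small rotation moves
  \<open>x\<close> by less.\<close>

lemma eventually_rot_transversal:
  assumes X: "lag X" and Y: "lag Y"
  shows "\<forall>\<^sub>F s in at_right 0. rot s ` X \<inter> Y = {0}"
proof -
  note sX = lagD(1)[OF X] and sY = lagD(1)[OF Y]
  define Z where "Z = {x \<in> X. \<forall>k\<in>X \<inter> Y. k \<bullet> x = 0}"
  have sZ: "subspace Z" using sX by (auto simp: Z_def subspace_def inner_add_right)
  have lin: "linear (\<lambda>x. x - closest_point Y x)"
    using linear_closest_point[OF sY] by (intro linear_compose_sub linear_ident)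
  have "x = 0" if "x \<in> Z" "x - closest_point Y x = 0" for x
  proof -
    have "x \<in> Y" using that(2) subspace_closest_point(1)[OF sY, of x] by simp
    then have "x \<bullet> x = 0" using that(1) by (auto simp: Z_def)
    then show ?thesis by simp
  qed
  then obtain c where c: "c > 0" "\<And>x. x \<in> Z \<Longrightarrow> c * norm x \<le> norm (x - closest_point Y x)"
    using injective_imp_isometric[OF closed_subspace[OF sZ] sZ, of "\<lambda>x. x - closest_point Y x"] lin
    by (auto simp: linear_conv_bounded_linear mult.commute)
  have normJ: "norm (J x) = norm x" for x
    using skew[of x "J x"] by (simp add: JJ norm_eq_sqrt_inner)
  have "((\<lambda>s::real. \<bar>1 - cos s\<bar> + \<bar>sin s\<bar>) \<longlongrightarrow> \<bar>1 - cos 0\<bar> + \<bar>sin 0\<bar>) (at_right 0)"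
    by (intro tendsto_intros)
  then have "((\<lambda>s::real. \<bar>1 - cos s\<bar> + \<bar>sin s\<bar>) \<longlongrightarrow> 0) (at_right 0)" by simp
  then have "\<forall>\<^sub>F s::real in at_right 0. \<bar>1 - cos s\<bar> + \<bar>sin s\<bar> < c" using c(1) by (rule order_tendstoD(2))
  moreover have "\<forall>\<^sub>F s::real in at_right 0. s \<in> {0<..<pi}"
    by (rule eventually_at_right_real) simp
  ultimately show ?thesis
  proof eventually_elim
    case (elim s)
    have "x = 0" if x: "x \<in> X" "rot s x \<in> Y" for x
    proof (rule ccontr)
      assume "x \<noteq> 0"
      have "x \<bullet> k = 0" if k: "k \<in> X \<inter> Y" for k
      proof -
        have "Om (rot s x) k = 0" using lagD(2)[OF Y x(2), of k] k by auto
        then have "sin s * (x \<bullet> k) = 0" using lagD(2)[OF X x(1), of k] k by (simp add: rot_def Om_J)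
        then show ?thesis using sin_gt_zero[of s] elim(2) by auto
      qed
      then have "x \<in> Z" using x by (auto simp: Z_def inner_commute)
      then have "c * norm x \<le> norm (x - closest_point Y x)" using c(2) by simp
      also have "\<dots> \<le> norm (x - rot s x)"
        using closest_point_le[OF closed_subspace[OF sY] x(2), of x] by (simp add: dist_norm)
      also have "x - rot s x = (1 - cos s) *\<^sub>R x - sin s *\<^sub>R J x" by (simp add: rot_def algebra_simps)
      also have "norm \<dots> \<le> (\<bar>1 - cos s\<bar> + \<bar>sin s\<bar>) * norm x"
        by (rule order_trans[OF norm_triangle_ineq4]) (simp add: normJ distrib_right)
      finally show False using elim(1) \<open>x \<noteq> 0\<close> by (simp add: mult_le_cancel_right)
    qed
    then show ?case
      using linear_0[OF rot_linear] subspace_0[OF sX] subspace_0[OF sY] by (auto intro!: image_eqI[of 0 _ 0])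
  qed
qed

lemma common_complement:
  assumes "lag X" "lag Y"
  obtains M where "lag M" "X \<inter> M = {0}" "Y \<inter> M = {0}"
proof -
  have "\<forall>\<^sub>F s in at_right 0. rot s ` X \<inter> X = {0} \<and> rot s ` X \<inter> Y = {0}"
    using eventually_conj[OF eventually_rot_transversal[OF assms(1,1)] eventually_rot_transversal[OF assms]] .
  then obtain s where "rot s ` X \<inter> X = {0}" "rot s ` X \<inter> Y = {0}"
    using eventually_happens'[OF trivial_limit_at_right_real] by blast
  then show ?thesis using that[OF lag_rot[OF assms(1), of s]] by (simp add: Int_commute)
qed

text \<open>The form lives on \<open>Y\<close>, not on \<open>X\<close>, so that it makes sense even
  when \<open>Y\<close> meets \<open>M\<close>; for \<open>Y\<close> transversal to \<open>M\<close>
  it is congruent to the usual chart form, see \<open>kap_chart\<close>.\<close>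

definition kap :: "'w set \<Rightarrow> 'w set \<Rightarrow> 'w set \<Rightarrow> int" where
  "kap X M Y = sig Y (\<lambda>u v. Om (proj_along X M u) v)"

text \<open>\<open>X\<close> and \<open>M\<close> are isotropic: expanding
  \<open>Om (u - p u) (v - p v) = 0\<close> with the projection \<open>p\<close> leaves
  \<open>Om u v = Om (p u) v + Om u (p v)\<close>.\<close>

lemma kap_form_symmetric:
  assumes "lag X" "lag M" "X \<inter> M = {0}" "Om u v = 0"
  shows "Om (proj_along X M u) v = Om (proj_along X M v) u"
proof -
  note p = proj_along[OF assms(1-3)]
  let ?p = "proj_along X M"
  have "Om (?p u) (?p v) = 0" by (rule lagD(2)[OF assms(1) p(1) p(1)])
  moreover have "Om (u - ?p u) (v - ?p v) = 0" by (rule lagD(2)[OF assms(2) p(2) p(2)])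
  ultimately have "Om u v = Om (?p u) v + Om u (?p v)" by simp
  then show ?thesis using assms(4) Om_skew[of u "?p v"] by simp
qed

lemma kap_sym_form:
  assumes "lag X" "lag M" "X \<inter> M = {0}" "lag Y"
  shows "sym_form Y (\<lambda>u v. Om (proj_along X M u) v)"
  unfolding sym_form_def
  using kap_form_symmetric[OF assms(1-3)] lagD(1,2)[OF assms(4)] proj_along_linear[OF assms(1-3)]
  by (auto simp: linear_add linear_cmul)

lemma kap_rad:
  assumes "lag X" "lag M" "X \<inter> M = {0}" "lag Y"
  shows "form_rad Y (\<lambda>u v. Om (proj_along X M u) v) = {u \<in> Y. proj_along X M u \<in> Y}"
proof -
  have "proj_along X M u \<in> Y" if "\<forall>w\<in>Y. Om (proj_along X M u) w = 0" for u
    using that by (intro lagD(3)[OF assms(4)]) (subst Om_skew, simp)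
  then show ?thesis using lagD(2)[OF assms(4)] unfolding form_rad_def by blast
qed

text \<open>The radical does not depend on \<open>X\<close>; this is what makes
  \<open>kap X M Y\<close> locally constant in \<open>X\<close> for fixed \<open>M\<close> and
  \<open>Y\<close>.\<close>

lemma kap_rad_transversal:
  assumes "lag X" "lag M" "X \<inter> M = {0}" "lag Y" "Y \<inter> X = {0}"
  shows "form_rad Y (\<lambda>u v. Om (proj_along X M u) v) = Y \<inter> M"
proof -
  note p = proj_along[OF assms(1-3)]
  have "u \<in> M" if "u \<in> Y" "proj_along X M u \<in> Y" for u
    using that p(1,2)[of u] assms(5) by (metis IntI diff_zero singletonD)
  moreover have "proj_along X M u = 0" if "u \<in> M" for u
    using that subspace_0[OF lagD(1)[OF assms(1)]] by (intro p(3)) auto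
  ultimately show ?thesis unfolding kap_rad[OF assms(1-4)] using subspace_0[OF lagD(1)[OF assms(4)]] by auto
qed

text \<open>The form \<open>Q((y, u), (y', u')) = q(y, y') + q(u, y') + q(u', y) + q(u, u')\<close> on \<open>Y \<times> M'\<close>, where
  \<open>q\<close> is the form of \<^term>\<open>kap L M\<close>, has two orthogonal decompositions, one with summand
  \<open>0 \<times> M'\<close> and one with summand \<open>Y \<times> 0\<close>; comparing signatures gives the cocycle identity.\<close>

lemma kap_cocycle:
  assumes L: "lag L" and M: "lag M" "L \<inter> M = {0}" and M': "lag M'" "L \<inter> M' = {0}"
    and Y: "lag Y" "Y \<inter> M = {0}" "Y \<inter> M' = {0}"
  shows "kap L M' Y + kap L M M' = kap L M Y + kap Y M M'"
proof -
  note p = proj_along[OF L M] and p' = proj_along[OF L M'] and pY = proj_along[OF Y(1) M(1) Y(2)]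
  define \<pi> where "\<pi> = proj_along L M"
  define q where "q u v = Om (\<pi> u) v" for u v
  define Q :: "'w \<times> 'w \<Rightarrow> 'w \<times> 'w \<Rightarrow> real" where
    "Q a b = q (fst a) (fst b) + q (snd a) (fst b) + q (snd b) (fst a) + q (snd a) (snd b)" for a b
  have l\<pi>: "linear \<pi>" unfolding \<pi>_def by (rule proj_along_linear[OF L M])
  have q_simps: "q (x + y) z = q x z + q y z" "q z (x + y) = q z x + q z y" "q (x - y) z = q x z - q y z"
    "q z (x - y) = q z x - q z y" "q (c *\<^sub>R x) z = c * q x z" "q z (c *\<^sub>R x) = c * q z x"
    "q (- x) z = - q x z" "q z (- x) = - q z x" "q 0 z = 0" "q z 0 = 0" for x y z c
    by (simp_all add: q_def linear_add[OF l\<pi>] linear_diff[OF l\<pi>] linear_cmul[OF l\<pi>] linear_neg[OF l\<pi>] linear_0[OF l\<pi>])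
  have sY: "subspace Y" and sM': "subspace M'" using Y M' lagD(1) by auto
  have qY: "q x y = q y x" if "x \<in> Y" "y \<in> Y" for x y
    unfolding q_def \<pi>_def using lagD(2)[OF Y(1) that] by (rule kap_form_symmetric[OF L M])
  have qM': "q x y = q y x" if "x \<in> M'" "y \<in> M'" for x y
    unfolding q_def \<pi>_def using lagD(2)[OF M'(1) that] by (rule kap_form_symmetric[OF L M])
  define V where "V = Y \<times> M'"
  have sV: "subspace V" unfolding V_def using sY sM' by (rule subspace_Times)
  have QV: "sym_form V Q"
    unfolding sym_form_def
  proof (intro conjI ballI allI sV)
    fix a b assume "a \<in> V" "b \<in> V"
    then show "Q a b = Q b a"
      using qY[of "fst a" "fst b"] qM'[of "snd a" "snd b"] by (auto simp: V_def Q_def)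
  qed (simp_all add: Q_def q_simps algebra_simps)
  have \<pi>Y: "q y y' = Om (proj_along L M y) y'" for y y' by (simp add: q_def \<pi>_def)
  define A1 where "A1 = {(0::'w, u) | u. u \<in> M'}"
  \<comment> \<open>\<open>A2\<close> is orthogonal to \<open>A1\<close> because \<open>q w\<close>
    vanishes on \<open>L\<close>, which contains the values of both projections. \<open>B2\<close>
    is orthogonal to \<open>B1\<close> because \<open>u - proj_along Y M u\<close> lies in
    \<open>M\<close>, the kernel of \<open>\<pi>\<close>. Restricted to the graphs, \<open>Q\<close>
    becomes the form of \<open>kap L M' Y\<close> and of \<open>kap Y M M'\<close>.\<close>
  define A2 where "A2 = (\<lambda>y. (y, - (y - proj_along L M' y))) ` Y"
  define B1 where "B1 = {(y, 0::'w) | y. y \<in> Y}"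
  define B2 where "B2 = (\<lambda>u. (- proj_along Y M u, u)) ` M'"
  have lA2: "linear (\<lambda>y. (y, - (y - proj_along L M' y)))"
    using proj_along_linear[OF L M'] by (intro linearI) (auto simp: linear_add linear_cmul algebra_simps)
  have lB2: "linear (\<lambda>u. (- proj_along Y M u, u))"
    using proj_along_linear[OF Y(1) M(1) Y(2)] by (intro linearI) (auto simp: linear_add linear_cmul algebra_simps)
  have lA1: "linear (\<lambda>u. (0::'w, u))" and lB1: "linear (\<lambda>y. (y, 0::'w))" by (auto intro!: linearI)
  have A1: "A1 = (\<lambda>u. (0::'w, u)) ` M'" and B1: "B1 = (\<lambda>y. (y, 0::'w)) ` Y" by (auto simp: A1_def B1_def)
  have sub: "subspace A1" "subspace A2" "subspace B1" "subspace B2"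
    unfolding A1 A2_def B1 B2_def using lA1 lA2 lB1 lB2 sY sM' by (auto intro!: linear_subspace_image)
  have diffM': "y - proj_along L M' y \<in> M'" for y by (rule p'(2))
  have "sig V Q = sig A1 Q + sig A2 Q"
  proof (rule sig_sum[OF QV sub(1,2)])
    show "A1 \<inter> A2 = {0}"
      using subspace_0[OF sub(1)] subspace_0[OF sub(2)] linear_0[OF proj_along_linear[OF L M']]
      by (auto simp: A1_def A2_def zero_prod_def)
    show "V = {x + y |x y. x \<in> A1 \<and> y \<in> A2}"
    proof (intro set_eqI iffI)
      fix a assume "a \<in> V"
      then obtain y u where a: "a = (y, u)" "y \<in> Y" "u \<in> M'" by (auto simp: V_def)
      have "a = (0, u + (y - proj_along L M' y)) + (y, - (y - proj_along L M' y))" by (simp add: a)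
      moreover have "(0, u + (y - proj_along L M' y)) \<in> A1"
        unfolding A1_def using subspace_add[OF sM' a(3) diffM'] by blast
      moreover have "(y, - (y - proj_along L M' y)) \<in> A2" unfolding A2_def using a(2) by (rule imageI)
      ultimately show "a \<in> {x + y |x y. x \<in> A1 \<and> y \<in> A2}" by blast
    next
      fix a assume "a \<in> {x + y |x y. x \<in> A1 \<and> y \<in> A2}"
      then obtain u y where a: "u \<in> M'" "y \<in> Y" "a = (0, u) + (y, - (y - proj_along L M' y))"
        unfolding A1_def A2_def by blast
      have "u - (y - proj_along L M' y) \<in> M'" using subspace_diff[OF sM' a(1) diffM'] .
      then show "a \<in> V" using a by (simp add: V_def algebra_simps)
    qed
    fix x y assume "x \<in> A1" "y \<in> A2"
    then obtain w y' where xy: "x = (0, w)" "w \<in> M'" "y = (y', - (y' - proj_along L M' y'))" "y' \<in> Y"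
      unfolding A1_def A2_def by blast
    have "Q x y = q w y' - q w (y' - proj_along L M' y')" by (simp add: Q_def xy q_simps)
    also have "\<dots> = q w (proj_along L M' y')" by (simp only: q_simps)
    also have "\<dots> = 0" using lagD(2)[OF L p(1) p'(1)] by (simp add: q_def \<pi>_def)
    finally show "Q x y = 0" .
  qed
  moreover have "sig V Q = sig B1 Q + sig B2 Q"
  proof (rule sig_sum[OF QV sub(3,4)])
    show "B1 \<inter> B2 = {0}"
      using subspace_0[OF sub(3)] subspace_0[OF sub(4)] linear_0[OF proj_along_linear[OF Y(1) M(1) Y(2)]]
      by (auto simp: B1_def B2_def zero_prod_def)
    show "V = {x + y |x y. x \<in> B1 \<and> y \<in> B2}"
    proof (intro set_eqI iffI)
      fix a assume "a \<in> V"
      then obtain y u where a: "a = (y, u)" "y \<in> Y" "u \<in> M'" by (auto simp: V_def)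
      have "a = (y + proj_along Y M u, 0) + (- proj_along Y M u, u)" by (simp add: a)
      moreover have "(y + proj_along Y M u, 0) \<in> B1"
        unfolding B1_def using subspace_add[OF sY a(2) pY(1)] by blast
      moreover have "(- proj_along Y M u, u) \<in> B2" unfolding B2_def using a(3) by (rule imageI)
      ultimately show "a \<in> {x + y |x y. x \<in> B1 \<and> y \<in> B2}" by blast
    next
      fix a assume "a \<in> {x + y |x y. x \<in> B1 \<and> y \<in> B2}"
      then obtain u y where a: "u \<in> M'" "y \<in> Y" "a = (y, 0) + (- proj_along Y M u, u)"
        unfolding B1_def B2_def by blast
      then show "a \<in> V" using subspace_diff[OF sY a(2) pY(1)] by (simp add: V_def)
    qed
    fix x y assume "x \<in> B1" "y \<in> B2"
    then obtain w u where xy: "x = (w, 0)" "w \<in> Y" "y = (- proj_along Y M u, u)" "u \<in> M'"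
      unfolding B1_def B2_def by blast
    have "proj_along L M (u - proj_along Y M u) = 0"
      using subspace_0[OF lagD(1)[OF L]] pY(2) by (intro p(3)) auto
    then have "\<pi> (proj_along Y M u) = \<pi> u" by (simp add: \<pi>_def[symmetric] linear_diff[OF l\<pi>])
    moreover have "Q x y = q u w - q w (proj_along Y M u)" by (simp add: Q_def xy q_simps)
    moreover have "q w (proj_along Y M u) = q (proj_along Y M u) w" using xy pY(1) by (intro qY) auto
    ultimately show "Q x y = 0" by (simp add: q_def)
  qed
  moreover have "sig A1 Q = kap L M M'"
    unfolding kap_def A1 using sM'
    by (intro sig_congruent[OF lA1]) (auto simp: inj_on_def Q_def q_simps \<pi>Y linear_0[OF proj_along_linear[OF L M]])
  moreover have "sig B1 Q = kap L M Y"
    unfolding kap_def B1 using sY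
    by (intro sig_congruent[OF lB1]) (auto simp: inj_on_def Q_def q_simps \<pi>Y linear_0[OF proj_along_linear[OF L M]])
  moreover have "sig A2 Q = kap L M' Y"
    unfolding kap_def A2_def
  proof (intro sig_congruent[OF lA2] sY refl)
    fix x y assume xy: "x \<in> Y" "y \<in> Y"
    let ?a = "proj_along L M' x" and ?b = "proj_along L M' y"
    have "Q (x, - (x - ?a)) (y, - (y - ?b)) = q x y - q (x - ?a) y - q (y - ?b) x + q (y - ?b) (x - ?a)"
      using qM'[OF diffM'[of y] diffM'[of x]] by (simp add: Q_def q_simps)
    also have "\<dots> = q x y - q (x - ?a) y - q (y - ?b) ?a" by (simp add: q_simps)
    also have "q (y - ?b) ?a = 0" using lagD(2)[OF L p(1) p'(1)] by (simp add: q_def \<pi>_def)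
    also have "q x y - q (x - ?a) y - 0 = q ?a y" by (simp add: q_simps)
    also have "\<pi> ?a = ?a" unfolding \<pi>_def using p'(1) subspace_0[OF lagD(1)[OF M(1)]] by (intro p(3)) auto
    then have "q ?a y = Om ?a y" by (simp add: q_def)
    finally show "Q (x, - (x - ?a)) (y, - (y - ?b)) = Om ?a y" .
  qed (auto simp: inj_on_def)
  moreover have "sig B2 Q = kap Y M M'"
    unfolding kap_def B2_def
  proof (intro sig_congruent[OF lB2] sM' refl)
    fix x y assume xy: "x \<in> M'" "y \<in> M'"
    let ?a = "proj_along Y M x" and ?b = "proj_along Y M y"
    have pa: "\<pi> ?a = \<pi> x" and pb: "\<pi> ?b = \<pi> y"
    proof -
      have "proj_along L M (u - proj_along Y M u) = 0" for u
        using subspace_0[OF lagD(1)[OF L]] pY(2) by (intro p(3)) auto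
      then show "\<pi> ?a = \<pi> x" "\<pi> ?b = \<pi> y" by (simp_all add: \<pi>_def[symmetric] linear_diff[OF l\<pi>])
    qed
    have "Q (- ?a, x) (- ?b, y) = q ?a ?b - q x ?b - q y ?a + q x y" by (simp add: Q_def q_simps)
    also have "q ?a ?b = q x ?b" using pa by (simp add: q_def)
    also have "q x ?b - q x ?b - q y ?a + q x y = q y (x - ?a)"
      using qM'[OF xy] by (simp add: q_simps)
    also have "\<dots> = Om (\<pi> ?b) (x - ?a)" using pb by (simp add: q_def)
    also have "\<dots> = Om ?b (x - ?a)"
    proof -
      have "Om (?b - \<pi> ?b) (x - ?a) = 0" using p(2)[of ?b] pY(2)[of x] lagD(2)[OF M(1)] by (simp only: \<pi>_def)
      then show ?thesis by simp
    qed
    also have "\<dots> = Om ?b x" using lagD(2)[OF Y(1) pY(1) pY(1)] by simp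
    also have "\<dots> = Om ?a y" using lagD(2)[OF M'(1) xy] by (intro kap_form_symmetric[OF Y(1) M(1) Y(2), symmetric])
    finally show "Q (- ?a, x) (- ?b, y) = Om ?a y" .
  qed (auto simp: inj_on_def)
  ultimately show ?thesis by simp
qed

text \<open>By the cocycle identity the difference is \<open>kap (Y p) M M'\<close> up to a
  constant. Its form lives on the fixed space \<open>M'\<close> with the fixed radical
  \<open>M' \<inter> M\<close>, so \<open>sig_eventually_const\<close> applies although
  \<open>kap L M (Y p)\<close> itself may jump.\<close>

lemma kap_transition:
  assumes L: "lag L" and M: "lag M" "L \<inter> M = {0}" and M': "lag M'" "L \<inter> M' = {0}"
    and Y: "lag_tendsto Y Y0 F" "Y0 \<inter> M = {0}" "Y0 \<inter> M' = {0}"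
  shows "\<forall>\<^sub>F p in F. kap L M' (Y p) - kap L M (Y p) = kap L M' Y0 - kap L M Y0"
proof -
  have lag0: "lag Y0" and lagY: "\<forall>\<^sub>F p in F. lag (Y p)" using Y(1) by (auto simp: lag_tendsto_def)
  have t: "\<forall>\<^sub>F p in F. Y p \<inter> M = {0}" "\<forall>\<^sub>F p in F. Y p \<inter> M' = {0}"
    using lag_tendsto_transversal[OF Y(1)] M M' Y by auto
  have "\<forall>\<^sub>F p in F. kap (Y p) M M' = kap Y0 M M'"
    unfolding kap_def
  proof (rule sig_eventually_const[OF kap_sym_form[OF lag0 M(1) Y(2) M'(1)]])
    show "\<forall>\<^sub>F p in F. sym_form M' (\<lambda>u v. Om (proj_along (Y p) M u) v)"
      using lagY t(1) by eventually_elim (rule kap_sym_form[OF _ M(1) _ M'(1)])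
    show "((\<lambda>p. Om (proj_along (Y p) M x) y) \<longlongrightarrow> Om (proj_along Y0 M x) y) F" for x y
      by (intro Om_tendsto tendsto_const lag_tendsto_proj[OF Y(1) M(1) Y(2)])
    have r0: "form_rad M' (\<lambda>u v. Om (proj_along Y0 M u) v) = M' \<inter> M"
      using Y(3) by (intro kap_rad_transversal[OF lag0 M(1) Y(2) M'(1)]) (simp add: Int_commute)
    show "\<forall>\<^sub>F p in F. dim (form_rad M' (\<lambda>u v. Om (proj_along Y0 M u) v)) \<le> dim (form_rad M' (\<lambda>u v. Om (proj_along (Y p) M u) v))"
      using lagY t
    proof eventually_elim
      case (elim p)
      have "form_rad M' (\<lambda>u v. Om (proj_along (Y p) M u) v) = M' \<inter> M"
        using elim by (intro kap_rad_transversal[OF elim(1) M(1) elim(2) M'(1)]) (simp add: Int_commute)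
      then show ?case using r0 by simp
    qed
  qed
  then show ?thesis using lagY t
  proof eventually_elim
    case (elim p)
    show ?case
      using kap_cocycle[OF L M M' elim(2-4)] kap_cocycle[OF L M M' lag0 Y(2,3)] elim(1) by simp
  qed
qed

end

section \<open>The Maslov index\<close>

lemma at_within_closed_eq_bot: "closed R \<Longrightarrow> p \<notin> R \<Longrightarrow> at p within R = bot"
  using at_within_eq_bot_iff[of p R] closure_closed[of R] closure_mono[of "R - {p}" R] by auto

context compatible_symplectic
begin

definition lag_family :: "'p::topological_space set \<Rightarrow> ('p \<Rightarrow> 'w set) \<Rightarrow> bool" where
  "lag_family S K \<longleftrightarrow> (\<forall>p\<in>S. lag (K p)) \<and> (\<forall>w. continuous_on S (\<lambda>p. closest_point (K p) w))"

lemma lag_family_subset: "lag_family S K \<Longrightarrow> T \<subseteq> S \<Longrightarrow> lag_family T K"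
  unfolding lag_family_def using continuous_on_subset by blast

lemma lag_family_tendsto:
  assumes "lag_family S K" "p \<in> S"
  shows "lag_tendsto K (K p) (at p within S)"
  using assms unfolding lag_family_def lag_tendsto_def continuous_on_def
  by (auto simp: eventually_at_filter)

text \<open>A locally defined antiderivative: near each point \<open>g\<close> differs from
  \<open>kap L M\<close> along \<open>K\<close> by a constant. Demanding this for all admissible
  \<open>M\<close> makes the notion independent of choices; \<open>maslov_primitiveI\<close> shows
  that one \<open>M\<close> per point is enough.\<close>

definition maslov_primitive :: "'w set \<Rightarrow> 'p::topological_space set \<Rightarrow> ('p \<Rightarrow> 'w set) \<Rightarrow> ('p \<Rightarrow> int) \<Rightarrow> bool" where
  "maslov_primitive L S K g \<longleftrightarrow> (\<forall>p\<in>S. \<forall>M. lag M \<and> L \<inter> M = {0} \<and> K p \<inter> M = {0} \<longrightarrow>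
     (\<forall>\<^sub>F q in at p within S. g q - kap L M (K q) = g p - kap L M (K p)))"

lemma maslov_primitive_subset:
  "maslov_primitive L S K g \<Longrightarrow> T \<subseteq> S \<Longrightarrow> maslov_primitive L T K g"
  unfolding maslov_primitive_def by (meson at_le filter_leD subsetD)

lemma maslov_primitiveI:
  assumes L: "lag L" and K: "lag_family S K"
    and ex: "\<And>p. p \<in> S \<Longrightarrow> \<exists>M. lag M \<and> L \<inter> M = {0} \<and> K p \<inter> M = {0} \<and>
      (\<forall>\<^sub>F q in at p within S. g q - kap L M (K q) = g p - kap L M (K p))"
  shows "maslov_primitive L S K g"
  unfolding maslov_primitive_def
proof (intro ballI allI impI)
  fix p M assume p: "p \<in> S" and M: "lag M \<and> L \<inter> M = {0} \<and> K p \<inter> M = {0}"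
  obtain N where N: "lag N" "L \<inter> N = {0}" "K p \<inter> N = {0}"
      and ev: "\<forall>\<^sub>F q in at p within S. g q - kap L N (K q) = g p - kap L N (K p)" using ex[OF p] by blast
  have "\<forall>\<^sub>F q in at p within S. kap L M (K q) - kap L N (K q) = kap L M (K p) - kap L N (K p)"
    using kap_transition[OF L N(1,2) _ _ lag_family_tendsto[OF K p] N(3)] M by blast
  then show "\<forall>\<^sub>F q in at p within S. g q - kap L M (K q) = g p - kap L M (K p)"
    using ev by eventually_elim linarith
qed

text \<open>Two primitives follow the same \<open>kap L M\<close> locally, so their difference is
  locally constant. This gives both the gluing constant and the well-definedness of
  \<open>maslov\<close>.\<close>

lemma maslov_primitive_diff_const:
  assumes L: "lag L" and K: "lag_family S K" and S: "connected S" "p \<in> S" "q \<in> S"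
    and g: "maslov_primitive L S K g" "maslov_primitive L S K g'"
  shows "g p - g' p = g q - g' q"
proof (rule connected_local_const[OF S, of "\<lambda>p. g p - g' p"], intro ballI)
  fix r assume r: "r \<in> S"
  then obtain M where M: "lag M" "L \<inter> M = {0}" "K r \<inter> M = {0}"
    using common_complement[OF L, of "K r"] K by (auto simp: lag_family_def)
  have "\<forall>\<^sub>F q in at r within S. g q - kap L M (K q) = g r - kap L M (K r)"
    "\<forall>\<^sub>F q in at r within S. g' q - kap L M (K q) = g' r - kap L M (K r)"
    using g r M unfolding maslov_primitive_def by auto
  then show "\<forall>\<^sub>F b in at r within S. g r - g' r = g b - g' b"
    by eventually_elim linarith
qed

text \<open>On the connected overlap the primitives differ by one constant, which is used to shift
  the second. Closedness makes the condition relative to \<open>S\<close> vacuous at points outside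
  \<open>S\<close>, and likewise for \<open>T\<close>.\<close>

lemma maslov_primitive_glue:
  assumes L: "lag L" and K: "lag_family (S \<union> T) K" and cl: "closed S" "closed T"
    and conn: "connected (S \<inter> T)" "S \<inter> T \<noteq> {}"
    and g: "maslov_primitive L S K g1" "maslov_primitive L T K g2"
  shows "\<exists>g. maslov_primitive L (S \<union> T) K g"
proof -
  obtain p0 where p0: "p0 \<in> S \<inter> T" using conn by blast
  define g where "g p = (if p \<in> S then g1 p else g2 p + (g1 p0 - g2 p0))" for p
  have eq: "g1 p - g2 p = g1 p0 - g2 p0" if "p \<in> S \<inter> T" for p
    using maslov_primitive_diff_const[OF L lag_family_subset[OF K] conn(1) that p0]
      maslov_primitive_subset[OF g(1)] maslov_primitive_subset[OF g(2)] by blast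
  have gS: "g p = g1 p" if "p \<in> S" for p using that by (simp add: g_def)
  have gT: "g p = g2 p + (g1 p0 - g2 p0)" if "p \<in> T" for p using that eq[of p] by (auto simp: g_def)
  have "\<forall>\<^sub>F q in at p within (S \<union> T). g q - kap L M (K q) = g p - kap L M (K p)"
    if p: "p \<in> S \<union> T" and M: "lag M \<and> L \<inter> M = {0} \<and> K p \<inter> M = {0}" for p M
    unfolding at_within_union eventually_sup
  proof
    show "\<forall>\<^sub>F q in at p within S. g q - kap L M (K q) = g p - kap L M (K p)"
    proof (cases "p \<in> S")
      case True
      then have "\<forall>\<^sub>F q in at p within S. g1 q - kap L M (K q) = g1 p - kap L M (K p)"
        using g(1) M unfolding maslov_primitive_def by blast
      moreover have "\<forall>\<^sub>F q in at p within S. q \<in> S" by (simp add: eventually_at_filter)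
      ultimately show ?thesis by eventually_elim (simp add: gS True)
    qed (simp add: at_within_closed_eq_bot[OF cl(1)])
    show "\<forall>\<^sub>F q in at p within T. g q - kap L M (K q) = g p - kap L M (K p)"
    proof (cases "p \<in> T")
      case True
      then have "\<forall>\<^sub>F q in at p within T. g2 q - kap L M (K q) = g2 p - kap L M (K p)"
        using g(2) M unfolding maslov_primitive_def by blast
      moreover have "\<forall>\<^sub>F q in at p within T. q \<in> T" by (simp add: eventually_at_filter)
      ultimately show ?thesis by eventually_elim (simp add: gT True)
    qed (simp add: at_within_closed_eq_bot[OF cl(2)])
  qed
  then have "maslov_primitive L (S \<union> T) K g" unfolding maslov_primitive_def by blast
  then show ?thesis by blast
qed

text \<open>Near \<open>p\<close> a single \<open>M\<close> stays transversal to all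
  \<open>K q\<close>, and there \<open>kap L M\<close> itself is a primitive. The claim covers every
  subset \<open>T\<close>, so that intervals and boxes can be cut out freely.\<close>

lemma maslov_primitive_local:
  assumes L: "lag L" and K: "lag_family S K" and p: "p \<in> S"
  shows "\<exists>U. open U \<and> p \<in> U \<and> (\<forall>T. T \<subseteq> S \<inter> U \<longrightarrow> (\<exists>g. maslov_primitive L T K g))"
proof -
  obtain M where M: "lag M" "L \<inter> M = {0}" "K p \<inter> M = {0}"
    using common_complement[OF L, of "K p"] K p by (auto simp: lag_family_def)
  have "\<forall>\<^sub>F q in at p within S. K q \<inter> M = {0}"
    by (rule lag_tendsto_transversal[OF lag_family_tendsto[OF K p] M(1,3)])
  then obtain U where U: "open U" "p \<in> U" "\<And>q. q \<in> U \<Longrightarrow> q \<noteq> p \<Longrightarrow> q \<in> S \<Longrightarrow> K q \<inter> M = {0}"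
    unfolding eventually_at_topological by blast
  have "maslov_primitive L T K (\<lambda>q. kap L M (K q))" if T: "T \<subseteq> S \<inter> U" for T
  proof (rule maslov_primitiveI[OF L lag_family_subset[OF K]])
    show "T \<subseteq> S" using T by auto
    fix q assume "q \<in> T"
    then have "K q \<inter> M = {0}" using T U(3)[of q] M(3) by (cases "q = p") auto
    then show "\<exists>M'. lag M' \<and> L \<inter> M' = {0} \<and> K q \<inter> M' = {0} \<and>
      (\<forall>\<^sub>F r in at q within T. kap L M (K r) - kap L M' (K r) = kap L M (K q) - kap L M' (K q))"
      using M by (intro exI[of _ M]) auto
  qed
  then show ?thesis using U by blast
qed

lemma maslov_primitive_interval:
  assumes L: "lag L" and K: "lag_family {a..b} K" and ab: "a \<le> (b::real)"
  shows "\<exists>g. maslov_primitive L {a..b} K g"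
proof -
  have "a \<le> a \<and> b \<le> b \<longrightarrow> (\<exists>g. maslov_primitive L {a..b} K g)"
    using ab
  proof (induction rule: Bolzano[where P = "\<lambda>x y. a \<le> x \<and> y \<le> b \<longrightarrow> (\<exists>g. maslov_primitive L {x..y} K g)"])
    case (trans x y z)
    show ?case
    proof
      assume xz: "a \<le> x \<and> z \<le> b"
      then obtain g1 g2 where "maslov_primitive L {x..y} K g1" "maslov_primitive L {y..z} K g2"
        using trans by fastforce
      moreover have "{x..y} \<union> {y..z} = {x..z}" "{x..y} \<inter> {y..z} = {y}" using trans by auto
      ultimately show "\<exists>g. maslov_primitive L {x..z} K g"
        using maslov_primitive_glue[OF L, of "{x..y}" "{y..z}" K g1 g2] lag_family_subset[OF K] xz by simp
    qed
  next
    case (local x)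
    then obtain U where U: "open U" "x \<in> U" "\<And>T. T \<subseteq> {a..b} \<inter> U \<Longrightarrow> \<exists>g. maslov_primitive L T K g"
      using maslov_primitive_local[OF L K, of x] by auto
    then obtain d where d: "d > 0" "\<And>y. dist y x < d \<Longrightarrow> y \<in> U" unfolding open_dist by blast
    show ?case
    proof (intro exI[of _ d] conjI d(1) allI impI)
      fix u v assume "u \<le> x \<and> x \<le> v \<and> v - u < d" "a \<le> u \<and> v \<le> b"
      then have "{u..v} \<subseteq> {a..b} \<inter> U" by (auto simp: dist_real_def intro!: d(2))
      then show "\<exists>g. maslov_primitive L {u..v} K g" by (rule U(3))
    qed
  qed
  then show ?thesis by simp
qed

text \<open>Bisection in both directions. Around each \<open>s\<close> boxes are glued along the
  \<open>t\<close>-interval to a strip; its width shrinks at every gluing and is therefore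
  existential. The strips are then glued along the \<open>s\<close>-interval. All overlaps are
  products of intervals, hence connected.\<close>

lemma maslov_primitive_rectangle:
  assumes L: "lag L" and K: "lag_family ({c..e} \<times> {a..b}) K" and ab: "a \<le> (b::real)" and ce: "c \<le> (e::real)"
  shows "\<exists>g. maslov_primitive L ({c..e} \<times> {a..b}) K g"
proof -
  have strip: "\<exists>d>0. \<exists>g. maslov_primitive L ({max c (s - d)..min e (s + d)} \<times> {a..b}) K g"
    if s: "c \<le> s" "s \<le> e" for s
  proof -
    have "a \<le> a \<and> b \<le> b \<longrightarrow> (\<exists>d>0. \<exists>g. maslov_primitive L ({max c (s - d)..min e (s + d)} \<times> {a..b}) K g)"
      using ab
    proof (induction rule: Bolzano[where P = "\<lambda>x y. a \<le> x \<and> y \<le> b \<longrightarrow>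
        (\<exists>d>0. \<exists>g. maslov_primitive L ({max c (s - d)..min e (s + d)} \<times> {x..y}) K g)"])
      case (trans x y z)
      show ?case
      proof
        assume xz: "a \<le> x \<and> z \<le> b"
        then obtain d1 g1 d2 g2 where d: "d1 > 0" "maslov_primitive L ({max c (s - d1)..min e (s + d1)} \<times> {x..y}) K g1"
          "d2 > 0" "maslov_primitive L ({max c (s - d2)..min e (s + d2)} \<times> {y..z}) K g2"
          using trans by fastforce
        define d where "d = min d1 d2"
        let ?I = "{max c (s - d)..min e (s + d)}"
        have g: "maslov_primitive L (?I \<times> {x..y}) K g1" "maslov_primitive L (?I \<times> {y..z}) K g2"
          by (rule maslov_primitive_subset[OF d(2)] maslov_primitive_subset[OF d(4)]; auto simp: d_def)+
        have u: "?I \<times> {x..y} \<union> ?I \<times> {y..z} = ?I \<times> {x..z}" "?I \<times> {x..y} \<inter> ?I \<times> {y..z} = ?I \<times> {y}"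
          using trans by auto
        have sI: "s \<in> ?I" using d s by (auto simp: d_def)
        have "\<exists>g. maslov_primitive L (?I \<times> {x..y} \<union> ?I \<times> {y..z}) K g"
        proof (rule maslov_primitive_glue[OF L _ _ _ _ _ g])
          show "lag_family (?I \<times> {x..y} \<union> ?I \<times> {y..z}) K" unfolding u
            using xz by (intro lag_family_subset[OF K]) auto
          show "connected (?I \<times> {x..y} \<inter> ?I \<times> {y..z})" unfolding u
            by (intro convex_connected convex_Times) auto
          show "?I \<times> {x..y} \<inter> ?I \<times> {y..z} \<noteq> {}" unfolding u using sI by blast
        qed (auto intro!: closed_Times)
        then show "\<exists>d>0. \<exists>g. maslov_primitive L ({max c (s - d)..min e (s + d)} \<times> {x..z}) K g"
          unfolding u using d by (intro exI[of _ d]) (auto simp: d_def)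
      qed
    next
      case (local x)
      then obtain U where U: "open U" "(s, x) \<in> U" "\<And>T. T \<subseteq> ({c..e} \<times> {a..b}) \<inter> U \<Longrightarrow> \<exists>g. maslov_primitive L T K g"
        using maslov_primitive_local[OF L K, of "(s, x)"] s by auto
      then obtain A B where AB: "open A" "open B" "s \<in> A" "x \<in> B" "A \<times> B \<subseteq> U"
        by (metis open_prod_elim SigmaE2 mem_Sigma_iff)
      obtain d1 where d1: "d1 > 0" "\<And>y. dist y s < d1 \<Longrightarrow> y \<in> A" using AB(1,3) unfolding open_dist by blast
      obtain d2 where d2: "d2 > 0" "\<And>y. dist y x < d2 \<Longrightarrow> y \<in> B" using AB(2,4) unfolding open_dist by blast
      show ?case
      proof (rule exI[of _ d2], intro conjI d2(1) allI impI)
        fix u v assume *: "u \<le> x \<and> x \<le> v \<and> v - u < d2" "a \<le> u \<and> v \<le> b"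
        have "{max c (s - d1 / 2)..min e (s + d1 / 2)} \<times> {u..v} \<subseteq> ({c..e} \<times> {a..b}) \<inter> (A \<times> B)"
          using * d1(1) by (auto simp: dist_real_def intro!: d1(2) d2(2))
        then have "{max c (s - d1 / 2)..min e (s + d1 / 2)} \<times> {u..v} \<subseteq> ({c..e} \<times> {a..b}) \<inter> U" using AB(5) by auto
        then show "\<exists>d>0. \<exists>g. maslov_primitive L ({max c (s - d)..min e (s + d)} \<times> {u..v}) K g"
          using U(3) d1(1) by (intro exI[of _ "d1 / 2"]) auto
      qed
    qed
    then show ?thesis by simp
  qed
  have "c \<le> c \<and> e \<le> e \<longrightarrow> (\<exists>g. maslov_primitive L ({c..e} \<times> {a..b}) K g)"
    using ce
  proof (induction rule: Bolzano[where P = "\<lambda>x y. c \<le> x \<and> y \<le> e \<longrightarrow> (\<exists>g. maslov_primitive L ({x..y} \<times> {a..b}) K g)"])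
    case (trans x y z)
    show ?case
    proof
      assume xz: "c \<le> x \<and> z \<le> e"
      then obtain g1 g2 where g: "maslov_primitive L ({x..y} \<times> {a..b}) K g1" "maslov_primitive L ({y..z} \<times> {a..b}) K g2"
        using trans by fastforce
      have u: "{x..y} \<times> {a..b} \<union> {y..z} \<times> {a..b} = {x..z} \<times> {a..b}" "({x..y} \<times> {a..b}) \<inter> ({y..z} \<times> {a..b}) = {y} \<times> {a..b}"
        using trans by auto
      have "\<exists>g. maslov_primitive L ({x..y} \<times> {a..b} \<union> {y..z} \<times> {a..b}) K g"
      proof (rule maslov_primitive_glue[OF L _ _ _ _ _ g])
        show "lag_family ({x..y} \<times> {a..b} \<union> {y..z} \<times> {a..b}) K" unfolding u
          using xz by (intro lag_family_subset[OF K]) auto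
        show "connected (({x..y} \<times> {a..b}) \<inter> ({y..z} \<times> {a..b}))" unfolding u
          by (intro convex_connected convex_Times) auto
        show "({x..y} \<times> {a..b}) \<inter> ({y..z} \<times> {a..b}) \<noteq> {}" unfolding u using ab by auto
      qed (auto intro!: closed_Times)
      then show "\<exists>g. maslov_primitive L ({x..z} \<times> {a..b}) K g" unfolding u .
    qed
  next
    case (local x)
    then obtain d g where d: "d > 0" "maslov_primitive L ({max c (x - d)..min e (x + d)} \<times> {a..b}) K g"
      using strip by blast
    show ?case
    proof (intro exI[of _ d] conjI d(1) allI impI)
      fix u v assume *: "u \<le> x \<and> x \<le> v \<and> v - u < d" "c \<le> u \<and> v \<le> e"
      then show "\<exists>g. maslov_primitive L ({u..v} \<times> {a..b}) K g"
        by (intro exI[of _ g] maslov_primitive_subset[OF d(2)]) auto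
    qed
  qed
  then show ?thesis by simp
qed

definition maslov :: "'w set \<Rightarrow> real \<Rightarrow> real \<Rightarrow> (real \<Rightarrow> 'w set) \<Rightarrow> int" where
  "maslov L a b K = (THE r. \<exists>g. maslov_primitive L {a..b} K g \<and> r = g b - g a)"

lemma maslov_eq:
  assumes "lag L" "lag_family {a..b} K" "a \<le> b" "maslov_primitive L {a..b} K g"
  shows "maslov L a b K = g b - g a"
  unfolding maslov_def
proof (rule the_equality)
  fix r assume "\<exists>g'. maslov_primitive L {a..b} K g' \<and> r = g' b - g' a"
  then obtain g' where g': "maslov_primitive L {a..b} K g'" "r = g' b - g' a" by blast
  have "g b - g' b = g a - g' a"
    using maslov_primitive_diff_const[OF assms(1,2) _ _ _ assms(4) g'(1), of b a] assms(3) by simp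
  then show "r = g b - g a" using g'(2) by simp
qed (use assms in blast)

lemma maslov_catenation:
  assumes "lag L" "lag_family {a..b} K" "a \<le> c" "c \<le> b"
  shows "maslov L a b K = maslov L a c K + maslov L c b K"
proof -
  obtain g where g: "maslov_primitive L {a..b} K g"
    using maslov_primitive_interval[OF assms(1,2)] assms by auto
  have "maslov_primitive L {a..c} K g" "maslov_primitive L {c..b} K g"
    using assms by (auto intro!: maslov_primitive_subset[OF g])
  moreover have "lag_family {a..c} K" "lag_family {c..b} K"
    using assms by (auto intro!: lag_family_subset[OF assms(2)])
  ultimately show ?thesis using maslov_eq[OF assms(1)] assms g by simp
qed

text \<open>A primitive on the rectangle restricts to a primitive of each slice. Along the two sides
  where the end point is held fixed, \<open>kap\<close> does not vary, so \<open>g\<close> is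
  constant and the slices have equal increments.\<close>

lemma maslov_homotopic:
  assumes L: "lag L" and K: "lag_family ({0..1} \<times> {a..b}) (\<lambda>(s, t). K s t)" and ab: "a \<le> (b::real)"
    and ends: "\<And>s::real. s \<in> {0..1} \<Longrightarrow> K s a = K 0 a" "\<And>s. s \<in> {0..1} \<Longrightarrow> K s b = K 0 b"
  shows "maslov L a b (K 0) = maslov L a b (K 1)"
proof -
  obtain g where g: "maslov_primitive L ({0..1} \<times> {a..b}) (\<lambda>(s, t). K s t) g"
    using maslov_primitive_rectangle[OF L K ab] by auto
  have slice: "lag_family {a..b} (K s) \<and> maslov_primitive L {a..b} (K s) (\<lambda>t. g (s, t))" if s: "s \<in> {0..1}" for s
  proof
    have c: "continuous_on {a..b} (\<lambda>t. (s, t))" by (intro continuous_intros)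
    have im: "(\<lambda>t. (s, t)) ` {a..b} \<subseteq> {0..1} \<times> {a..b}" using s by auto
    show fam: "lag_family {a..b} (K s)"
      unfolding lag_family_def
    proof (intro conjI ballI allI)
      show "lag (K s t)" if "t \<in> {a..b}" for t using K s that by (auto simp: lag_family_def)
      show "continuous_on {a..b} (\<lambda>t. closest_point (K s t) w)" for w
        using continuous_on_compose2[OF _ c im, of "\<lambda>p. closest_point (case p of (s, t) \<Rightarrow> K s t) w"] K
        by (auto simp: lag_family_def)
    qed
    show "maslov_primitive L {a..b} (K s) (\<lambda>t. g (s, t))"
      unfolding maslov_primitive_def
    proof (intro ballI allI impI)
      fix t M assume t: "t \<in> {a..b}" and M: "lag M \<and> L \<inter> M = {0} \<and> K s t \<inter> M = {0}"
      have "\<forall>\<^sub>F q in at (s, t) within ({0..1} \<times> {a..b}). g q - kap L M (case q of (s, t) \<Rightarrow> K s t) = g (s, t) - kap L M (K s t)"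
        using g s t M unfolding maslov_primitive_def by fastforce
      moreover have "filterlim (\<lambda>t. (s, t)) (at (s, t) within ({0..1} \<times> {a..b})) (at t within {a..b})"
        unfolding filterlim_at using s by (auto intro!: tendsto_intros simp: eventually_at_filter)
      ultimately have "\<forall>\<^sub>F u in at t within {a..b}. g (s, u) - kap L M (case (s, u) of (s, t) \<Rightarrow> K s t) = g (s, t) - kap L M (K s t)"
        by (rule eventually_compose_filterlim)
      then show "\<forall>\<^sub>F u in at t within {a..b}. g (s, u) - kap L M (K s u) = g (s, t) - kap L M (K s t)" by simp
    qed
  qed
  have edge: "g (0, t) = g (1, t)" if t: "t \<in> {a..b}" and c: "\<And>s. s \<in> {0..1} \<Longrightarrow> K s t = K 0 t" for t
  proof (rule connected_local_const[of "{0..1::real}" 0 1 "\<lambda>s. g (s, t)"])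
    show "\<forall>s\<in>{0..1}. \<forall>\<^sub>F b in at s within {0..1}. g (s, t) = g (b, t)"
    proof
      fix s :: real assume s: "s \<in> {0..1}"
      then have "lag (K s t)" using K t by (auto simp: lag_family_def)
      then obtain M where M: "lag M" "L \<inter> M = {0}" "K s t \<inter> M = {0}" using common_complement[OF L] by blast
      have "\<forall>\<^sub>F q in at (s, t) within ({0..1} \<times> {a..b}). g q - kap L M (case q of (s, t) \<Rightarrow> K s t) = g (s, t) - kap L M (K s t)"
        using g s t M unfolding maslov_primitive_def by fastforce
      moreover have "filterlim (\<lambda>s. (s, t)) (at (s, t) within ({0..1} \<times> {a..b})) (at s within {0..1})"
        unfolding filterlim_at using t by (auto intro!: tendsto_intros simp: eventually_at_filter)
      ultimately have "\<forall>\<^sub>F u in at s within {0..1}. g (u, t) - kap L M (case (u, t) of (s, t) \<Rightarrow> K s t) = g (s, t) - kap L M (K s t)"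
        by (rule eventually_compose_filterlim)
      moreover have "\<forall>\<^sub>F u in at s within {0..1}. u \<in> {0..1}" by (simp add: eventually_at_filter)
      ultimately show "\<forall>\<^sub>F b in at s within {0..1}. g (s, t) = g (b, t)"
      proof eventually_elim
        case (elim u)
        then show ?case using c[of u] c[OF s] by simp
      qed
    qed
  qed auto
  have "maslov L a b (K s) = g (s, b) - g (s, a)" if "s \<in> {0..1}" for s
    using maslov_eq[OF L conjunct1[OF slice[OF that]] ab conjunct2[OF slice[OF that]]] .
  from this[of 0] this[of 1] have "maslov L a b (K 0) = g (0, b) - g (0, a)" "maslov L a b (K 1) = g (1, b) - g (1, a)"
    by auto
  moreover have "g (0, a) = g (1, a)" using ab by (intro edge ends(1)) auto
  moreover have "g (0, b) = g (1, b)" using ab by (intro edge ends(2)) auto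
  ultimately show ?thesis by linarith
qed

end

section \<open>Charts over \<open>L\<close> and the behaviour at a crossing\<close>

lemma sym_form_tendsto:
  assumes F: "F \<noteq> bot" and B: "\<forall>\<^sub>F i in F. sym_form V (B i)"
    and lim: "\<And>x y. x \<in> V \<Longrightarrow> y \<in> V \<Longrightarrow> ((\<lambda>i. B i x y) \<longlongrightarrow> C x y) F"
  shows "sym_form V C"
proof -
  have sV: "subspace V" using eventually_happens'[OF F B] sym_formD(1) by blast
  note add = subspace_add[OF sV] and scale = subspace_scale[OF sV]
  have "C x y = C y x" if "x \<in> V" "y \<in> V" for x y
    using B by (intro tendsto_unique[OF F lim[OF that] Lim_transform_eventually[OF lim[OF that(2,1)]]])
      (auto elim!: eventually_mono simp: sym_formD(2) that)
  moreover have "C (x + y) z = C x z + C y z" if "x \<in> V" "y \<in> V" "z \<in> V" for x y z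
    using B that
    by (intro tendsto_unique[OF F lim[OF add[OF that(1,2)] that(3)]
          Lim_transform_eventually[OF tendsto_add[OF lim[OF that(1,3)] lim[OF that(2,3)]]]])
      (auto elim!: eventually_mono simp: sym_formD(3))
  moreover have "C (c *\<^sub>R x) y = c * C x y" if "x \<in> V" "y \<in> V" for c x y
    using B that
    by (intro tendsto_unique[OF F lim[OF scale[OF that(1)] that(2)]
          Lim_transform_eventually[OF tendsto_mult_left[OF lim[OF that]]]])
      (auto elim!: eventually_mono simp: sym_formD(5))
  ultimately show ?thesis using sV unfolding sym_form_def by blast
qed

text \<open>In the limit the two indices already exhaust the dimension; since they can only grow,
  the radical stays trivial nearby.\<close>

lemma nondegenerate_eventually:
  assumes C: "sym_form V C" and B: "\<forall>\<^sub>F i in F. sym_form V (B i)"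
    and lim: "\<And>x y. x \<in> V \<Longrightarrow> y \<in> V \<Longrightarrow> ((\<lambda>i. B i x y) \<longlongrightarrow> C x y) F"
    and rad: "form_rad V C = {0}"
  shows "\<forall>\<^sub>F i in F. sig V (B i) = sig V C \<and> form_rad V (B i) = {0}"
proof -
  obtain P where P: "subspace P" "P \<subseteq> V" "pos_def_on P C" "dim P = pos_index V C"
    using pos_index_attained[OF C] by blast
  obtain N where N: "subspace N" "N \<subseteq> V" "pos_def_on N (\<lambda>x y. - C x y)" "dim N = pos_index V (\<lambda>x y. - C x y)"
    using pos_index_attained[OF sym_form_uminus[OF C]] by blast
  have "\<forall>\<^sub>F i in F. pos_def_on P (B i)" by (rule pos_def_on_eventually[OF C B lim P(1-3)])
  moreover have "\<forall>\<^sub>F i in F. pos_def_on N (\<lambda>x y. - B i x y)"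
    using B lim
    by (intro pos_def_on_eventually[OF sym_form_uminus[OF C] _ _ N(1-3)] tendsto_minus)
      (auto elim!: eventually_mono intro: sym_form_uminus)
  ultimately show ?thesis using B
  proof eventually_elim
    case (elim i)
    have "pos_index V C \<le> pos_index V (B i)" using pos_index_ge[OF P(1,2) elim(1)] P(4) by simp
    moreover have "pos_index V (\<lambda>x y. - C x y) \<le> pos_index V (\<lambda>x y. - B i x y)"
      using pos_index_ge[OF N(1,2) elim(2)] N(4) by simp
    moreover have "dim (form_rad V C) = 0" using rad by simp
    ultimately have "dim (form_rad V (B i)) = 0" "sig V (B i) = sig V C"
      using index_sum[OF C] index_sum[OF elim(3)] unfolding sig_def by linarith+
    moreover have "0 \<in> form_rad V (B i)" by (rule subspace_0[OF subspace_form_rad[OF elim(3)]])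
    ultimately show ?case using dim_eq_0[of "form_rad V (B i)"] by auto
  qed
qed

text \<open>Derivatives as limits of quotients, so that
  \<open>linear_family_solution_tendsto\<close> and \<open>Om_tendsto\<close> apply to them.\<close>

lemma has_vector_derivative_quotient:
  "(f has_vector_derivative D) (at t within S) \<longleftrightarrow> ((\<lambda>s. (f s - f t) /\<^sub>R (s - t)) \<longlongrightarrow> D) (at t within S)"
proof -
  have "norm ((1 / norm (s - t)) *\<^sub>R (f s - (f t + (s - t) *\<^sub>R D))) = norm ((f s - f t) /\<^sub>R (s - t) - D)"
    if "s \<noteq> t" for s
  proof -
    have "(f s - f t) /\<^sub>R (s - t) - D = (1 / (s - t)) *\<^sub>R (f s - (f t + (s - t) *\<^sub>R D))"
      using that by (simp add: divide_inverse scaleR_diff_right scaleR_add_right)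
    then show ?thesis by simp
  qed
  then have ev: "\<forall>\<^sub>F s in at t within S. norm ((1 / norm (s - t)) *\<^sub>R (f s - (f t + (s - t) *\<^sub>R D))) = norm ((f s - f t) /\<^sub>R (s - t) - D)"
    by (simp add: eventually_at_filter)
  have "(f has_vector_derivative D) (at t within S) \<longleftrightarrow>
      ((\<lambda>s. norm ((1 / norm (s - t)) *\<^sub>R (f s - (f t + (s - t) *\<^sub>R D)))) \<longlongrightarrow> 0) (at t within S)"
    unfolding has_vector_derivative_def has_derivative_within tendsto_norm_zero_iff
    by (simp add: bounded_linear_scaleR_left)
  also have "\<dots> \<longleftrightarrow> ((\<lambda>s. norm ((f s - f t) /\<^sub>R (s - t) - D)) \<longlongrightarrow> 0) (at t within S)"
    using ev by (rule tendsto_cong)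
  also have "\<dots> \<longleftrightarrow> ((\<lambda>s. (f s - f t) /\<^sub>R (s - t)) \<longlongrightarrow> D) (at t within S)"
    by (simp add: tendsto_norm_zero_iff LIM_zero_iff)
  finally show ?thesis .
qed

lemma sym_form_cong:
  assumes "sym_form V B" "\<And>x y. x \<in> V \<Longrightarrow> y \<in> V \<Longrightarrow> B' x y = B x y"
  shows "sym_form V B'"
  unfolding sym_form_def
  using sym_formD[OF assms(1)] assms(2) subspace_add[OF sym_formD(1)[OF assms(1)]] subspace_scale[OF sym_formD(1)[OF assms(1)]]
  by auto

lemma sym_form_scale:
  assumes "sym_form V B"
  shows "sym_form V (\<lambda>x y. c * B x y)"
  unfolding sym_form_def
proof (intro conjI ballI allI)
  fix x y assume "x \<in> V" "y \<in> V"
  then show "c * B x y = c * B y x" using sym_formD(2)[OF assms, of x y] by simp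
qed (simp_all add: sym_formD(1,3,5)[OF assms] distrib_left)

context compatible_symplectic
begin

lemma lag_tendsto_mono: "lag_tendsto K Y0 F \<Longrightarrow> G \<le> F \<Longrightarrow> lag_tendsto K Y0 G"
  unfolding lag_tendsto_def by (meson filter_leD tendsto_mono)

text \<open>If \<open>Y\<close> is the graph of \<open>\<alpha>\<close> from \<open>L\<close> to
  \<open>M\<close>, then \<open>proj_along Y M l'\<close> is \<open>l' + \<alpha> l'\<close> for
  \<open>l'\<close> in \<open>L\<close>, and the isotropy of \<open>L\<close> leaves
  \<open>Om l (\<alpha> l')\<close>, the form that appears in the definition of the crossing
  form.\<close>

definition chart_form :: "'w set \<Rightarrow> 'w set \<Rightarrow> 'w \<Rightarrow> 'w \<Rightarrow> real" where
  "chart_form M Y l l' = Om l (proj_along Y M l')"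

text \<open>The projection onto \<open>Y\<close> along \<open>M\<close> maps \<open>L\<close>
  bijectively to \<open>Y\<close>, with the projection onto \<open>L\<close> as inverse, and carries
  one form to the other. The gain is a form on a fixed space, so that limits in \<open>Y\<close>
  make sense.\<close>

lemma kap_chart:
  assumes L: "lag L" and M: "lag M" "L \<inter> M = {0}" and Y: "lag Y" "Y \<inter> M = {0}"
  shows "kap L M Y = sig L (chart_form M Y)" "sym_form L (chart_form M Y)"
    "form_rad L (chart_form M Y) = L \<inter> Y"
proof -
  note pL = proj_along[OF L M] and pY = proj_along[OF Y(1) M(1) Y(2)]
  let ?T = "proj_along Y M"
  have sL: "subspace L" and sM: "subspace M" using L M lagD(1) by auto
  have pT: "proj_along L M (?T l) = l" if "l \<in> L" for l
    using that pY(2)[of l] subspace_neg[OF sM, of "l - ?T l"] by (intro pL(3)) auto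
  have Tp: "?T (proj_along L M y) = y" if "y \<in> Y" for y
    using that pL(2)[of y] subspace_neg[OF sM, of "y - proj_along L M y"] by (intro pY(3)) auto
  have inj: "inj_on ?T L" using pT by (metis inj_onI)
  have im: "?T ` L = Y" using Tp pL(1) pY(1) by (metis image_subset_iff imageI subsetI subset_antisym)
  have eq: "Om (proj_along L M (?T l)) (?T l') = chart_form M Y l l'" if "l \<in> L" for l l'
    using pT[OF that] by (simp add: chart_form_def)
  show "kap L M Y = sig L (chart_form M Y)"
    unfolding kap_def using proj_along_linear[OF Y(1) M(1) Y(2)] inj im sL eq by (intro sig_congruent[of ?T]) auto
  show sf: "sym_form L (chart_form M Y)"
    unfolding sym_form_def
  proof (intro conjI ballI allI sL)
    fix x y assume "x \<in> L" "y \<in> L"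
    then show "chart_form M Y x y = chart_form M Y y x"
      using eq[of x y] eq[of y x] kap_form_symmetric[OF L M lagD(2)[OF Y(1) pY(1)[of x] pY(1)[of y]]] by simp
  qed (simp_all add: chart_form_def)
  show "form_rad L (chart_form M Y) = L \<inter> Y"
  proof
    show "form_rad L (chart_form M Y) \<subseteq> L \<inter> Y"
    proof
      fix x assume x: "x \<in> form_rad L (chart_form M Y)"
      have "Om y x = 0" if y: "y \<in> Y" for y
      proof -
        have "Om x (?T (proj_along L M y)) = 0" using x pL(1) by (auto simp: form_rad_def chart_form_def)
        then show ?thesis using Tp[OF y] Om_skew[of y x] by simp
      qed
      then show "x \<in> L \<inter> Y" using x lagD(3)[OF Y(1)] by (auto simp: form_rad_def)
    qed
    show "L \<inter> Y \<subseteq> form_rad L (chart_form M Y)"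
      using lagD(2)[OF Y(1) _ pY(1)] by (auto simp: form_rad_def chart_form_def)
  qed
qed

lemma chart_form_tendsto:
  assumes "lag_tendsto K Y0 F" "lag M" "Y0 \<inter> M = {0}"
  shows "((\<lambda>q. chart_form M (K q) x y) \<longlongrightarrow> chart_form M Y0 x y) F"
  unfolding chart_form_def by (intro Om_tendsto tendsto_const lag_tendsto_proj[OF assms])

text \<open>The radical of the chart form is \<open>L \<inter> K q\<close>, so constant intersection
  dimension rules out a change of signature.\<close>

lemma kap_eventually_const:
  assumes L: "lag L" and M: "lag M" "L \<inter> M = {0}"
    and Y: "lag_tendsto K Y0 F" "Y0 \<inter> M = {0}"
    and dim: "\<forall>\<^sub>F q in F. dim (L \<inter> K q) = dim (L \<inter> Y0)"
  shows "\<forall>\<^sub>F q in F. kap L M (K q) = kap L M Y0"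
proof -
  have lag0: "lag Y0" and lagK: "\<forall>\<^sub>F q in F. lag (K q)" using Y(1) by (auto simp: lag_tendsto_def)
  note tr = lag_tendsto_transversal[OF Y(1) M(1) Y(2)]
  have "\<forall>\<^sub>F q in F. sig L (chart_form M (K q)) = sig L (chart_form M Y0)"
  proof (rule sig_eventually_const[OF kap_chart(2)[OF L M lag0 Y(2)] _ chart_form_tendsto[OF Y(1) M(1) Y(2)]])
    show "\<forall>\<^sub>F q in F. sym_form L (chart_form M (K q))"
      using lagK tr by eventually_elim (rule kap_chart(2)[OF L M])
    show "\<forall>\<^sub>F q in F. dim (form_rad L (chart_form M Y0)) \<le> dim (form_rad L (chart_form M (K q)))"
      using lagK tr dim by eventually_elim (simp add: kap_chart(3)[OF L M] lag0 Y(2))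
  qed
  then show ?thesis using lagK tr
    by eventually_elim (simp add: kap_chart(1)[OF L M] lag0 Y(2))
qed

lemma maslov_zero:
  assumes L: "lag L" and K: "lag_family {a..b} K" "a \<le> b" and dim: "\<And>t. t \<in> {a..b} \<Longrightarrow> dim (L \<inter> K t) = k"
  shows "maslov L a b K = 0"
proof -
  have "maslov_primitive L {a..b} K (\<lambda>_. 0)"
    unfolding maslov_primitive_def
  proof (intro ballI allI impI)
    fix p M assume p: "p \<in> {a..b}" and M: "lag M \<and> L \<inter> M = {0} \<and> K p \<inter> M = {0}"
    have "\<forall>\<^sub>F q in at p within {a..b}. dim (L \<inter> K q) = dim (L \<inter> K p)"
      using dim p by (simp add: eventually_at_filter)
    then have "\<forall>\<^sub>F q in at p within {a..b}. kap L M (K q) = kap L M (K p)"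
      using M by (intro kap_eventually_const[OF L _ _ lag_family_tendsto[OF K(1) p]]) auto
    then show "\<forall>\<^sub>F q in at p within {a..b}. 0 - kap L M (K q) = 0 - kap L M (K p)"
      by eventually_elim simp
  qed
  then show ?thesis using maslov_eq[OF L K] by simp
qed

text \<open>Rescaling \<open>L \<inter> Y0\<close> by \<open>(\<sigma> q)\<^sup>-\<^sup>1\<^sup>/\<^sup>2\<close> turns the chart forms into a family converging to a
  nondegenerate form, the orthogonal sum of the limit chart form on a complement of \<open>L \<inter> Y0\<close> and
  of \<open>G\<close>.\<close>

lemma kap_jump:
  assumes L: "lag L" and M: "lag M" "L \<inter> M = {0}"
    and Y: "lag_tendsto K Y0 F" "Y0 \<inter> M = {0}"
    and \<sigma>: "(\<sigma> \<longlongrightarrow> 0) F" "\<forall>\<^sub>F q in F. \<sigma> q > 0"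
    and lim: "\<And>v l. v \<in> L \<inter> Y0 \<Longrightarrow> l \<in> L \<Longrightarrow> ((\<lambda>q. chart_form M (K q) v l / \<sigma> q) \<longlongrightarrow> G v l) F"
    and G: "sym_form (L \<inter> Y0) G" "nondegenerate_on (L \<inter> Y0) G"
  shows "\<forall>\<^sub>F q in F. kap L M (K q) = kap L M Y0 + sig (L \<inter> Y0) G \<and> L \<inter> K q = {0}"
proof -
  have lag0: "lag Y0" and lagK: "\<forall>\<^sub>F q in F. lag (K q)" using Y(1) by (auto simp: lag_tendsto_def)
  note tr = lag_tendsto_transversal[OF Y(1) M(1) Y(2)]
  define K0 where "K0 = L \<inter> Y0"
  have sL: "subspace L" and sK0: "subspace K0"
    unfolding K0_def using L lag0 lagD(1) by (auto intro: subspace_inter)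
  define P where "P = closest_point K0"
  define B0 where "B0 = chart_form M Y0"
  have B0: "sym_form L B0" unfolding B0_def by (rule kap_chart(2)[OF L M lag0 Y(2)])
  have radB0: "form_rad L B0 = K0" unfolding B0_def K0_def by (rule kap_chart(3)[OF L M lag0 Y(2)])
  have B0K: "B0 k l = 0" "B0 l k = 0" if "k \<in> K0" "l \<in> L" for k l
    using radB0 that sym_formD(2)[OF B0, of l k] by (auto simp: form_rad_def)
  have lP: "linear P" unfolding P_def by (rule linear_closest_point[OF sK0])
  have PK: "P x \<in> K0" and PL: "P x \<in> L" for x
    using subspace_closest_point(1)[OF sK0] by (auto simp: P_def K0_def)
  have Pk: "P x = x" if "x \<in> K0" for x unfolding P_def by (rule closest_point_in_subspace[OF sK0 that])
  have PP: "P (P x) = P x" for x by (rule Pk[OF PK])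
  note P_simps = linear_add[OF lP] linear_diff[OF lP] linear_cmul[OF lP] linear_0[OF lP] PP
  have dL: "x - P x \<in> L" if "x \<in> L" for x using that PL subspace_diff[OF sL] by auto
  \<comment> \<open>\<open>S c\<close> scales the \<open>K0\<close>-component by \<open>c\<close>
    and keeps the component orthogonal to \<open>K0\<close>. For nonzero \<open>c\<close> it is a
    congruence of \<open>L\<close>, so it preserves the signature and the triviality of the
    radical.\<close>
  define S where "S c x = (x - P x) + c *\<^sub>R P x" for c :: real and x
  have lS: "linear (S c)" for c
    unfolding S_def by (intro linearI) (simp_all add: P_simps algebra_simps)
  have SL: "S c x \<in> L" if "x \<in> L" for c x
    unfolding S_def using dL[OF that] PL subspace_add[OF sL] subspace_scale[OF sL] by blast
  have SS: "S c (S (1 / c) x) = x" if "c \<noteq> 0" for c x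
    using that by (simp add: S_def P_simps)
  have SL_im: "S c ` L = L" if "c \<noteq> 0" for c
  proof
    show "L \<subseteq> S c ` L" using SS[OF that] SL by (metis imageI subsetI)
  qed (use SL in auto)
  have inj: "inj_on (S c) L" if "c \<noteq> 0" for c
  proof (rule inj_onI)
    fix x y assume "S c x = S c y"
    then have "S (1 / c) (S c x) = S (1 / c) (S c y)" by simp
    then show "x = y" using SS[of "1 / c"] that by simp
  qed
  define B where "B q = chart_form M (K q)" for q
  have evB: "\<forall>\<^sub>F q in F. sym_form L (B q)"
    unfolding B_def using lagK tr by eventually_elim (rule kap_chart(2)[OF L M])
  define B' where "B' q x y = B q (S (1 / sqrt (\<sigma> q)) x) (S (1 / sqrt (\<sigma> q)) y)" for q x y
  define C where "C x y = B0 (x - P x) (y - P y) + G (P x) (P y)" for x y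
  have GK: "G 0 y = 0" "G y 0 = 0" if "y \<in> K0" for y
    using sym_formD(7,8)[OF G(1)] that by (auto simp: K0_def)
  have G': "sym_form K0 G" using G(1) by (simp add: K0_def)
  have CL: "sym_form L C"
    unfolding sym_form_def
  proof (intro conjI ballI allI sL)
    fix x y assume "x \<in> L" "y \<in> L"
    then show "C x y = C y x"
      using sym_formD(2)[OF B0 dL dL] sym_formD(2)[OF G' PK PK] by (simp add: C_def)
  next
    fix x y z assume xyz: "x \<in> L" "y \<in> L" "z \<in> L"
    have "B0 (x + y - P (x + y)) (z - P z) = B0 ((x - P x) + (y - P y)) (z - P z)" by (simp add: P_simps algebra_simps)
    then show "C (x + y) z = C x z + C y z"
      using sym_formD(3)[OF B0 dL dL dL] sym_formD(3)[OF G' PK PK PK] xyz by (simp add: C_def P_simps)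
  next
    fix c x y assume xy: "x \<in> L" "y \<in> L"
    have "B0 (c *\<^sub>R x - P (c *\<^sub>R x)) (y - P y) = B0 (c *\<^sub>R (x - P x)) (y - P y)" by (simp add: P_simps algebra_simps)
    then show "C (c *\<^sub>R x) y = c * C x y"
      using sym_formD(5)[OF B0 dL dL] sym_formD(5)[OF G' PK PK] xy by (simp add: C_def P_simps algebra_simps)
  qed
  have evB': "\<forall>\<^sub>F q in F. sym_form L (B' q)"
    using evB
  proof eventually_elim
    case (elim q)
    note D = sym_formD[OF elim]
    show ?case
      unfolding sym_form_def
    proof (intro conjI ballI allI sL)
      fix x y assume "x \<in> L" "y \<in> L"
      then show "B' q x y = B' q y x" using D(2)[OF SL SL] by (simp add: B'_def)
    qed (simp_all add: B'_def linear_add[OF lS] linear_cmul[OF lS] D(3,5) SL)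
  qed
  have limB: "((\<lambda>q. B q x y) \<longlongrightarrow> B0 x y) F" for x y
    unfolding B_def B0_def by (rule chart_form_tendsto[OF Y(1) M(1) Y(2)])
  have lim': "((\<lambda>q. B' q x y) \<longlongrightarrow> C x y) F" if xy: "x \<in> L" "y \<in> L" for x y
  proof -
    let ?x = "x - P x" and ?y = "y - P y"
    have sq: "((\<lambda>q. sqrt (\<sigma> q)) \<longlongrightarrow> 0) F" using tendsto_real_sqrt[OF \<sigma>(1)] by simp
    \<comment> \<open>Cross terms receive only one factor \<open>1 / sqrt (\<sigma> q)\<close>. As
      \<open>B q k l / \<sigma> q\<close> converges for every \<open>l\<close> in \<open>L\<close>,
      not just for \<open>l\<close> in \<open>K0\<close>, they are of order
      \<open>sqrt (\<sigma> q)\<close> and disappear.\<close>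
    have a: "((\<lambda>q. sqrt (\<sigma> q) * (B q (P y) ?x / \<sigma> q)) \<longlongrightarrow> 0 * G (P y) ?x) F"
      "((\<lambda>q. sqrt (\<sigma> q) * (B q (P x) ?y / \<sigma> q)) \<longlongrightarrow> 0 * G (P x) ?y) F"
      unfolding B_def using PK dL xy by (intro tendsto_mult sq lim; simp add: K0_def)+
    have c: "((\<lambda>q. B q (P x) (P y) / \<sigma> q) \<longlongrightarrow> G (P x) (P y)) F"
      unfolding B_def using PK PL by (intro lim) (auto simp: K0_def)
    have "((\<lambda>q. B q ?x ?y + sqrt (\<sigma> q) * (B q (P y) ?x / \<sigma> q) + sqrt (\<sigma> q) * (B q (P x) ?y / \<sigma> q) + B q (P x) (P y) / \<sigma> q)
        \<longlongrightarrow> B0 ?x ?y + 0 * G (P y) ?x + 0 * G (P x) ?y + G (P x) (P y)) F"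
      by (intro tendsto_add limB a c)
    moreover have "\<forall>\<^sub>F q in F. B q ?x ?y + sqrt (\<sigma> q) * (B q (P y) ?x / \<sigma> q) + sqrt (\<sigma> q) * (B q (P x) ?y / \<sigma> q) + B q (P x) (P y) / \<sigma> q
        = B' q x y"
      using evB \<sigma>(2)
    proof eventually_elim
      case (elim q)
      note D = sym_formD[OF elim(1)]
      have r: "sqrt (\<sigma> q) / \<sigma> q = 1 / sqrt (\<sigma> q)" "1 / sqrt (\<sigma> q) * (1 / sqrt (\<sigma> q)) = 1 / \<sigma> q"
        using elim(2) by (simp_all add: field_simps)
      let ?c = "1 / sqrt (\<sigma> q)"
      have "B' q x y = B q ?x ?y + ?c * B q ?x (P y) + ?c * B q (P x) ?y + (?c * ?c) * B q (P x) (P y)"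
      proof -
        have "B q (a + c *\<^sub>R b) (a' + c *\<^sub>R b') = B q a a' + c * B q a b' + c * B q b a' + (c * c) * B q b b'"
          if "a \<in> L" "b \<in> L" "a' \<in> L" "b' \<in> L" for a b a' b' c
          using that subspace_scale[OF sL] subspace_add[OF sL] by (simp add: D(3-6) algebra_simps)
        then show ?thesis unfolding B'_def S_def using dL[OF xy(1)] dL[OF xy(2)] PL by blast
      qed
      also have "B q ?x (P y) = B q (P y) ?x" by (rule D(2)[OF dL[OF xy(1)] PL])
      finally have B'_eq: "B' q x y = B q ?x ?y + ?c * B q (P y) ?x + ?c * B q (P x) ?y + (?c * ?c) * B q (P x) (P y)" .
      have r1: "sqrt (\<sigma> q) * (z / \<sigma> q) = ?c * z" for z
        using r(1) by (metis times_divide_eq_left times_divide_eq_right)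
      have r2: "z / \<sigma> q = (?c * ?c) * z" for z
        unfolding r(2) by simp
      show ?case unfolding B'_eq r1 by (simp only: r2[of "B q (P x) (P y)"])
    qed
    ultimately have "((\<lambda>q. B' q x y) \<longlongrightarrow> B0 ?x ?y + 0 * G (P y) ?x + 0 * G (P x) ?y + G (P x) (P y)) F"
      by (rule Lim_transform_eventually)
    then show ?thesis by (simp add: C_def)
  qed
  have radC: "form_rad L C = {0}"
  proof -
    have "x = 0" if x: "x \<in> L" and 0: "\<forall>w\<in>L. C x w = 0" for x
    proof -
      have "G (P x) w = 0" if w: "w \<in> K0" for w
      proof -
        have "C x w = B0 (x - P x) 0 + G (P x) w" by (simp add: C_def Pk[OF w])
        then show ?thesis using 0 w sym_formD(8)[OF B0 dL[OF x]] by (auto simp: K0_def)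
      qed
      then have Px: "P x = 0" using G(2) PK[of x] unfolding nondegenerate_on_def K0_def by blast
      have "B0 x w = 0" if w: "w \<in> L" for w
      proof -
        have "C x w = B0 x (w - P w)" using GK(1)[OF PK] by (simp add: C_def Px)
        then have "B0 x (w - P w) = 0" using 0 w by simp
        moreover have "B0 x ((w - P w) + P w) = B0 x (w - P w) + B0 x (P w)"
          by (intro sym_formD(4)[OF B0] dL[OF w] PL x)
        ultimately show ?thesis using B0K(2)[OF PK x] by simp
      qed
      then have "x \<in> K0" using x radB0 by (auto simp: form_rad_def)
      then show ?thesis using Pk Px by simp
    qed
    then show ?thesis using subspace_0[OF subspace_form_rad[OF CL]] by (auto simp: form_rad_def)
  qed
  have ev: "\<forall>\<^sub>F q in F. sig L (B' q) = sig L C \<and> form_rad L (B' q) = {0}"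
    by (rule nondegenerate_eventually[OF CL evB' lim' radC])
  define V1 where "V1 = {x \<in> L. P x = 0}"
  have sV1: "subspace V1" using sL by (auto simp: V1_def subspace_def P_simps)
  have V1K: "V1 \<inter> K0 = {0}" using Pk subspace_0[OF sL] subspace_0[OF sK0] linear_0[OF lP] by (auto simp: V1_def)
  have Lsum: "L = {x + y |x y. x \<in> V1 \<and> y \<in> K0}"
  proof (intro set_eqI iffI)
    fix x assume "x \<in> L"
    then have "x - P x \<in> V1" using dL by (simp add: V1_def P_simps)
    moreover have "x = (x - P x) + P x" by simp
    ultimately show "x \<in> {x + y |x y. x \<in> V1 \<and> y \<in> K0}" using PK by blast
  qed (auto simp: V1_def K0_def intro!: subspace_add[OF sL])
  \<comment> \<open>\<open>C\<close> and \<open>B0\<close> agree on \<open>V1\<close>, while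
    \<open>B0\<close> vanishes on \<open>K0\<close>; splitting both forms isolates the jump
    \<open>sig K0 G\<close>.\<close>
  have "sig L C = sig V1 C + sig K0 C"
  proof (rule sig_sum[OF CL sV1 sK0 V1K Lsum])
    fix x y assume "x \<in> V1" "y \<in> K0"
    then show "C x y = 0" using sym_formD(8)[OF B0] GK by (simp add: C_def Pk V1_def)
  qed
  also have "sig V1 C = sig V1 B0"
    using GK(1)[OF subspace_0[OF sK0]] by (intro sig_cong sV1) (auto simp: C_def V1_def)
  also have "sig K0 C = sig K0 G"
    using sym_formD(7)[OF B0 subspace_0[OF sL]] by (intro sig_cong sK0) (auto simp: C_def Pk)
  finally have sC: "sig L C = sig V1 B0 + sig K0 G" .
  have "sig L B0 = sig V1 B0 + sig K0 B0"
    using B0K by (intro sig_sum[OF B0 sV1 sK0 V1K Lsum]) (auto simp: V1_def)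
  also have "sig K0 B0 = 0" using B0K by (intro sig_zero sK0) (auto simp: K0_def)
  finally have sB0: "sig L C = sig L B0 + sig K0 G" using sC by simp
  show ?thesis using ev lagK tr \<sigma>(2)
  proof eventually_elim
    case (elim q)
    have c: "1 / sqrt (\<sigma> q) \<noteq> 0" using elim(4) by simp
    have "sig L (B q) = sig L (B' q)"
      by (rule sig_congruent[OF lS inj[OF c] SL_im[OF c] sL]) (simp add: B'_def)
    moreover have "kap L M (K q) = sig L (B q)" "kap L M Y0 = sig L B0"
      unfolding B_def B0_def using kap_chart(1)[OF L M] elim lag0 Y(2) by auto
    moreover have "x = 0" if x: "x \<in> L" "x \<in> K q" for x
    proof -
      have xr: "x \<in> form_rad L (B q)" using x kap_chart(3)[OF L M elim(2,3)] by (simp add: B_def)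
      let ?y = "S (1 / (1 / sqrt (\<sigma> q))) x"
      have "?y \<in> form_rad L (B' q)"
        using xr SL[OF x(1)] SL SS[OF c, of x] by (auto simp: form_rad_def B'_def)
      then have "?y = 0" using elim(1) by auto
      then show ?thesis using SS[OF c, of x] linear_0[OF lS] by metis
    qed
    then have "L \<inter> K q = {0}" using subspace_0[OF sL] subspace_0[OF lagD(1)[OF elim(2)]] by auto
    ultimately show ?case using elim(1) sB0 by (simp add: K0_def)
  qed
qed

definition lag_differentiable :: "real set \<Rightarrow> (real \<Rightarrow> 'w set) \<Rightarrow> real \<Rightarrow> bool" where
  "lag_differentiable S K t \<longleftrightarrow> (\<forall>w. \<exists>D. ((\<lambda>t. closest_point (K t) w) has_vector_derivative D) (at t within S))"

text \<open>Implicit differentiation of \<open>comp_op (K s) M (proj_along (K s) M u) = u -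
  closest_point M u\<close>. The right-hand side is constant, so the derivative must solve an
  equation with right-hand side \<open>- E\<close>, and the difference quotients solve equations
  converging to it.\<close>

lemma proj_along_differentiable:
  assumes K: "lag_family S K" "t \<in> S" "lag_differentiable S K t" and M: "lag M" "K t \<inter> M = {0}"
  shows "\<exists>D. ((\<lambda>s. proj_along (K s) M u) has_vector_derivative D) (at t within S)"
proof -
  note ten = lag_family_tendsto[OF K(1,2)]
  have lagt: "lag (K t)" and lag: "\<forall>\<^sub>F s in at t within S. lag (K s)" using ten by (auto simp: lag_tendsto_def)
  have lin: "\<forall>\<^sub>F s in at t within S. linear (comp_op (K s) M)"
    using lag by eventually_elim (rule comp_op_linear[OF _ M(1)])
  have l0: "linear (comp_op (K t) M)" by (rule comp_op_linear[OF lagt M(1)])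
  have inj: "\<And>x. comp_op (K t) M x = 0 \<Longrightarrow> x = 0" using comp_op_inj_iff[OF lagt M(1)] M(2) by simp
  let ?u = "proj_along (K t) M u"
  obtain D where D: "((\<lambda>t. closest_point (K t) ?u) has_vector_derivative D) (at t within S)"
    using K(3) by (auto simp: lag_differentiable_def)
  have blM: "bounded_linear (closest_point M)"
    using linear_closest_point[OF lagD(1)[OF M(1)]] by (simp add: linear_conv_bounded_linear)
  obtain E where E: "((\<lambda>s. comp_op (K s) M ?u) has_vector_derivative E) (at t within S)"
    unfolding comp_op_def
    using has_vector_derivative_add[OF has_vector_derivative_diff[OF D bounded_linear.has_vector_derivative[OF blM D]]
       bounded_linear.has_vector_derivative[OF blM has_vector_derivative_diff[OF has_vector_derivative_const D]]] by blast
  obtain x0 where x0: "comp_op (K t) M x0 = - E"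
    using linear_injective_imp_surjective[OF l0] inj linear_injective_0[OF l0] by (metis surjD)
  have lim: "((\<lambda>s. comp_op (K s) M ((proj_along (K s) M u - ?u) /\<^sub>R (s - t))) \<longlongrightarrow> comp_op (K t) M x0) (at t within S)"
  proof -
    have "((\<lambda>s. - ((comp_op (K s) M ?u - comp_op (K t) M ?u) /\<^sub>R (s - t))) \<longlongrightarrow> - E) (at t within S)"
      using E unfolding has_vector_derivative_quotient by (rule tendsto_minus)
    moreover have "\<forall>\<^sub>F s in at t within S. - ((comp_op (K s) M ?u - comp_op (K t) M ?u) /\<^sub>R (s - t))
        = comp_op (K s) M ((proj_along (K s) M u - ?u) /\<^sub>R (s - t))"
      using lag lin lag_tendsto_transversal[OF ten M]
    proof eventually_elim
      case (elim s)
      have "comp_op (K s) M (proj_along (K s) M u) = comp_op (K t) M ?u"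
        using comp_op_proj[OF elim(1) M(1) elim(3)] comp_op_proj[OF lagt M] by simp
      then show ?case
        by (simp add: linear_cmul[OF elim(2)] linear_diff[OF elim(2)] flip: scaleR_minus_right)
    qed
    ultimately show ?thesis unfolding x0 by (rule Lim_transform_eventually)
  qed
  have "((\<lambda>s. (proj_along (K s) M u - ?u) /\<^sub>R (s - t)) \<longlongrightarrow> x0) (at t within S)"
    by (rule linear_family_solution_tendsto[OF lin l0 inj lag_tendsto_comp_op[OF ten M(1)] lim])
  then show ?thesis unfolding has_vector_derivative_quotient by blast
qed

lemma complementary_lag:
  assumes "lag Y" "lag M" "Y \<inter> M = {0}"
  shows "complementary Y M"
proof -
  have "w \<in> {v + m |v m. v \<in> Y \<and> m \<in> M}" for w
  proof -
    obtain x where x: "x \<in> Y" "w - x \<in> M" using lag_decomp[OF assms] by blast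
    have "w = x + (w - x)" by simp
    then show ?thesis using x by blast
  qed
  then show ?thesis using assms(3) by (auto simp: complementary_def)
qed

lemma Om_has_vector_derivative:
  assumes "(f has_vector_derivative D) F"
  shows "((\<lambda>s. Om v (f s)) has_vector_derivative Om v D) F"
  unfolding Om using linJ
  by (intro bounded_linear.has_vector_derivative[OF bounded_linear_inner_right_comp
        bounded_linear.has_vector_derivative[OF _ assms]]) (auto simp: linear_conv_bounded_linear bounded_linear_ident)

text \<open>Any differentiable curve \<open>f\<close> inside the moving Lagrangian may replace the
  graph map of the chosen complement. The difference of the two curves in \<open>K s\<close> pairs
  to zero with \<open>proj_along (K s) M v\<close>, and in the limit
  \<open>Om v (D - E) = 0\<close>. This removes the \<open>SOME\<close> from
  \<open>velocity_form\<close>.\<close>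

lemma velocity_form_eq:
  assumes ab: "a < b" and t: "t \<in> {a..b}" and K: "lag_family {a..b} K" "lag_differentiable {a..b} K t"
    and v: "v \<in> K t" and f: "\<forall>\<^sub>F s in at t within {a..b}. f s \<in> K s" "f t \<in> K t"
      "(f has_vector_derivative D) (at t within {a..b})"
  shows "velocity_form Om a b K t v (f t) = Om v D"
proof -
  let ?F = "at t within {a..b}"
  have F: "?F \<noteq> bot" using ab t by (simp add: trivial_limit_within islimpt_Icc)
  note ten = lag_family_tendsto[OF K(1) t]
  have lagt: "lag (K t)" and lag: "\<forall>\<^sub>F s in ?F. lag (K s)" using ten by (auto simp: lag_tendsto_def)
  define M where "M = (SOME M. lag M \<and> complementary (K t) M)"
  have "\<exists>M. lag M \<and> complementary (K t) M"
    using common_complement[OF lagt lagt] complementary_lag[OF lagt] by metis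
  then have "lag M \<and> complementary (K t) M" unfolding M_def by (rule someI_ex)
  then have M: "lag M" "K t \<inter> M = {0}" by (auto simp: complementary_def)
  note tr = lag_tendsto_transversal[OF ten M]
  let ?v' = "f t"
  obtain E where E: "((\<lambda>s. proj_along (K s) M ?v') has_vector_derivative E) ?F"
    using proj_along_differentiable[OF K(1) t K(2) M] by blast
  have pt: "proj_along (K t) M x = x" if "x \<in> K t" for x
    using that subspace_0[OF lagD(1)[OF M(1)]] by (intro proj_along(3)[OF lagt M]) auto
  have gm: "graph_map M (K s) x = proj_along (K s) M x - x" if "lag (K s)" "K s \<inter> M = {0}" for s x
    unfolding graph_map_def
  proof (rule the_equality)
    note p = proj_along[OF that(1) M(1) that(2)]
    show "proj_along (K s) M x - x \<in> M \<and> x + (proj_along (K s) M x - x) \<in> K s"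
      using p(1,2)[of x] subspace_neg[OF lagD(1)[OF M(1)] p(2)[of x]] by simp
    fix m assume m: "m \<in> M \<and> x + m \<in> K s"
    then have "proj_along (K s) M x = x + m"
      using subspace_neg[OF lagD(1)[OF M(1)], of m] by (intro p(3)) auto
    then show "m = proj_along (K s) M x - x" by simp
  qed
  have "((\<lambda>s. Om v (graph_map M (K s) ?v')) has_vector_derivative Om v E) ?F"
    unfolding has_vector_derivative_quotient
  proof (rule Lim_transform_eventually)
    have "((\<lambda>s. Om v (proj_along (K s) M ?v')) has_vector_derivative Om v E) ?F"
      by (rule Om_has_vector_derivative[OF E])
    then show "((\<lambda>s. (Om v (proj_along (K s) M ?v') - Om v (proj_along (K t) M ?v')) /\<^sub>R (s - t)) \<longlongrightarrow> Om v E) ?F"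
      unfolding has_vector_derivative_quotient .
    show "\<forall>\<^sub>F s in ?F. (Om v (proj_along (K s) M ?v') - Om v (proj_along (K t) M ?v')) /\<^sub>R (s - t)
      = (Om v (graph_map M (K s) ?v') - Om v (graph_map M (K t) ?v')) /\<^sub>R (s - t)"
      using lag tr by eventually_elim (simp add: gm lagt M)
  qed
  then have "vector_derivative (\<lambda>s. Om v (graph_map M (K s) ?v')) ?F = Om v E"
    using ab t by (intro vector_derivative_within_closed_interval) auto
  then have vel: "velocity_form Om a b K t v ?v' = Om v E"
    unfolding velocity_form_def Let_def M_def .
  have "((\<lambda>s. Om (proj_along (K s) M v) (((f s - proj_along (K s) M ?v') - (f t - proj_along (K t) M ?v')) /\<^sub>R (s - t)))
      \<longlongrightarrow> Om (proj_along (K t) M v) (D - E)) ?F"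
    using has_vector_derivative_diff[OF f(3) E] unfolding has_vector_derivative_quotient
    by (intro Om_tendsto lag_tendsto_proj[OF ten M])
  moreover have "\<forall>\<^sub>F s in ?F. Om (proj_along (K s) M v) (((f s - proj_along (K s) M ?v') - (f t - proj_along (K t) M ?v')) /\<^sub>R (s - t)) = 0"
    using lag tr f(1)
  proof eventually_elim
    case (elim s)
    note p = proj_along(1)[OF elim(1) M(1) elim(2)]
    have "f s - proj_along (K s) M ?v' \<in> K s" using elim(3) p subspace_diff[OF lagD(1)[OF elim(1)]] by auto
    then have 0: "Om (proj_along (K s) M v) (f s - proj_along (K s) M ?v') = 0" using lagD(2)[OF elim(1) p] by blast
    have e: "(f s - proj_along (K s) M ?v') - (f t - proj_along (K t) M ?v') = f s - proj_along (K s) M ?v'"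
      by (simp add: pt[OF f(2)])
    show ?case using 0 by (simp only: e Om_simps(6) mult_zero_right)
  qed
  ultimately have "((\<lambda>s. 0) \<longlongrightarrow> Om (proj_along (K t) M v) (D - E)) ?F" by (rule Lim_transform_eventually)
  then have "Om v (D - E) = 0" using tendsto_unique[OF F _ tendsto_const] pt[OF v] by metis
  then show ?thesis using vel by simp
qed

text \<open>The velocity form is the limit of \<open>chart_form M (K s)\<close> divided by
  \<open>s - t\<close>, so \<open>kap_jump\<close> applies with \<open>\<sigma>\<close> the distance
  to \<open>t\<close>. On the left, dividing by the distance reverses the sign of the limit.\<close>

lemma regular_crossing_jump:
  assumes L: "lag L" and ab: "a < b" and t: "t \<in> {a..b}" and K: "lag_family {a..b} K" "lag_differentiable {a..b} K t"
    and reg: "nondegenerate_on (K t \<inter> L) (velocity_form Om a b K t)"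
    and M: "lag M" "L \<inter> M = {0}" "K t \<inter> M = {0}"
  shows "sym_form (K t \<inter> L) (velocity_form Om a b K t)"
    "\<forall>\<^sub>F s in at t within {t..b}. kap L M (K s) = kap L M (K t) + sig (K t \<inter> L) (velocity_form Om a b K t) \<and> L \<inter> K s = {0}"
    "\<forall>\<^sub>F s in at t within {a..t}. kap L M (K s) = kap L M (K t) - sig (K t \<inter> L) (velocity_form Om a b K t) \<and> L \<inter> K s = {0}"
proof -
  let ?F = "at t within {a..b}"
  let ?V = "velocity_form Om a b K t"
  have F: "?F \<noteq> bot" using ab t by (simp add: trivial_limit_within islimpt_Icc)
  note ten = lag_family_tendsto[OF K(1) t]
  have lagt: "lag (K t)" and lag: "\<forall>\<^sub>F s in ?F. lag (K s)" using ten by (auto simp: lag_tendsto_def)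
  note tr = lag_tendsto_transversal[OF ten M(1,3)]
  obtain D where D: "\<And>u. ((\<lambda>s. proj_along (K s) M u) has_vector_derivative D u) ?F"
    using proj_along_differentiable[OF K(1) t K(2) M(1,3)] by metis
  define G where "G v l = Om v (D l)" for v l
  have pt: "proj_along (K t) M x = x" if "x \<in> K t" for x
    using that subspace_0[OF lagD(1)[OF M(1)]] by (intro proj_along(3)[OF lagt M(1,3)]) auto
  have GV: "G v w = ?V v w" if "v \<in> K t \<inter> L" "w \<in> K t \<inter> L" for v w
  proof -
    have "\<forall>\<^sub>F s in ?F. proj_along (K s) M w \<in> K s"
      using lag tr by eventually_elim (rule proj_along(1)[OF _ M(1)])
    from velocity_form_eq[OF ab t K _ this _ D] show ?thesis using that pt by (simp add: G_def)
  qed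
  have lim: "((\<lambda>s. chart_form M (K s) v l / (s - t)) \<longlongrightarrow> G v l) ?F" if v: "v \<in> L \<inter> K t" for v l
  proof -
    have "((\<lambda>s. (Om v (proj_along (K s) M l) - Om v (proj_along (K t) M l)) /\<^sub>R (s - t)) \<longlongrightarrow> Om v (D l)) ?F"
      using Om_has_vector_derivative[OF D, of v l] unfolding has_vector_derivative_quotient .
    moreover have "Om v (proj_along (K t) M l) = 0"
      using v lagD(2)[OF lagt] proj_along(1)[OF lagt M(1,3)] by blast
    ultimately show ?thesis by (simp add: G_def chart_form_def divide_inverse mult.commute)
  qed
  have sG: "sym_form (L \<inter> K t) G"
  proof (rule sym_form_tendsto[OF F _ lim])
    show "\<forall>\<^sub>F s in ?F. sym_form (L \<inter> K t) (\<lambda>v l. chart_form M (K s) v l / (s - t))"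
      using lag tr
    proof eventually_elim
      case (elim s)
      have "sym_form (L \<inter> K t) (chart_form M (K s))"
        by (rule sym_form_subset[OF kap_chart(2)[OF L M(1,2) elim]])
          (use subspace_inter[OF lagD(1)[OF L] lagD(1)[OF lagt]] in auto)
      then show ?case unfolding sym_form_def by (auto simp: add_divide_distrib)
    qed
  qed auto
  have "sym_form (L \<inter> K t) ?V"
    using GV by (intro sym_form_cong[OF sG]) (auto simp del: Om_simps)
  then show sV: "sym_form (K t \<inter> L) ?V" by (simp add: Int_commute)
  have "sig (L \<inter> K t) ?V = sig (L \<inter> K t) G"
    using GV by (intro sig_cong sym_formD(1)[OF sG]) auto
  then have sig: "sig (L \<inter> K t) G = sig (K t \<inter> L) ?V" by (simp add: Int_commute)
  have nd: "nondegenerate_on (L \<inter> K t) G"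
    using reg GV by (simp add: nondegenerate_on_def Int_commute)
  {
    \<comment> \<open>\<open>\<epsilon>\<close> is 1 to the right and -1 to the left of
      \<open>t\<close>, so that \<open>\<epsilon> * (s - t)\<close> is the distance in both
      cases.\<close>
    fix T :: "real set" and \<epsilon> :: real
    assume T: "T \<subseteq> {a..b}" and \<epsilon>: "\<epsilon> = 1 \<or> \<epsilon> = -1" and pos: "\<forall>\<^sub>F s in at t within T. \<epsilon> * (s - t) > 0"
    have le: "at t within T \<le> ?F" using T by (rule at_le)
    have ten': "lag_tendsto K (K t) (at t within T)"
      by (rule lag_tendsto_mono[OF ten le])
    have sG': "sym_form (L \<inter> K t) (\<lambda>v l. \<epsilon> * G v l)"
      using sG by (rule sym_form_scale)
    have "\<forall>\<^sub>F s in at t within T. kap L M (K s) = kap L M (K t) + sig (L \<inter> K t) (\<lambda>v l. \<epsilon> * G v l) \<and> L \<inter> K s = {0}"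
    proof (rule kap_jump[OF L M(1,2) ten' M(3) _ pos _ sG'])
      show "((\<lambda>s. \<epsilon> * (s - t)) \<longlongrightarrow> 0) (at t within T)"
        by (rule tendsto_eq_intros | simp)+
      show "nondegenerate_on (L \<inter> K t) (\<lambda>v l. \<epsilon> * G v l)"
        using nd \<epsilon> by (auto simp: nondegenerate_on_def)
      show "((\<lambda>s. chart_form M (K s) v l / (\<epsilon> * (s - t))) \<longlongrightarrow> \<epsilon> * G v l) (at t within T)" if "v \<in> L \<inter> K t" for v l
      proof -
        have "((\<lambda>s. \<epsilon> * (chart_form M (K s) v l / (s - t))) \<longlongrightarrow> \<epsilon> * G v l) (at t within T)"
          using tendsto_mono[OF le lim[OF that]] by (intro tendsto_mult_left)
        moreover have "(\<lambda>s. \<epsilon> * (chart_form M (K s) v l / (s - t))) = (\<lambda>s. chart_form M (K s) v l / (\<epsilon> * (s - t)))"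
          using \<epsilon> by (auto simp: minus_divide_right)
        ultimately show ?thesis by simp
      qed
    qed
  } note jump = this
  have "\<forall>\<^sub>F s in at t within {t..b}. kap L M (K s) = kap L M (K t) + sig (L \<inter> K t) (\<lambda>v l. 1 * G v l) \<and> L \<inter> K s = {0}"
    using t by (intro jump) (auto simp: eventually_at_filter)
  then show "\<forall>\<^sub>F s in at t within {t..b}. kap L M (K s) = kap L M (K t) + sig (K t \<inter> L) ?V \<and> L \<inter> K s = {0}"
    using sig by simp
  have "\<forall>\<^sub>F s in at t within {a..t}. kap L M (K s) = kap L M (K t) + sig (L \<inter> K t) (\<lambda>v l. (-1) * G v l) \<and> L \<inter> K s = {0}"
    using t by (intro jump) (auto simp: eventually_at_filter)
  then show "\<forall>\<^sub>F s in at t within {a..t}. kap L M (K s) = kap L M (K t) - sig (K t \<inter> L) ?V \<and> L \<inter> K s = {0}"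
    using sig sig_uminus[of "L \<inter> K t" G] by simp
qed

text \<open>Reaching a crossing from the left and leaving it to the right each change a primitive by
  the crossing signature. Its increment thus counts interior crossings twice and end points once,
  which is twice the weighting of \<open>regular_rs_index\<close>.\<close>

lemma maslov_eq_regular_rs_index:
  assumes L: "lag L" and ab: "a < b" and K: "lag_family {a..b} K" "\<And>t. t \<in> {a..b} \<Longrightarrow> lag_differentiable {a..b} K t"
    and reg: "regular_crossings Om L a b K"
  shows "regular_rs_index Om L a b K = of_int (maslov L a b K) / 2"
proof -
  let ?s = "crossing_signature Om L a b K" and ?c = "crossing L K"
  obtain g where g: "maslov_primitive L {a..b} K g"
    using maslov_primitive_interval[OF L K(1)] ab by auto
  \<comment> \<open>Where there is no crossing, the space is \<open>{0}\<close> and nondegeneracy is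
    trivial, so all times can be treated alike.\<close>
  have nd: "nondegenerate_on (K t \<inter> L) (velocity_form Om a b K t)" if t: "t \<in> {a..b}" for t
    using reg t by (cases "?c t") (auto simp: regular_crossings_def crossing_def nondegenerate_on_def)
  have loc: "\<exists>d>0. \<forall>s\<in>{a..b}. (t < s \<and> s < t + d \<longrightarrow> g s = g t + ?s t \<and> \<not> ?c s) \<and> (t - d < s \<and> s < t \<longrightarrow> g s = g t - ?s t \<and> \<not> ?c s)"
    if t: "t \<in> {a..b}" for t
  proof -
    have "lag (K t)" using K(1) t by (auto simp: lag_family_def)
    then obtain M where M: "lag M" "L \<inter> M = {0}" "K t \<inter> M = {0}" using common_complement[OF L] by blast
    note j = regular_crossing_jump[OF L ab t K(1) K(2)[OF t] nd[OF t] M]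
    have s: "?s t = sig (K t \<inter> L) (velocity_form Om a b K t)"
      unfolding crossing_signature_def by (rule sig_eq_form_signature[OF j(1)])
    have gt: "\<forall>\<^sub>F q in at t within {a..b}. g q - kap L M (K q) = g t - kap L M (K t)"
      using g t M unfolding maslov_primitive_def by blast
    have "\<forall>\<^sub>F q in at t within {t..b}. g q - kap L M (K q) = g t - kap L M (K t)"
      using t by (intro filter_leD[OF at_le gt]) auto
    with j(2) have "\<forall>\<^sub>F q in at t within {t..b}. g q = g t + ?s t \<and> \<not> ?c q"
      by eventually_elim (simp add: s crossing_def Int_commute)
    then obtain d1 where d1: "d1 > 0" "\<And>q. q \<in> {t..b} \<Longrightarrow> q \<noteq> t \<Longrightarrow> dist q t < d1 \<Longrightarrow> g q = g t + ?s t \<and> \<not> ?c q"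
      unfolding eventually_at by blast
    have "\<forall>\<^sub>F q in at t within {a..t}. g q - kap L M (K q) = g t - kap L M (K t)"
      using t by (intro filter_leD[OF at_le gt]) auto
    with j(3) have "\<forall>\<^sub>F q in at t within {a..t}. g q = g t - ?s t \<and> \<not> ?c q"
      by eventually_elim (simp add: s crossing_def Int_commute)
    then obtain d2 where d2: "d2 > 0" "\<And>q. q \<in> {a..t} \<Longrightarrow> q \<noteq> t \<Longrightarrow> dist q t < d2 \<Longrightarrow> g q = g t - ?s t \<and> \<not> ?c q"
      unfolding eventually_at by blast
    show ?thesis
    proof (rule exI[of _ "min d1 d2"], intro conjI ballI)
      show "min d1 d2 > 0" using d1(1) d2(1) by simp
      fix s assume s: "s \<in> {a..b}"
      show "t < s \<and> s < t + min d1 d2 \<longrightarrow> g s = g t + ?s t \<and> \<not> ?c s"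
      proof
        assume h: "t < s \<and> s < t + min d1 d2"
        then have "s - t < d1" by linarith
        then show "g s = g t + ?s t \<and> \<not> ?c s" using d1(2)[of s] s h by (simp add: dist_real_def)
      qed
      show "t - min d1 d2 < s \<and> s < t \<longrightarrow> g s = g t - ?s t \<and> \<not> ?c s"
      proof
        assume h: "t - min d1 d2 < s \<and> s < t"
        then have "t - s < d2" by linarith
        then show "g s = g t - ?s t \<and> \<not> ?c s" using d2(2)[of s] s h by (simp add: dist_real_def)
      qed
    qed
  qed
  have s0: "?s t = 0" if "\<not> ?c t" for t
  proof -
    have "K t \<inter> L = {0}" using that by (simp add: crossing_def)
    then have "form_eigenspace (K t \<inter> L) B c \<subseteq> {0}" for B c by (auto simp: form_eigenspace_def)
    then have d0: "dim (form_eigenspace (K t \<inter> L) B c) = 0" for B c using dim_eq_0 by blast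
    show ?thesis
      unfolding crossing_signature_def form_signature_def d0 by simp
  qed
  \<comment> \<open>The guard \<open>x < y\<close> is essential: for \<open>x = y\<close> the
    formula would claim that twice the signature at \<open>x\<close> is zero. Finiteness of the
    crossings is proved in the same induction.\<close>
  define P where "P x y \<longleftrightarrow> a \<le> x \<and> y \<le> b \<and> x < y \<longrightarrow> finite {t. x < t \<and> t < y \<and> ?c t} \<and>
      g y - g x = ?s x + 2 * (\<Sum>t | x < t \<and> t < y \<and> ?c t. ?s t) + ?s y" for x y
  have "P a b"
    using less_imp_le[OF ab]
  proof (induction rule: Bolzano)
    case (trans x y z)
    show ?case
    proof (cases "x = y \<or> y = z")
      case True then show ?thesis using trans by auto
    next
      case False
      show ?thesis
        unfolding P_def
      proof (intro impI)
        assume xz: "a \<le> x \<and> z \<le> b \<and> x < z"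
        let ?A = "{t. x < t \<and> t < y \<and> ?c t}" and ?B = "{t. y < t \<and> t < z \<and> ?c t}" and ?C = "{t. t = y \<and> ?c t}"
        have A: "finite ?A" "g y - g x = ?s x + 2 * (\<Sum>t\<in>?A. ?s t) + ?s y"
          and B: "finite ?B" "g z - g y = ?s y + 2 * (\<Sum>t\<in>?B. ?s t) + ?s z"
          using trans xz False unfolding P_def by auto
        have C: "finite ?C" "(\<Sum>t\<in>?C. ?s t) = ?s y"
          using s0[of y] by (cases "?c y"; auto simp: Collect_conv_if)+
        have split: "{t. x < t \<and> t < z \<and> ?c t} = ?A \<union> (?B \<union> ?C)" using trans False by auto
        have "(\<Sum>t\<in>?A \<union> (?B \<union> ?C). ?s t) = (\<Sum>t\<in>?A. ?s t) + ((\<Sum>t\<in>?B. ?s t) + ?s y)"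
          using A(1) B(1) C by (subst sum.union_disjoint; (subst sum.union_disjoint)?) auto
        then show "finite {t. x < t \<and> t < z \<and> ?c t} \<and> g z - g x = ?s x + 2 * (\<Sum>t | x < t \<and> t < z \<and> ?c t. ?s t) + ?s z"
          unfolding split using A B C by simp
      qed
    qed
  next
    case (local x)
    then obtain d where d: "d > 0"
      "\<And>s. s \<in> {a..b} \<Longrightarrow> x < s \<Longrightarrow> s < x + d \<Longrightarrow> g s = g x + ?s x \<and> \<not> ?c s"
      "\<And>s. s \<in> {a..b} \<Longrightarrow> x - d < s \<Longrightarrow> s < x \<Longrightarrow> g s = g x - ?s x \<and> \<not> ?c s"
      using loc[of x] by auto
    show ?case
    proof (rule exI[of _ d], intro conjI d(1) allI impI)
      fix u v assume uv: "u \<le> x \<and> x \<le> v \<and> v - u < d"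
      show "P u v"
        unfolding P_def
      proof (intro impI)
        assume uvab: "a \<le> u \<and> v \<le> b \<and> u < v"
        have nc: "\<not> ?c s" if "u < s" "s < v" "s \<noteq> x" for s
          using d(2)[of s] d(3)[of s] uv uvab that by (cases "s < x") auto
        have v: "x < v \<Longrightarrow> g v = g x + ?s x \<and> ?s v = 0" and u: "u < x \<Longrightarrow> g u = g x - ?s x \<and> ?s u = 0"
          using d(2)[of v] d(3)[of u] s0 uv uvab by auto
        show "finite {t. u < t \<and> t < v \<and> ?c t} \<and> g v - g u = ?s u + 2 * (\<Sum>t | u < t \<and> t < v \<and> ?c t. ?s t) + ?s v"
        proof (cases "u < x \<and> x < v \<and> ?c x")
          case True
          then have "{t. u < t \<and> t < v \<and> ?c t} = {x}" using nc by auto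
          then show ?thesis using u v True by simp
        next
          case False
          then have E: "{t. u < t \<and> t < v \<and> ?c t} = {}" using nc by auto
          consider "u = x" "x < v" | "u < x" "x = v" | "u < x" "x < v" "?s x = 0"
            using uv uvab False s0[of x] by fastforce
          then have "g v - g u = ?s u + ?s v" using u v by cases auto
          then show ?thesis unfolding E by simp
        qed
      qed
    qed
  qed
  then have "g b - g a = ?s a + 2 * (\<Sum>t | a < t \<and> t < b \<and> ?c t. ?s t) + ?s b" using ab by (simp add: P_def)
  then have "real_of_int (g b - g a) = ?s a + 2 * (\<Sum>t | a < t \<and> t < b \<and> ?c t. ?s t) + ?s b" by simp
  then show ?thesis
    using maslov_eq[OF L K(1) _ g] ab by (simp add: regular_rs_index_def)
qed

end

section \<open>Matrix calculus\<close>

text \<open>The norm of the matrix type is the Frobenius norm, which dominates the operator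
  norm.\<close>

lemma norm_matrix_vector_le: "norm ((A :: real^'n^'m) *v v) \<le> norm A * norm v"
proof -
  have "norm (A *v v) = L2_set (\<lambda>i. norm ((A *v v) $ i)) UNIV" by (simp add: norm_vec_def)
  also have "\<dots> \<le> L2_set (\<lambda>i. norm (A $ i) * norm v) UNIV"
    by (rule L2_set_mono) (simp_all add: matrix_vector_mul_component Cauchy_Schwarz_ineq2)
  also have "\<dots> = norm A * norm v" by (simp add: L2_set_left_distrib norm_vec_def[of A])
  finally show ?thesis .
qed

lemma bounded_bilinear_matrix_vector: "bounded_bilinear (\<lambda>(A :: real^'n^'m) v. A *v v)"
  by (rule bounded_bilinear.intro)
    (auto simp: matrix_vector_mult_add_rdistrib matrix_vector_right_distrib scaleR_matrix_vector_assoc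
      matrix_vector_mult_scaleR intro!: exI[of _ 1] norm_matrix_vector_le)

lemma bounded_bilinear_matrix_matrix: "bounded_bilinear (\<lambda>(A :: real^'n^'m) (B :: real^'k^'n). A ** B)"
proof -
  have "bilinear (\<lambda>(A :: real^'n^'m) (B :: real^'k^'n). A ** B)"
    unfolding bilinear_def
    by (auto intro!: linearI simp: vec_eq_iff matrix_matrix_mult_def algebra_simps sum.distrib sum_distrib_left)
  then show ?thesis by (simp add: bilinear_conv_bounded_bilinear)
qed

lemmas tendsto_matrix_vector = bounded_bilinear.tendsto[OF bounded_bilinear_matrix_vector]
lemmas tendsto_matrix_matrix = bounded_bilinear.tendsto[OF bounded_bilinear_matrix_matrix]
lemmas continuous_on_matrix_vector [continuous_intros] = bounded_bilinear.continuous_on[OF bounded_bilinear_matrix_vector]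
lemmas continuous_on_matrix_matrix [continuous_intros] = bounded_bilinear.continuous_on[OF bounded_bilinear_matrix_matrix]

lemma matrix_inv_works:
  assumes "invertible (A :: real^'n^'n)"
  shows "A ** matrix_inv A = mat 1" "matrix_inv A ** A = mat 1"
  using assms unfolding invertible_def matrix_inv_def by (metis (mono_tags, lifting) someI_ex)+

lemma matrix_inv_vector:
  assumes "invertible (A :: real^'n^'n)"
  shows "A *v (matrix_inv A *v v) = v" "matrix_inv A *v (A *v v) = v"
  using matrix_inv_works[OF assms] by (simp_all add: matrix_vector_mul_assoc)

lemma matrix_inv_unique:
  assumes "(A :: real^'n^'n) ** B = mat 1"
  shows "matrix_inv A = B"
proof -
  have "B ** A = mat 1" using assms by (simp add: matrix_left_right_inverse)
  then have inv: "invertible A" using assms unfolding invertible_def by blast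
  have "matrix_inv A = matrix_inv A ** (A ** B)" using assms by simp
  also have "\<dots> = B" using matrix_inv_works(2)[OF inv] by (simp add: matrix_mul_assoc)
  finally show ?thesis .
qed

lemma invertible_iff_ker:
  "invertible (A :: real^'n^'n) \<longleftrightarrow> (\<forall>v. A *v v = 0 \<longrightarrow> v = 0)"
  using matrix_left_invertible_ker[of A] by (metis invertible_def matrix_left_right_inverse)

lemma tendsto_matrix_iff:
  "((f \<longlongrightarrow> (A :: real^'n^'m)) F) \<longleftrightarrow> (\<forall>v. ((\<lambda>p. f p *v v) \<longlongrightarrow> A *v v) F)"
proof
  assume *: "\<forall>v. ((\<lambda>p. f p *v v) \<longlongrightarrow> A *v v) F"
  show "(f \<longlongrightarrow> A) F"
  proof (intro vec_tendstoI)
    fix i j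
    have "((\<lambda>p. (f p *v axis j 1) $ i) \<longlongrightarrow> (A *v axis j 1) $ i) F" using * by (intro tendsto_vec_nth) auto
    then show "((\<lambda>p. f p $ i $ j) \<longlongrightarrow> A $ i $ j) F"
      by (simp add: matrix_vector_mult_basis column_def)
  qed
qed (auto intro!: tendsto_matrix_vector tendsto_const)

text \<open>Applied to a vector, the inverse solves a linear equation whose coefficients converge to
  an injective map.\<close>

lemma tendsto_matrix_inv:
  assumes f: "(f \<longlongrightarrow> (A :: real^'n^'n)) F" and A: "invertible A"
  shows "((\<lambda>p. matrix_inv (f p)) \<longlongrightarrow> matrix_inv A) F" "\<forall>\<^sub>F p in F. invertible (f p)"
proof -
  have inj: "\<And>x. A *v x = 0 \<Longrightarrow> x = 0" using A invertible_iff_ker by blast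
  have lin: "\<forall>\<^sub>F p in F. linear ((*v) (f p))" by simp
  have lim: "\<And>x. ((\<lambda>p. f p *v x) \<longlongrightarrow> A *v x) F" using f by (simp add: tendsto_matrix_iff)
  obtain c where c: "c > 0" "\<forall>\<^sub>F p in F. \<forall>x. c * norm x \<le> norm (f p *v x)"
    using linear_family_inj_bound[OF lin _ inj lim] by auto
  show inv: "\<forall>\<^sub>F p in F. invertible (f p)"
    using c(2)
  proof eventually_elim
    case (elim p)
    have "x = 0" if "f p *v x = 0" for x
      using elim[rule_format, of x] that c(1) by (simp add: mult_le_0_iff)
    then show ?case using invertible_iff_ker by blast
  qed
  show "((\<lambda>p. matrix_inv (f p)) \<longlongrightarrow> matrix_inv A) F"
    unfolding tendsto_matrix_iff
  proof
    fix v
    have l: "((\<lambda>p. f p *v (matrix_inv (f p) *v v)) \<longlongrightarrow> A *v (matrix_inv A *v v)) F"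
      unfolding matrix_inv_vector(1)[OF A]
      by (rule Lim_transform_eventually[OF tendsto_const]) (use inv in \<open>eventually_elim, simp add: matrix_inv_vector\<close>)
    show "((\<lambda>p. matrix_inv (f p) *v v) \<longlongrightarrow> matrix_inv A *v v) F"
      by (rule linear_family_solution_tendsto[OF lin _ inj lim l]) auto
  qed
qed

lemma continuous_on_matrix_inv [continuous_intros]:
  assumes "continuous_on S f" "\<And>p. p \<in> S \<Longrightarrow> invertible (f p :: real^'n^'n)"
  shows "continuous_on S (\<lambda>p. matrix_inv (f p))"
  using assms tendsto_matrix_inv(1) unfolding continuous_on_def by blast

lemma small_invertible:
  assumes "c < 1" "\<And>v. norm ((X :: real^'n^'n) *v v) \<le> c * norm v"
  shows "invertible (mat 1 - X)" "invertible (mat 1 + X)"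
proof -
  have "v = 0" if "norm v \<le> norm (X *v v)" for v
  proof (rule ccontr)
    assume "v \<noteq> 0"
    then have "c * norm v < 1 * norm v" using assms(1) by (intro mult_strict_right_mono) auto
    then show False using assms(2)[of v] that by linarith
  qed
  moreover have "v = X *v v" if "(mat 1 - X) *v v = 0" for v
    using that by (simp add: matrix_vector_mult_diff_rdistrib)
  moreover have "v = - (X *v v)" if "(mat 1 + X) *v v = 0" for v
    using that by (simp add: matrix_vector_mult_add_rdistrib eq_neg_iff_add_eq_0)
  ultimately show "invertible (mat 1 - X)" "invertible (mat 1 + X)"
    unfolding invertible_iff_ker by (metis order_refl norm_minus_cancel)+
qed

section \<open>Smooth functions of one variable\<close>

text \<open>Differentiability of finite order, one-sided at the boundary of \<open>S\<close>. A
  fixed order permits induction for sums, products, inverses, \<open>sin\<close> and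
  \<open>cos\<close>; the single sequence of derivatives required by \<open>smooth_on_Icc\<close> is
  assembled only at the end.\<close>

primrec Ck :: "nat \<Rightarrow> real set \<Rightarrow> (real \<Rightarrow> 'a::real_normed_vector) \<Rightarrow> bool" where
  "Ck 0 S f \<longleftrightarrow> continuous_on S f"
| "Ck (Suc k) S f \<longleftrightarrow> (\<exists>f'. (\<forall>t\<in>S. (f has_vector_derivative f' t) (at t within S)) \<and> Ck k S f')"

definition Csmooth :: "real set \<Rightarrow> (real \<Rightarrow> 'a::real_normed_vector) \<Rightarrow> bool" where
  "Csmooth S f \<longleftrightarrow> (\<forall>k. Ck k S f)"

lemma Ck_Suc: "Ck (Suc k) S f \<Longrightarrow> Ck k S f"
proof (induction k arbitrary: f)
  case 0
  then show ?case by (auto simp: continuous_on_eq_continuous_within intro: has_vector_derivative_continuous)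
next
  case (Suc k)
  then show ?case by fastforce
qed

lemma Ck_cong: "(\<And>t. t \<in> S \<Longrightarrow> f t = g t) \<Longrightarrow> Ck k S f \<Longrightarrow> Ck k S g"
proof (cases k)
  case 0
  assume "\<And>t. t \<in> S \<Longrightarrow> f t = g t" "Ck k S f"
  then show ?thesis using 0 by (simp cong: continuous_on_cong)
next
  case (Suc m)
  assume fg: "\<And>t. t \<in> S \<Longrightarrow> f t = g t" and "Ck k S f"
  then obtain f' where f': "\<forall>t\<in>S. (f has_vector_derivative f' t) (at t within S)" "Ck m S f'" using Suc by auto
  have "(g has_vector_derivative f' t) (at t within S)" if "t \<in> S" for t
    using f'(1) that fg by (metis has_vector_derivative_transform)
  then show ?thesis using Suc f'(2) by auto
qed

lemma Ck_const: "Ck k S (\<lambda>t. c)"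
  by (induction k arbitrary: c) (auto intro!: exI[of _ "\<lambda>_. 0"] derivative_eq_intros)

lemma Ck_ident: "Ck k S (\<lambda>t::real. t)"
  by (cases k) (auto intro!: exI[of _ "\<lambda>_. 1"] Ck_const has_vector_derivative_id)

lemma Ck_add: "Ck k S f \<Longrightarrow> Ck k S g \<Longrightarrow> Ck k S (\<lambda>t. f t + g t)"
proof (induction k arbitrary: f g)
  case 0 then show ?case by (auto intro: continuous_on_add)
next
  case (Suc k)
  then obtain f' g' where "\<forall>t\<in>S. (f has_vector_derivative f' t) (at t within S)" "Ck k S f'"
    "\<forall>t\<in>S. (g has_vector_derivative g' t) (at t within S)" "Ck k S g'" by auto
  then show ?case using Suc.IH[of f' g'] by (auto intro!: exI[of _ "\<lambda>t. f' t + g' t"] has_vector_derivative_add)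
qed

lemma Ck_linear:
  assumes "bounded_linear T"
  shows "Ck k S f \<Longrightarrow> Ck k S (\<lambda>t. T (f t))"
proof (induction k arbitrary: f)
  case 0 then show ?case using assms by (auto intro: bounded_linear.continuous_on)
next
  case (Suc k)
  then obtain f' where f': "\<forall>t\<in>S. (f has_vector_derivative f' t) (at t within S)" "Ck k S f'" by auto
  have "((\<lambda>t. T (f t)) has_vector_derivative T (f' t)) (at t within S)" if "t \<in> S" for t
    using f'(1) that assms by (blast intro: bounded_linear.has_vector_derivative)
  then show ?case using Suc.IH[OF f'(2)] by (auto intro: exI[of _ "\<lambda>t. T (f' t)"])
qed

lemma Ck_bilinear:
  assumes "bounded_bilinear h"
  shows "Ck k S f \<Longrightarrow> Ck k S g \<Longrightarrow> Ck k S (\<lambda>t. h (f t) (g t))"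
proof (induction k arbitrary: f g)
  case 0 then show ?case using assms by (auto intro: bounded_bilinear.continuous_on)
next
  case (Suc k)
  then obtain f' g' where d: "\<forall>t\<in>S. (f has_vector_derivative f' t) (at t within S)" "Ck k S f'"
    "\<forall>t\<in>S. (g has_vector_derivative g' t) (at t within S)" "Ck k S g'" by auto
  have "Ck k S f" "Ck k S g" using Suc.prems by (auto dest: Ck_Suc simp del: Ck.simps)
  then have "Ck k S (\<lambda>t. h (f t) (g' t) + h (f' t) (g t))" using d by (intro Ck_add Suc.IH)
  then show ?case
    using d by (auto intro!: exI[of _ "\<lambda>t. h (f t) (g' t) + h (f' t) (g t)"] bounded_bilinear.has_vector_derivative[OF assms])
qed

text \<open>The difference of the inverses at \<open>s\<close> and \<open>t\<close> is
  \<open>- (matrix_inv (f s) ** (f s - f t) ** matrix_inv (f t))\<close>; dividing by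
  \<open>s - t\<close> gives the limit.\<close>

lemma matrix_inv_has_vector_derivative:
  fixes f :: "real \<Rightarrow> real^'n^'n"
  assumes f: "(f has_vector_derivative D) (at t within S)" and inv: "\<And>s. s \<in> S \<Longrightarrow> invertible (f s)" and t: "t \<in> S"
  shows "((\<lambda>s. matrix_inv (f s)) has_vector_derivative (- (matrix_inv (f t) ** D ** matrix_inv (f t)))) (at t within S)"
  unfolding has_vector_derivative_quotient
proof (rule Lim_transform_eventually)
  have c: "(f \<longlongrightarrow> f t) (at t within S)"
    using has_vector_derivative_continuous[OF f] by (simp add: continuous_within)
  show "((\<lambda>s. - (matrix_inv (f s) ** ((f s - f t) /\<^sub>R (s - t)) ** matrix_inv (f t))) \<longlongrightarrow> - (matrix_inv (f t) ** D ** matrix_inv (f t))) (at t within S)"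
    using f unfolding has_vector_derivative_quotient
    by (intro tendsto_minus tendsto_matrix_matrix tendsto_const tendsto_matrix_inv(1)[OF c inv[OF t]])
  show "\<forall>\<^sub>F s in at t within S. - (matrix_inv (f s) ** ((f s - f t) /\<^sub>R (s - t)) ** matrix_inv (f t)) = (matrix_inv (f s) - matrix_inv (f t)) /\<^sub>R (s - t)"
  proof -
    have "- (matrix_inv (f s) ** ((f s - f t) /\<^sub>R (s - t)) ** matrix_inv (f t)) = (matrix_inv (f s) - matrix_inv (f t)) /\<^sub>R (s - t)" if "s \<in> S" for s
    proof -
      note b = bounded_bilinear_matrix_matrix
      have e: "matrix_inv (f s) ** (f s - f t) ** matrix_inv (f t) = matrix_inv (f t) - matrix_inv (f s)"
        unfolding bounded_bilinear.diff_right[OF b] bounded_bilinear.diff_left[OF b]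
        using matrix_inv_works(2)[OF inv[OF that]] matrix_inv_works(1)[OF inv[OF t]] by (simp flip: matrix_mul_assoc)
      show ?thesis
        unfolding bounded_bilinear.scaleR_right[OF b] bounded_bilinear.scaleR_left[OF b] e
        by (simp only: minus_diff_eq flip: scaleR_minus_right)
    qed
    then show ?thesis by (simp add: eventually_at_filter)
  qed
qed

lemma Ck_matrix_inv:
  fixes f :: "real \<Rightarrow> real^'n^'n"
  assumes inv: "\<And>s. s \<in> S \<Longrightarrow> invertible (f s)"
  shows "Ck k S f \<Longrightarrow> Ck k S (\<lambda>t. matrix_inv (f t))"
proof (induction k)
  case 0 then show ?case using inv by (auto intro: continuous_on_matrix_inv)
next
  case (Suc k)
  then obtain f' where f': "\<forall>t\<in>S. (f has_vector_derivative f' t) (at t within S)" "Ck k S f'" by auto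
  have i: "Ck k S (\<lambda>t. matrix_inv (f t))" using Suc by (auto dest: Ck_Suc simp del: Ck.simps)
  have "Ck k S (\<lambda>t. - (matrix_inv (f t) ** f' t ** matrix_inv (f t)))"
    by (intro Ck_linear[OF bounded_linear_minus[OF bounded_linear_ident]] Ck_bilinear[OF bounded_bilinear_matrix_matrix] i f')
  then show ?case
    using f' inv by (auto intro!: exI[of _ "\<lambda>t. - (matrix_inv (f t) ** f' t ** matrix_inv (f t))"] matrix_inv_has_vector_derivative)
qed

lemma Ck_sin_cos:
  fixes f :: "real \<Rightarrow> real"
  shows "Ck k S f \<Longrightarrow> Ck k S (\<lambda>t. sin (f t)) \<and> Ck k S (\<lambda>t. cos (f t))"
proof (induction k)
  case 0 then show ?case by (auto intro: continuous_intros)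
next
  case (Suc k)
  then obtain f' where f': "\<forall>t\<in>S. (f has_vector_derivative f' t) (at t within S)" "Ck k S f'" by auto
  have i: "Ck k S (\<lambda>t. sin (f t))" "Ck k S (\<lambda>t. cos (f t))" using Suc by (auto dest: Ck_Suc simp del: Ck.simps)
  have d: "Ck k S (\<lambda>t. cos (f t) * f' t)" "Ck k S (\<lambda>t. - (sin (f t) * f' t))"
    by (intro Ck_linear[OF bounded_linear_minus[OF bounded_linear_ident]] Ck_bilinear[OF bounded_bilinear_mult] i f')+
  have s: "((\<lambda>s. sin (f s)) has_vector_derivative cos (f t) * f' t) (at t within S)"
    and c: "((\<lambda>s. cos (f s)) has_vector_derivative - (sin (f t) * f' t)) (at t within S)" if "t \<in> S" for t
    using f'(1) that unfolding has_real_derivative_iff_has_vector_derivative[symmetric]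
    by (auto intro!: derivative_eq_intros)
  have "Ck (Suc k) S (\<lambda>t. sin (f t))" using s d(1) by (auto intro: exI[of _ "\<lambda>t. cos (f t) * f' t"])
  moreover have "Ck (Suc k) S (\<lambda>t. cos (f t))" using c d(2) by (auto intro: exI[of _ "\<lambda>t. - (sin (f t) * f' t)"])
  ultimately show ?case ..
qed

text \<open>On a nondegenerate interval derivatives are unique, so the witnesses obtained separately
  for each order coincide and \<open>vector_derivative\<close> can be iterated.\<close>

lemma Csmooth_derivative:
  assumes ab: "a < b" and f: "Csmooth {a..b} f"
  shows "\<And>t. t \<in> {a..b} \<Longrightarrow> (f has_vector_derivative vector_derivative f (at t within {a..b})) (at t within {a..b})"
    "Csmooth {a..b} (\<lambda>t. vector_derivative f (at t within {a..b}))"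
proof -
  have uniq: "vector_derivative f (at t within {a..b}) = f' t"
    if "\<forall>t\<in>{a..b}. (f has_vector_derivative f' t) (at t within {a..b})" "t \<in> {a..b}" for f' t
    using that ab by (intro vector_derivative_within) (auto simp: trivial_limit_within islimpt_Icc)
  show "(f has_vector_derivative vector_derivative f (at t within {a..b})) (at t within {a..b})" if "t \<in> {a..b}" for t
  proof -
    have "Ck (Suc 0) {a..b} f" using f by (simp add: Csmooth_def del: Ck.simps)
    then obtain f' where "\<forall>t\<in>{a..b}. (f has_vector_derivative f' t) (at t within {a..b})" by auto
    then show ?thesis using uniq[of f' t] that by auto
  qed
  show "Csmooth {a..b} (\<lambda>t. vector_derivative f (at t within {a..b}))"
    unfolding Csmooth_def
  proof
    fix k
    have "Ck (Suc k) {a..b} f" using f by (simp add: Csmooth_def del: Ck.simps)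
    then obtain f' where f': "\<forall>t\<in>{a..b}. (f has_vector_derivative f' t) (at t within {a..b})" "Ck k {a..b} f'" by auto
    show "Ck k {a..b} (\<lambda>t. vector_derivative f (at t within {a..b}))"
      by (rule Ck_cong[OF uniq[OF f'(1), symmetric] f'(2)])
  qed
qed

lemma Csmooth_imp_smooth_on_Icc:
  assumes ab: "a < b" and f: "Csmooth {a..b} f"
  shows "smooth_on_Icc a b f"
proof -
  define D where "D k = ((\<lambda>g t. vector_derivative g (at t within {a..b})) ^^ k) f" for k
  have "Csmooth {a..b} (D k)" for k
    by (induction k) (auto simp: D_def f Csmooth_derivative(2)[OF ab])
  then have "(D k has_vector_derivative D (Suc k) t) (at t within {a..b})" if "t \<in> {a..b}" for k t
    using Csmooth_derivative(1)[OF ab, of "D k" t] that by (simp add: D_def)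
  then show ?thesis unfolding smooth_on_Icc_def by (intro exI[of _ D]) (simp add: D_def)
qed

section \<open>Symplectic matrices\<close>

text \<open>As a simp rule it turns \<open>transpose A *v x\<close> into a row-vector product,
  whereas computations with \<open>transpose_vector_inner\<close> keep the transpose
  explicit.\<close>

declare transpose_matrix_vector [simp del]

lemma transpose_vector_inner: "v \<bullet> ((A :: real^'n^'m) *v w) = (transpose A *v v) \<bullet> w"
  by (simp add: dot_lmul_matrix transpose_matrix_vector)

lemma Omega0_Omega0: "Omega0 *v (Omega0 *v x) = - x"
  using matrix_vector_mult_diff_rdistrib[of 0 "mat 1" x]
  by (simp add: matrix_vector_mul_assoc Omega0_squared)

lemma J0_eq: "J0 = - Omega0"
  by (auto simp: J0_def Omega0_def block_matrix_def vec_eq_iff split: sum.splits)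

lemma uminus_matrix_vector: "(- A) *v x = - ((A :: real^'n^'m) *v x)"
  using matrix_vector_mult_diff_rdistrib[of 0 A x] by simp

lemma Omega0_skew: "(Omega0 *v x) \<bullet> y = - (x \<bullet> (Omega0 *v y))"
proof -
  have "x \<bullet> (Omega0 *v y) = (- (Omega0 *v x)) \<bullet> y"
    unfolding transpose_vector_inner[of x] transpose_Omega0 uminus_matrix_vector ..
  then show ?thesis by simp
qed

lemma J0_vector: "J0 *v x = - (Omega0 *v x)"
  by (simp add: J0_eq uminus_matrix_vector)

global_interpretation sp: compatible_symplectic "(*v) (Omega0 :: real^('n::finite + 'n)^('n + 'n))" omega0
  by (rule compatible_symplectic.intro) (simp_all add: Omega0_Omega0 Omega0_skew omega0_def)

definition Omega_bar :: "(real^('n::finite + 'n)) \<times> (real^('n + 'n)) \<Rightarrow> (real^('n + 'n)) \<times> (real^('n + 'n))" where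
  "Omega_bar w = (- (Omega0 *v fst w), Omega0 *v snd w)"

global_interpretation gr: compatible_symplectic Omega_bar omega_bar
proof (rule compatible_symplectic.intro)
  show "linear Omega_bar"
    unfolding Omega_bar_def by (intro linearI) (simp_all add: matrix_vector_right_distrib matrix_vector_mult_scaleR)
  show "Omega_bar (Omega_bar x) = - x" for x
    by (simp add: Omega_bar_def prod_eq_iff Omega0_Omega0 linear_neg[OF sp.linJ])
  show "Omega_bar x \<bullet> y = - (x \<bullet> Omega_bar y)" for x y
    by (simp add: Omega_bar_def inner_prod_def Omega0_skew)
  show "omega_bar v w = v \<bullet> Omega_bar w" for v w
    by (simp add: Omega_bar_def omega_bar_def inner_prod_def omega0_def)
qed

lemma Sp_iff:
  fixes A :: "real^('n::finite + 'n)^('n + 'n)"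
  shows "A \<in> Sp \<longleftrightarrow> (\<forall>v w. omega0 (A *v v) (A *v w) = omega0 v w)"
proof -
  have e: "omega0 (A *v u) (A *v x) = u \<bullet> ((transpose A ** Omega0 ** A) *v x)" for u x
    by (simp add: omega0_def transpose_vector_inner[of _ "transpose A"] flip: matrix_vector_mul_assoc)
  show ?thesis
  proof
    assume "A \<in> Sp"
    then show "\<forall>v w. omega0 (A *v v) (A *v w) = omega0 v w" unfolding e by (simp add: Sp_def omega0_def)
  next
    assume "\<forall>v w. omega0 (A *v v) (A *v w) = omega0 v w"
    then have "v \<bullet> ((transpose A ** Omega0 ** A) *v w) = v \<bullet> (Omega0 *v w)" for v w
      unfolding e by (simp add: omega0_def)
    then have "(transpose A ** Omega0 ** A) *v w = Omega0 *v w" for w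
      by (subst vector_eq_ldot[symmetric]) blast
    then show "A \<in> Sp" by (simp add: Sp_def matrix_eq)
  qed
qed

lemma SpD: "A \<in> Sp \<Longrightarrow> omega0 (A *v v) (A *v w) = omega0 v w"
  by (simp add: Sp_iff)

lemma Sp_invertible: "A \<in> Sp \<Longrightarrow> invertible A"
  unfolding invertible_iff_ker
proof (intro allI impI)
  fix v assume A: "A \<in> Sp" and "A *v v = 0"
  then have "omega0 u v = 0" for u using SpD[OF A, of u v] by simp
  then show "v = 0" by (rule omega0_nondegenerate)
qed

lemma Sp_mat1: "mat 1 \<in> Sp" by (simp add: Sp_iff)

lemma Sp_mult: "A \<in> Sp \<Longrightarrow> B \<in> Sp \<Longrightarrow> A ** B \<in> Sp"
  by (simp add: Sp_iff flip: matrix_vector_mul_assoc)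

lemma Sp_inv: 
  assumes "A \<in> Sp" shows "matrix_inv A \<in> Sp"
  unfolding Sp_iff
proof (intro allI)
  fix v w
  show "omega0 (matrix_inv A *v v) (matrix_inv A *v w) = omega0 v w"
    using SpD[OF assms, of "matrix_inv A *v v" "matrix_inv A *v w"]
    unfolding matrix_inv_vector(1)[OF Sp_invertible[OF assms]] by simp
qed

text \<open>The Lie algebra of \<open>Sp\<close>. By \<open>J0_sym_sp_algebra\<close> and
  \<open>sp_algebra_eq_J0\<close> its elements are exactly the matrices \<open>J0 ** S\<close> with
  symmetric \<open>S\<close>.\<close>

definition sp_algebra :: "(real^('n::finite + 'n)^('n + 'n)) set" where
  "sp_algebra = {X. \<forall>v w. omega0 (X *v v) w + omega0 v (X *v w) = 0}"

lemma sp_algebraD: "X \<in> sp_algebra \<Longrightarrow> omega0 (X *v v) w = - omega0 v (X *v w)"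
  unfolding sp_algebra_def by (simp add: eq_neg_iff_add_eq_0)

lemma scaleR_matrix_vector: "(c *\<^sub>R (A :: real^'n^'m)) *v v = c *\<^sub>R (A *v v)"
  by (rule scaleR_matrix_vector_assoc[symmetric])

lemma sp_algebra_scaleR: "X \<in> sp_algebra \<Longrightarrow> c *\<^sub>R X \<in> sp_algebra"
  using sp_algebraD[of X] by (simp add: sp_algebra_def scaleR_matrix_vector)

lemma sp_algebra_add: "X \<in> sp_algebra \<Longrightarrow> Y \<in> sp_algebra \<Longrightarrow> X + Y \<in> sp_algebra"
  using sp_algebraD[of X] sp_algebraD[of Y] by (simp add: sp_algebra_def matrix_vector_mult_add_rdistrib)

lemma omega0_J0: "omega0 v (J0 *v w) = v \<bullet> w"
  by (simp add: J0_vector sp.Om_J)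

lemma J0_sym_sp_algebra:
  assumes "transpose S = S"
  shows "J0 ** S \<in> sp_algebra"
proof -
  have "omega0 (J0 *v (S *v v)) w + omega0 v (J0 *v (S *v w)) = 0" for v w
  proof -
    have "omega0 (J0 *v (S *v v)) w = - (w \<bullet> (S *v v))"
      by (subst omega0_antisym) (simp only: omega0_J0)
    moreover have "v \<bullet> (S *v w) = w \<bullet> (S *v v)"
      unfolding transpose_vector_inner[of v S w] assms by (rule inner_commute)
    ultimately show ?thesis by (simp only: omega0_J0)
  qed
  then show ?thesis by (simp add: sp_algebra_def flip: matrix_vector_mul_assoc)
qed

lemma norm_Omega0: "norm (Omega0 *v x) = norm x"
  using Omega0_skew[of x "Omega0 *v x"] by (simp add: Omega0_Omega0 norm_eq_sqrt_inner)

lemma omega0_le: "\<bar>omega0 v w\<bar> \<le> norm v * norm w"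
  using Cauchy_Schwarz_ineq2[of v "Omega0 *v w"] by (simp add: omega0_def norm_Omega0)

section \<open>Small matrices and the Cayley transform\<close>

definition small_matrix :: "real^'m^'m \<Rightarrow> bool" where
  "small_matrix X \<longleftrightarrow> (\<forall>v. norm (X *v v) \<le> norm v / 2)"

lemma small_matrix_convex:
  assumes "small_matrix X" "small_matrix Y" "0 \<le> s" "s \<le> 1"
  shows "small_matrix ((1 - s) *\<^sub>R X + s *\<^sub>R Y)"
  unfolding small_matrix_def
proof
  fix v
  have "norm (((1 - s) *\<^sub>R X + s *\<^sub>R Y) *v v) \<le> norm ((1 - s) *\<^sub>R (X *v v)) + norm (s *\<^sub>R (Y *v v))"
    unfolding matrix_vector_mult_add_rdistrib scaleR_matrix_vector by (rule norm_triangle_ineq)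
  also have "\<dots> \<le> (1 - s) * (norm v / 2) + s * (norm v / 2)"
    using assms unfolding small_matrix_def norm_scaleR by (intro add_mono mult_mono) auto
  finally show "norm (((1 - s) *\<^sub>R X + s *\<^sub>R Y) *v v) \<le> norm v / 2" by (simp add: field_simps)
qed

lemma small_matrix_0: "small_matrix 0" by (simp add: small_matrix_def)

lemma small_matrix_scaleR:
  assumes "small_matrix X" "0 \<le> s" "s \<le> 1" shows "small_matrix (s *\<^sub>R X)"
  using small_matrix_convex[OF small_matrix_0 assms] by simp

lemma small_matrix_norm:
  assumes "norm X \<le> 1/2" shows "small_matrix X"
  unfolding small_matrix_def
proof
  fix v
  have "norm (X *v v) \<le> norm X * norm v" by (rule norm_matrix_vector_le)
  also have "\<dots> \<le> 1/2 * norm v" using assms by (intro mult_right_mono) auto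
  finally show "norm (X *v v) \<le> norm v / 2" by simp
qed

lemma small_matrix_invertible:
  assumes "small_matrix X"
  shows "invertible (mat 1 - X)" "invertible (mat 1 + X)"
  using assms by (auto intro!: small_invertible[of "1/2"] simp: small_matrix_def)

text \<open>The Cayley transform. Unlike the exponential it has an explicit rational inverse, and
  its fixed vectors are exactly the kernel of \<open>X\<close> as soon as it is defined, see
  \<open>cay_ker\<close>.\<close>

definition cay :: "real^'m^'m \<Rightarrow> real^'m^'m" where
  "cay X = matrix_inv (mat 1 - X) ** (mat 1 + X)"

lemma matrix_diff_ldistrib: "(A :: real^'n^'m) ** (B - C) = A ** B - A ** C"
  by (rule bounded_bilinear.diff_right[OF bounded_bilinear_matrix_matrix])

lemma matrix_diff_rdistrib: "((A :: real^'n^'m) - B) ** C = A ** C - B ** C"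
  by (rule bounded_bilinear.diff_left[OF bounded_bilinear_matrix_matrix])

lemma matrix_add_ldist: "(A :: real^'n^'m) ** (B + C) = A ** B + A ** C"
  by (rule bounded_bilinear.add_right[OF bounded_bilinear_matrix_matrix])

lemma matrix_add_rdist: "((A :: real^'n^'m) + B) ** C = A ** C + B ** C"
  by (rule bounded_bilinear.add_left[OF bounded_bilinear_matrix_matrix])

lemmas matrix_distribs = matrix_diff_ldistrib matrix_diff_rdistrib matrix_add_ldist matrix_add_rdist

lemma cay_mult:
  assumes "invertible (mat 1 - X)"
  shows "(mat 1 - X) ** cay X = mat 1 + X" "cay X ** (mat 1 - X) = mat 1 + X"
proof -
  show "(mat 1 - X) ** cay X = mat 1 + X"
    using matrix_inv_works(1)[OF assms] by (simp add: cay_def matrix_mul_assoc)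
  have "(mat 1 + X) ** (mat 1 - X) = (mat 1 - X) ** (mat 1 + X)" by (simp add: matrix_distribs)
  then have "cay X ** (mat 1 - X) = matrix_inv (mat 1 - X) ** (mat 1 - X) ** (mat 1 + X)"
    by (simp add: cay_def flip: matrix_mul_assoc)
  then show "cay X ** (mat 1 - X) = mat 1 + X" using matrix_inv_works(2)[OF assms] by simp
qed

lemma cay_vector:
  assumes "invertible (mat 1 - X)"
  shows "cay X *v (u - X *v u) = u + X *v u" "cay X *v u - X *v (cay X *v u) = u + X *v u"
proof -
  have "cay X *v ((mat 1 - X) *v u) = (mat 1 + X) *v u" "(mat 1 - X) *v (cay X *v u) = (mat 1 + X) *v u"
    using cay_mult[OF assms] by (simp_all add: matrix_vector_mul_assoc)
  then show "cay X *v (u - X *v u) = u + X *v u" "cay X *v u - X *v (cay X *v u) = u + X *v u"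
    by (simp_all add: matrix_vector_mult_diff_rdistrib matrix_vector_mult_add_rdistrib)
qed

lemma cay_ker:
  assumes "invertible (mat 1 - X)"
  shows "cay X *v v = v \<longleftrightarrow> X *v v = 0"
proof
  assume "cay X *v v = v"
  then have "v - X *v v = v + X *v v" using cay_vector(2)[OF assms, of v] by simp
  then have "2 *\<^sub>R (X *v v) = 0" by (simp add: scaleR_2 algebra_simps)
  then show "X *v v = 0" by simp
next
  assume "X *v v = 0"
  then show "cay X *v v = v" using cay_vector(1)[OF assms, of v] by simp
qed

lemma cay_0: "cay 0 = mat 1"
  using matrix_inv_unique[of "mat 1" "mat 1"] by (simp add: cay_def)

lemma cay_Sp:
  assumes X: "X \<in> sp_algebra" and inv: "invertible (mat 1 - X)"
  shows "cay X \<in> Sp"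
  unfolding Sp_iff
proof (intro allI)
  fix v w
  define a b where "a = matrix_inv (mat 1 - X) *v v" and "b = matrix_inv (mat 1 - X) *v w"
  have v: "v = a - X *v a" "w = b - X *v b"
    using matrix_inv_vector(1)[OF inv] by (simp_all add: a_def b_def flip: matrix_vector_mult_diff_rdistrib[of "mat 1", simplified])
  show "omega0 (cay X *v v) (cay X *v w) = omega0 v w"
    unfolding v cay_vector(1)[OF inv] using sp_algebraD[OF X, of a b] by simp
qed

definition cay_inv :: "real^'m^'m \<Rightarrow> real^'m^'m" where
  "cay_inv A = (A - mat 1) ** matrix_inv (A + mat 1)"

lemma near_one_invertible:
  assumes "small_matrix (A - mat 1)"
  shows "invertible (A + mat 1)" "norm v \<le> norm ((A + mat 1) *v v)"
proof -
  have n: "norm v \<le> norm ((A + mat 1) *v v)" for v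
  proof -
    have "(A + mat 1) *v v = (A - mat 1) *v v + 2 *\<^sub>R v"
      by (simp add: matrix_vector_mult_diff_rdistrib matrix_vector_mult_add_rdistrib scaleR_2)
    then have "norm (2 *\<^sub>R v) - norm ((A - mat 1) *v v) \<le> norm ((A + mat 1) *v v)"
      using norm_triangle_ineq2[of "2 *\<^sub>R v" "- ((A - mat 1) *v v)"] by (simp add: add.commute)
    moreover have "norm ((A - mat 1) *v v) \<le> norm v / 2" using assms by (simp add: small_matrix_def)
    ultimately show ?thesis using norm_ge_zero[of v] norm_scaleR[of 2 v] by linarith
  qed
  then show "norm v \<le> norm ((A + mat 1) *v v)" .
  show "invertible (A + mat 1)"
    unfolding invertible_iff_ker using n by (metis norm_le_zero_iff norm_zero)
qed

lemma cay_inv_vector: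
  assumes "small_matrix (A - mat 1)"
  shows "cay_inv A *v ((A + mat 1) *v u) = (A - mat 1) *v u"
  using matrix_inv_works(2)[OF near_one_invertible(1)[OF assms]]
  by (simp add: cay_inv_def matrix_vector_mul_assoc flip: matrix_mul_assoc)

lemma near_one_surj:
  assumes "small_matrix (A - mat 1)"
  obtains u where "v = (A + mat 1) *v u"
  using matrix_inv_vector(1)[OF near_one_invertible(1)[OF assms], of v] by metis

text \<open>The bound 1/2 reproduces itself: for \<open>v = (A + mat 1) *v u\<close> the norm of
  \<open>v\<close> is at least that of \<open>u\<close>, while \<open>cay_inv A\<close> sends
  \<open>v\<close> to \<open>(A - mat 1) *v u\<close>.\<close>

lemma cay_inv_small:
  assumes "small_matrix (A - mat 1)"
  shows "small_matrix (cay_inv A)"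
  unfolding small_matrix_def
proof
  fix v
  obtain u where u: "v = (A + mat 1) *v u" using near_one_surj[OF assms] .
  have "norm (cay_inv A *v v) = norm ((A - mat 1) *v u)" unfolding u cay_inv_vector[OF assms] ..
  also have "\<dots> \<le> norm u / 2" using assms by (simp add: small_matrix_def)
  also have "\<dots> \<le> norm v / 2" using near_one_invertible(2)[OF assms, of u] by (simp add: u)
  finally show "norm (cay_inv A *v v) \<le> norm v / 2" .
qed

lemma cay_inv_sp_algebra:
  assumes "small_matrix (A - mat 1)" "A \<in> Sp"
  shows "cay_inv A \<in> sp_algebra"
  unfolding sp_algebra_def mem_Collect_eq
proof (intro allI)
  fix v w
  obtain u where u: "v = (A + mat 1) *v u" using near_one_surj[OF assms(1)] .
  obtain u' where u': "w = (A + mat 1) *v u'" using near_one_surj[OF assms(1)] .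
  show "omega0 (cay_inv A *v v) w + omega0 v (cay_inv A *v w) = 0"
    unfolding u u' cay_inv_vector[OF assms(1)]
    by (simp add: matrix_vector_mult_diff_rdistrib matrix_vector_mult_add_rdistrib SpD[OF assms(2)])
qed

lemma cay_cay_inv:
  assumes "small_matrix (A - mat 1)"
  shows "cay (cay_inv A) = A"
proof -
  let ?X = "cay_inv A"
  note inv = small_matrix_invertible(1)[OF cay_inv_small[OF assms]]
  have XA: "?X ** (A + mat 1) = A - mat 1"
    using matrix_inv_works(2)[OF near_one_invertible(1)[OF assms]] by (simp add: cay_inv_def flip: matrix_mul_assoc)
  have "?X ** A + ?X = A - mat 1" using XA by (simp add: matrix_distribs)
  then have "(mat 1 - ?X) ** A = mat 1 + ?X" by (simp add: matrix_distribs algebra_simps)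
  then have "matrix_inv (mat 1 - ?X) ** ((mat 1 - ?X) ** A) = cay ?X" by (simp add: cay_def)
  then show ?thesis using matrix_inv_works(2)[OF inv] by (simp add: matrix_mul_assoc)
qed

lemma cay_inv_1: "cay_inv (mat 1) = 0"
  by (simp add: cay_inv_def)

lemma continuous_on_cay:
  assumes "continuous_on S f" "\<And>p. p \<in> S \<Longrightarrow> small_matrix (f p)"
  shows "continuous_on S (\<lambda>p. cay (f p))"
  unfolding cay_def using assms small_matrix_invertible by (intro continuous_intros) auto

lemma continuous_on_cay_inv:
  assumes "continuous_on S f" "\<And>p. p \<in> S \<Longrightarrow> small_matrix (f p - mat 1)"
  shows "continuous_on S (\<lambda>p. cay_inv (f p))"
  unfolding cay_inv_def using assms near_one_invertible by (intro continuous_intros) auto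

definition rotation :: "real \<Rightarrow> real^('n::finite + 'n)^('n + 'n)" where
  "rotation \<theta> = cos \<theta> *\<^sub>R mat 1 + sin \<theta> *\<^sub>R J0"

lemma rotation_vector: "rotation \<theta> *v x = cos \<theta> *\<^sub>R x + sin \<theta> *\<^sub>R (J0 *v x)"
  by (simp add: rotation_def matrix_vector_mult_add_rdistrib scaleR_matrix_vector)

lemma rotation_eq_rot: "rotation \<theta> *v x = sp.rot (- \<theta>) x"
  by (simp add: rotation_vector sp.rot_def J0_vector)

lemma rotation_Sp: "rotation \<theta> \<in> Sp"
  unfolding Sp_iff rotation_eq_rot by (simp add: sp.Om_rot)

lemma rotation_0: "rotation 0 = mat 1" by (simp add: rotation_def)

lemma norm_J0: "norm (J0 *v x) = norm x" by (simp add: J0_vector norm_Omega0)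

lemma norm_rotation: "norm (rotation \<theta> *v x) = norm x"
proof -
  have "(J0 *v x) \<bullet> x = 0" using Omega0_skew[of x x] by (simp add: J0_vector inner_commute)
  then have "norm (rotation \<theta> *v x)^2 = (cos \<theta>)^2 * norm x^2 + (sin \<theta>)^2 * norm (J0 *v x)^2"
    unfolding rotation_vector power2_norm_eq_inner
    by (simp add: inner_add_left inner_add_right inner_commute[of x "J0 *v x"] power2_eq_square)
  also have "\<dots> = ((cos \<theta>)^2 + (sin \<theta>)^2) * norm x^2" by (simp only: norm_J0 distrib_right)
  finally have "norm (rotation \<theta> *v x)^2 = norm x^2" by (simp only: sin_cos_squared_add2 mult_1)
  then show ?thesis by (simp add: power2_eq_iff_nonneg)
qed

lemma continuous_on_rotation [continuous_intros]:
  fixes f :: "'p::t2_space \<Rightarrow> real"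
  shows "continuous_on S f \<Longrightarrow> continuous_on S (\<lambda>p. rotation (f p))"
  unfolding rotation_def by (intro continuous_intros)

section \<open>Graphs of symplectic matrices\<close>

lemma gram_invertible: "invertible (mat 1 + transpose A ** (A :: real^'m^'m))"
  unfolding invertible_iff_ker
proof (intro allI impI)
  fix v assume "(mat 1 + transpose A ** A) *v v = 0"
  then have "v \<bullet> (v + transpose A *v (A *v v)) = 0"
    by (simp add: matrix_vector_mult_add_rdistrib matrix_vector_mul_assoc)
  then have "v \<bullet> v + (A *v v) \<bullet> (A *v v) = 0"
    by (simp add: inner_add_right transpose_vector_inner[of v "transpose A"])
  then show "v = 0" by (metis add_nonneg_eq_0_iff inner_eq_zero_iff inner_ge_zero)
qed

lemma subspace_graph: "subspace (graph (A :: real^'m^'m))"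
  by (auto simp: subspace_def graph_def matrix_vector_right_distrib matrix_vector_mult_scaleR zero_prod_def)

text \<open>\<open>z w\<close> solves the normal equations of the least squares problem. The formula
  makes the projection onto a graph as regular in \<open>A\<close> as matrix inversion.\<close>

lemma closest_point_graph:
  fixes A :: "real^'m^'m"
  defines "z \<equiv> \<lambda>w. matrix_inv (mat 1 + transpose A ** A) *v (fst w + transpose A *v snd w)"
  shows "closest_point (graph A) w = (z w, A *v z w)"
proof (rule subspace_closest_point(3)[OF subspace_graph])
  show "(z w, A *v z w) \<in> graph A" by (auto simp: graph_def)
  fix x assume "x \<in> graph A"
  then obtain u where x: "x = (u, A *v u)" by (auto simp: graph_def)
  have "z w + transpose A *v (A *v z w) = fst w + transpose A *v snd w"
    using matrix_inv_vector(1)[OF gram_invertible, of A "fst w + transpose A *v snd w"]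
    by (simp add: z_def matrix_vector_mult_add_rdistrib flip: matrix_vector_mul_assoc)
  then have "(z w + transpose A *v (A *v z w)) \<bullet> u = (fst w + transpose A *v snd w) \<bullet> u" by simp
  then show "(w - (z w, A *v z w)) \<bullet> x = 0"
    using transpose_vector_inner[of "A *v z w" A u] transpose_vector_inner[of "snd w" A u]
    by (simp add: x inner_prod_def inner_diff_left inner_add_left)
qed

lemma transpose_bounded_linear: "bounded_linear (transpose :: real^'n^'m \<Rightarrow> real^'m^'n)"
proof -
  have "linear (transpose :: real^'n^'m \<Rightarrow> real^'m^'n)"
    by (rule linearI) (simp_all add: transpose_def vec_eq_iff)
  then show ?thesis by (simp add: linear_conv_bounded_linear)
qed

lemma continuous_on_closest_point_graph:
  fixes f :: "'p::topological_space \<Rightarrow> real^'m^'m"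
  assumes "continuous_on S f"
  shows "continuous_on S (\<lambda>p. closest_point (graph (f p)) w)"
  unfolding closest_point_graph
  by (intro continuous_intros gram_invertible assms bounded_linear.continuous_on[OF transpose_bounded_linear])

lemma graph_lag_family:
  assumes "continuous_on S f" "f ` S \<subseteq> Sp"
  shows "gr.lag_family S (\<lambda>p. graph (f p))"
  unfolding gr.lag_family_def using assms continuous_on_closest_point_graph lagrangian_graph by blast

lemma graph_Int_diagonal: "graph A \<inter> diagonal = (\<lambda>x. (x, x)) ` {v. (A - mat 1) *v v = 0}"
  by (auto simp: graph_def diagonal_def matrix_vector_mult_diff_rdistrib)

lemma dim_graph_Int_diagonal: "dim (diagonal \<inter> graph A) = dim {v. (A - mat 1) *v v = 0}"
proof -
  have "subspace {v. (A - mat 1) *v v = 0}" by (rule linear_subspace_kernel) simp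
  then show ?thesis
    unfolding Int_commute[of diagonal] graph_Int_diagonal
    by (intro dim_image_inj) (auto intro!: linearI inj_onI)
qed

text \<open>The inequality behind the proof: if \<^term>\<open>A *v (rotation e *v x) = x\<close>, then the component of
  \<^term>\<open>x\<close> in the kernel of \<^term>\<open>A - mat 1\<close> is of order \<^term>\<open>e\<close>, and so is
  \<^term>\<open>(A - mat 1) *v x\<close>.\<close>

lemma rotation_perturbation_injective:
  fixes A :: "real \<Rightarrow> real^('n::finite + 'n)^('n + 'n)"
  assumes A: "continuous_on {0..1} A" "A ` {0..1} \<subseteq> Sp"
    and ker: "\<And>s. s \<in> {0..1} \<Longrightarrow> {v. A s *v v = v} = K"
  obtains d where "d > 0"
    "\<And>s e x. s \<in> {0..1} \<Longrightarrow> 0 < \<bar>e\<bar> \<Longrightarrow> \<bar>e\<bar> < d \<Longrightarrow> A s *v (rotation e *v x) = x \<Longrightarrow> x = 0"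
proof -
  have K: "K = {v. (A 0 - mat 1) *v v = 0}" using ker[of 0] by (auto simp: matrix_vector_mult_diff_rdistrib)
  have sK: "subspace K" unfolding K by (rule linear_subspace_kernel) simp
  define P where "P = closest_point K"
  have lP: "linear P" unfolding P_def by (rule linear_closest_point[OF sK])
  have PK: "P x \<in> K" and Pdot: "k \<in> K \<Longrightarrow> (x - P x) \<bullet> k = 0" for x k
    using subspace_closest_point[OF sK] by (auto simp: P_def)
  \<comment> \<open>\<open>h\<close> vanishes only if \<open>x\<close> is fixed by
    \<open>A s\<close>, hence in \<open>K\<close>, and also orthogonal to \<open>K\<close>. On the
    compact product of interval and sphere it has a positive minimum \<open>c\<close>, uniform in
    \<open>s\<close> because all \<open>A s\<close> share the same \<open>K\<close>.\<close>
  define h where "h = (\<lambda>(s, x). norm (A s *v x - x) + norm (P x))"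
  have hcont: "continuous_on ({0..1} \<times> sphere 0 1) h"
    unfolding h_def case_prod_unfold
    by (intro continuous_intros continuous_on_compose2[OF A(1)]
        linear_continuous_on_compose[OF _ lP]) auto
  have comp: "compact ({0..1::real} \<times> sphere (0 :: real^('n + 'n)) 1)" by (intro compact_Times) auto
  have ne: "{0..1::real} \<times> sphere (0 :: real^('n + 'n)) 1 \<noteq> {}" by simp
  obtain p where p: "p \<in> {0..1} \<times> sphere 0 1" "\<And>q. q \<in> {0..1} \<times> sphere 0 1 \<Longrightarrow> h p \<le> h q"
    using continuous_attains_inf[OF comp ne hcont] by auto
  define c where "c = h p"
  have "c > 0"
  proof -
    obtain s x where sx: "p = (s, x)" "s \<in> {0..1}" "norm x = 1" using p(1) by auto
    have "h p \<noteq> 0"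
    proof
      assume "h p = 0"
      then have 0: "A s *v x = x" "P x = 0" by (auto simp: h_def sx add_nonneg_eq_0_iff)
      then have "x \<in> K" using ker[OF sx(2)] by auto
      then have "x = 0" using Pdot[of x x] 0(2) by simp
      then show False using sx by simp
    qed
    then show ?thesis unfolding c_def h_def by (auto simp: case_prod_unfold less_le)
  qed
  have hc: "c * norm x \<le> norm (A s *v x - x) + norm (P x)" if "s \<in> {0..1}" for s x
  proof (cases "x = 0")
    case False
    have "c \<le> h (s, x /\<^sub>R norm x)" unfolding c_def using False that by (intro p(2)) auto
    also have "h (s, x /\<^sub>R norm x) = (norm (A s *v x - x) + norm (P x)) / norm x"
      by (simp add: h_def matrix_vector_mult_scaleR linear_cmul[OF lP] divide_inverse distrib_left mult.commute flip: scaleR_diff_right)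
    finally show ?thesis using False by (simp add: field_simps)
  qed simp
  have "compact (A ` {0..1})" using A(1) by (intro compact_continuous_image) auto
  then obtain B where B: "B > 0" "\<And>s. s \<in> {0..1} \<Longrightarrow> norm (A s) \<le> B"
    using compact_imp_bounded bounded_pos by (metis imageI)
  \<comment> \<open>The two terms will bound \<open>norm (A s *v x - x)\<close> and
    \<open>norm (P x)\<close> relative to \<open>norm x\<close>. The quotient tends to 0 since it
    equals \<open>\<bar>sin e\<bar> / (1 + cos e)\<close> for small nonzero
    \<open>e\<close>.\<close>
  have "((\<lambda>e::real. B * (\<bar>1 - cos e\<bar> + \<bar>sin e\<bar>) + \<bar>1 - cos e\<bar> / \<bar>sin e\<bar>) \<longlongrightarrow> 0) (at 0)"
  proof -
    have 1: "((\<lambda>e::real. B * (\<bar>1 - cos e\<bar> + \<bar>sin e\<bar>)) \<longlongrightarrow> B * (\<bar>1 - cos 0\<bar> + \<bar>sin 0\<bar>)) (at 0)"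
      by (intro tendsto_intros)
    have "((\<lambda>e::real. \<bar>sin e\<bar> / (1 + cos e)) \<longlongrightarrow> \<bar>sin 0\<bar> / (1 + cos 0)) (at 0)"
      by (intro tendsto_intros) auto
    moreover have "\<forall>\<^sub>F e::real in at 0. \<bar>sin e\<bar> / (1 + cos e) = \<bar>1 - cos e\<bar> / \<bar>sin e\<bar>"
    proof -
      have "\<forall>\<^sub>F e::real in at 0. e \<in> {-1<..<1}" by (intro eventually_at_in_open') auto
      moreover have "\<forall>\<^sub>F e::real in at 0. e \<noteq> 0" by (simp add: eventually_at_filter)
      ultimately show ?thesis
      proof eventually_elim
        case (elim e)
        have "-pi/2 < e" "e < pi/2" using elim pi_gt3 by auto
        then have c: "cos e > 0" by (intro cos_gt_zero_pi) auto
        have "sin e \<noteq> 0" using elim sin_eq_0_pi[of e] pi_gt3 by auto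
        moreover have "\<bar>1 - cos e\<bar> * (1 + cos e) = \<bar>sin e\<bar> * \<bar>sin e\<bar>"
          using sin_cos_squared_add3[of e] by (simp add: algebra_simps)
        ultimately show ?case using c by (simp add: field_simps)
      qed
    qed
    ultimately have "((\<lambda>e::real. \<bar>1 - cos e\<bar> / \<bar>sin e\<bar>) \<longlongrightarrow> \<bar>sin 0\<bar> / (1 + cos 0)) (at 0)"
      by (rule Lim_transform_eventually)
    from tendsto_add[OF 1 this] show ?thesis by simp
  qed
  then have "\<forall>\<^sub>F e::real in at 0. B * (\<bar>1 - cos e\<bar> + \<bar>sin e\<bar>) + \<bar>1 - cos e\<bar> / \<bar>sin e\<bar> < c"
    using \<open>c > 0\<close> by (rule order_tendstoD(2))
  then obtain d0 where d0: "d0 > 0" "\<And>e::real. e \<noteq> 0 \<Longrightarrow> \<bar>e\<bar> < d0 \<Longrightarrow> B * (\<bar>1 - cos e\<bar> + \<bar>sin e\<bar>) + \<bar>1 - cos e\<bar> / \<bar>sin e\<bar> < c"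
    unfolding eventually_at by (auto simp: dist_real_def)
  show ?thesis
  proof (rule that[of "min d0 1"])
    show "min d0 1 > 0" using d0 by simp
    fix s e x assume s: "s \<in> {0..1}" and e: "0 < \<bar>e\<bar>" "\<bar>e\<bar> < min d0 1" and fixed: "A s *v (rotation e *v x) = x"
    have As: "A s \<in> Sp" using A(2) s by auto
    have "- pi < e" "e < pi" using e pi_gt3 by linarith+
    then have sin: "sin e \<noteq> 0" using e sin_eq_0_pi[of e] by auto
    have "norm (P x) \<le> \<bar>1 - cos e\<bar> / \<bar>sin e\<bar> * norm x"
    proof -
      let ?k = "P x"
      have "A s *v ?k = ?k" using PK ker[OF s] by blast
      \<comment> \<open>\<open>A s\<close> is symplectic and fixes \<open>?k\<close>, so pairing
        \<open>?k\<close> with \<open>x = A s *v (rotation e *v x)\<close> eliminates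
        \<open>A s\<close>. The \<open>J0\<close>-part of the rotation turns \<open>omega0\<close>
        into the inner product, which measures the projection \<open>?k\<close> of
        \<open>x\<close>.\<close>
      then have "omega0 ?k x = omega0 ?k (rotation e *v x)" using SpD[OF As, of ?k "rotation e *v x"] fixed by simp
      then have "sin e * (?k \<bullet> x) = (1 - cos e) * omega0 ?k x"
        by (simp add: rotation_vector omega0_J0 algebra_simps)
      moreover have "?k \<bullet> x = norm ?k * norm ?k"
      proof -
        have "(x - ?k) \<bullet> ?k = 0" by (rule Pdot[OF PK])
        then have "x \<bullet> ?k = ?k \<bullet> ?k" by (simp add: inner_diff_left)
        then show ?thesis by (simp add: inner_commute[of ?k x] dot_square_norm power2_eq_square)
      qed
      ultimately have "\<bar>sin e\<bar> * (norm ?k * norm ?k) = \<bar>1 - cos e\<bar> * \<bar>omega0 ?k x\<bar>"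
        by (metis abs_mult abs_mult_self_eq abs_norm_cancel)
      also have "\<dots> \<le> \<bar>1 - cos e\<bar> * (norm ?k * norm x)" by (intro mult_left_mono omega0_le) simp
      finally have "norm ?k * (\<bar>sin e\<bar> * norm ?k) \<le> norm ?k * (\<bar>1 - cos e\<bar> * norm x)" by (simp add: algebra_simps)
      then have "?k = 0 \<or> \<bar>sin e\<bar> * norm ?k \<le> \<bar>1 - cos e\<bar> * norm x" by (auto simp: mult_le_cancel_left)
      moreover have "0 \<le> \<bar>1 - cos e\<bar> * norm x" by simp
      ultimately have "\<bar>sin e\<bar> * norm ?k \<le> \<bar>1 - cos e\<bar> * norm x" by (metis mult_zero_right norm_zero)
      then show ?thesis using sin by (simp add: field_simps)
    qed
    moreover have "norm (A s *v x - x) \<le> B * (\<bar>1 - cos e\<bar> + \<bar>sin e\<bar>) * norm x"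
    proof -
      have "A s *v x - x = A s *v (x - rotation e *v x)" using fixed by (simp add: matrix_vector_mult_diff_distrib)
      also have "norm \<dots> \<le> B * norm (x - rotation e *v x)"
        using norm_matrix_vector_le[of "A s" "x - rotation e *v x"] B(2)[OF s] by (meson mult_right_mono norm_ge_zero order_trans)
      also have "x - rotation e *v x = (1 - cos e) *\<^sub>R x - sin e *\<^sub>R (J0 *v x)" by (simp add: rotation_vector algebra_simps)
      also have "norm \<dots> \<le> (\<bar>1 - cos e\<bar> + \<bar>sin e\<bar>) * norm x"
        by (rule order_trans[OF norm_triangle_ineq4]) (simp add: norm_J0 distrib_right)
      finally show ?thesis using B(1) by (simp add: mult_left_mono)
    qed
    ultimately have "c * norm x \<le> (B * (\<bar>1 - cos e\<bar> + \<bar>sin e\<bar>) + \<bar>1 - cos e\<bar> / \<bar>sin e\<bar>) * norm x"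
      using hc[OF s, of x] by (simp add: distrib_right)
    moreover have "B * (\<bar>1 - cos e\<bar> + \<bar>sin e\<bar>) + \<bar>1 - cos e\<bar> / \<bar>sin e\<bar> < c" using d0 e by auto
    ultimately show "x = 0" by (metis mult_le_cancel_right norm_le_zero_iff not_le)
  qed
qed

section \<open>The index of a path of symplectic matrices as a Maslov index\<close>

text \<open>Translates the pullback topology into continuity of \<open>closest_point (h p) w\<close>
  for each \<open>w\<close>. The topology on functions is that of pointwise convergence, so these
  coordinates suffice, here and for the converse below.\<close>

lemma continuous_map_lagrangian_grassmannian:
  assumes "continuous_map (top_of_set S) (lagrangian_grassmannian omega_bar) h"
  shows "gr.lag_family S h"
proof -
  have "continuous_map (lagrangian_grassmannian omega_bar) euclidean (id \<circ> closest_point)"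
    unfolding lagrangian_grassmannian_def by (intro continuous_map_pullback) simp
  from continuous_map_compose[OF assms this] have "continuous_on S (\<lambda>p. closest_point (h p))"
    by (simp add: o_def)
  then have "continuous_on S (\<lambda>p. closest_point (h p) w)" for w
    by (rule continuous_on_product_then_coordinatewise)
  moreover have "lagrangian omega_bar (h p)" if "p \<in> S" for p
    using assms that unfolding continuous_map_def lagrangian_grassmannian_def topspace_pullback_topology by auto
  ultimately show ?thesis by (simp add: gr.lag_family_def)
qed

lemma lag_family_continuous_map:
  assumes "gr.lag_family S h"
  shows "continuous_map (top_of_set S) (lagrangian_grassmannian omega_bar) h"
  unfolding lagrangian_grassmannian_def
proof (rule continuous_map_pullback')
  have "continuous_on S (\<lambda>p. closest_point (h p))"
    using assms unfolding gr.lag_family_def by (intro continuous_on_coordinatewise_then_product) blast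
  then show "continuous_map (top_of_set S) euclidean (closest_point \<circ> h)" by (simp add: o_def)
qed (use assms in \<open>auto simp: gr.lag_family_def\<close>)

lemma lagrangian_homotopic_maslov:
  assumes "lagrangian omega_bar L" "a \<le> b" "lagrangian_homotopic omega_bar a b K K'"
  shows "gr.maslov L a b K = gr.maslov L a b K'"
proof -
  obtain h where h: "continuous_map (prod_topology (top_of_set {0..1::real}) (top_of_set {a..b})) (lagrangian_grassmannian omega_bar) h"
    "\<forall>x. h (0, x) = K x" "\<forall>x. h (1, x) = K' x" "\<forall>t\<in>{0..1}. h (t, a) = K a \<and> h (t, b) = K b"
    using assms(3) unfolding lagrangian_homotopic_def homotopic_with_def by auto
  have "gr.lag_family ({0..1} \<times> {a..b}) h"
    using h(1) by (intro continuous_map_lagrangian_grassmannian) (simp add: prod_topology_subtopology_eu)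
  then have "gr.lag_family ({0..1} \<times> {a..b}) (\<lambda>(s, t). h (s, t))" by simp
  from gr.maslov_homotopic[OF assms(1) this assms(2)] show ?thesis using h by simp
qed

lemma graph_lagrangian_homotopic:
  fixes h :: "real \<times> real \<Rightarrow> real^('n::finite + 'n)^('n + 'n)"
  assumes h: "continuous_on ({0..1} \<times> {a..b}) h" "h ` ({0..1} \<times> {a..b}) \<subseteq> Sp" and ab: "a \<le> b"
    and f: "\<And>t. t \<in> {a..b} \<Longrightarrow> h (0, t) = f t" "\<And>t. t \<in> {a..b} \<Longrightarrow> h (1, t) = g t"
    and ends: "\<And>s. s \<in> {0..1} \<Longrightarrow> h (s, a) = f a" "\<And>s. s \<in> {0..1} \<Longrightarrow> h (s, b) = f b"
  shows "lagrangian_homotopic omega_bar a b (\<lambda>t. graph (f t)) (\<lambda>t. graph (g t))"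
proof -
  have "gr.lag_family ({0..1} \<times> {a..b}) (\<lambda>p. graph (h p))" by (rule graph_lag_family[OF h])
  then have "continuous_map (prod_topology (top_of_set {0..1::real}) (top_of_set {a..b})) (lagrangian_grassmannian omega_bar) (\<lambda>p. graph (h p))"
    unfolding prod_topology_subtopology_eu by (rule lag_family_continuous_map)
  then show ?thesis
    unfolding lagrangian_homotopic_def
    by (subst homotopic_with) (use f ends ab in \<open>auto intro!: exI[of _ "\<lambda>p. graph (h p)"]\<close>)
qed

lemma smooth_on_Icc_has_derivative:
  assumes "smooth_on_Icc a b f" "t \<in> {a..b}"
  shows "\<exists>D. (f has_vector_derivative D) (at t within {a..b})"
proof -
  obtain D where "D 0 = f" "\<forall>k. \<forall>t\<in>{a..b}. (D k has_vector_derivative D (Suc k) t) (at t within {a..b})"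
    using assms(1) unfolding smooth_on_Icc_def by blast
  then show ?thesis using assms(2) by metis
qed

lemma smooth_lagrangian_path_family:
  assumes "smooth_lagrangian_path omega_bar a b K"
  shows "gr.lag_family {a..b} K" "t \<in> {a..b} \<Longrightarrow> gr.lag_differentiable {a..b} K t"
proof -
  have d: "\<exists>D. ((\<lambda>t. closest_point (K t) w) has_vector_derivative D) (at t within {a..b})" if "t \<in> {a..b}" for t w
    using assms that smooth_on_Icc_has_derivative unfolding smooth_lagrangian_path_def by blast
  then have "continuous_on {a..b} (\<lambda>t. closest_point (K t) w)" for w
    unfolding continuous_on_eq_continuous_within by (metis has_vector_derivative_continuous)
  then show "gr.lag_family {a..b} K"
    using assms by (simp add: gr.lag_family_def smooth_lagrangian_path_def)
  show "t \<in> {a..b} \<Longrightarrow> gr.lag_differentiable {a..b} K t"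
    using d by (simp add: gr.lag_differentiable_def)
qed

lemma regular_rs_index_eq_maslov:
  assumes "a < b" "smooth_lagrangian_path omega_bar a b K" "regular_crossings omega_bar diagonal a b K"
  shows "regular_rs_index omega_bar diagonal a b K = of_int (gr.maslov diagonal a b K) / 2"
  using gr.maslov_eq_regular_rs_index[OF lagrangian_diagonal assms(1) smooth_lagrangian_path_family[OF assms(2)] assms(3)] .

section \<open>Smoothing a path of symplectic matrices\<close>

lemma Ck_affine:
  assumes sub: "\<And>t. t \<in> S \<Longrightarrow> \<alpha> * t + \<beta> \<in> T"
  shows "Ck k T f \<Longrightarrow> Ck k S (\<lambda>t. f (\<alpha> * t + \<beta>))"
proof (induction k arbitrary: f)
  case 0
  then show ?case using sub
    by (auto intro!: continuous_on_compose2[where g = f and t = T] continuous_intros)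
next
  case (Suc k)
  then obtain f' where f': "\<forall>t\<in>T. (f has_vector_derivative f' t) (at t within T)" "Ck k T f'" by auto
  have "((\<lambda>t. f (\<alpha> * t + \<beta>)) has_vector_derivative \<alpha> *\<^sub>R f' (\<alpha> * t + \<beta>)) (at t within S)" if t: "t \<in> S" for t
  proof -
    have 1: "((\<lambda>t. \<alpha> * t + \<beta>) has_vector_derivative \<alpha>) (at t within S)"
      by (auto intro!: derivative_eq_intros)
    have 2: "(f has_vector_derivative f' (\<alpha> * t + \<beta>)) (at (\<alpha> * t + \<beta>) within (\<lambda>t. \<alpha> * t + \<beta>) ` S)"
      by (rule has_vector_derivative_within_subset[OF f'(1)[rule_format, OF sub[OF t]]]) (use sub in auto)
    show ?thesis using vector_diff_chain_within[OF 1 2] by (simp add: o_def)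
  qed
  moreover have "Ck k S (\<lambda>t. \<alpha> *\<^sub>R f' (\<alpha> * t + \<beta>))"
    using Ck_linear[OF bounded_linear_scaleR_right Suc.IH[OF f'(2)]] .
  ultimately show ?case by (auto intro: exI[of _ "\<lambda>t. \<alpha> *\<^sub>R f' (\<alpha> * t + \<beta>)"])
qed

lemma Ck_matrix_mult:
  "Ck k S f \<Longrightarrow> Ck k S g \<Longrightarrow> Ck k S (\<lambda>t. (f t :: real^'n^'m) ** (g t :: real^'k^'n))"
  by (rule Ck_bilinear[OF bounded_bilinear_matrix_matrix])

lemma Ck_scaleR: "Ck k S f \<Longrightarrow> Ck k S g \<Longrightarrow> Ck k S (\<lambda>t. f t *\<^sub>R g t)"
  by (rule Ck_bilinear[OF bounded_bilinear_scaleR])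

lemma Ck_diff: "Ck k S f \<Longrightarrow> Ck k S g \<Longrightarrow> Ck k S (\<lambda>t. f t - g t)"
  using Ck_add[OF _ Ck_linear[OF bounded_linear_minus[OF bounded_linear_ident]], of k S f g] by simp

lemma Ck_cay:
  assumes "Ck k S f" "\<And>t. t \<in> S \<Longrightarrow> small_matrix (f t)"
  shows "Ck k S (\<lambda>t. cay (f t))"
  unfolding cay_def using assms small_matrix_invertible
  by (intro Ck_matrix_mult Ck_matrix_inv Ck_diff Ck_add Ck_const) auto

definition smoothing :: "real \<Rightarrow> real \<Rightarrow> (real \<Rightarrow> real^('n::finite + 'n)^('n + 'n)) \<Rightarrow> (real \<times> real \<Rightarrow> real^('n + 'n)^('n + 'n)) \<Rightarrow> bool" where
  "smoothing a b \<psi> h \<longleftrightarrow> continuous_on ({0..1} \<times> {a..b}) h \<and> h ` ({0..1} \<times> {a..b}) \<subseteq> Sp \<and>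
     (\<forall>t\<in>{a..b}. h (0, t) = \<psi> t) \<and> (\<forall>s\<in>{0..1}. h (s, a) = \<psi> a \<and> h (s, b) = \<psi> b) \<and> Csmooth {a..b} (\<lambda>t. h (1, t))"

text \<open>In the Cayley chart centred at \<open>\<psi> u\<close> the path becomes
  \<open>X t\<close> in a convex set of small elements of a linear space. The linear homotopy to the
  segment from \<open>X u = 0\<close> to \<open>X v\<close> therefore stays in the chart.\<close>

lemma smoothing_local:
  fixes \<psi> :: "real \<Rightarrow> real^('n::finite + 'n)^('n + 'n)"
  assumes uv: "u < v" and \<psi>: "continuous_on {u..v} \<psi>" "\<psi> ` {u..v} \<subseteq> Sp"
    and small: "\<And>t. t \<in> {u..v} \<Longrightarrow> small_matrix (matrix_inv (\<psi> u) ** \<psi> t - mat 1)"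
  shows "\<exists>h. smoothing u v \<psi> h"
proof -
  define A where "A t = matrix_inv (\<psi> u) ** \<psi> t" for t
  define X where "X t = cay_inv (A t)" for t
  define r where "r t = (t - u) / (v - u)" for t
  define h where "h = (\<lambda>(s, t). \<psi> u ** cay ((1 - s) *\<^sub>R X t + s *\<^sub>R (r t *\<^sub>R X v)))"
  have \<psi>S: "\<psi> t \<in> Sp" if "t \<in> {u..v}" for t using \<psi>(2) that by auto
  have u: "u \<in> {u..v}" and v: "v \<in> {u..v}" using uv by auto
  have AS: "A t \<in> Sp" if "t \<in> {u..v}" for t unfolding A_def using \<psi>S u that by (intro Sp_mult Sp_inv) auto
  have \<psi>A: "\<psi> u ** A t = \<psi> t" for t
    unfolding A_def using matrix_inv_works(1)[OF Sp_invertible[OF \<psi>S[OF u]]] by (simp add: matrix_mul_assoc)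
  have Xs: "small_matrix (X t)" "X t \<in> sp_algebra" "cay (X t) = A t" if "t \<in> {u..v}" for t
    using small[OF that] AS[OF that] unfolding X_def A_def[symmetric]
    by (auto intro: cay_inv_small cay_inv_sp_algebra cay_cay_inv)
  have r: "0 \<le> r t" "r t \<le> 1" if "t \<in> {u..v}" for t using that uv by (auto simp: r_def field_simps)
  have sm: "small_matrix ((1 - s) *\<^sub>R X t + s *\<^sub>R (r t *\<^sub>R X v))" if "s \<in> {0..1}" "t \<in> {u..v}" for s t
    using that Xs(1) r v by (intro small_matrix_convex small_matrix_scaleR) auto
  have cA: "continuous_on {u..v} A" unfolding A_def by (intro continuous_intros \<psi>(1))
  have cX: "continuous_on {u..v} X"
    unfolding X_def using cA small by (intro continuous_on_cay_inv) (auto simp: A_def)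
  have Au: "A u = mat 1" unfolding A_def using matrix_inv_works(2)[OF Sp_invertible[OF \<psi>S[OF u]]] .
  have Xu: "X u = 0" unfolding X_def Au by (rule cay_inv_1)
  have c1: "continuous_on ({0..1} \<times> {u..v}) (\<lambda>p. X (snd p))"
    by (rule continuous_on_compose2[OF cX]) (auto intro!: continuous_intros)
  have "continuous_on ({0..1} \<times> {u..v}) h"
    unfolding h_def case_prod_unfold using sm uv
    by (intro continuous_on_matrix_matrix continuous_on_const continuous_on_cay continuous_intros c1)
      (auto simp: r_def intro!: continuous_intros)
  moreover have "h ` ({0..1} \<times> {u..v}) \<subseteq> Sp"
    unfolding h_def using sm Xs(2) \<psi>S u v
    by (auto intro!: Sp_mult cay_Sp sp_algebra_add sp_algebra_scaleR small_matrix_invertible)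
  moreover have "\<forall>t\<in>{u..v}. h (0, t) = \<psi> t" using Xs(3) \<psi>A by (simp add: h_def)
  moreover have "\<forall>s\<in>{0..1}. h (s, u) = \<psi> u \<and> h (s, v) = \<psi> v"
  proof
    fix s :: real assume "s \<in> {0..1}"
    have "(1 - s) *\<^sub>R X v + s *\<^sub>R (r v *\<^sub>R X v) = X v" using uv by (simp add: r_def algebra_simps)
    then show "h (s, u) = \<psi> u \<and> h (s, v) = \<psi> v"
      using Xs(3)[OF v] \<psi>A[of v] by (simp add: h_def Xu r_def cay_0)
  qed
  moreover have "Csmooth {u..v} (\<lambda>t. h (1, t))"
    unfolding Csmooth_def
  proof
    fix k
    have rk: "Ck k {u..v} r"
      using Ck_affine[of "{u..v}" "1 / (v - u)" "- u / (v - u)" UNIV k "\<lambda>t. t", OF _ Ck_ident]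
      by (rule Ck_cong[rotated]) (auto simp: r_def diff_divide_distrib)
    have "Ck k {u..v} (\<lambda>t. \<psi> u ** cay (r t *\<^sub>R X v))"
      using Xs(1)[OF v] r by (intro Ck_matrix_mult Ck_const Ck_cay Ck_scaleR rk small_matrix_scaleR) auto
    then show "Ck k {u..v} (\<lambda>t. h (1, t))" by (simp add: h_def)
  qed
  ultimately show ?thesis unfolding smoothing_def by blast
qed

text \<open>Two smoothings on adjacent intervals are not concatenated but multiplied: the path
  \<^term>\<open>(min t y, max t y)\<close> in the rectangle \<^term>\<open>{x..y} \<times> {y..z}\<close> is replaced by a
  straight segment.\<close>

lemma smoothing_glue:
  fixes \<psi> :: "real \<Rightarrow> real^('n::finite + 'n)^('n + 'n)"
  assumes xyz: "x < y" "y < z" and \<psi>y: "\<psi> y \<in> Sp"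
    and h1: "smoothing x y \<psi> h1" and h2: "smoothing y z \<psi> h2"
  shows "\<exists>h. smoothing x z \<psi> h"
proof -
  define r1 where "r1 t = (y - x) / (z - x) * t + (x - (y - x) / (z - x) * x)" for t
  define r2 where "r2 t = (z - y) / (z - x) * t + (y - (z - y) / (z - x) * x)" for t
  have r1e: "r1 t = x + (y - x) * ((t - x) / (z - x))" and r2e: "r2 t = y + (z - y) * ((t - x) / (z - x))" for t
    by (simp_all add: r1_def r2_def diff_divide_distrib algebra_simps)
  have r: "r1 t \<in> {x..y}" "r2 t \<in> {y..z}" if t: "t \<in> {x..z}" for t
  proof -
    have "0 \<le> (t - x) / (z - x)" "(t - x) / (z - x) \<le> 1" using t xyz by auto
    then have "c * ((t - x) / (z - x)) \<in> {0..c}" if "0 < c" for c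
      using that mult_left_le[of "(t - x) / (z - x)" c] by (simp del: times_divide_eq_right)
    from this[of "y - x"] this[of "z - y"] show "r1 t \<in> {x..y}" "r2 t \<in> {y..z}"
      using xyz unfolding r1e r2e atLeastAtMost_iff by linarith+
  qed
  have re: "r1 x = x" "r1 z = y" "r2 x = y" "r2 z = z" using xyz by (auto simp: r1e r2e)
  define p1 where "p1 s t = (1 - s) * min t y + s * r1 t" for s t
  define p2 where "p2 s t = (1 - s) * max t y + s * r2 t" for s t
  have p: "p1 s t \<in> {x..y}" "p2 s t \<in> {y..z}" if "s \<in> {0..1}" "t \<in> {x..z}" for s t
  proof -
    have "min t y \<in> {x..y}" "max t y \<in> {y..z}" using that xyz by auto
    then show "p1 s t \<in> {x..y}" "p2 s t \<in> {y..z}"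
      using r[OF that(2)] that(1) convexD_alt[of "{x..y}" "min t y" "r1 t" s] convexD_alt[of "{y..z}" "max t y" "r2 t" s]
      by (simp_all add: p1_def p2_def)
  qed
  \<comment> \<open>At \<open>s = 0\<close> one of the two arguments equals \<open>y\<close>, so the
    product collapses to \<open>\<psi> t\<close>. At \<open>s = 1\<close> both arguments are affine
    in \<open>t\<close> on the whole interval, so no corner appears at \<open>y\<close>.\<close>
  define h where "h = (\<lambda>(s, t). h1 (s, p1 s t) ** matrix_inv (\<psi> y) ** h2 (s, p2 s t))"
  note H1 = h1[unfolded smoothing_def] and H2 = h2[unfolded smoothing_def]
  note inv = matrix_inv_works[OF Sp_invertible[OF \<psi>y]]
  have "continuous_on ({0..1} \<times> {x..z}) h"
  proof -
    have c: "continuous_on ({0..1} \<times> {x..z}) (\<lambda>q. (fst q, p1 (fst q) (snd q)))"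
      "continuous_on ({0..1} \<times> {x..z}) (\<lambda>q. (fst q, p2 (fst q) (snd q)))"
      unfolding p1_def p2_def r1_def r2_def by (intro continuous_intros)+
    have "continuous_on ({0..1} \<times> {x..z}) (\<lambda>q. h1 (fst q, p1 (fst q) (snd q)))"
      using H1 p by (intro continuous_on_compose2[OF _ c(1)]) auto
    moreover have "continuous_on ({0..1} \<times> {x..z}) (\<lambda>q. h2 (fst q, p2 (fst q) (snd q)))"
      using H2 p by (intro continuous_on_compose2[OF _ c(2)]) auto
    ultimately show ?thesis unfolding h_def case_prod_unfold by (intro continuous_intros)
  qed
  moreover have "h ` ({0..1} \<times> {x..z}) \<subseteq> Sp"
  proof clarify
    fix s t :: real assume st: "s \<in> {0..1}" "t \<in> {x..z}"
    have "h1 (s, p1 s t) \<in> Sp" "h2 (s, p2 s t) \<in> Sp" using H1 H2 p[OF st] st by auto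
    then show "h (s, t) \<in> Sp" using \<psi>y by (simp add: h_def Sp_mult Sp_inv)
  qed
  moreover have "\<forall>t\<in>{x..z}. h (0, t) = \<psi> t"
  proof
    fix t assume t: "t \<in> {x..z}"
    have "h (0, t) = \<psi> (min t y) ** matrix_inv (\<psi> y) ** \<psi> (max t y)"
      using H1 H2 t xyz by (auto simp: h_def p1_def p2_def)
    moreover have "\<psi> t ** matrix_inv (\<psi> y) ** \<psi> y = \<psi> t" "\<psi> y ** matrix_inv (\<psi> y) ** \<psi> t = \<psi> t"
      using inv by (simp_all flip: matrix_mul_assoc[of "\<psi> t"])
    ultimately show "h (0, t) = \<psi> t" by (cases "t \<le> y") (simp_all add: min_def max_def)
  qed
  moreover have "\<forall>s\<in>{0..1}. h (s, x) = \<psi> x \<and> h (s, z) = \<psi> z"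
  proof
    fix s :: real assume s: "s \<in> {0..1}"
    have "p1 s x = x" "p2 s x = y" "p1 s z = y" "p2 s z = z"
      using xyz re by (auto simp: p1_def p2_def algebra_simps)
    then have "h (s, x) = \<psi> x ** (matrix_inv (\<psi> y) ** \<psi> y)" "h (s, z) = (\<psi> y ** matrix_inv (\<psi> y)) ** \<psi> z"
      using H1 H2 s by (simp_all add: h_def matrix_mul_assoc)
    then show "h (s, x) = \<psi> x \<and> h (s, z) = \<psi> z" using inv by simp
  qed
  moreover have "Csmooth {x..z} (\<lambda>t. h (1, t))"
    unfolding Csmooth_def
  proof
    fix k
    have c: "Ck k {x..y} (\<lambda>t. h1 (1, t))" "Ck k {y..z} (\<lambda>t. h2 (1, t))"
      using H1 H2 unfolding Csmooth_def by blast+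
    have "Ck k {x..z} (\<lambda>t. h1 (1, r1 t))"
      unfolding r1_def by (rule Ck_affine[OF r(1)[unfolded r1_def] c(1)])
    moreover have "Ck k {x..z} (\<lambda>t. h2 (1, r2 t))"
      unfolding r2_def by (rule Ck_affine[OF r(2)[unfolded r2_def] c(2)])
    ultimately have "Ck k {x..z} (\<lambda>t. h1 (1, r1 t) ** matrix_inv (\<psi> y) ** h2 (1, r2 t))"
      by (intro Ck_matrix_mult Ck_const)
    then show "Ck k {x..z} (\<lambda>t. h (1, t))" by (simp add: h_def p1_def p2_def)
  qed
  ultimately show ?thesis unfolding smoothing_def by blast
qed

text \<open>\<open>matrix_inv (\<psi> u) ** \<psi> t\<close> is jointly continuous and equals the
  identity on the diagonal, so intervals that are short enough around a given time fit into one
  Cayley chart; bisection and gluing do the rest.\<close>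

lemma smoothing_exists:
  fixes \<psi> :: "real \<Rightarrow> real^('n::finite + 'n)^('n + 'n)"
  assumes ab: "a < b" and \<psi>: "continuous_on {a..b} \<psi>" "\<psi> ` {a..b} \<subseteq> Sp"
  shows "\<exists>h. smoothing a b \<psi> h"
proof -
  define P where "P x y \<longleftrightarrow> (a \<le> x \<and> y \<le> b \<and> x < y \<longrightarrow> (\<exists>h. smoothing x y \<psi> h))" for x y
  have \<psi>S: "\<psi> t \<in> Sp" if "t \<in> {a..b}" for t using \<psi>(2) that by auto
  have "P a b"
    using less_imp_le[OF ab]
  proof (induction rule: Bolzano)
    case (trans x y z)
    show ?case
    proof (cases "x = y \<or> y = z")
      case True then show ?thesis using trans by auto
    next
      case False
      then have xyz: "x < y" "y < z" using trans by auto
      show ?thesis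
        unfolding P_def
      proof
        assume "a \<le> x \<and> z \<le> b \<and> x < z"
        then show "\<exists>h. smoothing x z \<psi> h"
        proof -
          have "\<psi> y \<in> Sp" using xyz \<open>a \<le> x \<and> z \<le> b \<and> x < z\<close> by (intro \<psi>S) auto
          moreover obtain h1 h2 where "smoothing x y \<psi> h1" "smoothing y z \<psi> h2"
            using trans(1,2) xyz \<open>a \<le> x \<and> z \<le> b \<and> x < z\<close> unfolding P_def by auto
          ultimately show ?thesis by (rule smoothing_glue[OF xyz])
        qed
      qed
    qed
  next
    case (local x)
    define g where "g = (\<lambda>(u, t). matrix_inv (\<psi> u) ** \<psi> t)"
    have c: "continuous_on ({a..b} \<times> {a..b}) g"
    proof -
      have "continuous_on ({a..b} \<times> {a..b}) (\<lambda>p. \<psi> (fst p))" "continuous_on ({a..b} \<times> {a..b}) (\<lambda>p. \<psi> (snd p))"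
        by (rule continuous_on_compose2[OF \<psi>(1)]; auto intro!: continuous_intros)+
      then show ?thesis
        unfolding g_def case_prod_unfold by (intro continuous_intros) (auto intro!: Sp_invertible \<psi>S)
    qed
    have gx: "g (x, x) = mat 1"
      using local matrix_inv_works(2)[OF Sp_invertible[OF \<psi>S[of x]]] by (simp add: g_def)
    obtain d where d: "d > 0" "\<And>q. q \<in> {a..b} \<times> {a..b} \<Longrightarrow> dist q (x, x) < d \<Longrightarrow> dist (g q) (mat 1) < 1/2"
      using c[unfolded continuous_on_iff, rule_format, of "(x, x)" "1/2"] local unfolding gx by auto
    show ?case
    proof (rule exI[of _ "d / 2"], intro conjI allI impI)
      show "d / 2 > 0" using d by simp
      fix u v assume uv: "u \<le> x \<and> x \<le> v \<and> v - u < d / 2"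
      show "P u v"
        unfolding P_def
      proof
        assume uvab: "a \<le> u \<and> v \<le> b \<and> u < v"
        show "\<exists>h. smoothing u v \<psi> h"
        proof (rule smoothing_local)
          show "u < v" using uvab by simp
          show "continuous_on {u..v} \<psi>" using uvab by (intro continuous_on_subset[OF \<psi>(1)]) auto
          show "\<psi> ` {u..v} \<subseteq> Sp" using uvab \<psi>S by auto
          fix t assume t: "t \<in> {u..v}"
          have "dist (u, t) (x, x) \<le> \<bar>u - x\<bar> + \<bar>t - x\<bar>"
            by (simp add: dist_Pair_Pair dist_real_def sqrt_sum_squares_le_sum_abs)
          also have "\<dots> < d" using uv t by auto
          finally have "dist (g (u, t)) (mat 1) < 1/2" using uvab t by (intro d(2)) auto
          then show "small_matrix (matrix_inv (\<psi> u) ** \<psi> t - mat 1)"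
            by (intro small_matrix_norm) (simp add: g_def dist_norm)
        qed
      qed
    qed
  qed
  then show ?thesis using ab by (simp add: P_def)
qed

lemma Csmooth_graph:
  fixes F :: "real \<Rightarrow> real^('n::finite + 'n)^('n + 'n)"
  assumes ab: "a < b" and F: "Csmooth {a..b} F" "F ` {a..b} \<subseteq> Sp"
  shows "smooth_lagrangian_path omega_bar a b (\<lambda>t. graph (F t))"
  unfolding smooth_lagrangian_path_def
proof (intro conjI ballI allI)
  show "lagrangian omega_bar (graph (F t))" if "t \<in> {a..b}" for t
    using F(2) that by (intro lagrangian_graph) auto
  fix w :: "(real^('n + 'n)) \<times> (real^('n + 'n))"
  show "smooth_on_Icc a b (\<lambda>t. closest_point (graph (F t)) w)"
  proof (rule Csmooth_imp_smooth_on_Icc[OF ab], unfold Csmooth_def, rule allI)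
    fix k
    have Fk: "Ck k {a..b} F" using F(1) unfolding Csmooth_def by blast
    have Tk: "Ck k {a..b} (\<lambda>t. transpose (F t))" by (rule Ck_linear[OF transpose_bounded_linear Fk])
    define z where "z t = matrix_inv (mat 1 + transpose (F t) ** F t) *v (fst w + transpose (F t) *v snd w)" for t
    note mv = Ck_bilinear[OF bounded_bilinear_matrix_vector]
    have zk: "Ck k {a..b} z"
      unfolding z_def
      by (intro mv Ck_matrix_inv gram_invertible Ck_add Ck_const Ck_matrix_mult Tk Fk)
    have "Ck k {a..b} (\<lambda>t. (z t, 0) + (0, F t *v z t))"
      by (intro Ck_add Ck_linear[OF bounded_linear_Pair[OF bounded_linear_ident bounded_linear_zero] zk]
          Ck_linear[OF bounded_linear_Pair[OF bounded_linear_zero bounded_linear_ident]] mv Fk zk)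
    then show "Ck k {a..b} (\<lambda>t. closest_point (graph (F t)) w)"
      by (simp add: closest_point_graph z_def)
  qed
qed

lemma J0_J0: "J0 ** J0 = (- mat 1 :: real^('n::finite + 'n)^('n + 'n))"
  by (simp add: matrix_eq J0_vector Omega0_Omega0 linear_neg[OF sp.linJ] uminus_matrix_vector flip: matrix_vector_mul_assoc)

lemma rotation_has_vector_derivative:
  assumes "(f has_real_derivative f') (at t within S)"
  shows "((\<lambda>s. rotation (f s)) has_vector_derivative f' *\<^sub>R (rotation (f t) ** J0)) (at t within S)"
proof -
  have d: "((\<lambda>s. cos (f s) *\<^sub>R mat 1 + sin (f s) *\<^sub>R J0) has_vector_derivative
      (- sin (f t) * f') *\<^sub>R mat 1 + (cos (f t) * f') *\<^sub>R J0) (at t within S)"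
    using assms
    by (intro has_vector_derivative_add has_vector_derivative_scaleR[where g = "\<lambda>_. _" and g' = 0, simplified]
        has_vector_derivative_const) (auto intro!: derivative_eq_intros simp: has_real_derivative_iff_has_vector_derivative[symmetric])
  have e: "f' *\<^sub>R (rotation (f t) ** J0) = (- sin (f t) * f') *\<^sub>R mat 1 + (cos (f t) * f') *\<^sub>R J0"
    by (simp add: rotation_def matrix_add_rdist bounded_bilinear.scaleR_left[OF bounded_bilinear_matrix_matrix] J0_J0
        scaleR_add_right scaleR_diff_right mult.commute)
  show ?thesis unfolding e using d by (simp only: rotation_def)
qed

text \<open>A smooth path \<^term>\<open>F\<close> is multiplied by \<^term>\<open>rotation (\<theta> t)\<close>, where \<^term>\<open>\<theta>\<close> is a quadratic polynomial
  vanishing at the end points, with large derivative except near the midpoint, where the value of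
  \<^term>\<open>\<theta>\<close> is chosen such that no crossing occurs.\<close>

lemma regular_representative:
  fixes \<psi> :: "real \<Rightarrow> real^('n::finite + 'n)^('n + 'n)"
  assumes ab: "a < b" and \<psi>: "continuous_on {a..b} \<psi>" "\<psi> ` {a..b} \<subseteq> Sp"
  obtains K where "smooth_lagrangian_path omega_bar a b K" "regular_crossings omega_bar diagonal a b K"
    "lagrangian_homotopic omega_bar a b (\<lambda>t. graph (\<psi> t)) K"
proof -
  obtain h where "smoothing a b \<psi> h" using smoothing_exists[OF ab \<psi>] by blast
  note h = this[unfolded smoothing_def]
  define F where "F t = h (1, t)" for t
  have hom1: "lagrangian_homotopic omega_bar a b (\<lambda>t. graph (\<psi> t)) (\<lambda>t. graph (F t))"
    using h ab by (intro graph_lagrangian_homotopic[of a b h]) (auto simp: F_def)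
  have FS: "F t \<in> Sp" if "t \<in> {a..b}" for t using h that by (auto simp: F_def)
  have Fs: "Csmooth {a..b} F" using h unfolding F_def[abs_def] by blast
  define F' where "F' t = vector_derivative F (at t within {a..b})" for t
  have F': "(F has_vector_derivative F' t) (at t within {a..b})" if "t \<in> {a..b}" for t
    unfolding F'_def using Csmooth_derivative(1)[OF ab Fs that] .
  have cF: "continuous_on {a..b} F"
    unfolding continuous_on_eq_continuous_within using F' has_vector_derivative_continuous by blast
  have "Ck 0 {a..b} F'"
    using Csmooth_derivative(2)[OF ab Fs] unfolding Csmooth_def F'_def by blast
  then have "compact (F' ` {a..b})" by (intro compact_continuous_image) auto
  then obtain C where C: "C > 0" "\<And>t. t \<in> {a..b} \<Longrightarrow> norm (F' t) \<le> C"
    using compact_imp_bounded bounded_pos by (metis imageI)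
  define c where "c = (a + b) / 2"
  have cab: "c \<in> {a..b}" using ab by (simp add: c_def)
  \<comment> \<open>Applied to the constant path at \<open>F c\<close>: a small nonzero angle
    \<open>\<theta>0\<close> leaves no fixed vector, and by openness neither do pairs of time and
    angle within \<open>\<epsilon>\<close> of \<open>(c, \<theta>0)\<close>.\<close>
  obtain d where d: "d > 0"
    "\<And>s e x. s \<in> {0..1::real} \<Longrightarrow> 0 < \<bar>e\<bar> \<Longrightarrow> \<bar>e\<bar> < d \<Longrightarrow> F c *v (rotation e *v x) = x \<Longrightarrow> x = 0"
    by (rule rotation_perturbation_injective[of "\<lambda>_. F c" "{v. F c *v v = v}"]) (use FS[OF cab] in auto)
  define \<theta>0 where "\<theta>0 = d / 2"
  have \<theta>0: "\<theta>0 > 0" "\<And>x. F c *v (rotation \<theta>0 *v x) = x \<Longrightarrow> x = 0" using d(1) d(2)[of 0 \<theta>0] by (auto simp: \<theta>0_def)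
  define S where "S = {a..b} \<times> (UNIV :: real set)"
  define D where "D p x = F (fst p) *v (rotation (snd p) *v x) - x" for p x
  have cD: "continuous_on S (\<lambda>p. D p x)" for x
  proof -
    have "continuous_on S (\<lambda>p. F (fst p))"
      by (rule continuous_on_compose2[OF cF]) (auto simp: S_def intro!: continuous_intros)
    then show ?thesis unfolding D_def by (intro continuous_intros)
  qed
  have lD: "linear (D p)" for p
    unfolding D_def by (intro linearI) (simp_all add: matrix_vector_right_distrib matrix_vector_mult_scaleR algebra_simps)
  have p0S: "(c, \<theta>0) \<in> S" using cab by (simp add: S_def)
  have iD: "\<And>x. D (c, \<theta>0) x = 0 \<Longrightarrow> x = 0" using \<theta>0(2) by (simp add: D_def)
  have tD: "\<And>x. ((\<lambda>p. D p x) \<longlongrightarrow> D (c, \<theta>0) x) (at (c, \<theta>0) within S)"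
    using cD p0S by (simp add: continuous_on_def)
  obtain m where m: "m > 0" "\<forall>\<^sub>F p in at (c, \<theta>0) within S. \<forall>x. m * norm x \<le> norm (D p x)"
    by (rule linear_family_inj_bound[OF always_eventually[OF allI[OF lD]] lD iD tD])
  then obtain \<epsilon> where \<epsilon>: "\<epsilon> > 0" "\<And>p. p \<in> S \<Longrightarrow> p \<noteq> (c, \<theta>0) \<Longrightarrow> dist p (c, \<theta>0) < \<epsilon> \<Longrightarrow> \<forall>x. m * norm x \<le> norm (D p x)"
    unfolding eventually_at by blast
  have noncross: "x = 0" if "p \<in> S" "dist p (c, \<theta>0) < \<epsilon>" "D p x = 0" for p x
  proof (cases "p = (c, \<theta>0)")
    case False
    then have "m * norm x \<le> 0" using \<epsilon>(2)[OF that(1) _ that(2)] that(3) by (metis norm_zero)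
    then show ?thesis using m(1) by (simp add: mult_le_0_iff)
  qed (use iD that in auto)
  \<comment> \<open>Adding \<open>2 * pi * real k\<close> to the midpoint angle does not change the
    rotation there but allows an arbitrarily steep parabola through 0 at both ends.
    \<open>\<rho>\<close> is dictated by \<open>\<theta> a = \<theta> b = 0\<close>, and
    \<open>k\<close> is so large that on the window \<open>\<bar>t - c\<bar> < C / \<rho>\<close>
    time and reduced angle stay within \<open>\<epsilon>\<close> of
    \<open>(c, \<theta>0)\<close>.\<close>
  obtain k :: nat where k: "(C + C\<^sup>2) / \<epsilon> * (b - a)\<^sup>2 < real k" using reals_Archimedean2 by blast
  define \<rho> where "\<rho> = 4 * (\<theta>0 + 2 * pi * real k) / (b - a)\<^sup>2"
  have ba: "(b - a)\<^sup>2 > 0" using ab by simp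
  have "(C + C\<^sup>2) / \<epsilon> < real k / (b - a)\<^sup>2" using k ba by (simp add: less_divide_eq)
  also have "real k \<le> 4 * (\<theta>0 + 2 * pi * real k)"
  proof -
    have "1 * real k \<le> (2 * pi) * real k" using pi_gt3 by (intro mult_right_mono) auto
    then show ?thesis using \<theta>0(1) by simp
  qed
  then have "real k / (b - a)\<^sup>2 \<le> \<rho>" unfolding \<rho>_def using ba by (intro divide_right_mono) auto
  finally have \<rho>\<epsilon>: "(C + C\<^sup>2) / \<epsilon> < \<rho>" .
  have "0 < (C + C\<^sup>2) / \<epsilon>" using C(1) \<epsilon>(1) by (simp add: add_pos_nonneg)
  then have \<rho>0: "\<rho> > 0" using \<rho>\<epsilon> by linarith
  have \<rho>C: "C / \<rho> + C\<^sup>2 / \<rho> < \<epsilon>" using \<rho>\<epsilon> \<rho>0 \<epsilon>(1) by (simp add: field_simps)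
  define \<theta> where "\<theta> t = \<theta>0 + 2 * pi * real k - \<rho> * (t - c)\<^sup>2" for t
  have sq: "(a - c)\<^sup>2 = (b - a)\<^sup>2 / 4" "(b - c)\<^sup>2 = (b - a)\<^sup>2 / 4"
    by (simp_all add: c_def power2_eq_square field_simps)
  have "\<rho> * ((b - a)\<^sup>2 / 4) = \<theta>0 + 2 * pi * real k" unfolding \<rho>_def using ba by simp
  then have \<theta>ab: "\<theta> a = 0" "\<theta> b = 0" unfolding \<theta>_def sq by simp_all
  have rot\<theta>: "rotation (\<theta> t) = rotation (\<theta>0 - \<rho> * (t - c)\<^sup>2)" for t
  proof -
    have "\<theta> t = (\<theta>0 - \<rho> * (t - c)\<^sup>2) + 2 * pi * real k" by (simp add: \<theta>_def)
    moreover have "sin (x + 2 * pi * real k) = sin x" "cos (x + 2 * pi * real k) = cos x" for x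
      by (simp_all add: sin_add cos_add mult.assoc[symmetric] sin_integer_2pi cos_integer_2pi)
    ultimately show ?thesis by (simp add: rotation_def)
  qed
  define G where "G t = F t ** rotation (\<theta> t)" for t
  have GS: "G t \<in> Sp" if "t \<in> {a..b}" for t unfolding G_def using FS[OF that] rotation_Sp by (rule Sp_mult)
  have c\<theta>: "continuous_on T \<theta>" for T unfolding \<theta>_def by (intro continuous_intros)
  have hom2: "lagrangian_homotopic omega_bar a b (\<lambda>t. graph (F t)) (\<lambda>t. graph (G t))"
  proof (rule graph_lagrangian_homotopic[of a b "\<lambda>(s, t). F t ** rotation (s * \<theta> t)"])
    have "continuous_on ({0..1} \<times> {a..b}) (\<lambda>p. F (snd p))"
      by (rule continuous_on_compose2[OF cF]) (auto intro!: continuous_intros)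
    moreover have "continuous_on ({0..1} \<times> {a..b}) (\<lambda>p::real \<times> real. fst p * \<theta> (snd p))"
      by (intro continuous_intros continuous_on_compose2[OF c\<theta>[of UNIV]]) auto
    ultimately show "continuous_on ({0..1} \<times> {a..b}) (\<lambda>(s, t). F t ** rotation (s * \<theta> t))"
      unfolding case_prod_unfold by (intro continuous_on_matrix_matrix continuous_on_rotation)
    show "(\<lambda>(s, t). F t ** rotation (s * \<theta> t)) ` ({0..1} \<times> {a..b}) \<subseteq> Sp"
      using FS rotation_Sp by (auto intro!: Sp_mult)
  qed (use ab in \<open>auto simp: rotation_0 \<theta>ab G_def\<close>)
  have \<theta>': "(\<theta> has_real_derivative (- 2 * \<rho> * (t - c))) (at t within {a..b})" for t
    unfolding \<theta>_def by (auto intro!: derivative_eq_intros)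
  have Gs: "Csmooth {a..b} G"
    unfolding Csmooth_def
  proof
    fix k
    have Fk: "Ck k {a..b} F" using Fs unfolding Csmooth_def by blast
    have "Ck k {a..b} \<theta>"
      unfolding \<theta>_def power2_eq_square
      by (intro Ck_diff Ck_add Ck_const Ck_bilinear[OF bounded_bilinear_mult] Ck_ident)
    then show "Ck k {a..b} G"
      unfolding G_def rotation_def
      using Ck_sin_cos[of k "{a..b}" \<theta>] by (intro Ck_matrix_mult Fk Ck_add Ck_scaleR Ck_const) auto
  qed
  define G' where "G' t = F t ** ((- 2 * \<rho> * (t - c)) *\<^sub>R (rotation (\<theta> t) ** J0)) + F' t ** rotation (\<theta> t)" for t
  have G': "(G has_vector_derivative G' t) (at t within {a..b})" if t: "t \<in> {a..b}" for t
    unfolding G_def G'_def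
    by (rule bounded_bilinear.has_vector_derivative[OF bounded_bilinear_matrix_matrix F'[OF t] rotation_has_vector_derivative[OF \<theta>']])
  have smooth: "smooth_lagrangian_path omega_bar a b (\<lambda>t. graph (G t))"
    using GS by (intro Csmooth_graph[OF ab Gs]) auto
  have reg: "regular_crossings omega_bar diagonal a b (\<lambda>t. graph (G t))"
    unfolding regular_crossings_def
  proof (intro ballI impI)
    fix t assume t: "t \<in> {a..b}" and cr: "crossing diagonal (\<lambda>t. graph (G t)) t"
    \<comment> \<open>No crossing occurs inside the window. Outside it the derivative of
      \<open>\<theta>\<close> has size \<open>2 * \<rho> * \<bar>t - c\<bar>\<close>, at least
      \<open>2 * C\<close>, which beats the bound \<open>C\<close> for \<open>F'\<close>.\<close>
    have far: "\<bar>t - c\<bar> \<ge> C / \<rho>"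
    proof (rule ccontr)
      assume "\<not> \<bar>t - c\<bar> \<ge> C / \<rho>"
      then have tc: "\<bar>t - c\<bar> < C / \<rho>" by simp
      have "(t - c)\<^sup>2 \<le> (C / \<rho>)\<^sup>2" using tc by (metis abs_ge_zero less_imp_le power2_abs power_mono)
      then have "\<rho> * (t - c)\<^sup>2 \<le> \<rho> * (C / \<rho>)\<^sup>2" using \<rho>0 by (intro mult_left_mono) auto
      also have "\<dots> = C\<^sup>2 / \<rho>" using \<rho>0 by (simp add: power2_eq_square)
      finally have q: "\<rho> * (t - c)\<^sup>2 \<le> C\<^sup>2 / \<rho>" .
      let ?p = "(t, \<theta>0 - \<rho> * (t - c)\<^sup>2)"
      have "dist ?p (c, \<theta>0) \<le> \<bar>t - c\<bar> + \<bar>(\<theta>0 - \<rho> * (t - c)\<^sup>2) - \<theta>0\<bar>"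
        unfolding dist_Pair_Pair dist_real_def by (simp only: fst_conv snd_conv sqrt_sum_squares_le_sum_abs power2_abs)
      also have "\<dots> = \<bar>t - c\<bar> + \<rho> * (t - c)\<^sup>2" using \<rho>0 by simp
      also have "\<dots> < \<epsilon>" using tc q \<rho>C by linarith
      finally have near: "dist ?p (c, \<theta>0) < \<epsilon>" .
      have "x = 0" if "G t *v x = x" for x
        using noncross[OF _ near, of x] that t by (simp add: S_def D_def G_def rot\<theta> matrix_vector_mul_assoc)
      then have "graph (G t) \<inter> diagonal = {0}"
        by (auto simp: graph_Int_diagonal matrix_vector_mult_diff_rdistrib zero_prod_def image_iff)
      then show False using cr by (simp add: crossing_def)
    qed
    show "nondegenerate_on (graph (G t) \<inter> diagonal) (velocity_form omega_bar a b (\<lambda>t. graph (G t)) t)"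
      unfolding nondegenerate_on_def
    proof (intro ballI impI)
      fix v assume v: "v \<in> graph (G t) \<inter> diagonal"
        and 0: "\<forall>w\<in>graph (G t) \<inter> diagonal. velocity_form omega_bar a b (\<lambda>t. graph (G t)) t v w = 0"
      obtain x where x: "v = (x, x)" "G t *v x = x"
        using v by (auto simp: graph_Int_diagonal matrix_vector_mult_diff_rdistrib)
      have ft: "(x, G t *v x) = v" using x by simp
      \<comment> \<open>Testing \<open>v\<close> against itself is enough. The curve with constant
        first component stays in the moving graph, so \<open>velocity_form_eq\<close> makes the form
        explicit as \<open>omega0 x (G' t *v x)\<close>.\<close>
      have "velocity_form omega_bar a b (\<lambda>t. graph (G t)) t v (x, G t *v x) = omega_bar v (0, G' t *v x)"
      proof (rule gr.velocity_form_eq[OF ab t smooth_lagrangian_path_family(1)[OF smooth] smooth_lagrangian_path_family(2)[OF smooth t],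
            where f = "\<lambda>s. (x, G s *v x)"])
        show "v \<in> graph (G t)" using v by blast
        show "(x, G t *v x) \<in> graph (G t)" by (auto simp: graph_def)
        show "\<forall>\<^sub>F s in at t within {a..b}. (x, G s *v x) \<in> graph (G s)" by (simp add: graph_def)
        show "((\<lambda>s. (x, G s *v x)) has_vector_derivative (0, G' t *v x)) (at t within {a..b})"
          using bounded_bilinear.has_vector_derivative[OF bounded_bilinear_matrix_vector G'[OF t] has_vector_derivative_const]
          by (intro has_vector_derivative_Pair has_vector_derivative_const) simp
      qed
      then have "omega_bar v (0, G' t *v x) = 0" using 0 v ft by simp
      then have z: "omega0 x (G' t *v x) = 0" by (simp add: x(1) omega_bar_def)
      \<comment> \<open>Because \<open>x = G t *v x\<close> and \<open>G t\<close> is symplectic,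
        the rotational part of \<open>G'\<close> contributes the derivative of
        \<open>\<theta>\<close> times \<open>x \<bullet> x\<close>; the remaining part is at most
        \<open>C * (x \<bullet> x)\<close>.\<close>
      have "omega0 x (F t *v (rotation (\<theta> t) *v (J0 *v x))) = omega0 (G t *v x) (G t *v (J0 *v x))"
        using x(2) by (simp add: G_def matrix_vector_mul_assoc matrix_mul_assoc)
      also have "\<dots> = x \<bullet> x" using SpD[OF GS[OF t]] by (simp add: omega0_J0)
      finally have "(- 2 * \<rho> * (t - c)) * (x \<bullet> x) + omega0 x (F' t *v (rotation (\<theta> t) *v x)) = 0"
        using z by (simp add: G'_def matrix_vector_mult_add_rdistrib scaleR_matrix_vector matrix_vector_mult_scaleR
            uminus_matrix_vector linear_neg[OF matrix_vector_mul_linear] flip: matrix_vector_mul_assoc)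
      then have "\<bar>(- 2 * \<rho> * (t - c)) * (x \<bullet> x)\<bar> = \<bar>omega0 x (F' t *v (rotation (\<theta> t) *v x))\<bar>"
        by (metis abs_minus_cancel eq_neg_iff_add_eq_0)
      also have "\<dots> \<le> norm x * (C * norm x)"
      proof -
        have "norm (F' t *v (rotation (\<theta> t) *v x)) \<le> norm (F' t) * norm x"
          using norm_matrix_vector_le[of "F' t" "rotation (\<theta> t) *v x"] by (simp add: norm_rotation)
        also have "\<dots> \<le> C * norm x" by (rule mult_right_mono[OF C(2)[OF t] norm_ge_zero])
        finally show ?thesis by (intro order_trans[OF omega0_le] mult_left_mono) auto
      qed
      also have "\<dots> = C * (x \<bullet> x)" by (simp add: dot_square_norm power2_eq_square)
      also have "\<bar>(- 2 * \<rho> * (t - c)) * (x \<bullet> x)\<bar> = 2 * (\<rho> * \<bar>t - c\<bar>) * (x \<bullet> x)"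
        using \<rho>0 by (simp add: abs_mult)
      finally have "2 * (\<rho> * \<bar>t - c\<bar>) * (x \<bullet> x) \<le> C * (x \<bullet> x)" .
      moreover have "C \<le> \<rho> * \<bar>t - c\<bar>" using far \<rho>0 by (simp add: field_simps)
      ultimately have "2 * C * (x \<bullet> x) \<le> C * (x \<bullet> x)"
        by (smt (verit) inner_ge_zero mult_right_mono)
      then have "C * (x \<bullet> x) \<le> 0" by simp
      then have "x \<bullet> x \<le> 0" using C(1) by (simp add: mult_le_0_iff)
      then have "x \<bullet> x = 0" using inner_ge_zero[of x] by linarith
      then have "x = 0" by simp
      then show "v = 0" by (simp add: x(1) zero_prod_def)
    qed
  qed
  have "lagrangian_homotopic omega_bar a b (\<lambda>t. graph (\<psi> t)) (\<lambda>t. graph (G t))"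
  proof -
    have e: "graph (F a) = graph (\<psi> a)" "graph (F b) = graph (\<psi> b)" using h by (auto simp: F_def)
    show ?thesis
      using hom1 hom2 unfolding lagrangian_homotopic_def e by (rule homotopic_with_trans)
  qed
  then show ?thesis using that smooth reg by blast
qed

definition maslov_graph :: "real \<Rightarrow> real \<Rightarrow> (real \<Rightarrow> real^('n::finite + 'n)^('n + 'n)) \<Rightarrow> int" where
  "maslov_graph a b \<psi> = gr.maslov diagonal a b (\<lambda>t. graph (\<psi> t))"

text \<open>Resolves the \<open>THE\<close>: a regular representative exists, and the index of each
  one is half the Maslov index, which is invariant under the homotopy to the given path.\<close>

theorem rs_index_eq_maslov:
  assumes ab: "a < b" and \<psi>: "symplectic_path a b \<psi>"
  shows "rs_index a b \<psi> = of_int (maslov_graph a b \<psi>) / 2"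
  unfolding rs_index_def lagrangian_rs_index_def maslov_graph_def
proof (rule the_equality)
  have val: "regular_rs_index omega_bar diagonal a b K = of_int (gr.maslov diagonal a b (\<lambda>t. graph (\<psi> t))) / 2"
    if "smooth_lagrangian_path omega_bar a b K" "regular_crossings omega_bar diagonal a b K"
      "lagrangian_homotopic omega_bar a b (\<lambda>t. graph (\<psi> t)) K" for K
    using regular_rs_index_eq_maslov[OF ab that(1,2)] lagrangian_homotopic_maslov[OF lagrangian_diagonal less_imp_le[OF ab] that(3)]
    by simp
  obtain K where K: "smooth_lagrangian_path omega_bar a b K" "regular_crossings omega_bar diagonal a b K"
      "lagrangian_homotopic omega_bar a b (\<lambda>t. graph (\<psi> t)) K"
    using regular_representative[OF ab] \<psi> unfolding symplectic_path_def by blast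
  show "\<exists>\<Lambda>'. smooth_lagrangian_path omega_bar a b \<Lambda>' \<and> regular_crossings omega_bar diagonal a b \<Lambda>' \<and>
        lagrangian_homotopic omega_bar a b (\<lambda>t. graph (\<psi> t)) \<Lambda>' \<and>
        of_int (gr.maslov diagonal a b (\<lambda>t. graph (\<psi> t))) / 2 = regular_rs_index omega_bar diagonal a b \<Lambda>'"
    using K val[OF K] by (intro exI[of _ K]) simp
  show "r = of_int (gr.maslov diagonal a b (\<lambda>t. graph (\<psi> t))) / 2"
    if "\<exists>\<Lambda>'. smooth_lagrangian_path omega_bar a b \<Lambda>' \<and> regular_crossings omega_bar diagonal a b \<Lambda>' \<and>
        lagrangian_homotopic omega_bar a b (\<lambda>t. graph (\<psi> t)) \<Lambda>' \<and> r = regular_rs_index omega_bar diagonal a b \<Lambda>'" for r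
    using that val by blast
qed

section \<open>Half-integrality, catenation, zero and homotopy for the index\<close>

lemma symplectic_path_lag_family:
  "symplectic_path a b \<psi> \<Longrightarrow> gr.lag_family {a..b} (\<lambda>t. graph (\<psi> t))"
  unfolding symplectic_path_def by (intro graph_lag_family) auto

lemma symplectic_path_subset:
  "symplectic_path a b \<psi> \<Longrightarrow> a \<le> c \<Longrightarrow> d \<le> b \<Longrightarrow> symplectic_path c d \<psi>"
  unfolding symplectic_path_def by (auto intro: continuous_on_subset)

lemma rs_index_half_integer: "half_integer_valued (rs_index :: real \<Rightarrow> real \<Rightarrow> (real \<Rightarrow> real^('n::finite + 'n)^('n + 'n)) \<Rightarrow> real)"
  unfolding half_integer_valued_def using rs_index_eq_maslov by blast

lemma rs_index_catenation: "catenation_property (rs_index :: real \<Rightarrow> real \<Rightarrow> (real \<Rightarrow> real^('n::finite + 'n)^('n + 'n)) \<Rightarrow> real)"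
  unfolding catenation_property_def
proof (intro allI impI, elim conjE)
  fix a b c and \<psi> :: "real \<Rightarrow> real^('n + 'n)^('n + 'n)"
  assume *: "a < c" "c < b" "symplectic_path a b \<psi>"
  then have "symplectic_path a c \<psi>" "symplectic_path c b \<psi>" by (auto intro: symplectic_path_subset)
  moreover have "maslov_graph a b \<psi> = maslov_graph a c \<psi> + maslov_graph c b \<psi>"
    unfolding maslov_graph_def using *
    by (intro gr.maslov_catenation[OF lagrangian_diagonal symplectic_path_lag_family]) auto
  ultimately show "rs_index a b \<psi> = rs_index a c \<psi> + rs_index c b \<psi>"
    using * by (simp add: rs_index_eq_maslov)
qed

lemma rs_index_zero: "zero_property (rs_index :: real \<Rightarrow> real \<Rightarrow> (real \<Rightarrow> real^('n::finite + 'n)^('n + 'n)) \<Rightarrow> real)"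
  unfolding zero_property_def
proof (intro allI impI, elim conjE)
  fix a b k and \<psi> :: "real \<Rightarrow> real^('n + 'n)^('n + 'n)"
  assume *: "a < b" "symplectic_path a b \<psi>" "\<forall>t\<in>{a..b}. dim {v. (\<psi> t - mat 1) *v v = 0} = k"
  have "maslov_graph a b \<psi> = 0"
    unfolding maslov_graph_def using *
    by (intro gr.maslov_zero[OF lagrangian_diagonal symplectic_path_lag_family]) (auto simp: dim_graph_Int_diagonal)
  then show "rs_index a b \<psi> = 0" using * by (simp add: rs_index_eq_maslov)
qed

lemma rs_index_homotopy: "homotopy_property (rs_index :: real \<Rightarrow> real \<Rightarrow> (real \<Rightarrow> real^('n::finite + 'n)^('n + 'n)) \<Rightarrow> real)"
  unfolding homotopy_property_def
proof (intro allI impI, elim conjE)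
  fix a b and \<psi> \<phi> :: "real \<Rightarrow> real^('n + 'n)^('n + 'n)"
  assume *: "a < b" "symplectic_path a b \<psi>" "symplectic_path a b \<phi>"
    and "homotopic_with_canon (\<lambda>\<xi>. \<xi> a = \<psi> a \<and> \<xi> b = \<psi> b) {a..b} Sp \<psi> \<phi>"
  then obtain h :: "real \<times> real \<Rightarrow> real^('n + 'n)^('n + 'n)" where h: "continuous_on ({0..1} \<times> {a..b}) h" "h \<in> {0..1} \<times> {a..b} \<rightarrow> Sp"
    "\<forall>x. h (0, x) = \<psi> x" "\<forall>x. h (1, x) = \<phi> x" "\<forall>t\<in>{0..1}. h (t, a) = \<psi> a \<and> h (t, b) = \<psi> b"
    unfolding homotopic_with_def by auto
  have "lagrangian_homotopic omega_bar a b (\<lambda>t. graph (\<psi> t)) (\<lambda>t. graph (\<phi> t))"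
    using h * by (intro graph_lagrangian_homotopic[of a b h]) (auto simp: Pi_iff)
  then have "maslov_graph a b \<psi> = maslov_graph a b \<phi>"
    unfolding maslov_graph_def using * by (intro lagrangian_homotopic_maslov lagrangian_diagonal) auto
  then show "rs_index a b \<psi> = rs_index a b \<phi>" using * by (simp add: rs_index_eq_maslov)
qed

section \<open>The exponential of matrices\<close>

definition matrix_pow :: "real^'m^'m \<Rightarrow> nat \<Rightarrow> real^'m^'m" where
  "matrix_pow X k = ((**) X ^^ k) (mat 1)"

lemma matrix_pow_0 [simp]: "matrix_pow X 0 = mat 1"
  by (simp add: matrix_pow_def)

lemma matrix_pow_Suc: "matrix_pow X (Suc k) = X ** matrix_pow X k"
  by (simp add: matrix_pow_def)

lemma matrix_pow_Suc_right: "matrix_pow X (Suc k) = matrix_pow X k ** X"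
  by (induction k) (simp_all add: matrix_pow_Suc matrix_mul_assoc)

lemma matrix_pow_scaleR: "matrix_pow (t *\<^sub>R X) k = t ^ k *\<^sub>R matrix_pow X k"
  by (induction k) (simp_all add: matrix_pow_Suc bounded_bilinear.scaleR_left[OF bounded_bilinear_matrix_matrix]
      bounded_bilinear.scaleR_right[OF bounded_bilinear_matrix_matrix])

lemma summable_matrix_exp: "summable (\<lambda>k. (1 / fact k) *\<^sub>R matrix_pow X k)"
proof -
  obtain K where K: "K > 0" "\<And>(A :: real^'a^'a) (B :: real^'a^'a). norm (A ** B) \<le> norm A * norm B * K"
    using bounded_bilinear.pos_bounded[OF bounded_bilinear_matrix_matrix] by blast
  have "norm (matrix_pow X k) \<le> (K * norm X) ^ k * norm (mat 1 :: real^'a^'a)" for k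
  proof (induction k)
    case (Suc k)
    have "norm (matrix_pow X (Suc k)) \<le> norm X * norm (matrix_pow X k) * K"
      unfolding matrix_pow_Suc by (rule K(2))
    also have "\<dots> \<le> norm X * ((K * norm X) ^ k * norm (mat 1 :: real^'a^'a)) * K"
      using K(1) by (intro mult_right_mono mult_left_mono Suc) auto
    finally show ?case by (simp add: algebra_simps)
  qed simp
  then have "norm ((1 / fact k) *\<^sub>R matrix_pow X k) \<le> (inverse (fact k) * (K * norm X) ^ k) * norm (mat 1 :: real^'a^'a)" for k
    by (simp add: divide_inverse mult_left_mono mult.assoc)
  then show ?thesis
    by (intro summable_comparison_test'[OF summable_mult2[OF summable_exp[of "K * norm X"]]]) auto
qed

lemma matrix_exp_sums: "(\<lambda>k. (1 / fact k) *\<^sub>R matrix_pow X k) sums matrix_exp X"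
  using summable_sums[OF summable_matrix_exp] by (simp add: matrix_exp_def matrix_pow_def)

lemma matrix_exp_vector_sums: "(\<lambda>k. (1 / fact k) *\<^sub>R (matrix_pow X k *v v)) sums (matrix_exp X *v v)"
  using bounded_linear.sums[OF bounded_bilinear.bounded_linear_left[OF bounded_bilinear_matrix_vector] matrix_exp_sums, of X v]
  by (simp add: scaleR_matrix_vector)

text \<open>Each component is a scalar power series in \<open>t\<close>, to which termwise
  differentiation applies in \<open>matrix_exp_vector_derivative\<close>.\<close>

lemma matrix_exp_vector_inner_sums:
  "(\<lambda>k. ((matrix_pow X k *v v) \<bullet> i / fact k) * t ^ k) sums ((matrix_exp (t *\<^sub>R X) *v v) \<bullet> i)"
  using bounded_linear.sums[OF bounded_linear_inner_left matrix_exp_vector_sums[of "t *\<^sub>R X" v], of i]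
  by (simp add: matrix_pow_scaleR scaleR_matrix_vector mult.commute)

lemma matrix_exp_commute: "matrix_exp X ** X = X ** matrix_exp X"
proof -
  have "(\<lambda>k. ((1 / fact k) *\<^sub>R matrix_pow X k) ** X) sums (matrix_exp X ** X)"
    by (rule bounded_linear.sums[OF bounded_bilinear.bounded_linear_left[OF bounded_bilinear_matrix_matrix] matrix_exp_sums])
  moreover have "(\<lambda>k. X ** ((1 / fact k) *\<^sub>R matrix_pow X k)) sums (X ** matrix_exp X)"
    by (rule bounded_linear.sums[OF bounded_bilinear.bounded_linear_right[OF bounded_bilinear_matrix_matrix] matrix_exp_sums])
  moreover have "((1 / fact k) *\<^sub>R matrix_pow X k) ** X = X ** ((1 / fact k) *\<^sub>R matrix_pow X k)" for k
    using matrix_pow_Suc[of X k] matrix_pow_Suc_right[of X k]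
    by (simp add: bounded_bilinear.scaleR_left[OF bounded_bilinear_matrix_matrix] bounded_bilinear.scaleR_right[OF bounded_bilinear_matrix_matrix])
  ultimately show ?thesis using sums_unique2 by fastforce
qed

lemma matrix_exp_scaleR_commute: "matrix_exp (t *\<^sub>R X) *v (X *v v) = X *v (matrix_exp (t *\<^sub>R X) *v v)"
proof (cases "t = 0")
  case False
  have "t *\<^sub>R (matrix_exp (t *\<^sub>R X) ** X) = t *\<^sub>R (X ** matrix_exp (t *\<^sub>R X))"
    using matrix_exp_commute[of "t *\<^sub>R X"]
    by (simp add: bounded_bilinear.scaleR_left[OF bounded_bilinear_matrix_matrix] bounded_bilinear.scaleR_right[OF bounded_bilinear_matrix_matrix])
  then show ?thesis using False by (simp add: matrix_vector_mul_assoc)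
next
  case True
  have "matrix_pow 0 k = (if k = 0 then mat 1 else 0 :: real^'a^'a)" for k
    by (cases k) (simp_all add: matrix_pow_Suc)
  then have "(\<lambda>k. (1 / fact k) *\<^sub>R matrix_pow 0 k) = (\<lambda>k. if k = 0 then mat 1 else 0 :: real^'a^'a)" by auto
  moreover have "(\<lambda>k. if k = 0 then mat 1 else 0 :: real^'a^'a) sums mat 1"
    using sums_single[of 0 "\<lambda>_. mat 1 :: real^'a^'a"] by simp
  ultimately have "matrix_exp 0 = (mat 1 :: real^'a^'a)" using matrix_exp_sums[of 0] sums_unique2 by metis
  then show ?thesis using True by simp
qed

lemma matrix_exp_kernel:
  assumes "X *v v = 0"
  shows "matrix_exp X *v v = v"
proof -
  have "matrix_pow X k *v v = (if k = 0 then v else 0)" for k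
    using assms by (cases k) (simp_all add: matrix_pow_Suc_right flip: matrix_vector_mul_assoc)
  then have "(\<lambda>k. (1 / fact k) *\<^sub>R (matrix_pow X k *v v)) = (\<lambda>k. if k = 0 then v else 0)" by auto
  then have "(\<lambda>k. if k = 0 then v else 0) sums (matrix_exp X *v v)" using matrix_exp_vector_sums[of X v] by simp
  moreover have "(\<lambda>k. if k = 0 then v else 0) sums v" using sums_single[of 0 "\<lambda>_. v"] by simp
  ultimately show ?thesis by (rule sums_unique2)
qed

lemma matrix_exp_0: "matrix_exp 0 = mat 1"
  by (simp add: matrix_eq matrix_exp_kernel)

lemma matrix_exp_vector_derivative:
  "((\<lambda>t. matrix_exp (t *\<^sub>R X) *v v) has_vector_derivative matrix_exp (t *\<^sub>R X) *v (X *v v)) (at t within S)"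
proof -
  have "((\<lambda>t. (matrix_exp (t *\<^sub>R X) *v v) \<bullet> i) has_real_derivative (matrix_exp (t *\<^sub>R X) *v (X *v v)) \<bullet> i) (at t)" for i
  proof -
    define c where "c k = (matrix_pow X k *v v) \<bullet> i / fact k" for k
    have s: "(\<lambda>k. c k * y ^ k) sums ((matrix_exp (y *\<^sub>R X) *v v) \<bullet> i)" for y
      unfolding c_def by (rule matrix_exp_vector_inner_sums)
    have "diffs c = (\<lambda>k. (matrix_pow X k *v (X *v v)) \<bullet> i / fact k)"
      by (auto simp: diffs_def c_def matrix_pow_Suc_right fun_eq_iff simp flip: matrix_vector_mul_assoc)
    then have d: "(\<Sum>k. diffs c k * t ^ k) = (matrix_exp (t *\<^sub>R X) *v (X *v v)) \<bullet> i"
      using matrix_exp_vector_inner_sums[of X "X *v v" i t] by (simp add: sums_iff)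
    have "(\<lambda>y. \<Sum>k. c k * y ^ k) = (\<lambda>y. (matrix_exp (y *\<^sub>R X) *v v) \<bullet> i)"
      using s by (simp add: sums_iff)
    moreover have "((\<lambda>y. \<Sum>k. c k * y ^ k) has_real_derivative (\<Sum>k. diffs c k * t ^ k)) (at t)"
      using s by (intro termdiffs_strong_converges_everywhere) (auto simp: sums_iff)
    ultimately show ?thesis using d by simp
  qed
  then have "((\<lambda>t. matrix_exp (t *\<^sub>R X) *v v) has_vector_derivative matrix_exp (t *\<^sub>R X) *v (X *v v)) (at t)"
    unfolding has_vector_derivative_def
    by (subst has_derivative_componentwise_within)
      (auto simp: has_field_derivative_def mult.commute[of _ "_ \<bullet> _"] mult_commute_abs)
  then show ?thesis by (rule has_vector_derivative_at_within)
qed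

lemma matrix_exp_derivative:
  "((\<lambda>t. matrix_exp (t *\<^sub>R X)) has_vector_derivative matrix_exp (t *\<^sub>R X) ** X) (at t within S)"
  unfolding has_vector_derivative_quotient tendsto_matrix_iff
proof
  fix v
  show "((\<lambda>s. (matrix_exp (s *\<^sub>R X) - matrix_exp (t *\<^sub>R X)) /\<^sub>R (s - t) *v v) \<longlongrightarrow> matrix_exp (t *\<^sub>R X) ** X *v v) (at t within S)"
    using matrix_exp_vector_derivative[of X v t S] unfolding has_vector_derivative_quotient
    by (simp add: scaleR_matrix_vector matrix_vector_mult_diff_rdistrib flip: matrix_vector_mul_assoc)
qed

lemma Csmooth_matrix_exp: "Csmooth S (\<lambda>t. matrix_exp (t *\<^sub>R X))"
proof -
  have "Ck k S (\<lambda>t. matrix_exp (t *\<^sub>R X))" for k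
  proof (induction k)
    case 0
    then show ?case
      by (auto simp: continuous_on_eq_continuous_within intro: has_vector_derivative_continuous matrix_exp_derivative)
  next
    case (Suc k)
    have "Ck k S (\<lambda>t. matrix_exp (t *\<^sub>R X) ** X)" by (intro Ck_matrix_mult Suc Ck_const)
    then show ?case using matrix_exp_derivative by (auto intro!: exI[of _ "\<lambda>t. matrix_exp (t *\<^sub>R X) ** X"])
  qed
  then show ?thesis by (simp add: Csmooth_def)
qed

lemma continuous_on_matrix_exp: "continuous_on S (\<lambda>t. matrix_exp (t *\<^sub>R X))"
  using Csmooth_matrix_exp[of S X] unfolding Csmooth_def by (metis Ck.simps(1))

lemma matrix_exp_Sp:
  assumes X: "X \<in> sp_algebra"
  shows "matrix_exp (t *\<^sub>R X) \<in> Sp"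
  unfolding Sp_iff
proof (intro allI)
  fix v w
  define f where "f t = omega0 (matrix_exp (t *\<^sub>R X) *v v) (matrix_exp (t *\<^sub>R X) *v w)" for t
  have bil: "bounded_bilinear (omega0 :: real^('a+'a) \<Rightarrow> real^('a+'a) \<Rightarrow> real)"
  proof -
    have "bilinear (omega0 :: real^('a+'a) \<Rightarrow> real^('a+'a) \<Rightarrow> real)"
      unfolding bilinear_def by (auto intro!: linearI)
    then show ?thesis by (simp add: bilinear_conv_bounded_bilinear)
  qed
  have "(f has_vector_derivative 0) (at t)" for t
    unfolding f_def
    using bounded_bilinear.has_vector_derivative[OF bil matrix_exp_vector_derivative[of X v t UNIV] matrix_exp_vector_derivative[of X w t UNIV]]
      sp_algebraD[OF X, of "matrix_exp (t *\<^sub>R X) *v v" "matrix_exp (t *\<^sub>R X) *v w"]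
    by (simp add: matrix_exp_scaleR_commute)
  then have "f t = f 0"
    using has_derivative_zero_unique[of UNIV f t 0] by (auto simp: has_vector_derivative_def)
  then show "omega0 (matrix_exp (t *\<^sub>R X) *v v) (matrix_exp (t *\<^sub>R X) *v w) = omega0 v w"
    by (simp add: f_def matrix_exp_0)
qed

text \<open>\<open>X\<close> acts on \<open>p + \<i> q\<close> as multiplication by
  \<open>\<i> * \<theta>\<close>, so componentwise its exponential is multiplication by the complex
  exponential.\<close>

lemma matrix_exp_rotation_plane:
  assumes "X *v p = - (\<theta> *\<^sub>R q)" "X *v q = \<theta> *\<^sub>R p"
  shows "matrix_exp X *v p = cos \<theta> *\<^sub>R p - sin \<theta> *\<^sub>R q" "matrix_exp X *v q = sin \<theta> *\<^sub>R p + cos \<theta> *\<^sub>R q"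
proof -
  have pow: "complex_of_real ((matrix_pow X k *v p) $ j) + \<i> * complex_of_real ((matrix_pow X k *v q) $ j)
      = (\<i> * complex_of_real \<theta>) ^ k * (complex_of_real (p $ j) + \<i> * complex_of_real (q $ j))" for k j
  proof (induction k)
    case (Suc k)
    have "matrix_pow X (Suc k) *v p = - (\<theta> *\<^sub>R (matrix_pow X k *v q))" "matrix_pow X (Suc k) *v q = \<theta> *\<^sub>R (matrix_pow X k *v p)"
      using assms by (simp_all add: matrix_pow_Suc_right linear_neg[OF matrix_vector_mul_linear] matrix_vector_mult_scaleR flip: matrix_vector_mul_assoc)
    then have "complex_of_real ((matrix_pow X (Suc k) *v p) $ j) + \<i> * complex_of_real ((matrix_pow X (Suc k) *v q) $ j)
       = (\<i> * complex_of_real \<theta>) * (complex_of_real ((matrix_pow X k *v p) $ j) + \<i> * complex_of_real ((matrix_pow X k *v q) $ j))"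
      by (simp add: algebra_simps)
    then show ?case using Suc by (simp add: mult.assoc)
  qed simp
  have comp: "complex_of_real ((matrix_exp X *v p) $ j) + \<i> * complex_of_real ((matrix_exp X *v q) $ j)
    = exp (\<i> * complex_of_real \<theta>) * (complex_of_real (p $ j) + \<i> * complex_of_real (q $ j))" for j
  proof -
    have s: "(\<lambda>k. (1 / fact k) * ((matrix_pow X k *v v) $ j)) sums ((matrix_exp X *v v) $ j)" for v
      using bounded_linear.sums[OF bounded_linear_vec_nth matrix_exp_vector_sums] by simp
    have "(\<lambda>k. complex_of_real ((1 / fact k) * ((matrix_pow X k *v p) $ j)) + \<i> * complex_of_real ((1 / fact k) * ((matrix_pow X k *v q) $ j)))
      sums (complex_of_real ((matrix_exp X *v p) $ j) + \<i> * complex_of_real ((matrix_exp X *v q) $ j))"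
      by (intro sums_add sums_mult sums_of_real s)
    moreover have "complex_of_real ((1 / fact k) * ((matrix_pow X k *v p) $ j)) + \<i> * complex_of_real ((1 / fact k) * ((matrix_pow X k *v q) $ j))
      = ((\<i> * complex_of_real \<theta>) ^ k /\<^sub>R fact k) * (complex_of_real (p $ j) + \<i> * complex_of_real (q $ j))" for k
      using arg_cong[OF pow[of k j], of "\<lambda>z. z /\<^sub>R fact k"]
      by (simp add: scaleR_conv_of_real divide_inverse algebra_simps)
    moreover have "(\<lambda>k. ((\<i> * complex_of_real \<theta>) ^ k /\<^sub>R fact k) * (complex_of_real (p $ j) + \<i> * complex_of_real (q $ j)))
      sums (exp (\<i> * complex_of_real \<theta>) * (complex_of_real (p $ j) + \<i> * complex_of_real (q $ j)))"
      by (intro sums_mult2 exp_converges)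
    ultimately show ?thesis using sums_unique2 by fastforce
  qed
  have "(matrix_exp X *v p) $ j = cos \<theta> * p $ j - sin \<theta> * q $ j" "(matrix_exp X *v q) $ j = sin \<theta> * p $ j + cos \<theta> * q $ j" for j
    using comp[of j] by (auto simp: complex_eq_iff Re_exp Im_exp)
  then show "matrix_exp X *v p = cos \<theta> *\<^sub>R p - sin \<theta> *\<^sub>R q" "matrix_exp X *v q = sin \<theta> *\<^sub>R p + cos \<theta> *\<^sub>R q"
    by (simp_all add: vec_eq_iff)
qed

text \<open>Fixing the plane forces \<open>\<theta>\<close> to be a positive multiple of
  \<open>2 * pi\<close>. The norm bound, used for \<open>p\<close> and for \<open>q\<close>, gives
  \<open>\<theta> * norm q < 2 * pi * norm p\<close> and the same with \<open>p\<close> and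
  \<open>q\<close> exchanged; together these are contradictory even if \<open>p\<close> and
  \<open>q\<close> have different lengths.\<close>

lemma rotation_plane_fixed:
  assumes X: "\<And>v. v \<noteq> 0 \<Longrightarrow> norm (X *v v) < 2 * pi * norm v"
    and pq: "X *v p = - (\<theta> *\<^sub>R q)" "X *v q = \<theta> *\<^sub>R p" and p0: "p \<noteq> 0" and \<theta>: "\<theta> > 0"
    and fixed: "matrix_exp X *v p = p" "matrix_exp X *v q = q"
  shows False
proof -
  have 1: "(1 - cos \<theta>) *\<^sub>R p = - (sin \<theta> *\<^sub>R q)" "(1 - cos \<theta>) *\<^sub>R q = sin \<theta> *\<^sub>R p"
    using matrix_exp_rotation_plane[OF pq] fixed by (simp_all add: algebra_simps)
  have "((1 - cos \<theta>) * (1 - cos \<theta>)) *\<^sub>R p = - (sin \<theta> *\<^sub>R ((1 - cos \<theta>) *\<^sub>R q))"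
    using arg_cong[OF 1(1), of "\<lambda>v. (1 - cos \<theta>) *\<^sub>R v"] by (simp add: mult.commute)
  also have "\<dots> = - ((sin \<theta> * sin \<theta>) *\<^sub>R p)" by (simp add: 1(2))
  finally have "((1 - cos \<theta>) * (1 - cos \<theta>) + sin \<theta> * sin \<theta>) *\<^sub>R p = 0" by (simp add: scaleR_add_left)
  then have "(1 - cos \<theta>) * (1 - cos \<theta>) + sin \<theta> * sin \<theta> = 0" using p0 by simp
  then have "(1 - cos \<theta>) * (1 - cos \<theta>) = 0" by (metis add_nonneg_eq_0_iff zero_le_square)
  then have "cos \<theta> = 1" by simp
  then obtain n :: int where n: "\<theta> = of_int n * 2 * pi" by (auto simp: cos_one_2pi_int)
  then have "n \<ge> 1" using \<theta> by (smt (verit) mult_nonneg_nonneg mult_neg_pos of_int_0_less_iff of_int_0_le_iff pi_gt_zero zero_less_mult_iff)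
  then have th: "\<theta> \<ge> 2 * pi" using n by simp
  have q0: "q \<noteq> 0" using pq(2) p0 \<theta> by auto
  have "\<theta> * norm q < 2 * pi * norm p" "\<theta> * norm p < 2 * pi * norm q"
    using X[OF p0] X[OF q0] pq \<theta> by simp_all
  moreover have "2 * pi * norm p \<le> \<theta> * norm p" "2 * pi * norm q \<le> \<theta> * norm q" using th by (auto intro: mult_right_mono)
  ultimately show False by linarith
qed

text \<open>On the fixed space of \<^term>\<open>matrix_exp X\<close> the orbits of \<^term>\<open>\<lambda>t. matrix_exp (t *\<^sub>R X)\<close> are
  periodic, so averaging the inner product over one period gives one for which \<^term>\<open>X\<close> is
  skew-adjoint. Hence \<^term>\<open>X\<close> acts by rotations of planes.\<close>

lemma matrix_exp_fixed_iff:
  fixes X :: "real^'m^'m"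
  assumes X: "\<And>v. v \<noteq> 0 \<Longrightarrow> norm (X *v v) < 2 * pi * norm v"
  shows "matrix_exp X *v v = v \<longleftrightarrow> X *v v = 0"
proof
  assume fixed: "matrix_exp X *v v = v"
  define E where "E t = matrix_exp (t *\<^sub>R X)" for t
  define V where "V = {v. E 1 *v v = v}"
  have "V = {v. (E 1 - mat 1) *v v = 0}" by (auto simp: V_def matrix_vector_mult_diff_rdistrib)
  then have sV: "subspace V" by (simp only: linear_subspace_kernel matrix_vector_mul_linear)
  have XV: "X *v x \<in> V" if "x \<in> V" for x
    using that matrix_exp_scaleR_commute[of 1 X x] by (simp add: V_def E_def)
  have E0: "E 0 *v x = x" for x by (simp add: E_def matrix_exp_0)
  have cE: "continuous_on {0..1} (\<lambda>t. (E t *v x) \<bullet> (E t *v y))" for x y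
    unfolding E_def by (intro continuous_intros continuous_on_matrix_exp)
  define G where "G x y = integral {0..1} (\<lambda>t. (E t *v x) \<bullet> (E t *v y))" for x y
  have int: "((\<lambda>t. (E t *v x) \<bullet> (E t *v y)) has_integral G x y) {0..1}" for x y
    unfolding G_def by (intro integrable_integral integrable_continuous_real cE)
  have G_add: "G (x + y) z = G x z + G y z" and G_sc: "G (c *\<^sub>R x) z = c * G x z" and G_sym: "G x y = G y x" for x y z c
  proof -
    show "G (x + y) z = G x z + G y z"
      using has_integral_add[OF int[of x z] int[of y z]] int[of "x + y" z]
      by (intro has_integral_unique[of "\<lambda>t. (E t *v (x + y)) \<bullet> (E t *v z)"]) (simp_all add: matrix_vector_right_distrib inner_add_left)
    show "G (c *\<^sub>R x) z = c * G x z"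
      using has_integral_mult_right[OF int[of x z], of c] int[of "c *\<^sub>R x" z]
      by (intro has_integral_unique[of "\<lambda>t. (E t *v (c *\<^sub>R x)) \<bullet> (E t *v z)"]) (simp_all add: matrix_vector_mult_scaleR)
    show "G x y = G y x" unfolding G_def by (simp only: inner_commute)
  qed
  have GV: "sym_form V G" unfolding sym_form_def using sV G_add G_sc G_sym by blast
  have G_pos: "G x x > 0" if "x \<noteq> 0" for x
  proof -
    have "G x x \<ge> 0" unfolding G_def by (intro integral_nonneg integrable_continuous_real cE) auto
    moreover have "G x x \<noteq> 0"
    proof
      assume "G x x = 0"
      then have "(E 0 *v x) \<bullet> (E 0 *v x) = 0"
        using integral_eq_0_iff[OF cE[of x x]] by (simp add: G_def)
      then show False using that by (simp add: E0)
    qed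
    ultimately show ?thesis by simp
  qed
  \<comment> \<open>The derivative of \<open>(E t *v x) \<bullet> (E t *v y)\<close> integrates to
    zero because \<open>E 1\<close> fixes \<open>x\<close> and \<open>y\<close>.\<close>
  have G_skew: "G (X *v x) y = - G x (X *v y)" if xy: "x \<in> V" "y \<in> V" for x y
  proof -
    have "((\<lambda>t. (E t *v x) \<bullet> (E t *v y)) has_vector_derivative (E t *v x) \<bullet> (E t *v (X *v y)) + (E t *v (X *v x)) \<bullet> (E t *v y)) (at t within {0..1})" for t
      unfolding E_def
      by (rule bounded_bilinear.has_vector_derivative[OF bounded_bilinear_inner matrix_exp_vector_derivative matrix_exp_vector_derivative])
    then have 1: "((\<lambda>t. (E t *v x) \<bullet> (E t *v (X *v y)) + (E t *v (X *v x)) \<bullet> (E t *v y)) has_integral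
        ((E 1 *v x) \<bullet> (E 1 *v y) - (E 0 *v x) \<bullet> (E 0 *v y))) {0..1}"
      by (intro fundamental_theorem_of_calculus) auto
    have "(E 1 *v x) \<bullet> (E 1 *v y) - (E 0 *v x) \<bullet> (E 0 *v y) = 0" using xy by (simp add: V_def E0)
    then have "G x (X *v y) + G (X *v x) y = 0"
      using has_integral_unique[OF has_integral_add[OF int[of x "X *v y"] int[of "X *v x" y]] 1] by simp
    then show ?thesis by simp
  qed
  obtain N where N: "finite N" "pairwise orthogonal N" "\<forall>e\<in>N. norm e = 1" "span N = V" "\<forall>e\<in>N. \<forall>f\<in>N. e \<noteq> f \<longrightarrow> G e f = 0"
    using sym_form_eigenbasis[OF GV] by auto
  have NV: "e \<in> V" if "e \<in> N" for e using that N(4) span_base by auto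
  have Ne: "e \<bullet> f = (if e = f then 1 else 0)" if "e \<in> N" "f \<in> N" for e f
    using that N(2,3) by (auto simp: pairwise_def orthogonal_def dot_square_norm)
  have gpos: "G e e > 0" if "e \<in> N" for e using that N(3) by (intro G_pos) auto
  have gne: "G e e \<noteq> 0" if "e \<in> N" for e using gpos[OF that] by simp
  \<comment> \<open>Normalizing a \<open>G\<close>-orthogonal basis yields an isometry from the
    Euclidean product on \<open>V\<close> to \<open>G\<close>. The spectral theorem is available for
    the Euclidean product, and \<open>T\<close> transports it to \<open>G\<close>.\<close>
  define T where "T x = (\<Sum>e\<in>N. ((x \<bullet> e) / sqrt (G e e)) *\<^sub>R e)" for x
  have lT: "linear T"
    unfolding T_def by (intro linearI) (simp_all add: inner_add_left add_divide_distrib scaleR_add_left sum.distrib scaleR_sum_right)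
  have TV: "T x \<in> V" for x unfolding T_def using NV sV by (intro subspace_sum subspace_scale) auto
  have Te: "T x \<bullet> e = (x \<bullet> e) / sqrt (G e e)" if "e \<in> N" for x e
  proof -
    have "T x \<bullet> e = (\<Sum>f\<in>N. if f = e then (x \<bullet> e) / sqrt (G e e) else 0)"
      unfolding T_def inner_sum_left using that Ne by (intro sum.cong) auto
    then show ?thesis using N(1) that by simp
  qed
  have GT: "G (T x) (T y) = x \<bullet> y" if "x \<in> V" for x y
  proof -
    have "G (T x) (T y) = (\<Sum>e\<in>N. (x \<bullet> e) * (y \<bullet> e))"
      unfolding eigenbasis_form[OF GV N TV TV] using gpos Te
      by (intro sum.cong) (auto simp: abs_of_pos gne)
    also have "\<dots> = (\<Sum>e\<in>N. (x \<bullet> e) *\<^sub>R e) \<bullet> y" by (subst inner_commute[of _ y]) (simp add: inner_sum_right)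
    also have "(\<Sum>e\<in>N. (x \<bullet> e) *\<^sub>R e) = x" using orthonormal_basis_expand[OF N(2)] N that by auto
    finally show ?thesis .
  qed
  have Tsurj: "\<exists>x\<in>V. T x = y" if y: "y \<in> V" for y
  proof -
    let ?x = "\<Sum>e\<in>N. ((y \<bullet> e) * sqrt (G e e)) *\<^sub>R e"
    have xe: "?x \<bullet> e = (y \<bullet> e) * sqrt (G e e)" if "e \<in> N" for e
    proof -
      have "?x \<bullet> e = (\<Sum>f\<in>N. if f = e then (y \<bullet> e) * sqrt (G e e) else 0)"
        unfolding inner_sum_left using that Ne by (intro sum.cong) auto
      then show ?thesis using N(1) that by simp
    qed
    have "T ?x = (\<Sum>e\<in>N. (y \<bullet> e) *\<^sub>R e)"
      unfolding T_def using xe gpos by (intro sum.cong) (auto simp: gne)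
    also have "\<dots> = y" using orthonormal_basis_expand[OF N(2)] N y by auto
    finally show ?thesis using NV sV by (intro bexI[of _ ?x] subspace_sum subspace_scale) auto
  qed
  \<comment> \<open>\<open>B\<close> represents minus the square of \<open>X\<close>: as
    \<open>X\<close> is skew for \<open>G\<close>, an eigenvector \<open>e\<close> with value
    \<open>l\<close> satisfies \<open>X *v (X *v T e) = - (l *\<^sub>R T e)\<close>.\<close>
  define B where "B x y = G (X *v T x) (X *v T y)" for x y
  have BV: "sym_form V B"
    unfolding sym_form_def
  proof (intro conjI ballI allI sV)
    show "B x y = B y x" for x y unfolding B_def by (rule G_sym)
  qed (simp_all add: B_def linear_add[OF lT] linear_cmul[OF lT] matrix_vector_right_distrib matrix_vector_mult_scaleR G_add G_sc)
  obtain E2 where E2: "finite E2" "pairwise orthogonal E2" "\<forall>e\<in>E2. norm e = 1" "span E2 = V" "\<forall>e\<in>E2. \<forall>f\<in>E2. e \<noteq> f \<longrightarrow> B e f = 0"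
    using sym_form_eigenbasis[OF BV] by auto
  have zero: "X *v T e = 0" if e: "e \<in> E2" for e
  proof (rule ccontr)
    assume ne: "X *v T e \<noteq> 0"
    let ?u = "T e"
    define l where "l = B e e"
    have eV: "e \<in> V" using e E2(4) span_base by auto
    have "e \<in> span {f\<in>E2. B f f = l}" using e by (intro span_base) (simp add: l_def)
    then have Be: "B e w = l * (e \<bullet> w)" if "w \<in> V" for w
      using form_rad_eigenbasis[OF BV E2, of l] that by auto
    have lpos: "l > 0" unfolding l_def B_def by (rule G_pos[OF ne])
    have "G (X *v (X *v ?u) + l *\<^sub>R ?u) y = 0" if y: "y \<in> V" for y
    proof -
      obtain w where w: "w \<in> V" "T w = y" using Tsurj[OF y] by blast
      have "G (X *v ?u) (X *v y) = l * G ?u y" using Be[OF w(1)] GT[OF eV, of w] by (simp add: B_def w(2))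
      moreover have "G (X *v (X *v ?u)) y = - G (X *v ?u) (X *v y)" by (rule G_skew[OF XV[OF TV] y])
      ultimately show ?thesis by (simp add: G_add G_sc)
    qed
    moreover have "X *v (X *v ?u) + l *\<^sub>R ?u \<in> V" using XV TV sV by (intro subspace_add subspace_scale) auto
    ultimately have XX: "X *v (X *v ?u) + l *\<^sub>R ?u = 0" using G_pos by (metis less_irrefl)
    \<comment> \<open>\<open>T e\<close> and \<open>q\<close> span a plane in \<open>V\<close> on
      which \<open>X\<close> acts with angular speed \<open>\<theta>\<close>; since
      \<open>matrix_exp X\<close> fixes \<open>V\<close>, this contradicts the norm bound.\<close>
    define \<theta> where "\<theta> = sqrt l"
    define q where "q = - ((1 / \<theta>) *\<^sub>R (X *v ?u))"
    have th: "\<theta> > 0" "\<theta> * \<theta> = l" using lpos by (simp_all add: \<theta>_def)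
    have fx: "matrix_exp X *v x = x" if "x \<in> V" for x using that by (simp add: V_def E_def)
    have uq: "X *v ?u = - (\<theta> *\<^sub>R q)" using th by (simp add: q_def)
    have "X *v q = - ((1 / \<theta>) *\<^sub>R (X *v (X *v ?u)))"
      by (simp add: q_def linear_neg[OF matrix_vector_mul_linear] matrix_vector_mult_scaleR)
    also have "X *v (X *v ?u) = - (l *\<^sub>R ?u)" using XX by (simp add: eq_neg_iff_add_eq_0)
    also have "- ((1 / \<theta>) *\<^sub>R - (l *\<^sub>R ?u)) = \<theta> *\<^sub>R ?u" using th by (simp flip: th(2))
    finally have qu: "X *v q = \<theta> *\<^sub>R ?u" .
    have "q \<in> V" unfolding q_def using XV[OF TV] sV by (intro subspace_neg subspace_scale)
    then show False
      using rotation_plane_fixed[OF X uq qu _ th(1)] fx TV ne by fastforce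
  qed
  have "X *v T x = 0" if "x \<in> span E2" for x
    using that
  proof (induction rule: span_induct_alt)
    case base then show ?case by (simp add: linear_0[OF lT])
  next
    case (step c x y)
    then show ?case using zero by (simp add: linear_add[OF lT] linear_cmul[OF lT] matrix_vector_right_distrib matrix_vector_mult_scaleR)
  qed
  then have "X *v y = 0" if "y \<in> V" for y using Tsurj[OF that] E2(4) by auto
  moreover have "v \<in> V" using fixed by (simp add: V_def E_def)
  ultimately show "X *v v = 0" by blast
qed (rule matrix_exp_kernel)

section \<open>Normalization\<close>

lemma sym_matrix_form:
  assumes "transpose S = (S :: real^'m^'m)"
  shows "sym_form UNIV (\<lambda>v w. v \<bullet> (S *v w))"
  unfolding sym_form_def
proof (intro conjI ballI allI subspace_UNIV)
  show "x \<bullet> (S *v y) = y \<bullet> (S *v x)" for x y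
    unfolding transpose_vector_inner[of x S y] assms by (rule inner_commute)
qed (simp_all add: inner_add_left)

text \<open>In an orthonormal eigenbasis each coordinate is multiplied by an eigenvalue of size
  below \<open>r\<close>; a nonzero coordinate makes the inequality strict. As \<open>J0\<close> is
  an isometry, this supplies the norm condition of \<open>matrix_exp_fixed_iff\<close>.\<close>

lemma symmetric_matrix_norm_less:
  fixes S :: "real^'m^'m"
  assumes S: "transpose S = S" and ev: "\<And>c. is_eigenvalue S c \<Longrightarrow> \<bar>c\<bar> < r" and v: "v \<noteq> 0"
  shows "norm (S *v v) < r * norm v"
proof -
  let ?B = "\<lambda>v w. v \<bullet> (S *v w)"
  obtain E where E: "finite E" "pairwise orthogonal E" "\<forall>e\<in>E. norm e = 1" "span E = UNIV"
    "\<forall>e\<in>E. \<forall>f\<in>E. e \<noteq> f \<longrightarrow> ?B e f = 0" using sym_form_eigenbasis[OF sym_matrix_form[OF S]] by auto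
  have expand: "w = (\<Sum>e\<in>E. (w \<bullet> e) *\<^sub>R e)" for w
    using orthonormal_basis_expand[OF E(2), of w] E by auto
  have ww: "w \<bullet> w = (\<Sum>e\<in>E. (w \<bullet> e)\<^sup>2)" for w
    using arg_cong[OF expand[of w], of "\<lambda>x. w \<bullet> x"] by (simp add: inner_sum_right power2_eq_square)
  define l where "l e = e \<bullet> (S *v e)" for e
  have Se: "S *v e = l e *\<^sub>R e" if e: "e \<in> E" for e
  proof -
    have "S *v e = (\<Sum>f\<in>E. ((S *v e) \<bullet> f) *\<^sub>R f)" by (rule expand)
    also have "\<dots> = (\<Sum>f\<in>E. if f = e then l e *\<^sub>R e else 0)"
      using E(5) e by (intro sum.cong) (auto simp: l_def inner_commute)
    finally show ?thesis using E(1) e by simp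
  qed
  have le: "\<bar>l e\<bar> < r" if e: "e \<in> E" for e
  proof -
    have "e \<noteq> 0" using E(3) e by auto
    then have "is_eigenvalue S (l e)" unfolding is_eigenvalue_def using Se[OF e] by blast
    then show ?thesis by (rule ev)
  qed
  have Sve: "(S *v v) \<bullet> e = l e * (v \<bullet> e)" if e: "e \<in> E" for e
  proof -
    have "(S *v v) \<bullet> e = v \<bullet> (S *v e)" unfolding transpose_vector_inner[of v S e] S ..
    then show ?thesis by (simp add: Se[OF e])
  qed
  have "\<exists>e\<in>E. v \<bullet> e \<noteq> 0"
  proof (rule ccontr)
    assume "\<not> ?thesis"
    then have "(\<Sum>e\<in>E. (v \<bullet> e) *\<^sub>R e) = 0" by (intro sum.neutral) auto
    then show False using expand[of v] v by simp
  qed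
  then obtain e0 where e0: "e0 \<in> E" "v \<bullet> e0 \<noteq> 0" by blast
  have r: "r > 0" using le[OF e0(1)] by linarith
  have sq: "(l e)\<^sup>2 < r\<^sup>2" if "e \<in> E" for e
    using power_strict_mono[OF le[OF that], of 2] by simp
  have "(S *v v) \<bullet> (S *v v) < (\<Sum>e\<in>E. r\<^sup>2 * (v \<bullet> e)\<^sup>2)"
    unfolding ww[of "S *v v"]
  proof (rule sum_strict_mono_ex1[OF E(1)])
    show "\<forall>x\<in>E. ((S *v v) \<bullet> x)\<^sup>2 \<le> r\<^sup>2 * (v \<bullet> x)\<^sup>2"
      using less_imp_le[OF sq] by (auto simp: Sve power_mult_distrib intro!: mult_right_mono)
    show "\<exists>a\<in>E. ((S *v v) \<bullet> a)\<^sup>2 < r\<^sup>2 * (v \<bullet> a)\<^sup>2"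
      using sq[OF e0(1)] e0 by (intro bexI[of _ e0]) (auto simp: Sve power_mult_distrib intro!: mult_strict_right_mono)
  qed
  also have "\<dots> = (r * norm v)\<^sup>2"
    by (simp add: sum_distrib_left[symmetric] ww[symmetric] power_mult_distrib power2_norm_eq_inner)
  finally have "(norm (S *v v))\<^sup>2 < (r * norm v)\<^sup>2" unfolding dot_square_norm .
  then show ?thesis by (rule power_less_imp_less_base) (use r in simp)
qed

text \<open>By the eigenvalue bound the fixed space equals the kernel of \<open>S\<close> at all
  times in \<open>(0, 1]\<close>, so the index is concentrated at time 0. There the chart forms
  divided by \<open>s\<close> converge to the form of \<open>S\<close>, while
  \<open>kap L M (K 0)\<close> is 0 because \<open>K 0 = L\<close>.\<close>

lemma maslov_graph_matrix_exp:
  fixes S :: "real^('n::finite + 'n)^('n + 'n)"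
  assumes S: "transpose S = S" and ev: "\<And>c. is_eigenvalue S c \<Longrightarrow> \<bar>c\<bar> < 2 * pi"
  shows "maslov_graph 0 1 (\<lambda>t. matrix_exp (t *\<^sub>R (J0 ** S))) = matrix_signature S"
proof -
  define X where "X = J0 ** S"
  define \<psi> where "\<psi> t = matrix_exp (t *\<^sub>R X)" for t
  define L where "L = (diagonal :: ((real^('n + 'n)) \<times> _) set)"
  define K where "K t = graph (\<psi> t)" for t
  have L: "lagrangian omega_bar L" unfolding L_def by (rule lagrangian_diagonal)
  have Xs: "X \<in> sp_algebra" unfolding X_def by (rule J0_sym_sp_algebra[OF S])
  have XS: "X *v v = J0 *v (S *v v)" for v by (simp add: X_def flip: matrix_vector_mul_assoc)
  have Xn: "norm (X *v v) < 2 * pi * norm v" if "v \<noteq> 0" for v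
    unfolding XS norm_J0 using symmetric_matrix_norm_less[OF S ev that] .
  have \<psi>S: "\<psi> t \<in> Sp" for t unfolding \<psi>_def by (rule matrix_exp_Sp[OF Xs])
  have smooth: "smooth_lagrangian_path omega_bar 0 1 K"
    unfolding K_def by (rule Csmooth_graph) (use \<psi>S Csmooth_matrix_exp[of "{0..1}" X] in \<open>auto simp: \<psi>_def[abs_def]\<close>)
  note fam = smooth_lagrangian_path_family(1)[OF smooth] and diff = smooth_lagrangian_path_family(2)[OF smooth]
  have ker: "{v. (\<psi> t - mat 1) *v v = 0} = {v. S *v v = 0}" if t: "0 < t" "t \<le> 1" for t
  proof -
    have "norm ((t *\<^sub>R X) *v v) < 2 * pi * norm v" if "v \<noteq> 0" for v
    proof -
      have "norm ((t *\<^sub>R X) *v v) \<le> norm (X *v v)" using t by (simp add: scaleR_matrix_vector mult_left_le_one_le)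
      also have "\<dots> < 2 * pi * norm v" by (rule Xn[OF that])
      finally show ?thesis .
    qed
    then have "matrix_exp (t *\<^sub>R X) *v v = v \<longleftrightarrow> (t *\<^sub>R X) *v v = 0" for v by (rule matrix_exp_fixed_iff)
    moreover have "X *v v = 0 \<longleftrightarrow> S *v v = 0" for v
      using arg_cong[OF norm_J0[of "S *v v"], of "\<lambda>r. r = 0"] unfolding XS norm_eq_zero .
    ultimately show ?thesis using t unfolding \<psi>_def matrix_vector_mult_diff_rdistrib scaleR_matrix_vector by simp
  qed
  define k where "k = dim {v. S *v v = 0}"
  have dim: "dim (L \<inter> K t) = k" if "0 < t" "t \<le> 1" for t
    unfolding L_def K_def dim_graph_Int_diagonal k_def ker[OF that] ..
  obtain g where g: "gr.maslov_primitive L {0..1} K g"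
    using gr.maslov_primitive_interval[OF L fam] by auto
  have const: "g 1 = g t" if t: "0 < t" "t \<le> 1" for t
  proof -
    have f: "gr.lag_family {t..1} K" and p: "gr.maslov_primitive L {t..1} K g"
      using t by (auto intro!: gr.lag_family_subset[OF fam] gr.maslov_primitive_subset[OF g])
    have "gr.maslov L t 1 K = 0" using dim t by (intro gr.maslov_zero[OF L f]) auto
    then show ?thesis using gr.maslov_eq[OF L f _ p] t by simp
  qed
  have Kf: "K = (\<lambda>t. graph (\<psi> t))" by (simp add: K_def fun_eq_iff)
  have K0: "K 0 = L" by (simp add: K_def L_def \<psi>_def matrix_exp_0 graph_def diagonal_def)
  obtain M where M: "lagrangian omega_bar M" "L \<inter> M = {0}"
    by (rule gr.common_complement[OF L L])
  have M0: "K 0 \<inter> M = {0}" using M K0 by simp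
  let ?F = "at 0 within {0..1::real}"
  have F: "?F \<noteq> bot" by (simp add: trivial_limit_within islimpt_Icc)
  have 0: "(0::real) \<in> {0..1}" by simp
  note ten = gr.lag_family_tendsto[OF fam 0]
  have lag: "\<forall>\<^sub>F s in ?F. lagrangian omega_bar (K s)" using ten by (auto simp: gr.lag_tendsto_def)
  note tr = gr.lag_tendsto_transversal[OF ten M(1) M0]
  define \<Gamma> where "\<Gamma> v l = fst v \<bullet> (S *v fst l)" for v l :: "(real^('n + 'n)) \<times> (real^('n + 'n))"
  have pL: "proj_along (K 0) M l = l" if "l \<in> L" for l
    using that M(1) M0 L K0 by (intro gr.proj_along(3)) auto
  \<comment> \<open>The projection along \<open>M\<close> has no explicit derivative.
    \<open>velocity_form_eq\<close> is applied both to it and to the explicit curve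
    \<open>(y, \<psi> s *v y)\<close>; equating the two values identifies the limit.\<close>
  have lim: "((\<lambda>s. (1 / s) * gr.chart_form M (K s) v l) \<longlongrightarrow> \<Gamma> v l) ?F" if v: "v \<in> L" and l: "l \<in> L" for v l
  proof -
    obtain D where D: "((\<lambda>s. proj_along (K s) M l) has_vector_derivative D) ?F"
      using gr.proj_along_differentiable[OF fam 0 diff[OF 0] M(1) M0] by blast
    have vK: "v \<in> K 0" and lK: "l \<in> K 0" using v l K0 by auto
    have "\<forall>\<^sub>F s in ?F. proj_along (K s) M l \<in> K s"
      using lag tr by eventually_elim (rule gr.proj_along(1)[OF _ M(1)])
    from gr.velocity_form_eq[OF _ 0 fam diff[OF 0] vK this _ D]
    have 1: "velocity_form omega_bar 0 1 K 0 v l = omega_bar v D" using lK pL[OF l] by simp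
    obtain y where y: "l = (y, y)" using l by (auto simp: L_def diagonal_def)
    have "((\<lambda>s. (y, \<psi> s *v y)) has_vector_derivative (0, X *v y)) ?F"
      using matrix_exp_vector_derivative[of X y 0 "{0..1}"]
      by (intro has_vector_derivative_Pair has_vector_derivative_const) (simp add: \<psi>_def matrix_exp_0)
    from gr.velocity_form_eq[OF _ 0 fam diff[OF 0] vK _ _ this]
    have 2: "velocity_form omega_bar 0 1 K 0 v (y, \<psi> 0 *v y) = omega_bar v (0, X *v y)"
      by (simp add: Kf graph_def)
    obtain x where x: "v = (x, x)" using v by (auto simp: L_def diagonal_def)
    have "omega_bar v D = omega_bar v (0, X *v y)" using 1 2 by (simp add: y \<psi>_def matrix_exp_0)
    also have "\<dots> = \<Gamma> v l" by (simp add: omega_bar_def x y \<Gamma>_def XS omega0_J0)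
    finally have G: "omega_bar v D = \<Gamma> v l" .
    have "((\<lambda>s. (omega_bar v (proj_along (K s) M l) - omega_bar v (proj_along (K 0) M l)) /\<^sub>R (s - 0)) \<longlongrightarrow> omega_bar v D) ?F"
      using gr.Om_has_vector_derivative[OF D, of v] unfolding has_vector_derivative_quotient .
    moreover have "omega_bar v (proj_along (K 0) M l) = 0" using gr.lagD(2)[OF L v l] pL[OF l] by simp
    ultimately show ?thesis by (simp add: G gr.chart_form_def divide_inverse)
  qed
  have sB: "\<forall>\<^sub>F s in ?F. sym_form L (\<lambda>v l. (1 / s) * gr.chart_form M (K s) v l)"
    using lag tr by eventually_elim (intro sym_form_scale gr.kap_chart(2)[OF L M])
  have s\<Gamma>: "sym_form L \<Gamma>" by (rule sym_form_tendsto[OF F sB lim])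
  have lin2: "linear (\<lambda>x. (x, x) :: (real^('n + 'n)) \<times> (real^('n + 'n)))" by (auto intro!: linearI)
  have L_image: "L = (\<lambda>x. (x, x)) ` UNIV" by (auto simp: L_def diagonal_def)
  have rad\<Gamma>: "dim (form_rad L \<Gamma>) = k"
  proof -
    have "form_rad L \<Gamma> = (\<lambda>x. (x, x)) ` {v. S *v v = 0}"
    proof -
      have "(\<forall>w\<in>L. \<Gamma> (x, x) w = 0) \<longleftrightarrow> S *v x = 0" for x
      proof -
        have "(\<forall>w\<in>L. \<Gamma> (x, x) w = 0) \<longleftrightarrow> (\<forall>y. (S *v x) \<bullet> y = 0)"
          unfolding L_image \<Gamma>_def by (simp add: transpose_vector_inner[of x S] S)
        then show ?thesis using inner_eq_zero_iff[of "S *v x"] by auto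
      qed
      then have "form_rad L \<Gamma> = {v \<in> L. \<exists>x. v = (x, x) \<and> S *v x = 0}"
        unfolding form_rad_def by (auto simp: L_def diagonal_def)
      then show ?thesis by (auto simp: L_def diagonal_def)
    qed
    moreover have "subspace {v. S *v v = 0}" by (rule linear_subspace_kernel) simp
    ultimately show ?thesis unfolding k_def by (auto intro!: dim_image_inj lin2 inj_onI)
  qed
  have pos: "\<forall>\<^sub>F s in ?F. 0 < s \<and> s \<le> 1" by (auto simp: eventually_at_filter)
  have "\<forall>\<^sub>F s in ?F. sig L (\<lambda>v l. (1 / s) * gr.chart_form M (K s) v l) = sig L \<Gamma>"
  proof (rule sig_eventually_const[OF s\<Gamma> sB lim])
    show "\<forall>\<^sub>F s in ?F. dim (form_rad L \<Gamma>) \<le> dim (form_rad L (\<lambda>v l. (1 / s) * gr.chart_form M (K s) v l))"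
      using pos lag tr
    proof eventually_elim
      case (elim s)
      have "form_rad L (\<lambda>v l. (1 / s) * gr.chart_form M (K s) v l) = form_rad L (gr.chart_form M (K s))"
        using elim(1) by (auto simp: form_rad_def)
      also have "\<dots> = L \<inter> K s" by (rule gr.kap_chart(3)[OF L M elim(2,3)])
      finally show ?case using dim[of s] elim(1) rad\<Gamma> by simp
    qed
  qed
  moreover have "\<forall>\<^sub>F q in ?F. g q - gr.kap L M (K q) = g 0 - gr.kap L M (K 0)"
    using g[unfolded gr.maslov_primitive_def, rule_format, OF 0 conjI[OF M(1) conjI[OF M(2) M0]]] .
  ultimately have "\<forall>\<^sub>F s::real in ?F. g 1 = g 0 - gr.kap L M (K 0) + sig L \<Gamma>"
    using pos lag tr
  proof eventually_elim
    case (elim s)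
    have "gr.kap L M (K s) = sig L (gr.chart_form M (K s))" by (rule gr.kap_chart(1)[OF L M elim(4,5)])
    then show ?case using elim sig_scale[of "1 / s" L "gr.chart_form M (K s)"] const[of s] by simp
  qed
  then have "g 1 = g 0 - gr.kap L M (K 0) + sig L \<Gamma>" using eventually_happens'[OF F] by blast
  moreover have "gr.kap L M (K 0) = 0"
  proof -
    have "form_rad L (gr.chart_form M L) = L" using gr.kap_chart(3)[OF L M L M(2)] by simp
    then have "sig L (gr.chart_form M L) = 0"
      by (intro sig_zero gr.lagD(1)[OF L]) (auto simp: form_rad_def)
    then show ?thesis using gr.kap_chart(1)[OF L M L M(2)] K0 by simp
  qed
  moreover have "sig L \<Gamma> = matrix_signature S"
  proof -
    have "sig L \<Gamma> = sig UNIV (\<lambda>v w. v \<bullet> (S *v w))"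
      unfolding L_image by (intro sig_congruent[OF lin2]) (auto simp: inj_on_def \<Gamma>_def)
    then show ?thesis
      using matrix_signature_eq_form_signature[OF S] sig_eq_form_signature[OF sym_matrix_form[OF S]] by simp
  qed
  moreover have "gr.maslov L 0 1 K = g 1 - g 0" using gr.maslov_eq[OF L fam _ g] by simp
  ultimately show ?thesis unfolding maslov_graph_def L_def K_def \<psi>_def X_def by simp
qed

lemma symplectic_path_matrix_exp:
  "X \<in> sp_algebra \<Longrightarrow> symplectic_path a b (\<lambda>t. matrix_exp (t *\<^sub>R X))"
  unfolding symplectic_path_def using continuous_on_matrix_exp matrix_exp_Sp by blast

lemma rs_index_normalization:
  "normalization_property (rs_index :: real \<Rightarrow> real \<Rightarrow> (real \<Rightarrow> real^('n::finite + 'n)^('n + 'n)) \<Rightarrow> real)"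
  unfolding normalization_property_def
  proof (intro allI impI)
  fix S :: "real^('n + 'n)^('n + 'n)"
  assume S: "transpose S = S \<and> (\<forall>c. is_eigenvalue S c \<longrightarrow> \<bar>c\<bar> < 2 * pi)"
  have "symplectic_path 0 1 (\<lambda>t. matrix_exp (t *\<^sub>R (J0 ** S)))"
    using S by (intro symplectic_path_matrix_exp J0_sym_sp_algebra) auto
  from rs_index_eq_maslov[OF _ this] maslov_graph_matrix_exp[of S] S
  show "rs_index 0 1 (\<lambda>t. matrix_exp (t *\<^sub>R (J0 ** S))) = 1/2 * of_int (matrix_signature S)" by simp
qed

lemma rs_index_properties:
  "rs_properties (rs_index :: real \<Rightarrow> real \<Rightarrow> (real \<Rightarrow> real^('n::finite + 'n)^('n + 'n)) \<Rightarrow> real)"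
  unfolding rs_properties_def
  using rs_index_half_integer rs_index_homotopy rs_index_catenation rs_index_zero rs_index_normalization by blast

section \<open>Uniqueness\<close>

lemma sp_algebra_eq_J0:
  assumes X: "X \<in> sp_algebra"
  shows "X = J0 ** (Omega0 ** X)" "transpose (Omega0 ** X) = Omega0 ** X"
proof -
  show "X = J0 ** (Omega0 ** X)"
    by (simp add: matrix_eq J0_vector Omega0_Omega0 flip: matrix_vector_mul_assoc)
  have "(transpose (Omega0 ** X) *v x) \<bullet> y = ((Omega0 ** X) *v x) \<bullet> y" for x y
  proof -
    have "(transpose (Omega0 ** X) *v x) \<bullet> y = omega0 x (X *v y)"
      using transpose_vector_inner[of x "Omega0 ** X" y] by (simp only: omega0_def matrix_vector_mul_assoc)
    also have "\<dots> = omega0 y (X *v x)" using sp_algebraD[OF X, of x y] omega0_antisym[of y "X *v x"] by simp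
    finally show ?thesis by (simp only: omega0_def matrix_vector_mul_assoc inner_commute)
  qed
  then have "transpose (Omega0 ** X) *v x = (Omega0 ** X) *v x" for x
    using vector_eq_rdot[of "transpose (Omega0 ** X) *v x"] by blast
  then show "transpose (Omega0 ** X) = Omega0 ** X" by (simp add: matrix_eq del: transpose_matrix_vector)
qed

lemma rotation_add: "rotation (s + t) = (rotation s ** rotation t :: real^('n::finite + 'n)^('n + 'n))"
proof -
  have "rotation (s + t) *v x = rotation s *v (rotation t *v x)" for x :: "real^('n + 'n)"
  proof -
    have J: "J0 *v (J0 *v x) = - x" unfolding matrix_vector_mul_assoc J0_J0 by (simp add: uminus_matrix_vector)
    have "J0 *v (rotation t *v x) = cos t *\<^sub>R (J0 *v x) + sin t *\<^sub>R (J0 *v (J0 *v x))"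
      by (simp only: rotation_vector matrix_vector_right_distrib matrix_vector_mult_scaleR)
    then have "rotation s *v (rotation t *v x) = cos s *\<^sub>R (cos t *\<^sub>R x + sin t *\<^sub>R (J0 *v x))
        + sin s *\<^sub>R (cos t *\<^sub>R (J0 *v x) - sin t *\<^sub>R x)"
      unfolding rotation_vector[of s] J by (simp add: rotation_vector[of t])
    then show ?thesis unfolding rotation_vector cos_add sin_add
      by (simp add: scaleR_add_left scaleR_add_right scaleR_diff_left scaleR_diff_right mult.commute)
  qed
  then show ?thesis by (simp only: matrix_eq matrix_vector_mul_assoc simp_thms)
qed

text \<open>Abstracts the difference of two correspondences: the structural properties are linear in
  the index, and the prescribed values on exponentials cancel.\<close>

locale vanishing_index =
  fixes \<nu> :: "real \<Rightarrow> real \<Rightarrow> (real \<Rightarrow> real^('n::finite + 'n)^('n + 'n)) \<Rightarrow> real"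
  assumes homotopy: "homotopy_property \<nu>" and catenation: "catenation_property \<nu>" and zero: "zero_property \<nu>"
    and exponential: "\<And>S. transpose S = S \<Longrightarrow> (\<And>c. is_eigenvalue S c \<Longrightarrow> \<bar>c\<bar> < 2 * pi) \<Longrightarrow>
      \<nu> 0 1 (\<lambda>t. matrix_exp (t *\<^sub>R (J0 ** S))) = 0"
begin

lemma homotopic:
  assumes "a < b" "homotopic_with_canon (\<lambda>\<xi>. \<xi> a = \<psi> a \<and> \<xi> b = \<psi> b) {a..b} Sp \<psi> \<phi>"
  shows "\<nu> a b \<psi> = \<nu> a b \<phi>"
proof -
  have "symplectic_path a b \<psi> \<and> symplectic_path a b \<phi>"
    unfolding symplectic_path_def
    using homotopic_with_imp_continuous[OF assms(2)] homotopic_with_imp_subset1[OF assms(2)]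
      homotopic_with_imp_subset2[OF assms(2)] by (simp add: image_subset_iff_funcset)
  then show ?thesis
    using homotopy[unfolded homotopy_property_def, rule_format, of a b \<psi> \<phi>] assms by blast
qed

lemma cong:
  assumes ab: "a < b" and \<psi>: "symplectic_path a b \<psi>" and eq: "\<And>t. t \<in> {a..b} \<Longrightarrow> \<phi> t = \<psi> t"
  shows "\<nu> a b \<phi> = \<nu> a b \<psi>"
proof -
  have "homotopic_with_canon (\<lambda>\<xi>. \<xi> a = \<psi> a \<and> \<xi> b = \<psi> b) {a..b} Sp \<psi> \<phi>"
  proof (rule homotopic_with_equal)
    show "continuous_map (top_of_set {a..b}) (top_of_set Sp) \<psi>"
      using \<psi> by (auto simp: symplectic_path_def)
  qed (use eq ab in auto)
  from homotopic[OF ab this] show ?thesis ..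
qed

lemma subdivide:
  assumes "a \<le> c" "c \<le> b" "a < b" "symplectic_path a b \<psi>"
  shows "\<nu> a b \<psi> = (if a < c then \<nu> a c \<psi> else 0) + (if c < b then \<nu> c b \<psi> else 0)"
proof (cases "a < c \<and> c < b")
  case True
  then have "\<nu> a b \<psi> = \<nu> a c \<psi> + \<nu> c b \<psi>"
    using catenation assms(4) unfolding catenation_property_def by blast
  then show ?thesis using True by simp
qed (use assms(1-3) in auto)

lemma fixed_space_const:
  assumes "a < b" "symplectic_path a b \<psi>" "\<And>t. t \<in> {a..b} \<Longrightarrow> {v. \<psi> t *v v = v} = K"
  shows "\<nu> a b \<psi> = 0"
proof -
  have "dim {v. (\<psi> t - mat 1) *v v = 0} = dim K" if "t \<in> {a..b}" for t
    using assms(3)[OF that] by (simp add: matrix_vector_mult_diff_rdistrib)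
  then show ?thesis using zero[unfolded zero_property_def, rule_format, of a b \<psi> "dim K"] assms(1,2) by blast
qed

lemma constant_path: "a < b \<Longrightarrow> A \<in> Sp \<Longrightarrow> \<nu> a b (\<lambda>t. A) = 0"
  by (rule fixed_space_const[OF _ _ refl]) (auto simp: symplectic_path_def)

text \<open>The homotopy property compares paths on one interval only. Both paths are therefore
  extended by constant pieces, which contribute 0, to a common interval \<open>{A..B}\<close>; there
  the two parameter functions are joined by a linear homotopy in \<open>{c..d}\<close>.\<close>

lemma reparametrize:
  assumes ab: "a < b" and cd: "c < d" and \<psi>: "symplectic_path c d \<psi>"
    and \<theta>: "continuous_on {a..b} \<theta>" "\<theta> ` {a..b} \<subseteq> {c..d}" "\<theta> a = c" "\<theta> b = d"
  shows "\<nu> a b (\<lambda>t. \<psi> (\<theta> t)) = \<nu> c d \<psi>"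
proof -
  have comp: "symplectic_path u v (\<lambda>t. \<psi> (\<eta> t))" if "continuous_on {u..v} \<eta>" "\<eta> ` {u..v} \<subseteq> {c..d}" for u v \<eta>
    using \<psi> that unfolding symplectic_path_def
    by (auto intro!: continuous_on_compose2[of "{c..d}" \<psi>])
  \<comment> \<open>The margins of length 1 keep all constant pieces nondegenerate, as the
    catenation property requires.\<close>
  define A where "A = min a c - 1"
  define B where "B = max b d + 1"
  define clamp :: "real \<Rightarrow> real \<Rightarrow> real \<Rightarrow> real" where "clamp u v t = max u (min v t)" for u v t
  have cl: "continuous_on S (clamp u v)" for u v S unfolding clamp_def by (intro continuous_intros)
  have AB: "A < a" "A < c" "b < B" "d < B" by (auto simp: A_def B_def)
  have ext: "\<nu> A B (\<lambda>t. \<psi> (\<eta> (clamp u v t))) = \<nu> u v (\<lambda>t. \<psi> (\<eta> t))"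
    if uv: "u < v" "A < u" "v < B" and \<eta>: "continuous_on {u..v} \<eta>" "\<eta> ` {u..v} \<subseteq> {c..d}" for u v \<eta>
  proof -
    let ?f = "\<lambda>t. \<psi> (\<eta> (clamp u v t))"
    have in_uv: "clamp u v t \<in> {u..v}" for t using uv by (auto simp: clamp_def)
    have cont: "continuous_on {A..B} (\<lambda>t. \<eta> (clamp u v t))"
      using in_uv by (intro continuous_on_compose2[OF \<eta>(1) cl]) auto
    have sp: "symplectic_path A B ?f" using cont \<eta>(2) in_uv by (intro comp) auto
    note spv = symplectic_path_subset[OF sp]
    have inS: "\<psi> (\<eta> t) \<in> Sp" if "t \<in> {u..v}" for t using \<psi> \<eta>(2) that unfolding symplectic_path_def image_subset_iff by blast
    have "\<nu> A B ?f = \<nu> A u ?f + \<nu> u B ?f" using subdivide[of A u B] uv sp by simp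
    also have "\<nu> u B ?f = \<nu> u v ?f + \<nu> v B ?f" using subdivide[of u v B ?f] uv spv[of u B] by simp
    also have "\<nu> A u ?f = \<nu> A u (\<lambda>t. \<psi> (\<eta> u))"
      using uv inS[of u] by (intro cong) (auto simp: clamp_def symplectic_path_def)
    also have "\<dots> = 0" using uv inS[of u] by (intro constant_path) auto
    also have "\<nu> v B ?f = \<nu> v B (\<lambda>t. \<psi> (\<eta> v))"
      using uv inS[of v] by (intro cong) (auto simp: clamp_def symplectic_path_def)
    also have "\<dots> = 0" using uv inS[of v] by (intro constant_path) auto
    also have "\<nu> u v ?f = \<nu> u v (\<lambda>t. \<psi> (\<eta> t))"
      using uv comp[OF \<eta>] by (intro cong) (auto simp: clamp_def)
    finally show ?thesis by simp
  qed
  define h where "h = (\<lambda>(s::real, t::real). \<psi> ((1 - s) * \<theta> (clamp a b t) + s * clamp c d t))"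
  have in_ab: "clamp a b t \<in> {a..b}" and in_cd: "clamp c d t \<in> {c..d}" for t
    using ab cd by (auto simp: clamp_def)
  have mem: "(1 - s) * \<theta> (clamp a b t) + s * clamp c d t \<in> {c..d}" if "s \<in> {0..1}" for s t
  proof -
    have "\<theta> (clamp a b t) \<in> {c..d}" using \<theta>(2) in_ab by blast
    then show ?thesis using convexD_alt[OF convex_real_interval(5), of _ c d "clamp c d t" s] in_cd[of t] that by auto
  qed
  have cont: "continuous_on ({0..1} \<times> {A..B}) (\<lambda>x. (1 - fst x) * \<theta> (clamp a b (snd x)) + fst x * clamp c d (snd x))"
    using in_ab by (intro continuous_intros continuous_on_compose2[OF \<theta>(1)] continuous_on_compose2[OF cl[of UNIV]]) auto
  have "\<nu> A B (\<lambda>t. \<psi> (\<theta> (clamp a b t))) = \<nu> A B (\<lambda>t. \<psi> (clamp c d t))"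
  proof (rule homotopic)
    show "A < B" using AB ab by linarith
    show "homotopic_with_canon (\<lambda>\<xi>. \<xi> A = \<psi> (\<theta> (clamp a b A)) \<and> \<xi> B = \<psi> (\<theta> (clamp a b B))) {A..B} Sp
        (\<lambda>t. \<psi> (\<theta> (clamp a b t))) (\<lambda>t. \<psi> (clamp c d t))"
      unfolding homotopic_with_def
    proof (rule exI[of _ h], intro conjI ballI allI impI)
      have "continuous_on ({0..1} \<times> {A..B}) h"
        using \<psi> mem unfolding h_def case_prod_beta symplectic_path_def
        by (intro continuous_on_compose2[OF _ cont, of "{c..d}"]) auto
      moreover have "h ` ({0..1} \<times> {A..B}) \<subseteq> Sp"
        using \<psi> mem unfolding h_def symplectic_path_def by (auto simp: image_subset_iff)
      ultimately show "continuous_map (prod_topology (top_of_set {0..1}) (top_of_set {A..B})) (top_of_set Sp) h"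
        by (simp add: image_subset_iff_funcset prod_topology_subtopology_eu)
      
      fix s :: real
      have ends: "clamp a b A = a" "clamp a b B = b" "clamp c d A = c" "clamp c d B = d"
        using AB ab cd by (simp_all add: clamp_def)
      have affine: "(1 - s) * u + s * u = u" for u :: real by (simp add: algebra_simps)
      show "h (s, A) = \<psi> (\<theta> (clamp a b A))" "h (s, B) = \<psi> (\<theta> (clamp a b B))"
        by (simp_all add: h_def ends \<theta>(3,4) affine)
    qed (simp_all add: h_def)
  qed
  moreover have "\<nu> A B (\<lambda>t. \<psi> (\<theta> (clamp a b t))) = \<nu> a b (\<lambda>t. \<psi> (\<theta> t))" by (rule ext) (use ab AB \<theta> in auto)
  moreover have "\<nu> A B (\<lambda>t. \<psi> (clamp c d t)) = \<nu> c d (\<lambda>t. \<psi> t)" using ext[of c d "\<lambda>t. t"] cd AB by simp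
  ultimately show ?thesis by simp
qed

lemma affine:
  assumes "a < b" "c < d" "symplectic_path c d \<psi>"
  shows "\<nu> a b (\<lambda>t. \<psi> (c + (d - c) / (b - a) * (t - a))) = \<nu> c d \<psi>"
proof (rule reparametrize[OF assms])
  have "0 \<le> (t - a) / (b - a)" "(t - a) / (b - a) \<le> 1" if "t \<in> {a..b}" for t using that assms(1) by auto
  then have "c + (d - c) * ((t - a) / (b - a)) \<in> {c..d}" if "t \<in> {a..b}" for t
    using that assms(2) mult_left_le[of "(t - a) / (b - a)" "d - c"] by (auto simp: mult_nonneg_nonneg)
  then show "(\<lambda>t. c + (d - c) / (b - a) * (t - a)) ` {a..b} \<subseteq> {c..d}" by auto
  show "continuous_on {a..b} (\<lambda>t. c + (d - c) / (b - a) * (t - a))" by (intro continuous_intros)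
  show "c + (d - c) / (b - a) * (a - a) = c" by simp
  show "c + (d - c) / (b - a) * (b - a) = d" using assms(1) by simp
qed

lemma homotopic_paths:
  assumes "homotopic_paths Sp p q" shows "\<nu> 0 1 p = \<nu> 0 1 q"
  using assms homotopic[of 0 1 p q] unfolding homotopic_paths_def pathstart_def pathfinish_def by simp

lemma symplectic_path_path: "symplectic_path 0 1 p \<longleftrightarrow> path p \<and> path_image p \<subseteq> Sp"
  unfolding symplectic_path_def path_def path_image_def ..

lemma join:
  assumes p: "symplectic_path 0 1 p" and q: "symplectic_path 0 1 q" and pq: "pathfinish p = pathstart q"
  shows "\<nu> 0 1 (p +++ q) = \<nu> 0 1 p + \<nu> 0 1 q"
proof -
  have pq': "p 1 = q 0" using pq by (simp add: pathfinish_def pathstart_def)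
  have j: "symplectic_path 0 1 (p +++ q)"
    using assms unfolding symplectic_path_path by (auto simp: path_image_join)
  have "\<nu> 0 1 (p +++ q) = \<nu> 0 (1/2) (p +++ q) + \<nu> (1/2) 1 (p +++ q)" using subdivide[OF _ _ _ j, of "1/2"] by simp
  also have "\<nu> 0 (1/2) (p +++ q) = \<nu> 0 (1/2) (\<lambda>t. p (2 * t))"
    proof (rule cong[symmetric])
    fix t :: real assume t: "t \<in> {0..1/2}"
    show "p (2 * t) = (p +++ q) t" using t by (auto simp: joinpaths_def)
  qed (use symplectic_path_subset[OF j, of 0 "1/2"] in auto)
  also have "\<dots> = \<nu> 0 1 p" using affine[of 0 "1/2" 0 1 p] p by (simp add: mult.commute)
  also have "\<nu> (1/2) 1 (p +++ q) = \<nu> (1/2) 1 (\<lambda>t. q (2 * t - 1))"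
  proof (rule cong[symmetric])
    fix t :: real assume t: "t \<in> {1/2..1}"
    show "q (2 * t - 1) = (p +++ q) t" 
    proof (cases "t = 1/2")
      case True then show ?thesis unfolding True by (simp add: joinpaths_def pq')
    next
      case False then show ?thesis using t by (simp add: joinpaths_def)
    qed
  qed (use symplectic_path_subset[OF j, of "1/2" 1] in auto)
  also have "\<dots> = \<nu> 0 1 q" using affine[of "1/2" 1 0 1 q] q by (simp add: algebra_simps)
  finally show ?thesis .
qed

text \<open>The two ways around the boundary are homotopic in the convex square, and
  \<open>F\<close> carries this homotopy into \<open>Sp\<close>.\<close>

lemma unit_square:
  fixes F :: "real \<times> real \<Rightarrow> real^('n + 'n)^('n + 'n)"
  assumes F: "continuous_on ({0..1} \<times> {0..1}) F" "F ` ({0..1} \<times> {0..1}) \<subseteq> Sp"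
  shows "\<nu> 0 1 (\<lambda>s. F (s, 0)) + \<nu> 0 1 (\<lambda>t. F (1, t)) = \<nu> 0 1 (\<lambda>t. F (0, t)) + \<nu> 0 1 (\<lambda>s. F (s, 1))"
proof -
  let ?Q = "{0..1::real} \<times> {0..1::real}"
  let ?l = "linepath :: real \<times> real \<Rightarrow> _"
  have cQ: "convex ?Q" by (intro convex_Times convex_real_interval)
  have seg: "path_image (?l x y) \<subseteq> ?Q" if "x \<in> ?Q" "y \<in> ?Q" for x y
    unfolding path_image_linepath by (rule closed_segment_subset[OF that cQ])
  have sub: "path_image (?l x y +++ ?l y z) \<subseteq> ?Q" if "x \<in> ?Q" "y \<in> ?Q" "z \<in> ?Q" for x y z
    using seg[OF that(1,2)] seg[OF that(2,3)] by (simp add: path_image_join)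
  have "homotopic_paths ?Q (?l (0,0) (1,0) +++ ?l (1,0) (1,1)) (?l (0,0) (0,1) +++ ?l (0,1) (1,1))"
  proof (rule homotopic_paths_linear)
    fix t :: real assume t: "t \<in> {0..1}"
    have "(?l (0,0) (1,0) +++ ?l (1,0) (1,1)) t \<in> ?Q" using sub[of "(0,0)" "(1,0)" "(1,1)"] t unfolding path_image_def by auto
    moreover have "(?l (0,0) (0,1) +++ ?l (0,1) (1,1)) t \<in> ?Q" using sub[of "(0,0)" "(0,1)" "(1,1)"] t unfolding path_image_def by auto
    ultimately show "closed_segment ((?l (0,0) (1,0) +++ ?l (1,0) (1,1)) t) ((?l (0,0) (0,1) +++ ?l (0,1) (1,1)) t) \<subseteq> ?Q"
      by (rule closed_segment_subset[OF _ _ cQ])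
  qed simp_all
  then have "homotopic_paths Sp (F \<circ> (?l (0,0) (1,0) +++ ?l (1,0) (1,1))) (F \<circ> (?l (0,0) (0,1) +++ ?l (0,1) (1,1)))"
    by (rule homotopic_paths_continuous_image) (use F in auto)
  then have eq: "\<nu> 0 1 ((F \<circ> ?l (0,0) (1,0)) +++ (F \<circ> ?l (1,0) (1,1))) = \<nu> 0 1 ((F \<circ> ?l (0,0) (0,1)) +++ (F \<circ> ?l (0,1) (1,1)))"
    unfolding path_compose_join by (rule homotopic_paths)
  have sp: "symplectic_path 0 1 (F \<circ> ?l x y)" if "x \<in> ?Q" "y \<in> ?Q" for x y
    unfolding symplectic_path_path
  proof
    show "path (F \<circ> ?l x y)"
      by (rule path_continuous_image) (use continuous_on_subset[OF F(1) seg[OF that]] in auto)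
    show "path_image (F \<circ> ?l x y) \<subseteq> Sp" unfolding path_image_compose using F(2) seg[OF that] by blast
  qed
  have l: "F \<circ> ?l (0,0) (1,0) = (\<lambda>s. F (s, 0))" "F \<circ> ?l (1,0) (1,1) = (\<lambda>t. F (1, t))"
    "F \<circ> ?l (0,0) (0,1) = (\<lambda>t. F (0, t))" "F \<circ> ?l (0,1) (1,1) = (\<lambda>s. F (s, 1))"
    by (simp_all add: fun_eq_iff linepath_def)
  have "\<nu> 0 1 ((F \<circ> ?l (0,0) (1,0)) +++ (F \<circ> ?l (1,0) (1,1))) = \<nu> 0 1 (F \<circ> ?l (0,0) (1,0)) + \<nu> 0 1 (F \<circ> ?l (1,0) (1,1))"
    by (intro join sp) (simp_all add: pathstart_compose pathfinish_compose)
  moreover have "\<nu> 0 1 ((F \<circ> ?l (0,0) (0,1)) +++ (F \<circ> ?l (0,1) (1,1))) = \<nu> 0 1 (F \<circ> ?l (0,0) (0,1)) + \<nu> 0 1 (F \<circ> ?l (0,1) (1,1))"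
    by (intro join sp) (simp_all add: pathstart_compose pathfinish_compose)
  ultimately show ?thesis using eq unfolding l by simp
qed

text \<open>The main computational tool: if \<open>\<nu>\<close> vanishes on three sides of a
  rectangle in \<open>Sp\<close>, it vanishes on the fourth.\<close>

lemma rectangle:
  fixes F :: "real \<times> real \<Rightarrow> real^('n + 'n)^('n + 'n)"
  assumes ab: "a < b" and cd: "c < d"
    and F: "continuous_on ({a..b} \<times> {c..d}) F" "F ` ({a..b} \<times> {c..d}) \<subseteq> Sp"
  shows "\<nu> a b (\<lambda>s. F (s, c)) + \<nu> c d (\<lambda>t. F (b, t)) = \<nu> c d (\<lambda>t. F (a, t)) + \<nu> a b (\<lambda>s. F (s, d))"
proof -
  let ?p = "\<lambda>(s, t). (a + (b - a) * s, c + (d - c) * t) :: real \<times> real"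
  have p: "?p ` ({0..1} \<times> {0..1}) \<subseteq> {a..b} \<times> {c..d}"
  proof -
    have "u + (v - u) * s \<in> {u..v}" if "u < v" "s \<in> {0..1}" for u v s :: real
    proof -
      have "0 \<le> (v - u) * s" "(v - u) * s \<le> v - u" using that mult_left_le[of s "v - u"] by auto
      then show ?thesis by simp
    qed
    then show ?thesis using ab cd by (auto simp: image_subset_iff)
  qed
  have "continuous_on ({0..1} \<times> {0..1}) (\<lambda>x. F (?p x))"
    by (rule continuous_on_compose2[OF F(1) _ p]) (auto simp: case_prod_beta intro!: continuous_intros)
  moreover have "(\<lambda>x. F (?p x)) ` ({0..1} \<times> {0..1}) \<subseteq> Sp" using F(2) p by blast
  ultimately have "\<nu> 0 1 (\<lambda>s. F (?p (s, 0))) + \<nu> 0 1 (\<lambda>t. F (?p (1, t))) = \<nu> 0 1 (\<lambda>t. F (?p (0, t))) + \<nu> 0 1 (\<lambda>s. F (?p (s, 1)))"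
    by (rule unit_square)
  moreover have "symplectic_path a b (\<lambda>s. F (s, t))" if "t \<in> {c..d}" for t
    unfolding symplectic_path_def
    using F(2) that by (auto intro!: continuous_on_compose2[OF F(1)] continuous_intros)
  from affine[OF _ ab this, of 0 1]
  have "\<nu> 0 1 (\<lambda>s. F (a + (b - a) * s, t)) = \<nu> a b (\<lambda>s. F (s, t))" if "t \<in> {c..d}" for t using that by simp
  moreover have "symplectic_path c d (\<lambda>t. F (s, t))" if "s \<in> {a..b}" for s
    unfolding symplectic_path_def
    using F(2) that by (auto intro!: continuous_on_compose2[OF F(1)] continuous_intros)
  from affine[OF _ cd this, of 0 1]
  have "\<nu> 0 1 (\<lambda>t. F (s, c + (d - c) * t)) = \<nu> c d (\<lambda>t. F (s, t))" if "s \<in> {a..b}" for s using that by simp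
  ultimately show ?thesis using ab cd by simp
qed

end

section \<open>Vanishing near the identity\<close>

context vanishing_index
begin

text \<open>In the rectangle \<open>cay (s *\<^sub>R W t)\<close> the side \<open>s = 0\<close> is
  constant, so the index along \<open>cay (W t)\<close> is the difference of two Cayley
  rays.\<close>

lemma cay_family:
  assumes cd: "c < d" and W: "continuous_on {c..d} W" "\<And>t. t \<in> {c..d} \<Longrightarrow> W t \<in> sp_algebra"
    "\<And>t. t \<in> {c..d} \<Longrightarrow> small_matrix (W t)"
  shows "\<nu> 0 1 (\<lambda>s. cay (s *\<^sub>R W c)) + \<nu> c d (\<lambda>t. cay (W t)) = \<nu> 0 1 (\<lambda>s. cay (s *\<^sub>R W d))"
proof -
  let ?F = "\<lambda>x. cay (fst x *\<^sub>R W (snd x))"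
  have small: "small_matrix (fst x *\<^sub>R W (snd x))" if "x \<in> {0..1} \<times> {c..d}" for x
    using that by (intro small_matrix_scaleR W(3)) auto
  have "continuous_on ({0..1} \<times> {c..d}) ?F"
    by (intro continuous_on_cay small continuous_intros continuous_on_compose2[OF W(1)]) auto
  moreover have "?F x \<in> Sp" if "x \<in> {0..1} \<times> {c..d}" for x
    using that by (intro cay_Sp sp_algebra_scaleR W(2) small_matrix_invertible small) auto
  ultimately have "\<nu> 0 1 (\<lambda>s. ?F (s, c)) + \<nu> c d (\<lambda>t. ?F (1, t)) = \<nu> c d (\<lambda>t. ?F (0, t)) + \<nu> 0 1 (\<lambda>s. ?F (s, d))"
    by (intro rectangle cd) auto
  moreover have "\<nu> c d (\<lambda>t. ?F (0, t)) = 0" using constant_path[OF cd Sp_mat1] by (simp add: cay_0)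
  ultimately show ?thesis by simp
qed

text \<open>Between \<open>c\<close> and 1 only the length of the generator changes, so the fixed
  space remains the kernel of \<open>X\<close>.\<close>

lemma cay_scale:
  assumes X: "X \<in> sp_algebra" "small_matrix X" and c: "0 < c" "c \<le> 1"
  shows "\<nu> 0 1 (\<lambda>s. cay (s *\<^sub>R (c *\<^sub>R X))) = \<nu> 0 1 (\<lambda>s. cay (s *\<^sub>R X))"
proof (cases "c = 1")
  case False
  then have c1: "c < 1" using c by simp
  have small: "small_matrix (t *\<^sub>R X)" if "t \<in> {c..1}" for t using that c by (intro small_matrix_scaleR X) auto
  have "\<nu> c 1 (\<lambda>t. cay (t *\<^sub>R X)) = 0"
  proof (rule fixed_space_const[OF c1])
    show "symplectic_path c 1 (\<lambda>t. cay (t *\<^sub>R X))" unfolding symplectic_path_def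
      by (auto intro!: continuous_on_cay cay_Sp sp_algebra_scaleR X small_matrix_invertible small continuous_intros)
    show "{v. cay (t *\<^sub>R X) *v v = v} = {v. X *v v = 0}" if "t \<in> {c..1}" for t
      using that c by (simp add: cay_ker[OF small_matrix_invertible(1)[OF small[OF that]]] scaleR_matrix_vector)
  qed
  moreover have "\<nu> 0 1 (\<lambda>s. cay (s *\<^sub>R (c *\<^sub>R X))) + \<nu> c 1 (\<lambda>t. cay (t *\<^sub>R X)) = \<nu> 0 1 (\<lambda>s. cay (s *\<^sub>R (1 *\<^sub>R X)))"
    by (rule cay_family[OF c1]) (use small in \<open>auto intro!: sp_algebra_scaleR X continuous_intros\<close>)
  ultimately show ?thesis by simp
qed simp

text \<open>The symmetric matrix belonging to \<open>Y\<close> is \<open>Omega0 ** Y\<close>. As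
  \<open>Omega0\<close> is an isometry, its eigenvalues have size at most 1/2, below the bound in
  the normalization.\<close>

lemma small_exponential:
  assumes Y: "Y \<in> sp_algebra" "small_matrix Y"
  shows "\<nu> 0 1 (\<lambda>t. matrix_exp (t *\<^sub>R Y)) = 0"
proof -
  have "\<nu> 0 1 (\<lambda>t. matrix_exp (t *\<^sub>R (J0 ** (Omega0 ** Y)))) = 0"
  proof (rule exponential[OF sp_algebra_eq_J0(2)[OF Y(1)]])
    fix c assume "is_eigenvalue (Omega0 ** Y) c"
    then obtain v where v: "v \<noteq> 0" "(Omega0 ** Y) *v v = c *\<^sub>R v" unfolding is_eigenvalue_def by blast
    have "\<bar>c\<bar> * norm v = norm (Y *v v)"
      using arg_cong[OF v(2), of norm] by (simp add: norm_Omega0 flip: matrix_vector_mul_assoc)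
    also have "\<dots> \<le> 1/2 * norm v" using Y(2) by (simp add: small_matrix_def)
    finally have "\<bar>c\<bar> \<le> 1/2" using v(1) by (simp only: mult_le_cancel_right) simp
    then show "\<bar>c\<bar> < 2 * pi" using pi_gt3 by linarith
  qed
  then show ?thesis using sp_algebra_eq_J0(1)[OF Y(1)] by metis
qed

text \<open>The paths \<^term>\<open>%s. cay (s *\<^sub>R (c *\<^sub>R W t))\<close>, where \<^term>\<open>cay (t *\<^sub>R W t)\<close> is
  \<^term>\<open>matrix_exp (t *\<^sub>R X)\<close>, deform the Cayley ray of \<^term>\<open>X\<close> to a reparametrized exponential
  without changing the fixed space at the end point.\<close>

lemma cay_radial:
  assumes X: "X \<in> sp_algebra" "small_matrix X"
  shows "\<nu> 0 1 (\<lambda>s. cay (s *\<^sub>R X)) = 0"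
proof -
  define E where "E t = matrix_exp (t *\<^sub>R X)" for t
  have E0: "E 0 = mat 1" by (simp add: E_def matrix_exp_0)
  have contE: "continuous_on S E" for S unfolding E_def by (rule continuous_on_matrix_exp)
  have ESp: "E t \<in> Sp" for t unfolding E_def by (rule matrix_exp_Sp[OF X(1)])
  obtain r where r: "r > 0" "\<And>t. dist t 0 < r \<Longrightarrow> dist (E t) (E 0) < 1/2"
    using contE[of UNIV, unfolded continuous_on_iff, rule_format, of 0 "1/2"] by auto
  define d where "d = min 1 (r / 2)"
  have d: "0 < d" "d \<le> 1" using r(1) by (auto simp: d_def)
  have sm: "small_matrix (E t - mat 1)" if "t \<in> {0..d}" for t
  proof (rule small_matrix_norm)
    have "dist t 0 < r" using that r(1) by (auto simp: d_def dist_real_def)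
    from r(2)[OF this] show "norm (E t - mat 1) \<le> 1/2" by (simp add: E0 dist_norm)
  qed
  have X_le: "norm ((t *\<^sub>R X) *v v) \<le> norm v / 2" if "t \<in> {0..1}" for t v
    using small_matrix_scaleR[OF X(2), of t] that unfolding small_matrix_def by auto
  define Z where "Z t = cay_inv (E t)" for t
  have Z: "Z t \<in> sp_algebra" "small_matrix (Z t)" "cay (Z t) = E t" if "t \<in> {0..d}" for t
    unfolding Z_def using cay_inv_sp_algebra[OF sm ESp] cay_inv_small[OF sm] cay_cay_inv[OF sm] that by auto
  have contZ: "continuous_on {0..d} Z" unfolding Z_def by (intro continuous_on_cay_inv contE sm)
  have kerZ: "Z t *v v = 0 \<longleftrightarrow> X *v v = 0" if t: "0 < t" "t \<le> d" for t v
  proof -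
    have td: "t \<in> {0..d}" "t \<in> {0..1}" using t d by auto
    have "norm ((t *\<^sub>R X) *v v) < 2 * pi * norm v" if "v \<noteq> 0" for v
    proof -
      have "norm ((t *\<^sub>R X) *v v) \<le> norm v / 2" by (rule X_le[OF td(2)])
      also have "\<dots> < 2 * pi * norm v" using that pi_gt3 by (intro less_le_trans[of _ "norm v" "2 * pi * norm v"]) auto
      finally show ?thesis .
    qed
    from matrix_exp_fixed_iff[OF this, of v] have "E t *v v = v \<longleftrightarrow> X *v v = 0"
      using t unfolding E_def by (simp add: scaleR_matrix_vector)
    moreover have "cay (Z t) *v v = v \<longleftrightarrow> Z t *v v = 0"
      by (rule cay_ker[OF small_matrix_invertible(1)[OF Z(2)[OF td(1)]]])
    ultimately show ?thesis unfolding Z(3)[OF td(1)] by blast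
  qed
  \<comment> \<open>Dividing the Cayley generator \<open>Z t\<close> of \<open>E t\<close> by
    \<open>t\<close> has a continuous extension to 0: the difference quotient of \<open>E\<close>
    tends to \<open>X\<close> and \<open>E 0 + mat 1\<close> is twice the identity, whence
    \<open>W 0 = (1 / 2) *\<^sub>R X\<close>.\<close>
  define D where "D t = (if t = 0 then X else (1 / t) *\<^sub>R (E t - mat 1))" for t
  define W where "W t = D t ** matrix_inv (E t + mat 1)" for t
  have contD: "continuous_on {0..d} D"
    unfolding continuous_on_def
  proof
    fix x assume x: "x \<in> {0..d}"
    show "(D \<longlongrightarrow> D x) (at x within {0..d})"
    proof (cases "x = 0")
      case True
      have "(E has_vector_derivative X) (at 0 within {0..d})"
        using matrix_exp_derivative[of X 0 "{0..d}"] by (simp add: E_def[abs_def] matrix_exp_0)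
      then have "((\<lambda>s. (E s - E 0) /\<^sub>R (s - 0)) \<longlongrightarrow> X) (at 0 within {0..d})" unfolding has_vector_derivative_quotient .
      then show ?thesis unfolding True
        by (subst Lim_cong_within[OF refl refl refl, of _ _ _ "\<lambda>s. (E s - E 0) /\<^sub>R (s - 0)"]) (auto simp: D_def E0 divide_inverse)
    next
      case False
      have "((\<lambda>t. (1 / t) *\<^sub>R (E t - mat 1)) \<longlongrightarrow> (1 / x) *\<^sub>R (E x - mat 1)) (at x within {0..d})"
        using contE[of "{0..d}"] x False unfolding continuous_on_def by (intro tendsto_intros) auto
      moreover have "\<forall>\<^sub>F t in at x within {0..d}. D t = (1 / t) *\<^sub>R (E t - mat 1)"
      proof -
        have "((\<lambda>t. t) \<longlongrightarrow> x) (at x within {0..d})" by (rule tendsto_ident_at)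
        from tendsto_imp_eventually_ne[OF this False] show ?thesis by eventually_elim (simp add: D_def)
      qed
      ultimately show ?thesis using False by (subst tendsto_cong) (auto simp: D_def)
    qed
  qed
  have contW: "continuous_on {0..d} W" unfolding W_def
    by (intro continuous_intros contD contE near_one_invertible(1) sm)
  have Wt: "W t = (1 / t) *\<^sub>R Z t" if "t \<noteq> 0" for t
    using that by (simp add: W_def D_def Z_def cay_inv_def bounded_bilinear.scaleR_left[OF bounded_bilinear_matrix_matrix])
  have W0: "W 0 = (1 / 2) *\<^sub>R X"
  proof -
    have "(mat 1 + mat 1) ** ((1/2) *\<^sub>R mat 1) = (mat 1 :: real^('n + 'n)^('n + 'n))"
      unfolding bounded_bilinear.scaleR_right[OF bounded_bilinear_matrix_matrix] matrix_mul_rid by (rule scaleR_half_double)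
    from matrix_inv_unique[OF this] show ?thesis
      by (simp add: W_def D_def E0 bounded_bilinear.scaleR_right[OF bounded_bilinear_matrix_matrix])
  qed
  have Wsp: "W t \<in> sp_algebra" if "t \<in> {0..d}" for t
    using Z(1)[OF that] by (cases "t = 0") (auto simp: W0 Wt intro!: sp_algebra_scaleR X)
  have kerW: "W t *v v = 0 \<longleftrightarrow> X *v v = 0" if "t \<in> {0..d}" for t v
    using kerZ[of t v] that by (cases "t = 0") (auto simp: W0 Wt scaleR_matrix_vector)
  obtain b where b: "b > 0" "\<And>t. t \<in> {0..d} \<Longrightarrow> norm (W t) \<le> b"
    using compact_imp_bounded[OF compact_continuous_image[OF contW compact_Icc]] unfolding bounded_pos by auto
  \<comment> \<open>\<open>1 / (2 * b)\<close> makes all \<open>c *\<^sub>R W t\<close> small, and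
    \<open>c \<le> d\<close> allows \<open>cay_scale\<close> to compare
    \<open>c *\<^sub>R W d = (c / d) *\<^sub>R Z d\<close> with \<open>Z d\<close>.\<close>
  define c where "c = min d (1 / (2 * b))"
  have c: "0 < c" "c \<le> d" "c * b \<le> 1/2"
    using d b(1) by (auto simp: c_def min_def field_simps)
  have small: "small_matrix (c *\<^sub>R W t)" if "t \<in> {0..d}" for t
  proof (rule small_matrix_norm)
    have "norm (c *\<^sub>R W t) \<le> c * b" using c(1) b(2)[OF that] by simp
    then show "norm (c *\<^sub>R W t) \<le> 1/2" using c(3) by linarith
  qed
  have cW: "c *\<^sub>R W t \<in> sp_algebra" if "t \<in> {0..d}" for t by (rule sp_algebra_scaleR[OF Wsp[OF that]])
  have contcW: "continuous_on {0..d} (\<lambda>t. c *\<^sub>R W t)" by (intro continuous_intros contW)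
  have "\<nu> 0 d (\<lambda>t. cay (c *\<^sub>R W t)) = 0"
  proof (rule fixed_space_const[OF d(1)])
    show "symplectic_path 0 d (\<lambda>t. cay (c *\<^sub>R W t))" unfolding symplectic_path_def
      using cay_Sp[OF cW small_matrix_invertible(1)[OF small]] continuous_on_cay[OF contcW small] by auto
    show "{v. cay (c *\<^sub>R W t) *v v = v} = {v. X *v v = 0}" if "t \<in> {0..d}" for t
      using c(1) by (simp add: cay_ker[OF small_matrix_invertible(1)[OF small[OF that]]] scaleR_matrix_vector kerW[OF that])
  qed
  with cay_family[OF d(1) contcW cW small]
  have eq: "\<nu> 0 1 (\<lambda>s. cay (s *\<^sub>R (c *\<^sub>R W 0))) = \<nu> 0 1 (\<lambda>s. cay (s *\<^sub>R (c *\<^sub>R W d)))" by simp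
  have d': "d \<in> {0..d}" using d by simp
  have cWd: "c *\<^sub>R W d = (c / d) *\<^sub>R Z d" using d by (simp add: Wt)
  have "\<nu> 0 1 (\<lambda>s. cay (s *\<^sub>R ((c / d) *\<^sub>R Z d))) = \<nu> 0 1 (\<lambda>s. cay (s *\<^sub>R Z d))"
    using c d by (intro cay_scale Z d') auto
  \<comment> \<open>Here the exponential hypothesis enters: \<open>cay (Z (t * d))\<close> is an
    exponential path that closes the triangle between the constant ray at 0 and the ray of
    \<open>Z d\<close>.\<close>
  moreover have "\<nu> 0 1 (\<lambda>s. cay (s *\<^sub>R Z d)) = 0"
  proof -
    have in_d: "t * d \<in> {0..d}" if "t \<in> {0..1}" for t using that d mult_right_mono[of t 1 d] by auto
    have "\<nu> 0 1 (\<lambda>s. cay (s *\<^sub>R Z (0 * d))) + \<nu> 0 1 (\<lambda>t. cay (Z (t * d))) = \<nu> 0 1 (\<lambda>s. cay (s *\<^sub>R Z (1 * d)))"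
      by (rule cay_family) (use in_d in \<open>auto intro!: Z continuous_on_compose2[OF contZ] continuous_intros\<close>)
    moreover have "\<nu> 0 1 (\<lambda>s. cay (s *\<^sub>R Z (0 * d))) = 0"
      using constant_path[OF _ Sp_mat1, of 0 1] by (simp add: Z_def E0 cay_inv_1 cay_0)
    moreover have "\<nu> 0 1 (\<lambda>t. cay (Z (t * d))) = 0"
    proof -
      have dX: "d *\<^sub>R X \<in> sp_algebra" "small_matrix (d *\<^sub>R X)"
        using d by (auto intro!: sp_algebra_scaleR small_matrix_scaleR X)
      have "\<nu> 0 1 (\<lambda>t. cay (Z (t * d))) = \<nu> 0 1 (\<lambda>t. matrix_exp (t *\<^sub>R (d *\<^sub>R X)))"
      proof (rule cong)
        show "symplectic_path 0 1 (\<lambda>t. matrix_exp (t *\<^sub>R (d *\<^sub>R X)))" by (rule symplectic_path_matrix_exp[OF dX(1)])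
        show "cay (Z (t * d)) = matrix_exp (t *\<^sub>R (d *\<^sub>R X))" if "t \<in> {0..1}" for t
          using Z(3)[OF in_d[OF that]] by (simp add: E_def)
      qed simp
      then show ?thesis using small_exponential[OF dX] by simp
    qed
    ultimately show ?thesis by simp
  qed
  ultimately have "\<nu> 0 1 (\<lambda>s. cay (s *\<^sub>R ((c / 2) *\<^sub>R X))) = 0" using eq cWd by (simp add: W0)
  moreover have "\<nu> 0 1 (\<lambda>s. cay (s *\<^sub>R ((c / 2) *\<^sub>R X))) = \<nu> 0 1 (\<lambda>s. cay (s *\<^sub>R X))"
    using c d by (intro cay_scale X) auto
  ultimately show ?thesis by simp
qed

text \<open>The Cayley rays from the identity to all points of the path have index 0, hence so has
  the path by \<open>cay_family\<close>.\<close>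

lemma near_identity:
  assumes cd: "c < d" and \<psi>: "symplectic_path c d \<psi>" and small: "\<And>t. t \<in> {c..d} \<Longrightarrow> small_matrix (\<psi> t - mat 1)"
  shows "\<nu> c d \<psi> = 0"
proof -
  have Sp: "\<psi> t \<in> Sp" if "t \<in> {c..d}" for t using \<psi> that unfolding symplectic_path_def by blast
  have cont: "continuous_on {c..d} \<psi>" using \<psi> by (simp add: symplectic_path_def)
  have cay: "cay_inv (\<psi> t) \<in> sp_algebra" "small_matrix (cay_inv (\<psi> t))" if "t \<in> {c..d}" for t
    using cay_inv_sp_algebra[OF small Sp] cay_inv_small[OF small] that by auto
  have rad: "\<nu> 0 1 (\<lambda>s. cay (s *\<^sub>R cay_inv (\<psi> t))) = 0" if "t \<in> {c..d}" for t
    by (rule cay_radial[OF cay[OF that]])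
  have "\<nu> 0 1 (\<lambda>s. cay (s *\<^sub>R cay_inv (\<psi> c))) + \<nu> c d (\<lambda>t. cay (cay_inv (\<psi> t))) = \<nu> 0 1 (\<lambda>s. cay (s *\<^sub>R cay_inv (\<psi> d)))"
    by (rule cay_family[OF cd continuous_on_cay_inv[OF cont small] cay])
  then have "\<nu> c d (\<lambda>t. cay (cay_inv (\<psi> t))) = 0" using rad[of c] rad[of d] cd by simp
  moreover have "\<nu> c d (\<lambda>t. cay (cay_inv (\<psi> t))) = \<nu> c d \<psi>"
    by (rule cong[OF cd \<psi>]) (rule cay_cay_inv[OF small])
  ultimately show ?thesis by simp
qed

end

text \<open>The fixed space itself is prescribed, not only its dimension:
  \<open>rotation_perturbation_injective\<close> needs one \<open>K\<close> along the whole
  path.\<close>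

definition fixed_stratum :: "(real^('n::finite + 'n)) set \<Rightarrow> (real^('n + 'n)^('n + 'n)) set" where
  "fixed_stratum K = {A \<in> Sp. {v. A *v v = v} = K}"

text \<open>With \<^term>\<open>B = A - mat 1\<close>, the inverse of \<^term>\<open>B\<close> on its range, composed with \<^term>\<open>Omega0\<close>, is
  changed by a symmetric form of rank one; symmetric changes are those that keep \<^term>\<open>A\<close> symplectic.
  The sign of \<^term>\<open>s\<close> is the one for which the changed map stays invertible along the path.\<close>

lemma transvection_step:
  fixes A :: "real^('n::finite + 'n)^('n + 'n)"
  assumes A: "A \<in> fixed_stratum K" and R: "R \<ge> 0"
  obtains s A' where "\<bar>s\<bar> = R" "path_component (fixed_stratum K) A A'"
    "\<And>x. (A' - mat 1) *v (x - (s * (e \<bullet> ((A - mat 1) *v x))) *\<^sub>R (Omega0 *v e)) = (A - mat 1) *v x"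
proof -
  define B where "B = A - mat 1"
  define p where "p = Omega0 *v e"
  define m where "m = - (e \<bullet> (B *v p))"
  \<comment> \<open>Sherman-Morrison: adding a rank-one term with coefficient \<open>c\<close> to
    \<open>B\<close> changes the inverse by one with coefficient \<open>s\<close>. Since
    \<open>s * m \<ge> 0\<close>, the denominator is at least 1, and
    \<open>1 - c * m = 1 / (1 + s * m)\<close> is positive.\<close>
  define s where "s = (if m \<ge> 0 then R else - R)"
  define c where "c = s / (1 + s * m)"
  have ASp: "A \<in> Sp" and AK: "{v. A *v v = v} = K" using A by (auto simp: fixed_stratum_def)
  have Bv: "B *v x = A *v x - x" for x by (simp add: B_def matrix_vector_mult_diff_rdistrib)
  have "s * m \<ge> 0" using R by (auto simp: s_def mult_nonneg_nonpos)
  then have sm: "1 + s * m > 0" by linarith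
  have cs: "c * (1 + s * m) = s" using sm by (simp add: c_def)
  have cm: "1 - c * m > 0"
  proof -
    have "(1 - c * m) * (1 + s * m) = 1 + s * m - m * (c * (1 + s * m))" by (simp add: algebra_simps)
    also have "\<dots> = 1" unfolding cs by simp
    finally have "0 < (1 - c * m) * (1 + s * m)" by simp
    then show ?thesis using sm by (simp add: zero_less_mult_iff)
  qed
  define D where "D = matrix (\<lambda>x. (e \<bullet> (B *v x)) *\<^sub>R (B *v p))"
  have D: "D *v x = (e \<bullet> (B *v x)) *\<^sub>R (B *v p)" for x
  proof -
    have "linear (\<lambda>x. (e \<bullet> (B *v x)) *\<^sub>R (B *v p))"
      by (auto intro!: linearI simp: matrix_vector_right_distrib matrix_vector_mult_scaleR inner_add_right scaleR_add_left)
    then have "Vector_Spaces.linear (*s) (*s) (\<lambda>x. (e \<bullet> (B *v x)) *\<^sub>R (B *v p))"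
      by (rule linear_matrix_vector_mul_eq[THEN iffD2])
    from matrix_works[OF this, of x] show ?thesis unfolding D_def .
  qed
  define g where "g t = A + (t * c) *\<^sub>R D" for t :: real
  have g: "g t *v x = A *v x + (t * c * (e \<bullet> (B *v x))) *\<^sub>R (B *v p)" for t x
    by (simp add: g_def matrix_vector_mult_add_rdistrib scaleR_matrix_vector D)
  have expand: "omega0 (x + a *\<^sub>R u) (y + b *\<^sub>R u) = omega0 x y + b * omega0 x u + a * omega0 u y" for x y u :: "real^('n + 'n)" and a b
    using omega0_antisym[of u u]
    by (simp add: omega0_def matrix_vector_right_distrib matrix_vector_mult_scaleR inner_add_left inner_add_right algebra_simps)
  \<comment> \<open>So \<open>D *v x\<close> is \<open>omega0 (A *v x) (B *v p)\<close> times
    \<open>B *v p\<close>: \<open>g t\<close> is \<open>A\<close> followed by a symplectic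
    transvection in the direction \<open>B *v p\<close>.\<close>
  have om: "omega0 (A *v x) (B *v p) = e \<bullet> (B *v x)" for x
  proof -
    have "omega0 (A *v x) (B *v p) = omega0 (A *v x) (A *v p) - omega0 (A *v x) p"
      unfolding Bv by (rule linear_diff[OF omega0_linear_right])
    also have "\<dots> = (x - A *v x) \<bullet> (Omega0 *v p)" unfolding SpD[OF ASp] by (simp add: omega0_def inner_diff_left)
    also have "\<dots> = e \<bullet> (B *v x)" unfolding p_def Omega0_Omega0 Bv by (simp add: inner_diff_left inner_diff_right inner_commute)
    finally show ?thesis .
  qed
  have gSp: "g t \<in> Sp" for t
    unfolding Sp_iff g expand om omega0_antisym[of "B *v p"] SpD[OF ASp] by simp
  have gK: "{v. g t *v v = v} = K" if t: "t \<in> {0..1}" for t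
  proof -
    have "g t *v v = v \<longleftrightarrow> A *v v = v" for v
    proof
      assume "A *v v = v"
      then show "g t *v v = v" by (simp add: g Bv)
    next
      assume "g t *v v = v"
      then have 0: "B *v v + (t * c * (e \<bullet> (B *v v))) *\<^sub>R (B *v p) = 0" by (simp add: g Bv algebra_simps)
      from arg_cong[OF this, of "\<lambda>z. e \<bullet> z"]
      have "(e \<bullet> (B *v v)) * (1 - t * (c * m)) = 0" by (simp add: inner_add_right m_def algebra_simps)
      moreover have "1 - t * (c * m) > 0"
      proof -
        have "t * (c * m) < 1"
        proof (cases "c * m \<le> 0")
          case True then show ?thesis using t mult_nonneg_nonpos[of t "c * m"] by simp
        next
          case False then show ?thesis using t cm mult_right_mono[of t 1 "c * m"] by simp
        qed
        then show ?thesis by simp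
      qed
      ultimately have "e \<bullet> (B *v v) = 0" by simp
      then show "A *v v = v" using 0 by (simp add: Bv)
    qed
    then show ?thesis using AK by simp
  qed
  have "path_component (fixed_stratum K) A (g 1)"
    unfolding path_component_def
  proof (rule exI[of _ g], intro conjI)
    show "path g" unfolding path_def g_def by (intro continuous_intros)
    show "path_image g \<subseteq> fixed_stratum K" using gSp gK unfolding path_image_def fixed_stratum_def by blast
    show "pathstart g = A" by (simp add: pathstart_def g_def)
    show "pathfinish g = g 1" by (simp add: pathfinish_def)
  qed
  moreover have "(g 1 - mat 1) *v (x - (s * (e \<bullet> (B *v x))) *\<^sub>R p) = B *v x" for x
  proof -
    define \<beta> where "\<beta> = e \<bullet> (B *v x)"
    define y where "y = x - (s * \<beta>) *\<^sub>R p"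
    have By: "B *v y = B *v x - (s * \<beta>) *\<^sub>R (B *v p)"
      by (simp add: y_def matrix_vector_mult_diff_distrib matrix_vector_mult_scaleR)
    have "(g 1 - mat 1) *v y = B *v y + (c * (e \<bullet> (B *v y))) *\<^sub>R (B *v p)"
      by (simp add: matrix_vector_mult_diff_rdistrib g Bv)
    also have "c * (e \<bullet> (B *v y)) = c * (1 + s * m) * \<beta>"
      by (simp add: By inner_diff_right m_def \<beta>_def[symmetric] algebra_simps)
    also have "B *v y + (c * (1 + s * m) * \<beta>) *\<^sub>R (B *v p) = B *v x" unfolding cs By by simp
    finally show ?thesis unfolding y_def \<beta>_def .
  qed
  moreover have "\<bar>s\<bar> = R" using R by (simp add: s_def)
  ultimately show ?thesis using that[of s "g 1"] unfolding B_def p_def by blast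
qed

text \<open>One \<open>transvection_step\<close> for each vector of an orthonormal basis of the
  range of \<open>B\<close>. Together they change the inverse of \<open>B\<close> on its range by a
  map of size \<open>R\<close>, and a large inverse means a small \<open>A' - mat 1\<close>. The
  signs of the coefficients are not under control, but only their squares enter the norm.\<close>

lemma stratum_near_identity:
  fixes A :: "real^('n::finite + 'n)^('n + 'n)"
  assumes A: "A \<in> fixed_stratum K" and r: "r > 0"
  obtains A' where "path_component (fixed_stratum K) A A'" "\<And>x. norm ((A' - mat 1) *v x) \<le> r * norm x"
proof -
  define B where "B = A - mat 1"
  have ASp: "A \<in> Sp" and AK: "K = {v. A *v v = v}" using A by (auto simp: fixed_stratum_def)
  have Bv: "B *v x = A *v x - x" for x by (simp add: B_def matrix_vector_mult_diff_rdistrib)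
  have K: "K = {v. B *v v = 0}" by (simp add: AK Bv)
  have subK: "subspace K" unfolding K by (rule linear_subspace_kernel) simp
  have subN: "subspace (range ((*v) B))" by (intro linear_subspace_image) auto
  obtain E where E: "E \<subseteq> range ((*v) B)" "pairwise orthogonal E" "\<And>x. x \<in> E \<Longrightarrow> norm x = 1"
    "independent E" "span E = range ((*v) B)" using orthonormal_basis_subspace[OF subN] by metis
  have fE: "finite E" using E(4) by (rule independent_imp_finite)
  define U where "U = {x. \<forall>k\<in>K. k \<bullet> x = 0}"
  have subU: "subspace U" by (auto simp: U_def subspace_def inner_add_right)
  have "\<forall>x\<in>U. B *v x = 0 \<longrightarrow> x = 0" using inner_eq_zero_iff by (auto simp: U_def K)
  then obtain \<delta> where \<delta>: "\<delta> > 0" "\<forall>x\<in>U. norm (B *v x) \<ge> \<delta> * norm x"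
    using injective_imp_isometric[OF closed_subspace[OF subU] subU matrix_vector_mul_bounded_linear[of B]] by blast
  \<comment> \<open>\<open>1 / \<delta>\<close> absorbs the original inverse of \<open>B\<close>,
    which has at most this size on the complement \<open>U\<close> of \<open>K\<close>; the
    remaining \<open>1 / r\<close> gives the required bound.\<close>
  define R where "R = 1 / \<delta> + 1 / r"
  have R: "R \<ge> 0" using \<delta> r by (simp add: R_def)
  have ind: "\<exists>\<sigma> A'. (\<forall>e\<in>F. \<bar>\<sigma> e\<bar> = R) \<and> path_component (fixed_stratum K) A A' \<and>
      (\<forall>x. (A' - mat 1) *v (x - Omega0 *v (\<Sum>e\<in>F. (\<sigma> e * (e \<bullet> (B *v x))) *\<^sub>R e)) = B *v x)" if "finite F" for F
    using that
  proof induction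
    case empty
    show ?case using path_component_refl[OF A] by (intro exI[of _ "\<lambda>_. R"] exI[of _ A]) (simp add: B_def)
  next
    case (insert f F)
    then obtain \<sigma> A1 where 1: "\<forall>e\<in>F. \<bar>\<sigma> e\<bar> = R" "path_component (fixed_stratum K) A A1"
      "\<And>x. (A1 - mat 1) *v (x - Omega0 *v (\<Sum>e\<in>F. (\<sigma> e * (e \<bullet> (B *v x))) *\<^sub>R e)) = B *v x" by blast
    have A1: "A1 \<in> fixed_stratum K" using path_component_mem(2)[OF 1(2)] .
    obtain s A2 where 2: "\<bar>s\<bar> = R" "path_component (fixed_stratum K) A1 A2"
      "\<And>x. (A2 - mat 1) *v (x - (s * (f \<bullet> ((A1 - mat 1) *v x))) *\<^sub>R (Omega0 *v f)) = (A1 - mat 1) *v x"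
      using transvection_step[OF A1 R, of f] by blast
    define \<tau> where "\<tau> = \<sigma>(f := s)"
    have "(A2 - mat 1) *v (x - Omega0 *v (\<Sum>e\<in>insert f F. (\<tau> e * (e \<bullet> (B *v x))) *\<^sub>R e)) = B *v x" for x
    proof -
      define y where "y = x - Omega0 *v (\<Sum>e\<in>F. (\<sigma> e * (e \<bullet> (B *v x))) *\<^sub>R e)"
      have y: "(A1 - mat 1) *v y = B *v x" unfolding y_def by (rule 1(3))
      have "(\<Sum>e\<in>F. (\<tau> e * (e \<bullet> (B *v x))) *\<^sub>R e) = (\<Sum>e\<in>F. (\<sigma> e * (e \<bullet> (B *v x))) *\<^sub>R e)"
        using insert.hyps by (intro sum.cong) (auto simp: \<tau>_def)
      then have "x - Omega0 *v (\<Sum>e\<in>insert f F. (\<tau> e * (e \<bullet> (B *v x))) *\<^sub>R e) = y - (s * (f \<bullet> (B *v x))) *\<^sub>R (Omega0 *v f)"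
        using insert.hyps by (simp add: y_def \<tau>_def matrix_vector_right_distrib matrix_vector_mult_scaleR)
      then show ?thesis using 2(3)[of y] unfolding y by simp
    qed
    moreover have "\<forall>e\<in>insert f F. \<bar>\<tau> e\<bar> = R" using 1(1) 2(1) by (auto simp: \<tau>_def)
    ultimately show ?case using path_component_trans[OF 1(2) 2(2)] by blast
  qed
  obtain \<sigma> A' where \<sigma>: "\<forall>e\<in>E. \<bar>\<sigma> e\<bar> = R" and A': "path_component (fixed_stratum K) A A'"
    and inv: "\<And>x. (A' - mat 1) *v (x - Omega0 *v (\<Sum>e\<in>E. (\<sigma> e * (e \<bullet> (B *v x))) *\<^sub>R e)) = B *v x"
    using ind[OF fE] by blast
  define T where "T x = (\<Sum>e\<in>E. (\<sigma> e * (e \<bullet> (B *v x))) *\<^sub>R e)" for x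
  define h where "h x = x - Omega0 *v T x" for x
  have linT: "linear T"
    by (rule linearI) (simp_all add: T_def matrix_vector_right_distrib matrix_vector_mult_scaleR inner_add_right
      sum.distrib scaleR_sum_right algebra_simps)
  have linh: "linear h"
    by (rule linearI) (simp_all add: h_def linear_add[OF linT] linear_scale[OF linT] matrix_vector_right_distrib
      matrix_vector_mult_scaleR algebra_simps)
  have hB: "(A' - mat 1) *v h x = B *v x" for x using inv by (simp add: h_def T_def)
  have "inj h" unfolding linear_injective_0[OF linh]
  proof (intro allI impI)
    fix x assume hx: "h x = 0"
    then have "B *v x = 0" using hB[of x] by simp
    then have "T x = 0" by (simp add: T_def)
    then show "x = 0" using hx by (simp add: h_def)
  qed
  then have surj: "surj h" using linear_injective_imp_surjective[OF linh] by simp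
  have normT: "norm (T x) = R * norm (B *v x)" for x
  proof -
    have orth: "(norm (\<Sum>e\<in>E. f e *\<^sub>R e))\<^sup>2 = (\<Sum>e\<in>E. (f e)\<^sup>2)" for f
    proof -
      have "(norm (\<Sum>e\<in>E. f e *\<^sub>R e))\<^sup>2 = (\<Sum>e\<in>E. (norm (f e *\<^sub>R e))\<^sup>2)"
      proof (rule norm_sum_Pythagorean[OF fE])
        show "pairwise (\<lambda>i j. orthogonal (f i *\<^sub>R i) (f j *\<^sub>R j)) E"
          using E(2) by (auto simp: pairwise_def orthogonal_def)
      qed
      also have "\<dots> = (\<Sum>e\<in>E. (f e)\<^sup>2)" using E(3) by (intro sum.cong) auto
      finally show ?thesis .
    qed
    have "B *v x = (\<Sum>e\<in>E. (e \<bullet> (B *v x)) *\<^sub>R e)"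
      using orthonormal_basis_expand[OF E(2), of "B *v x"] E(3,5) fE by (simp add: inner_commute)
    then have "(norm (B *v x))\<^sup>2 = (\<Sum>e\<in>E. (e \<bullet> (B *v x))\<^sup>2)" using orth[of "\<lambda>e. e \<bullet> (B *v x)"] by simp
    moreover have "(norm (T x))\<^sup>2 = R\<^sup>2 * (\<Sum>e\<in>E. (e \<bullet> (B *v x))\<^sup>2)"
    proof -
      have s2: "(\<sigma> e)\<^sup>2 = R\<^sup>2" if "e \<in> E" for e using \<sigma> that power2_abs[of "\<sigma> e"] by simp
      have "(norm (T x))\<^sup>2 = (\<Sum>e\<in>E. (\<sigma> e * (e \<bullet> (B *v x)))\<^sup>2)" unfolding T_def by (rule orth)
      also have "\<dots> = (\<Sum>e\<in>E. R\<^sup>2 * (e \<bullet> (B *v x))\<^sup>2)" by (intro sum.cong) (auto simp: power_mult_distrib s2)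
      finally show ?thesis by (simp add: sum_distrib_left)
    qed
    ultimately have "(norm (T x))\<^sup>2 = (R * norm (B *v x))\<^sup>2" by (simp add: power_mult_distrib)
    then show ?thesis by (rule power2_eq_imp_eq) (use R in simp_all)
  qed
  have "norm ((A' - mat 1) *v y) \<le> r * norm y" for y
  proof -
    obtain x where x: "y = h x" using surjD[OF surj, of y] by blast
    have spanK: "span K = K" using subK by (simp add: span_eq_iff)
    obtain k p where k: "k \<in> K" and p: "\<And>w. w \<in> K \<Longrightarrow> orthogonal p w" and kp: "x = k + p"
      using orthogonal_subspace_decomp_exists[of K x] unfolding spanK by blast
    have "w \<bullet> p = 0" if "w \<in> K" for w using p[OF that] unfolding orthogonal_def inner_commute[of p] .
    then have pU: "p \<in> U" unfolding U_def by blast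
    have Bxp: "B *v x = B *v p" using k by (simp add: kp K matrix_vector_right_distrib)
    have "T x \<in> span E" unfolding T_def by (intro span_sum span_scale span_base)
    then obtain z where z: "T x = B *v z" unfolding E(5) by blast
    \<comment> \<open>The range of \<open>B\<close> is \<open>omega0\<close>-orthogonal to the fixed
      space, so \<open>Omega0 *v T x\<close> has no component in \<open>K\<close>. Hence
      \<open>k\<close> and \<open>q\<close> are orthogonal and \<open>norm q \<le> norm y\<close>,
      whatever the component \<open>k\<close> is.\<close>
    have KT: "k' \<bullet> (Omega0 *v T x) = 0" if "k' \<in> K" for k'
    proof -
      have "k' \<bullet> (Omega0 *v T x) = omega0 k' (A *v z) - omega0 k' z"
        unfolding z Bv omega0_def by (simp add: matrix_vector_mult_diff_distrib inner_diff_right)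
      also have "omega0 k' (A *v z) = omega0 (A *v k') (A *v z)" using that by (simp add: AK)
      finally show ?thesis unfolding SpD[OF ASp] by simp
    qed
    define q where "q = p - Omega0 *v T x"
    have y: "y = k + q" by (simp add: x h_def kp q_def)
    have "orthogonal k q" using KT[OF k] p[OF k] by (simp add: q_def orthogonal_def inner_diff_right inner_commute)
    then have "(norm y)\<^sup>2 = (norm k)\<^sup>2 + (norm q)\<^sup>2" unfolding y by (rule norm_add_Pythagorean)
    then have qy: "norm q \<le> norm y" using power2_le_imp_le[of "norm q" "norm y"] by simp
    have "R * norm (B *v x) = norm (Omega0 *v T x)" by (simp add: norm_Omega0 normT)
    also have "\<dots> \<le> norm p + norm q" using norm_triangle_ineq4[of p q] by (simp add: q_def)
    also have "norm p \<le> norm (B *v x) / \<delta>" using \<delta> pU by (simp add: Bxp field_simps)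
    finally have "R * norm (B *v x) \<le> norm (B *v x) / \<delta> + norm q" by simp
    moreover have "R * norm (B *v x) = norm (B *v x) / \<delta> + norm (B *v x) / r"
      by (simp add: R_def distrib_right)
    ultimately have "norm (B *v x) / r \<le> norm y" using qy by linarith
    then have "norm (B *v x) \<le> r * norm y" using r by (simp add: pos_divide_le_eq mult.commute)
    then show ?thesis using hB[of x] by (simp add: x)
  qed
  then show ?thesis using that[OF A'] by blast
qed

section \<open>From rotation paths to all paths\<close>

context vanishing_index
begin

text \<open>In the rectangle \<open>g s ** rotation \<theta>\<close>, with \<open>g\<close> running
  inside the stratum from \<open>A\<close> to a matrix near the identity, the sides with constant
  angle have constant fixed space and the side at \<open>A'\<close> stays near the identity. The
  remaining side is the claim.\<close>

lemma short_rotation: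
  assumes A: "A \<in> Sp"
  shows "\<exists>d>0. (\<forall>u v. u < v \<longrightarrow> \<bar>u\<bar> < d \<longrightarrow> \<bar>v\<bar> < d \<longrightarrow> \<nu> u v (\<lambda>\<theta>. A ** rotation \<theta>) = 0) \<and>
    (\<forall>e x. 0 < \<bar>e\<bar> \<longrightarrow> \<bar>e\<bar> < d \<longrightarrow> A *v (rotation e *v x) = x \<longrightarrow> x = 0)"
proof -
  define K where "K = {v. A *v v = v}"
  have "A \<in> fixed_stratum K" using A by (simp add: fixed_stratum_def K_def)
  then obtain A' where A': "path_component (fixed_stratum K) A A'" "\<And>x. norm ((A' - mat 1) *v x) \<le> 1/4 * norm x"
    by (rule stratum_near_identity[of _ _ "1/4"]) auto
  obtain g where g: "path g" "path_image g \<subseteq> fixed_stratum K" "pathstart g = A" "pathfinish g = A'"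
    using A'(1) unfolding path_component_def by blast
  have contg: "continuous_on {0..1} g" using g(1) by (simp add: path_def)
  have gK: "g s \<in> Sp" "{v. g s *v v = v} = K" if "s \<in> {0..1}" for s
  proof -
    have "g s \<in> fixed_stratum K" using g(2) that unfolding path_image_def by blast
    then show "g s \<in> Sp" "{v. g s *v v = v} = K" unfolding fixed_stratum_def by simp_all
  qed
  have ends: "g 0 = A" "g 1 = A'" using g(3,4) by (simp_all add: pathstart_def pathfinish_def)
  have gSp: "g ` {0..1} \<subseteq> Sp" using gK(1) by blast
  obtain d1 where d1: "d1 > 0" "\<And>s e x. s \<in> {0..1} \<Longrightarrow> 0 < \<bar>e\<bar> \<Longrightarrow> \<bar>e\<bar> < d1 \<Longrightarrow> g s *v (rotation e *v x) = x \<Longrightarrow> x = 0"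
    using rotation_perturbation_injective[OF contg gSp gK(2)] by blast
  have rot: "continuous_on UNIV (\<lambda>t. rotation t :: real^('n + 'n)^('n + 'n))" by (intro continuous_intros)
  \<comment> \<open>The bounds 1/4 for \<open>A' - mat 1\<close> and for
    \<open>rotation \<theta> - mat 1\<close> add up to the 1/2 in
    \<open>small_matrix\<close>.\<close>
  obtain d2 where d2: "d2 > 0" "\<And>t. dist t 0 < d2 \<Longrightarrow> dist (rotation t) (rotation 0 :: real^('n + 'n)^('n + 'n)) < 1/4"
    using rot[unfolded continuous_on_iff, rule_format, of 0 "1/4"] by auto
  define d where "d = min d1 d2"
  have "\<nu> u v (\<lambda>\<theta>. A ** rotation \<theta>) = 0" if uv: "u < v" "\<bar>u\<bar> < d" "\<bar>v\<bar> < d" for u v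
  proof -
    have in_d: "\<bar>\<theta>\<bar> < d" if "\<theta> \<in> {u..v}" for \<theta> using that uv by auto
    let ?F = "\<lambda>x. g (fst x) ** rotation (snd x)"
    have F: "continuous_on ({0..1} \<times> {u..v}) ?F"
      by (intro continuous_intros continuous_on_compose2[OF contg]) auto
    have "\<nu> 0 1 (\<lambda>s. ?F (s, u)) + \<nu> u v (\<lambda>\<theta>. ?F (1, \<theta>)) = \<nu> u v (\<lambda>\<theta>. ?F (0, \<theta>)) + \<nu> 0 1 (\<lambda>s. ?F (s, v))"
      by (rule rectangle[OF _ uv(1) F]) (auto intro!: Sp_mult gK(1) rotation_Sp)
    \<comment> \<open>For angle 0 the fixed space is \<open>K\<close> by the choice of
      \<open>g\<close>, for other angles it is trivial by the choice of \<open>d1\<close>; in both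
      cases it does not depend on \<open>s\<close>.\<close>
    moreover have side: "\<nu> 0 1 (\<lambda>s. ?F (s, \<theta>)) = 0" if \<theta>: "\<theta> \<in> {u..v}" for \<theta>
    proof (rule fixed_space_const)
      show "symplectic_path 0 1 (\<lambda>s. ?F (s, \<theta>))"
        unfolding symplectic_path_def using contg by (auto intro!: Sp_mult gK(1) rotation_Sp continuous_intros)
      show "{x. ?F (s, \<theta>) *v x = x} = (if \<theta> = 0 then K else {0})" if s: "s \<in> {0..1}" for s
      proof (cases "\<theta> = 0")
        case True then show ?thesis using gK(2)[OF s] by (simp add: rotation_0)
      next
        case False
        have "x = 0" if "g s ** rotation \<theta> *v x = x" for x
          using d1(2)[OF s _ _ that[folded matrix_vector_mul_assoc]] False in_d[OF \<theta>] by (simp add: d_def)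
        then show ?thesis using False by auto
      qed
    qed simp
    moreover have "\<nu> u v (\<lambda>\<theta>. A' ** rotation \<theta>) = 0"
    proof (rule near_identity[OF uv(1)])
      show "symplectic_path u v (\<lambda>\<theta>. A' ** rotation \<theta>)"
        unfolding symplectic_path_def ends(2)[symmetric]
        by (auto intro!: Sp_mult gK(1) rotation_Sp continuous_intros)
      show "small_matrix (A' ** rotation \<theta> - mat 1)" if \<theta>: "\<theta> \<in> {u..v}" for \<theta>
        unfolding small_matrix_def
      proof
        fix x :: "real^('n + 'n)"
        have "norm (rotation \<theta> - mat 1 :: real^('n + 'n)^('n + 'n)) \<le> 1/4"
          using d2(2)[of \<theta>] in_d[OF \<theta>] by (simp add: d_def rotation_0 dist_norm)
        then have 2: "norm ((rotation \<theta> - mat 1) *v x) \<le> 1/4 * norm x"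
          by (rule order_trans[OF norm_matrix_vector_le mult_right_mono[OF _ norm_ge_zero]])
        have "(A' ** rotation \<theta> - mat 1) *v x = (A' - mat 1) *v (rotation \<theta> *v x) + (rotation \<theta> - mat 1) *v x"
          by (simp add: matrix_vector_mult_diff_rdistrib flip: matrix_vector_mul_assoc)
        then have "norm ((A' ** rotation \<theta> - mat 1) *v x) \<le> norm ((A' - mat 1) *v (rotation \<theta> *v x)) + norm ((rotation \<theta> - mat 1) *v x)"
          by (simp only: norm_triangle_ineq)
        also have "\<dots> \<le> 1/4 * norm x + 1/4 * norm x"
          using A'(2)[of "rotation \<theta> *v x"] 2 by (intro add_mono) (auto simp: norm_rotation)
        finally show "norm ((A' ** rotation \<theta> - mat 1) *v x) \<le> norm x / 2" by simp
      qed
    qed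
    ultimately show ?thesis using uv(1) by (simp add: ends)
  qed
  moreover have "x = 0" if "0 < \<bar>e\<bar>" "\<bar>e\<bar> < d" "A *v (rotation e *v x) = x" for e x
    using d1(2)[of 0 e x] that by (simp add: ends d_def)
  moreover have "d > 0" using d1(1) d2(1) by (simp add: d_def)
  ultimately show ?thesis by blast
qed

lemma symplectic_path_rotation: "A \<in> Sp \<Longrightarrow> symplectic_path u v (\<lambda>\<theta>. A ** rotation \<theta>)"
  unfolding symplectic_path_def by (auto intro!: Sp_mult rotation_Sp continuous_intros)

text \<open>Vanishing is a local condition by compactness of the parameter interval.\<close>

lemma locally_vanishing:
  assumes ab: "a < b" and \<psi>: "symplectic_path a b \<psi>"
    and local: "\<And>t. t \<in> {a..b} \<Longrightarrow> \<exists>d>0. \<forall>u v. a \<le> u \<and> u < v \<and> v \<le> b \<and> u \<le> t \<and> t \<le> v \<and> v - u < d \<longrightarrow> \<nu> u v \<psi> = 0"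
  shows "\<nu> a b \<psi> = 0"
proof -
  define P where "P u v \<longleftrightarrow> (a \<le> u \<and> u < v \<and> v \<le> b \<longrightarrow> \<nu> u v \<psi> = 0)" for u v
  have "P a b"
  proof (rule Bolzano)
    show "a \<le> b" using ab by simp
  next
    fix u v w assume uv: "P u v" and vw: "P v w" and le: "u \<le> v" "v \<le> w"
    show "P u w" unfolding P_def
    proof
      assume uw: "a \<le> u \<and> u < w \<and> w \<le> b"
      have "symplectic_path u w \<psi>" using symplectic_path_subset[OF \<psi>] uw by blast
      from subdivide[OF le _ this] uw
      have eq: "\<nu> u w \<psi> = (if u < v then \<nu> u v \<psi> else 0) + (if v < w then \<nu> v w \<psi> else 0)" by blast
      have "\<nu> u v \<psi> = 0" if "u < v" using uv[unfolded P_def, rule_format] uw le that by linarith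
      moreover have "\<nu> v w \<psi> = 0" if "v < w" using vw[unfolded P_def, rule_format] uw le that by linarith
      ultimately show "\<nu> u w \<psi> = 0" unfolding eq by (cases "u < v"; cases "v < w") simp_all
    qed
  next
    fix t assume "a \<le> t" "t \<le> b"
    then have "t \<in> {a..b}" by simp
    then obtain d where d: "d > 0"
      "\<forall>u v. a \<le> u \<and> u < v \<and> v \<le> b \<and> u \<le> t \<and> t \<le> v \<and> v - u < d \<longrightarrow> \<nu> u v \<psi> = 0" using local by blast
    have "P u v" if "u \<le> t \<and> t \<le> v \<and> v - u < d" for u v
      unfolding P_def using d(2)[rule_format, of u v] that by blast
    then show "\<exists>d>0. \<forall>u v. u \<le> t \<and> t \<le> v \<and> v - u < d \<longrightarrow> P u v" using d(1) by blast
  qed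
  then show ?thesis using ab by (simp add: P_def)
qed

text \<open>Around an arbitrary angle \<open>t\<close>, \<open>short_rotation\<close> is applied to
  \<open>A ** rotation t\<close> in place of \<open>A\<close>.\<close>

lemma rotation_path:
  assumes A: "A \<in> Sp" and ab: "a < b"
  shows "\<nu> a b (\<lambda>\<theta>. A ** rotation \<theta>) = 0"
proof (rule locally_vanishing[OF ab symplectic_path_rotation[OF A]])
  fix t
  have At: "A ** rotation t \<in> Sp" by (intro Sp_mult A rotation_Sp)
  obtain d where d: "d > 0" "\<And>u v. u < v \<Longrightarrow> \<bar>u\<bar> < d \<Longrightarrow> \<bar>v\<bar> < d \<Longrightarrow> \<nu> u v (\<lambda>\<theta>. A ** rotation t ** rotation \<theta>) = 0"
    using short_rotation[OF At] by blast
  have "\<nu> u v (\<lambda>\<theta>. A ** rotation \<theta>) = 0" if uv: "u < v" "u \<le> t" "t \<le> v" "v - u < d" for u v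
  proof -
    have eq: "A ** rotation t ** rotation \<theta> = A ** rotation (t + \<theta>)" for \<theta>
      by (simp add: rotation_add matrix_mul_assoc)
    have "\<nu> (u - t) (v - t) (\<lambda>\<theta>. A ** rotation (t + \<theta>)) = \<nu> u v (\<lambda>\<theta>. A ** rotation \<theta>)"
    proof (rule reparametrize[OF _ uv(1) symplectic_path_rotation[OF A]])
      show "continuous_on {u - t..v - t} ((+) t)" by (intro continuous_intros)
    qed (use uv in auto)
    moreover have "\<nu> (u - t) (v - t) (\<lambda>\<theta>. A ** rotation t ** rotation \<theta>) = 0"
      by (rule d(2)) (use uv in auto)
    ultimately show ?thesis unfolding eq by simp
  qed
  then show "\<exists>d>0. \<forall>u v. a \<le> u \<and> u < v \<and> v \<le> b \<and> u \<le> t \<and> t \<le> v \<and> v - u < d \<longrightarrow> \<nu> u v (\<lambda>\<theta>. A ** rotation \<theta>) = 0"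
    using d(1) by blast
qed

text \<open>In the rectangle \<open>\<psi> s ** rotation \<theta>\<close> for angles up to a small
  \<open>e\<close>, the sides with constant \<open>s\<close> vanish by \<open>rotation_path\<close>.
  At angle \<open>e\<close> there are no fixed vectors for \<open>s\<close> near \<open>t\<close>,
  because invertibility of \<open>\<psi> s ** rotation e - mat 1\<close> is an open
  condition.\<close>

lemma vanishes:
  assumes ab: "a < b" and \<psi>: "symplectic_path a b \<psi>"
  shows "\<nu> a b \<psi> = 0"
proof (rule locally_vanishing[OF ab \<psi>])
  have cont: "continuous_on {a..b} \<psi>" and Sp: "\<And>t. t \<in> {a..b} \<Longrightarrow> \<psi> t \<in> Sp"
    using \<psi> by (auto simp: symplectic_path_def)
  fix t assume t: "t \<in> {a..b}"
  obtain d where d: "d > 0" "\<And>e x. 0 < \<bar>e\<bar> \<Longrightarrow> \<bar>e\<bar> < d \<Longrightarrow> \<psi> t *v (rotation e *v x) = x \<Longrightarrow> x = 0"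
    using short_rotation[OF Sp[OF t]] by blast
  define e where "e = d / 2"
  have e: "0 < e" "e < d" using d(1) by (auto simp: e_def)
  define G where "G s = \<psi> s ** rotation e - mat 1" for s
  have contG: "continuous_on {a..b} G" unfolding G_def by (intro continuous_intros cont)
  have Gv: "G s *v x = 0 \<longleftrightarrow> \<psi> s *v (rotation e *v x) = x" for s x
    by (simp add: G_def matrix_vector_mult_diff_rdistrib matrix_vector_mul_assoc)
  have "invertible (G t)" unfolding invertible_iff_ker Gv using d(2)[of e] e by auto
  moreover have "(G \<longlongrightarrow> G t) (at t within {a..b})" using contG t unfolding continuous_on_def by blast
  ultimately have "\<forall>\<^sub>F s in at t within {a..b}. invertible (G s)" using tendsto_matrix_inv(2) by blast
  then obtain r where r: "r > 0" "\<And>s. s \<in> {a..b} \<Longrightarrow> s \<noteq> t \<Longrightarrow> dist s t < r \<Longrightarrow> invertible (G s)"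
    unfolding eventually_at by blast
  have inv: "invertible (G s)" if "s \<in> {a..b}" "dist s t < r" for s
    using r(2)[OF that(1) _ that(2)] \<open>invertible (G t)\<close> by (cases "s = t") auto
  have "\<nu> u v \<psi> = 0" if uv: "a \<le> u" "u < v" "v \<le> b" "u \<le> t" "t \<le> v" "v - u < r" for u v
  proof -
    have sub: "s \<in> {a..b}" if "s \<in> {u..v}" for s using that uv by auto
    have near: "dist s t < r" if "s \<in> {u..v}" for s using that uv by (auto simp: dist_real_def)
    let ?F = "\<lambda>x. \<psi> (fst x) ** rotation (snd x)"
    have F: "continuous_on ({u..v} \<times> {0..e}) ?F"
      using sub by (intro continuous_intros continuous_on_compose2[OF cont]) auto
    have "\<nu> u v (\<lambda>s. ?F (s, 0)) + \<nu> 0 e (\<lambda>\<theta>. ?F (v, \<theta>)) = \<nu> 0 e (\<lambda>\<theta>. ?F (u, \<theta>)) + \<nu> u v (\<lambda>s. ?F (s, e))"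
      by (rule rectangle[OF uv(2) e(1) F]) (auto intro!: Sp_mult Sp sub rotation_Sp)
    moreover have "\<nu> 0 e (\<lambda>\<theta>. ?F (s, \<theta>)) = 0" if "s \<in> {u..v}" for s
      using rotation_path[OF Sp[OF sub[OF that]] e(1)] by simp
    moreover have "\<nu> u v (\<lambda>s. ?F (s, e)) = 0"
    proof (rule fixed_space_const[OF uv(2)])
      show "symplectic_path u v (\<lambda>s. ?F (s, e))" unfolding symplectic_path_def
        using sub by (auto intro!: Sp_mult Sp rotation_Sp continuous_intros continuous_on_compose2[OF cont])
      show "{x. ?F (s, e) *v x = x} = {0}" if s: "s \<in> {u..v}" for s
      proof -
        have "?F (s, e) *v x = x \<longleftrightarrow> G s *v x = 0" for x by (simp add: Gv matrix_vector_mul_assoc)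
        moreover have "G s *v x = 0 \<longleftrightarrow> x = 0" for x
          using inv[OF sub[OF s] near[OF s]] unfolding invertible_iff_ker by auto
        ultimately show ?thesis by simp
      qed
    qed
    ultimately show ?thesis using uv(2) by (simp add: rotation_0)
  qed
  then show "\<exists>d>0. \<forall>u v. a \<le> u \<and> u < v \<and> v \<le> b \<and> u \<le> t \<and> t \<le> v \<and> v - u < d \<longrightarrow> \<nu> u v \<psi> = 0"
    using r(1) by blast
qed

end

lemma vanishing_index_diff:
  assumes \<mu>: "rs_properties (\<mu> :: real \<Rightarrow> real \<Rightarrow> (real \<Rightarrow> real^('n::finite + 'n)^('n + 'n)) \<Rightarrow> real)"
    and \<mu>': "rs_properties \<mu>'"
  shows "vanishing_index (\<lambda>a b \<psi>. \<mu> a b \<psi> - \<mu>' a b \<psi>)"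
proof
  note props = \<mu>[unfolded rs_properties_def] \<mu>'[unfolded rs_properties_def]
  show "homotopy_property (\<lambda>a b \<psi>. \<mu> a b \<psi> - \<mu>' a b \<psi>)"
    unfolding homotopy_property_def
  proof (intro allI impI)
    fix a b \<psi> \<phi> assume h: "a < b \<and> symplectic_path a b \<psi> \<and> symplectic_path a b \<phi> \<and>
      homotopic_with_canon (\<lambda>\<xi>. \<xi> a = \<psi> a \<and> \<xi> b = \<psi> b) {a..b} Sp \<psi> (\<phi> :: real \<Rightarrow> real^('n + 'n)^('n + 'n))"
    have "\<mu> a b \<psi> = \<mu> a b \<phi>" "\<mu>' a b \<psi> = \<mu>' a b \<phi>" using props h unfolding homotopy_property_def by blast+
    then show "\<mu> a b \<psi> - \<mu>' a b \<psi> = \<mu> a b \<phi> - \<mu>' a b \<phi>" by (simp only:)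
  qed
  show "catenation_property (\<lambda>a b \<psi>. \<mu> a b \<psi> - \<mu>' a b \<psi>)"
    unfolding catenation_property_def
  proof (intro allI impI)
    fix a b c \<psi> assume h: "a < c \<and> c < b \<and> symplectic_path a b (\<psi> :: real \<Rightarrow> real^('n + 'n)^('n + 'n))"
    have 1: "\<mu> a b \<psi> = \<mu> a c \<psi> + \<mu> c b \<psi>" using props h unfolding catenation_property_def by blast
    have 2: "\<mu>' a b \<psi> = \<mu>' a c \<psi> + \<mu>' c b \<psi>" using props h unfolding catenation_property_def by blast
    show "\<mu> a b \<psi> - \<mu>' a b \<psi> = \<mu> a c \<psi> - \<mu>' a c \<psi> + (\<mu> c b \<psi> - \<mu>' c b \<psi>)" using 1 2 by linarith
  qed
  show "zero_property (\<lambda>a b \<psi>. \<mu> a b \<psi> - \<mu>' a b \<psi>)"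
    unfolding zero_property_def
  proof (intro allI impI)
    fix a b \<psi> k assume h: "a < b \<and> symplectic_path a b (\<psi> :: real \<Rightarrow> real^('n + 'n)^('n + 'n)) \<and>
      (\<forall>t\<in>{a..b}. dim {v. (\<psi> t - mat 1) *v v = 0} = k)"
    have "\<mu> a b \<psi> = 0" "\<mu>' a b \<psi> = 0" using props h unfolding zero_property_def by blast+
    then show "\<mu> a b \<psi> - \<mu>' a b \<psi> = 0" by simp
  qed
  fix S :: "real^('n + 'n)^('n + 'n)"
  assume S: "transpose S = S" "\<And>c. is_eigenvalue S c \<Longrightarrow> \<bar>c\<bar> < 2 * pi"
  have "\<mu> 0 1 (\<lambda>t. matrix_exp (t *\<^sub>R (J0 ** S))) = 1/2 * of_int (matrix_signature S)"
    "\<mu>' 0 1 (\<lambda>t. matrix_exp (t *\<^sub>R (J0 ** S))) = 1/2 * of_int (matrix_signature S)"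
    using props S unfolding normalization_property_def by blast+
  then show "\<mu> 0 1 (\<lambda>t. matrix_exp (t *\<^sub>R (J0 ** S))) - \<mu>' 0 1 (\<lambda>t. matrix_exp (t *\<^sub>R (J0 ** S))) = 0" by simp
qed

theorem theorem2:
  shows "rs_properties
           (rs_index :: real \<Rightarrow> real \<Rightarrow> (real \<Rightarrow> real^('n::finite + 'n)^('n + 'n)) \<Rightarrow> real) \<and>
         (\<forall>\<mu> :: real \<Rightarrow> real \<Rightarrow> (real \<Rightarrow> real^('n + 'n)^('n + 'n)) \<Rightarrow> real.
            rs_properties \<mu> \<longrightarrow>
            (\<forall>a b \<psi>. a < b \<and> symplectic_path a b \<psi> \<longrightarrow> \<mu> a b \<psi> = rs_index a b \<psi>))"
proof (intro conjI allI impI)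
  show props: "rs_properties (rs_index :: real \<Rightarrow> real \<Rightarrow> (real \<Rightarrow> real^('n + 'n)^('n + 'n)) \<Rightarrow> real)"
    by (rule rs_index_properties)
  fix \<mu> :: "real \<Rightarrow> real \<Rightarrow> (real \<Rightarrow> real^('n + 'n)^('n + 'n)) \<Rightarrow> real" and a b
    and \<psi> :: "real \<Rightarrow> real^('n + 'n)^('n + 'n)"
  assume "rs_properties \<mu>" and \<psi>: "a < b \<and> symplectic_path a b \<psi>"
  then interpret vanishing_index "\<lambda>a b \<psi>. \<mu> a b \<psi> - rs_index a b \<psi>" by (intro vanishing_index_diff props)
  show "\<mu> a b \<psi> = rs_index a b \<psi>" using vanishes[of a b \<psi>] \<psi> by simp
qed

end
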